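(* Let $\mu\in\mathcal M_c(\mathbb R^d)$ and $f\in\mathcal P\setminus\{0\}$. Then under $\mathbb P_\mu(\cdot\mid D^c)$, \[ \Upsilon^f_t:=\frac{X_{t+1}(f)-X_t(P^\alpha_1f)}{\|X_t\|^{1-\tilde\beta}}\xrightarrow[t\to\infty]{d}\zeta^f_0, \] where $\zeta^f_0$ is a $(1+\beta)$-stable random variable with characteristic function $\theta\mapsto e^{\langle Z_1(\theta f),\varphi\rangle}$.
   Context: Fix $d\in\mathbb N$, $\sigma>0$, $b>0$. Let $\xi=((\xi_t);(\Pi_x))$ be the Ornstein–Uhlenbeck process on $\mathbb R^d$ with generator $\frac12\sigma^2\Delta-bx\cdot\nabla$ and semigroup $P_tf(x)=\Pi_x[f(\xi_t)]$ (extended to complex $f$ by linearity); $P^\alpha_t:=e^{\alpha t}P_t$. Let $\psi(z)=-\alpha z+\rho z^2+\int_{(0,\infty)}(e^{-zy}-1+zy)\pi(dy)$ with $\alpha>0$, $\rho\ge0$, $\int(y\wedge y^2)\pi(dy)<\infty$. $\mathcal M(\mathbb R^d)$ = finite Borel measures, $\mathcal M_c(\mathbb R^d)$ those with compact support, $\mu(f)=\int fd\mu$, $\|\mu\|=\mu(1)$. $X=((X_t);(\mathbb P_\mu))$ is the super-OU process: the $\mathcal M(\mathbb R^d)$-valued Hunt process with $\mathbb P_\mu[e^{-X_t(f)}]=e^{-\mu(V_tf)}$ for bounded nonnegative Borel $f$, $V_tf$ being the unique locally bounded nonnegative solution of $V_tf(x)+\Pi_x[\int_0^t\psi(V_{t-s}f(\xi_s))ds]=\Pi_x[f(\xi_t)]$.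 Assume Grey's condition (there is $z'>0$ with $\psi>0$ on $(z',\infty)$ and $\int_{z'}^\infty\psi^{-1}<\infty$) and that there exist $\eta>0$, $\beta\in(0,1)$, $\delta>0$ with $\int_{(1,\infty)}y^{1+\beta+\delta}|\pi(dy)-\frac{\eta\,dy}{\Gamma(-1-\beta)y^{2+\beta}}|<\infty$. $\tilde\beta=\beta/(1+\beta)$. $D=\{\exists t\ge0:\|X_t\|=0\}$. $\mathcal P$ = real Borel functions of polynomial growth on $\mathbb R^d$. $\varphi(x)=(b/(\pi\sigma^2))^{d/2}e^{-b|x|^2/\sigma^2}$ and $\langle g,\varphi\rangle=\int g\varphi\,dx$. Complex powers use the principal logarithm ($z^\gamma=e^{\gamma\log z}$, $0^\gamma=0$). For $f\in\mathcal P$, $Z_1f:=\int_0^1P^\alpha_{1-s}\big(\eta(-iP^\alpha_sf)^{1+\beta}\big)ds$. *)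

theory Defs
  imports "HOL-Probability.Probability" "HOL-Probability.Convolution"
begin

definition std_gauss :: "'a::euclidean_space measure" where
  "std_gauss = density lborel
     (\<lambda>z. ennreal ((2 * pi) powr (- real DIM('a) / 2) * exp (- (norm z)\<^sup>2 / 2)))"

text \<open>Transition semigroup of the OU process with generator
  (1/2) sigma^2 Laplacian - b x . grad :  xi_t = e^{-bt} x + sqrt(sigma^2 (1-e^{-2bt})/(2b)) Z.
  Works for real- or complex-valued f.\<close>
definition OU_P :: "real \<Rightarrow> real \<Rightarrow> real \<Rightarrow> ('a::euclidean_space \<Rightarrow> 'b::{banach,second_countable_topology})
    \<Rightarrow> 'a \<Rightarrow> 'b" where
  "OU_P \<sigma> b t f x =
     (\<integral>z. f (exp (- b * t) *\<^sub>R x + (\<sigma> * sqrt ((1 - exp (- 2 * b * t)) / (2 * b))) *\<^sub>R z) \<partial>std_gauss)"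

definition OU_Pa :: "real \<Rightarrow> real \<Rightarrow> real \<Rightarrow> real \<Rightarrow> ('a::euclidean_space \<Rightarrow> 'b::{banach,second_countable_topology})
    \<Rightarrow> 'a \<Rightarrow> 'b" where
  "OU_Pa \<alpha> \<sigma> b t f x = exp (\<alpha> * t) *\<^sub>R OU_P \<sigma> b t f x"

text \<open>Invariant density of the OU process.\<close>
definition OU_phi :: "real \<Rightarrow> real \<Rightarrow> 'a::euclidean_space \<Rightarrow> real" where
  "OU_phi \<sigma> b x = (b / (pi * \<sigma>\<^sup>2)) powr (real DIM('a) / 2) * exp (- b * (norm x)\<^sup>2 / \<sigma>\<^sup>2)"

definition psi :: "real \<Rightarrow> real \<Rightarrow> real measure \<Rightarrow> real \<Rightarrow> real" where
  "psi \<alpha> \<rho> \<pi> z = - \<alpha> * z + \<rho> * z\<^sup>2 + (\<integral>y. exp (- z * y) - 1 + z * y \<partial>\<pi>)"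

text \<open>v is a (jointly measurable) locally bounded nonnegative solution of
  v_t(x) + Pi_x[int_0^t psi(v_{t-s}(xi_s)) ds] = P_t f(x), t >= 0, where the path expectation
  is written via Fubini as int_0^t P_s(psi o v_{t-s})(x) ds.\<close>
definition is_cumulant_sol :: "real \<Rightarrow> real \<Rightarrow> real measure \<Rightarrow> real \<Rightarrow> real
    \<Rightarrow> ('a::euclidean_space \<Rightarrow> real) \<Rightarrow> (real \<Rightarrow> 'a \<Rightarrow> real) \<Rightarrow> bool" where
  "is_cumulant_sol \<alpha> \<rho> \<pi> \<sigma> b f v \<longleftrightarrow>
     (\<lambda>(t, x). v t x) \<in> borel_measurable borel \<and>
     (\<forall>t\<ge>0. \<forall>x. 0 \<le> v t x) \<and>
     (\<forall>T\<ge>0. \<exists>C. \<forall>t\<in>{0..T}. \<forall>x. \<bar>v t x\<bar> \<le> C) \<and>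
     (\<forall>t\<ge>0. \<forall>x. v t x + (LINT s:{0..t}|lborel. OU_P \<sigma> b s (\<lambda>y. psi \<alpha> \<rho> \<pi> (v (t - s) y)) x)
                   = OU_P \<sigma> b t f x)"

definition cumV :: "real \<Rightarrow> real \<Rightarrow> real measure \<Rightarrow> real \<Rightarrow> real
    \<Rightarrow> ('a::euclidean_space \<Rightarrow> real) \<Rightarrow> real \<Rightarrow> 'a \<Rightarrow> real" where
  "cumV \<alpha> \<rho> \<pi> \<sigma> b f = (THE v. is_cumulant_sol \<alpha> \<rho> \<pi> \<sigma> b f v \<and> (\<forall>t<0. \<forall>x. v t x = 0))"

definition natF :: "'w measure \<Rightarrow> (real \<Rightarrow> 'w \<Rightarrow> 'a::euclidean_space measure) \<Rightarrow> real \<Rightarrow> 'w measure" where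
  "natF M X t = sigma (space M)
     {{\<omega> \<in> space M. measure (X r \<omega>) A \<in> B} | r A B.
        0 \<le> r \<and> r \<le> t \<and> A \<in> sets (borel :: 'a measure) \<and> B \<in> sets (borel :: real measure)}"

text \<open>X (on the probability space M) is the super-OU process started at mu, i.e. its law is
  P_mu: finite-measure-valued, right-continuous (weak topology) paths, X_0 = mu a.s., and the
  Markov property with Laplace functional E[exp(-X_{t+s}(f)) | F_t] = exp(-X_t(V_s f)).\<close>
definition superOU :: "real \<Rightarrow> real \<Rightarrow> real measure \<Rightarrow> real \<Rightarrow> real
    \<Rightarrow> 'w measure \<Rightarrow> (real \<Rightarrow> 'w \<Rightarrow> 'a::euclidean_space measure) \<Rightarrow> 'a measure \<Rightarrow> bool" where
  "superOU \<alpha> \<rho> \<pi> \<sigma> b M X \<mu> \<longleftrightarrow>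
     prob_space M \<and>
     (\<forall>t. \<forall>\<omega>\<in>space M. sets (X t \<omega>) = sets borel \<and> finite_measure (X t \<omega>)) \<and>
     (\<forall>t\<ge>0. \<forall>A\<in>sets borel. (\<lambda>\<omega>. measure (X t \<omega>) A) \<in> borel_measurable M) \<and>
     (AE \<omega> in M. X 0 \<omega> = \<mu>) \<and>
     (\<forall>\<omega>\<in>space M. \<forall>g::'a \<Rightarrow> real. continuous_on UNIV g \<and> bounded (range g) \<longrightarrow>
        (\<forall>t\<ge>0. ((\<lambda>s. \<integral>x. g x \<partial>(X s \<omega>)) \<longlongrightarrow> (\<integral>x. g x \<partial>(X t \<omega>))) (at_right t))) \<and>
     (\<forall>t\<ge>0. \<forall>s\<ge>0. \<forall>f::'a \<Rightarrow> real.
        f \<in> borel_measurable borel \<and> bounded (range f) \<and> (\<forall>x. 0 \<le> f x) \<longrightarrow>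
        (AE \<omega> in M. real_cond_exp M (natF M X t) (\<lambda>\<omega>. exp (- (\<integral>x. f x \<partial>(X (t + s) \<omega>)))) \<omega>
            = exp (- (\<integral>x. cumV \<alpha> \<rho> \<pi> \<sigma> b f s x \<partial>(X t \<omega>)))))"

definition survival :: "'w measure \<Rightarrow> (real \<Rightarrow> 'w \<Rightarrow> 'a::euclidean_space measure) \<Rightarrow> 'w set" where
  "survival M X = {\<omega> \<in> space M. \<forall>t\<ge>0. measure (X t \<omega>) UNIV \<noteq> 0}"

definition poly_growth :: "('a::euclidean_space \<Rightarrow> real) \<Rightarrow> bool" where
  "poly_growth f \<longleftrightarrow> f \<in> borel_measurable borel \<and> (\<exists>C (n::nat). \<forall>x. \<bar>f x\<bar> \<le> C * (1 + norm x ^ n))"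

text \<open>Tail condition int_{(1,oo)} y^{1+beta+delta} |pi(dy) - eta dy/(Gamma(-1-beta) y^{2+beta})| < oo,
  with the total variation |pi - nu| written via the Lebesgue decomposition of pi on (1,oo):
  pi = p(y) dy + pi restricted to a Lebesgue-null set N.\<close>
definition tail_cond :: "real measure \<Rightarrow> real \<Rightarrow> real \<Rightarrow> real \<Rightarrow> bool" where
  "tail_cond \<pi> \<eta> \<beta> \<delta> \<longleftrightarrow>
     (\<exists>p N. p \<in> borel_measurable borel \<and> (\<forall>y. 0 \<le> p y) \<and>
        N \<in> sets borel \<and> N \<subseteq> {1<..} \<and> emeasure lborel N = 0 \<and>
        (\<forall>A\<in>sets borel. A \<subseteq> {1<..} \<longrightarrow>
           emeasure \<pi> A = (\<integral>\<^sup>+y. ennreal (p y) * indicator A y \<partial>lborel) + emeasure \<pi> (A \<inter> N)) \<and>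
        (\<integral>\<^sup>+y. ennreal (y powr (1 + \<beta> + \<delta>) *
              \<bar>p y - \<eta> / (Gamma (- 1 - \<beta>) * y powr (2 + \<beta>))\<bar>) * indicator {1<..} y \<partial>lborel)
        + (\<integral>\<^sup>+y. ennreal (y powr (1 + \<beta> + \<delta>)) * indicator N y \<partial>\<pi>) < \<infinity>)"

definition Z1 :: "real \<Rightarrow> real \<Rightarrow> real \<Rightarrow> real \<Rightarrow> real \<Rightarrow> ('a::euclidean_space \<Rightarrow> real) \<Rightarrow> 'a \<Rightarrow> complex" where
  "Z1 \<alpha> \<sigma> b \<eta> \<beta> f x =
     (LINT s:{0..1}|lborel. OU_Pa \<alpha> \<sigma> b (1 - s)
        (\<lambda>y. complex_of_real \<eta> * ((- \<i>) * complex_of_real (OU_Pa \<alpha> \<sigma> b s f y)) powr complex_of_real (1 + \<beta>)) x)"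

definition cond_conv_dist :: "'w measure \<Rightarrow> 'w set \<Rightarrow> (real \<Rightarrow> 'w \<Rightarrow> real) \<Rightarrow> real measure \<Rightarrow> bool" where
  "cond_conv_dist M A Y \<nu> \<longleftrightarrow>
     (\<forall>g::real \<Rightarrow> real. continuous_on UNIV g \<and> bounded (range g) \<longrightarrow>
        ((\<lambda>t. (\<integral>\<omega>. g (Y t \<omega>) * indicator A \<omega> \<partial>M) / measure M A) \<longlongrightarrow> (\<integral>x. g x \<partial>\<nu>)) at_top)"

fun conv_pow :: "real measure \<Rightarrow> nat \<Rightarrow> real measure" where
  "conv_pow \<nu> 0 = return borel 0"
| "conv_pow \<nu> (Suc n) = convolution \<nu> (conv_pow \<nu> n)"

definition stable_index :: "real \<Rightarrow> real measure \<Rightarrow> bool" where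
  "stable_index a \<nu> \<longleftrightarrow>
     (\<forall>n::nat. n \<ge> 1 \<longrightarrow> (\<exists>c. conv_pow \<nu> n = distr \<nu> borel (\<lambda>x. real n powr (1 / a) * x + c)))"

end

(* The Markov property reduces a Laplace transform of the fluctuation
   X_{t+T}(h) - X_t(P^alpha_T h), with h >= 0 and a small F_t-measurable factor L, to the expansion
     V_T(L h) = L P^alpha_T h - L^(1+beta) Z_T h + O(L^(1+beta+kappa)),
   which follows from a Gronwall argument in the mild equation, the tail condition giving
   psi(z) = -alpha z + eta z^(1+beta) + O(z^(1+beta+kappa)) near 0.  A first use of it, with L = e^(-alpha t),
   yields the law of large numbers X_t(g)/||X_t|| -> <g,phi> on survival, where Grey's condition
   ensures that ||X_t|| has order e^(alpha t) there.  A second use, with L = ||X_t||^(-1/(1+beta)), gives the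
   limit of E[exp(-a F1 - c F2)] for a, c >= 0, where F1, F2 are the normalized fluctuations of the positive and
   negative parts of f.  Damping by exp(-epsilon(F1 + F2)) turns these into a two-sided Laplace
   transform of F1 - F2, so Vitali's theorem carries the limit to the imaginary axis; then epsilon -> 0. *)
theory Submission
  imports Defs "HOL-Real_Asymp.Real_Asymp" "HOL-Complex_Analysis.Complex_Analysis"
begin

text \<open>The Laplace functional is given for bounded nonnegative test functions with constant
  coefficients, whereas f has polynomial growth and both signs and L is random. Cutting h off at k
  and rounding L down to multiples of 2^-k bridges the first and the third gap; the constants in the
  expansion must therefore depend on h only through its growth bound. The sign is the real obstacle.
  Each limiting fluctuation is totally asymmetric, so E[exp(-aF)] stays finite for a >= 0, but F1 -
  F2 has heavy tails on both sides and no Laplace transform off the imaginary axis. The damping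
  factor creates a strip |Re w| < epsilon on which one exists and is bounded uniformly in t; real w
  suffice to identify the limit there. The limit law is extracted from a tight family, which avoids
  checking that its exponent belongs to a probability law.\<close>

abbreviation "Bm \<equiv> borel_measurable"

abbreviation (input) seq_lim (infix "---->" 60) where
 "f ----> l \<equiv> LIMSEQ f l"

section \<open>Gaussian measure and the Ornstein--Uhlenbeck semigroup\<close>

lemma nn_integral_exp_neg_square:
 assumes "0 < a"
 shows "(\<integral>\<^sup>+x. ennreal (exp (- a * x\<^sup>2)) \<partial>lborel) = ennreal (sqrt (pi / a))"
proof -
 define s where "s = sqrt (1 / (2 * a))"
 have s: "0 < s" "s\<^sup>2 = 1 / (2 * a)" using assms by (auto simp: s_def)
 have eq: "exp (- a * x\<^sup>2) = sqrt (pi / a) * normal_density 0 s x" for x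
 proof -
  have "a = 1 / (2 * s\<^sup>2)" "pi / a = 2 * pi * s\<^sup>2" using assms s by (auto simp: field_simps)
  then show ?thesis using s(1) by (simp add: normal_density_def ac_simps)
 qed
 have "(\<integral>\<^sup>+x. ennreal (exp (- a * x\<^sup>2)) \<partial>lborel)
   = (\<integral>\<^sup>+x. ennreal (sqrt (pi / a)) * ennreal (normal_density 0 s x) \<partial>lborel)"
  unfolding eq using assms by (intro nn_integral_cong) (simp add: ennreal_mult)
 also have "... = ennreal (sqrt (pi / a)) * (\<integral>\<^sup>+x. ennreal (normal_density 0 s x) \<partial>lborel)"
  by (rule nn_integral_cmult) simp
 also have "(\<integral>\<^sup>+x. ennreal (normal_density 0 s x) \<partial>lborel) = 1"
  using prob_space.emeasure_space_1[OF prob_space_normal_density[OF s(1), of 0]]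
  by (simp add: emeasure_density)
 finally show ?thesis by simp
qed

lemma nn_integral_gauss:
 assumes "0 < a"
 shows "(\<integral>\<^sup>+x. ennreal (exp (- a * (norm (x::'a::euclidean_space))\<^sup>2)) \<partial>lborel)
  = ennreal ((pi / a) powr (real DIM('a) / 2))"
proof -
 have "exp (- a * (norm (x::'a))\<^sup>2) = (\<Prod>i\<in>Basis. exp (- a * (x \<bullet> i)\<^sup>2))" for x :: 'a
 proof -
  have "(norm x)\<^sup>2 = (\<Sum>i\<in>Basis. (x \<bullet> i)\<^sup>2)"
   unfolding power2_norm_eq_inner power2_eq_square[of "x \<bullet> _"] by (rule euclidean_inner)
  then show ?thesis by (simp add: exp_sum[symmetric] sum_distrib_left)
 qed
 then have "(\<integral>\<^sup>+x. ennreal (exp (- a * (norm (x::'a))\<^sup>2)) \<partial>lborel)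
   = (\<integral>\<^sup>+x. (\<Prod>i\<in>(Basis::'a set). ennreal (exp (- a * (x \<bullet> i)\<^sup>2))) \<partial>lborel)"
  by (simp add: prod_ennreal)
 also have "... = (\<Prod>i\<in>(Basis::'a set). \<integral>\<^sup>+x. ennreal (exp (- a * x\<^sup>2)) \<partial>lborel)"
  by (rule nn_integral_lborel_prod) auto
 also have "... = (\<Prod>i\<in>(Basis::'a set). ennreal (sqrt (pi / a)))"
  by (simp only: nn_integral_exp_neg_square[OF assms])
 also have "... = ennreal ((pi / a) powr (real DIM('a) / 2))"
  using assms
  by (simp add: ennreal_power powr_half_sqrt[symmetric] powr_powr powr_realpow[symmetric])
 finally show ?thesis .
qed

lemma sets_std_gauss [simp, measurable_cong]: "sets std_gauss = sets borel"
 by (simp add: std_gauss_def)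

lemma space_std_gauss [simp]: "space std_gauss = UNIV"
 by (simp add: std_gauss_def)

lemma nn_integral_std_gauss:
 assumes [measurable]: "f : Bm borel"
 shows "(\<integral>\<^sup>+z. f z \<partial>std_gauss) =
  (\<integral>\<^sup>+(z::'a::euclidean_space). ennreal ((2 * pi) powr (- real DIM('a) / 2)
    * exp (- (norm z)\<^sup>2 / 2)) * f z \<partial>lborel)"
 unfolding std_gauss_def by (subst nn_integral_density) auto

lemma prob_space_std_gauss: "prob_space (std_gauss :: 'a::euclidean_space measure)"
proof
 have "emeasure (std_gauss :: 'a measure) (space std_gauss) = (\<integral>\<^sup>+(z::'a). 1 \<partial>std_gauss)"
  by simp
 also have "... = (\<integral>\<^sup>+(z::'a). ennreal ((2 * pi) powr (- real DIM('a) / 2))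
    * ennreal (exp (- (1/2) * (norm z)\<^sup>2)) \<partial>lborel)"
  by (subst nn_integral_std_gauss) (auto simp: ennreal_mult'[symmetric])
 also have "... = ennreal ((2 * pi) powr (- real DIM('a) / 2))
    * ennreal ((pi / (1/2)) powr (real DIM('a) / 2))"
  using nn_integral_gauss[of "1/2", where 'a='a] by (subst nn_integral_cmult) auto
 also have "... = 1"
  by (simp add: ennreal_mult'[symmetric] powr_add[symmetric] mult.commute)
 finally show "emeasure (std_gauss :: 'a measure) (space std_gauss) = 1" .
qed

interpretation std_gauss: prob_space "std_gauss :: 'a::euclidean_space measure"
 by (rule prob_space_std_gauss)

lemma emeasure_std_gauss_UNIV [simp]: "emeasure std_gauss UNIV = 1"
 and measure_std_gauss_UNIV [simp]: "measure std_gauss UNIV = 1"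
 by (rule std_gauss.emeasure_space_1[unfolded space_std_gauss], rule std_gauss.prob_space[unfolded space_std_gauss])

text \<open>The density of \<open>c\<close> times a standard Gaussian vector, for
  \<open>c > 0\<close>.\<close>

definition gauss_kernel :: "real => 'a::euclidean_space => real" where
 "gauss_kernel c y = (2 * pi * c\<^sup>2) powr (- real DIM('a) / 2) * exp (- (norm y)\<^sup>2 / (2 * c\<^sup>2))"

lemma gauss_kernel_nonneg [simp]: "0 <= gauss_kernel c y"
 by (simp add: gauss_kernel_def)

lemma gauss_kernel_measurable [measurable]: "gauss_kernel c : Bm borel"
 unfolding gauss_kernel_def by simp

lemma nn_integral_std_gauss_affine:
 fixes m :: "'a::euclidean_space"
 assumes "0 < c" and [measurable]: "f : Bm borel"
 shows "(\<integral>\<^sup>+z. f (m + c *\<^sub>R z) \<partial>std_gauss) = (\<integral>\<^sup>+y. ennreal (gauss_kernel c (y - m)) * f y \<partial>lborel)"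
proof -
 have *: "c ^ DIM('a) * gauss_kernel c (c *\<^sub>R z)
   = (2 * pi) powr (- real DIM('a) / 2) * exp (- (norm z)\<^sup>2 / 2)" for z :: 'a
 proof -
  have "(2 * pi * c\<^sup>2) powr (- real DIM('a) / 2)
    = (2 * pi) powr (- real DIM('a) / 2) * (c powr 2) powr (- real DIM('a) / 2)"
   using assms(1) by (simp add: powr_mult powr_numeral)
  also have "(c powr 2) powr (- real DIM('a) / 2) = c powr (- real DIM('a))"
   by (simp add: powr_powr)
  finally show ?thesis
   using assms(1)
   by (simp add: gauss_kernel_def power_mult_distrib powr_minus powr_realpow field_simps)
 qed
 have "(\<integral>\<^sup>+y. ennreal (gauss_kernel c (y - m)) * f y \<partial>lborel)
  = (\<integral>\<^sup>+y. ennreal (gauss_kernel c (y - m)) * f y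
    \<partial>density (distr lborel borel (%x. m + c *\<^sub>R x)) (%_. ennreal (\<bar>c\<bar> ^ DIM('a))))"
  using lborel_affine[of c m] assms(1) by simp
 also have "... = (\<integral>\<^sup>+z. ennreal (\<bar>c\<bar> ^ DIM('a)) * (ennreal (gauss_kernel c (c *\<^sub>R z)) * f (m + c *\<^sub>R z)) \<partial>lborel)"
  by (subst nn_integral_density, simp, simp, subst nn_integral_distr) auto
 also have "... = (\<integral>\<^sup>+z. ennreal (c ^ DIM('a) * gauss_kernel c (c *\<^sub>R z)) * f (m + c *\<^sub>R z) \<partial>lborel)"
  using assms(1) by (simp add: ennreal_mult mult.assoc)
 also have "... = (\<integral>\<^sup>+z. f (m + c *\<^sub>R z) \<partial>std_gauss)"
  unfolding * by (subst nn_integral_std_gauss) auto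
 finally show ?thesis by simp
qed

lemma nn_integral_gauss_kernel:
 assumes "0 < c" shows "(\<integral>\<^sup>+y. ennreal (gauss_kernel c (y - (m::'a::euclidean_space))) \<partial>lborel) = 1"
proof -
 have "(\<integral>\<^sup>+y. ennreal (gauss_kernel c (y - m)) * 1 \<partial>lborel) = (\<integral>\<^sup>+(z::'a). 1 \<partial>std_gauss)"
  by (rule nn_integral_std_gauss_affine[OF assms, symmetric]) simp
 then show ?thesis by simp
qed

text \<open>Completing the square. With u = c1 z1 + c2 z2 and v = c2 z2 the left side is the joint
  density of (u, v), and the right side factors it into the density of u and the conditional density
  of v given u.\<close>

lemma gauss_kernel_mult:
 fixes u v :: "'a::euclidean_space"
 assumes "0 < c1" "0 < c2"
 defines "c \<equiv> sqrt (c1\<^sup>2 + c2\<^sup>2)"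
 shows "gauss_kernel c1 (u - v) * gauss_kernel c2 v
  = gauss_kernel c u * gauss_kernel (c1 * c2 / c) (v - (c2\<^sup>2 / c\<^sup>2) *\<^sub>R u)"
proof -
 have c: "0 < c" "c\<^sup>2 = c1\<^sup>2 + c2\<^sup>2"
  using assms by (auto simp: c_def add_pos_pos)
 let ?p = "- real DIM('a) / 2"
 have "(2 * pi * c1\<^sup>2) * (2 * pi * c2\<^sup>2) = (2 * pi * c\<^sup>2) * (2 * pi * (c1 * c2 / c)\<^sup>2)"
  using c(1) by (simp add: field_simps)
 then have pw: "(2 * pi * c1\<^sup>2) powr ?p * (2 * pi * c2\<^sup>2) powr ?p
   = (2 * pi * c\<^sup>2) powr ?p * (2 * pi * (c1 * c2 / c)\<^sup>2) powr ?p"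
  by (metis powr_mult zero_le_mult_iff pi_ge_zero zero_le_numeral zero_le_power2)
 have nuv: "(norm (u - v))\<^sup>2 = (norm u)\<^sup>2 - 2 * (u \<bullet> v) + (norm v)\<^sup>2"
  by (simp add: power2_norm_eq_inner inner_diff inner_commute)
 have nvu: "(norm (v - k *\<^sub>R u))\<^sup>2 = (norm v)\<^sup>2 - 2 * k * (u \<bullet> v) + k\<^sup>2 * (norm u)\<^sup>2" for k
  unfolding power2_norm_eq_inner by (simp add: inner_diff inner_commute power2_eq_square algebra_simps)
 have ex: "- (norm (u - v))\<^sup>2 / (2 * c1\<^sup>2) + - (norm v)\<^sup>2 / (2 * c2\<^sup>2)
   = - (norm u)\<^sup>2 / (2 * c\<^sup>2) + - (norm (v - (c2\<^sup>2 / c\<^sup>2) *\<^sub>R u))\<^sup>2 / (2 * (c1 * c2 / c)\<^sup>2)"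
 proof -
  \<comment> \<open>In the variances A, B and D = A + B the identity of the exponents is an identity
    of rational functions.\<close>
  define A B D where "A = c1\<^sup>2" "B = c2\<^sup>2" "D = c\<^sup>2"
  have AB: "A > 0" "B > 0" "D = A + B" "D > 0" using assms c by (auto simp: A_B_D_def)
  have "(c1 * c2 / c)\<^sup>2 = A * B / D"
   by (simp add: A_B_D_def power_mult_distrib power_divide)
  then show ?thesis
   unfolding nuv nvu A_B_D_def[symmetric]
   apply (simp add: AB(3))
   using AB(1,2) AB(4)[unfolded AB(3)]
   apply (simp add: divide_simps)
   apply (simp add: algebra_simps power2_eq_square)
   done
 qed
 have "gauss_kernel c1 (u - v) * gauss_kernel c2 v
   = ((2 * pi * c1\<^sup>2) powr ?p * (2 * pi * c2\<^sup>2) powr ?p)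
    * exp (- (norm (u - v))\<^sup>2 / (2 * c1\<^sup>2) + - (norm v)\<^sup>2 / (2 * c2\<^sup>2))"
  by (simp only: gauss_kernel_def exp_add mult_ac)
 also have "... = gauss_kernel c u * gauss_kernel (c1 * c2 / c) (v - (c2\<^sup>2 / c\<^sup>2) *\<^sub>R u)"
  unfolding pw ex exp_add by (simp only: gauss_kernel_def mult_ac)
 finally show ?thesis .
qed

text \<open>Under the factorization \<open>gauss_kernel_mult\<close> the conditional density
  integrates to 1, and the density of the sum remains.\<close>

lemma distr_std_gauss_add:
 assumes "0 < c1" "0 < c2"
 shows "distr (std_gauss \<Otimes>\<^sub>M std_gauss) borel (%(z1, z2). c1 *\<^sub>R z1 + c2 *\<^sub>R (z2::'a::euclidean_space))
  = distr std_gauss borel (%z. sqrt (c1\<^sup>2 + c2\<^sup>2) *\<^sub>R z)" (is "?L = ?R")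
proof (rule measure_eqI)
 define c where "c = sqrt (c1\<^sup>2 + c2\<^sup>2)"
 have c: "0 < c" using assms by (auto simp: c_def add_pos_pos)
 fix A assume "A : sets ?L"
 then have [measurable]: "A : sets borel" by simp
 interpret pg: pair_sigma_finite "std_gauss :: 'a measure" "std_gauss :: 'a measure"
  by (intro pair_sigma_finite.intro std_gauss.sigma_finite_measure_axioms)
 have "emeasure ?L A = (\<integral>\<^sup>+x. indicator A x \<partial>?L)" by simp
 also have "... = (\<integral>\<^sup>+z. indicator A (c1 *\<^sub>R fst z + c2 *\<^sub>R snd z) \<partial>(std_gauss \<Otimes>\<^sub>M std_gauss))"
  by (subst nn_integral_distr) (auto simp: split_beta')
 also have "... = (\<integral>\<^sup>+z2. (\<integral>\<^sup>+z1. indicator A (c2 *\<^sub>R z2 + c1 *\<^sub>R z1) \<partial>std_gauss) \<partial>std_gauss)"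
  by (subst pg.nn_integral_snd[symmetric]) (auto simp: add.commute)
 also have "... = (\<integral>\<^sup>+z2. (\<integral>\<^sup>+y. ennreal (gauss_kernel c1 (y - c2 *\<^sub>R z2)) * indicator A y \<partial>lborel) \<partial>std_gauss)"
  by (subst nn_integral_std_gauss_affine[OF assms(1)]) auto
 also have "... = (\<integral>\<^sup>+y. (\<integral>\<^sup>+z2. ennreal (gauss_kernel c1 (y - (0 + c2 *\<^sub>R z2))) * indicator A y \<partial>std_gauss) \<partial>lborel)"
  by (subst pair_sigma_finite.Fubini')
    (auto intro: pair_sigma_finite.intro std_gauss.sigma_finite_measure_axioms lborel.sigma_finite_measure_axioms)
 also have "... = (\<integral>\<^sup>+y. (\<integral>\<^sup>+v. ennreal (gauss_kernel c2 (v - 0)) * (ennreal (gauss_kernel c1 (y - v)) * indicator A y) \<partial>lborel) \<partial>lborel)"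
  by (subst nn_integral_std_gauss_affine[OF assms(2), where m=0]) auto
 also have "... = (\<integral>\<^sup>+y. (\<integral>\<^sup>+v. (ennreal (gauss_kernel c y) * indicator A y)
    * ennreal (gauss_kernel (c1 * c2 / c) (v - (c2\<^sup>2 / c\<^sup>2) *\<^sub>R y)) \<partial>lborel) \<partial>lborel)"
  using gauss_kernel_mult[OF assms, folded c_def]
  by (intro nn_integral_cong) (auto simp: ennreal_mult''[symmetric] indicator_def mult_ac)
 also have "... = (\<integral>\<^sup>+y. (ennreal (gauss_kernel c (y - 0)) * indicator A y) \<partial>lborel)"
  using assms c by (subst nn_integral_cmult) (auto simp: nn_integral_gauss_kernel)
 also have "... = (\<integral>\<^sup>+z. indicator A (0 + c *\<^sub>R z) \<partial>std_gauss)"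
  by (subst nn_integral_std_gauss_affine[OF c]) auto
 also have "... = emeasure ?R A"
  by (subst nn_integral_indicator[symmetric], simp, subst nn_integral_distr) (auto simp: c_def)
 finally show "emeasure ?L A = emeasure ?R A" .
qed simp

section \<open>Polynomial weights and Gaussian moments\<close>

text \<open>The summand 1 keeps the weight bounded below, so that constants are dominated by
  multiples of every \<open>wt n\<close> and a bounded function is the case \<open>n = 0\<close>,
  where the weight is the constant 2.\<close>

definition wt :: "nat => 'a::euclidean_space => real" where
 "wt n x = 1 + norm x ^ n"

lemma wt_ge_1 [simp]: "1 <= wt n x" and wt_pos [simp]: "0 < wt n x" and wt_nonneg [simp]: "0 <= wt n x"
 by (auto simp: wt_def add_pos_nonneg)

lemma wt_measurable [measurable]: "wt n : Bm borel"
 unfolding wt_def by measurable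

lemma wt_mono:
 fixes x :: "'a::euclidean_space"
 assumes "n <= m" shows "wt n x <= 2 * wt m x"
proof -
 define r where "r = norm x"
 have r: "0 <= r" by (simp add: r_def)
 have "r ^ n <= 1 + r ^ m"
 proof (cases "r <= 1")
  case True
  then have "r ^ n <= 1" using r by (simp add: power_le_one)
  moreover have "0 <= r ^ m" using r by simp
  ultimately show ?thesis by linarith
 next
  case False
  then have "r ^ n <= r ^ m" using assms by (intro power_increasing) auto
  then show ?thesis by linarith
 qed
 then have "1 + r ^ n <= 2 + 2 * r ^ m" using zero_le_power[OF r, of m] by linarith
 then show ?thesis by (simp add: wt_def r_def)
qed

lemma wt_square: "(wt n x)\<^sup>2 <= 2 * wt (2 * n) x"
proof -
 define p where "p = norm x ^ n"
 have "norm x ^ (2 * n) = p\<^sup>2" by (simp add: p_def power_mult mult.commute)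
 moreover have "0 <= (1 - p)\<^sup>2" by simp
 then have "(1 + p)\<^sup>2 <= 2 * (1 + p\<^sup>2)" by (simp add: power2_eq_square algebra_simps)
 ultimately show ?thesis by (simp add: wt_def p_def)
qed

text \<open>For an exponent between 1 and 2 the power is dominated by the square, because
  \<open>C * wt n x\<close> is at least 1; squaring doubles the degree of the weight. Applied with p
  = 1 + beta, this is how the degree grows from n to 2n.\<close>

lemma wt_powr:
 assumes "1 <= p" "p <= 2" "1 <= C" "0 <= u" "u <= C * wt n x"
 shows "u powr p <= 2 * C\<^sup>2 * wt (2 * n) x"
proof -
 have 1: "1 <= C * wt n x" using assms(3) mult_mono[of 1 C 1 "wt n x"] by simp
 have "u powr p <= (C * wt n x) powr p" using assms by (intro powr_mono2) auto
 also have "... <= (C * wt n x) powr 2" using assms 1 by (intro powr_mono) auto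
 also have "... = C\<^sup>2 * (wt n x)\<^sup>2" using assms by (simp add: powr_numeral power_mult_distrib)
 also have "... <= C\<^sup>2 * (2 * wt (2 * n) x)" by (intro mult_left_mono wt_square) auto
 finally show ?thesis by simp
qed

lemma wt_add_scale:
 assumes "norm x' <= norm x"
 shows "wt n (x' + c *\<^sub>R z) <= 1 + 2 ^ n * (norm x ^ n + \<bar>c\<bar> ^ n * norm z ^ n)"
proof -
 define p q where "p = norm x" and "q = \<bar>c\<bar> * norm z"
 have pq: "0 <= p" "0 <= q" by (auto simp: p_def q_def)
 have "norm (x' + c *\<^sub>R z) <= p + q"
  using norm_triangle_ineq[of x' "c *\<^sub>R z"] assms by (simp add: p_def q_def)
 also have "p + q <= 2 * max p q" by linarith
 finally have "norm (x' + c *\<^sub>R z) ^ n <= (2 * max p q) ^ n"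
  by (intro power_mono) auto
 also have "... = 2 ^ n * max p q ^ n" by (rule power_mult_distrib)
 also have "max p q ^ n <= p ^ n + q ^ n"
  using pq by (cases "p <= q") (auto simp: max_def)
 finally show ?thesis by (simp add: wt_def p_def q_def power_mult_distrib)
qed

lemma integrable_std_gauss_norm_power: "integrable std_gauss (%z::'a::euclidean_space. norm z ^ n)"
proof (rule integrableI_nonneg)
 \<comment> \<open>A single term of the exponential series gives r^n <= n! e^r, and (r/2 - 1)^2 >= 0
   absorbs e^r into half of the Gaussian exponent.\<close>
 have bd: "norm z ^ n * exp (- (norm z)\<^sup>2 / 2) <= (fact n * exp 1) * exp (- (1/4) * (norm z)\<^sup>2)" for z :: 'a
 proof -
  define r where "r = norm z"
  have r: "0 <= r" by (simp add: r_def)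
  have "(\<Sum>k\<in>{n}. r ^ k /\<^sub>R fact k) <= exp r"
   unfolding exp_def by (rule sum_le_suminf[OF summable_exp_generic]) (auto simp: r)
  then have "r ^ n <= fact n * exp r" by (simp add: field_simps)
  then have "r ^ n * exp (- r\<^sup>2 / 2) <= fact n * exp r * exp (- r\<^sup>2 / 2)"
   by (intro mult_right_mono) auto
  also have "... = fact n * exp (r - r\<^sup>2 / 2)" by (simp only: mult.assoc exp_add[symmetric]) (simp add: field_simps)
  also have "... <= fact n * exp (1 - r\<^sup>2 / 4)"
  proof -
   have "0 <= (r / 2 - 1)\<^sup>2" by simp
   then have "r - r\<^sup>2 / 2 <= 1 - r\<^sup>2 / 4" by (simp add: power2_eq_square algebra_simps)
   then show ?thesis by simp
  qed
  also have "... = (fact n * exp 1) * exp (- (1/4) * r\<^sup>2)"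
   by (simp only: mult.assoc exp_add[symmetric]) (simp add: field_simps)
  finally show ?thesis by (simp add: r_def)
 qed
 let ?K = "(2 * pi) powr (- real DIM('a) / 2)"
 have "(\<integral>\<^sup>+(z::'a). ennreal (norm z ^ n) \<partial>std_gauss)
   = (\<integral>\<^sup>+(z::'a). ennreal (?K * exp (- (norm z)\<^sup>2 / 2)) * ennreal (norm z ^ n) \<partial>lborel)"
  by (subst nn_integral_std_gauss) auto
 also have "... <= (\<integral>\<^sup>+(z::'a). ennreal (?K * (fact n * exp 1)) * ennreal (exp (- (1/4) * (norm z)\<^sup>2)) \<partial>lborel)"
 proof (intro nn_integral_mono)
  fix z :: 'a
  show "ennreal (?K * exp (- (norm z)\<^sup>2 / 2)) * ennreal (norm z ^ n)
    <= ennreal (?K * (fact n * exp 1)) * ennreal (exp (- (1/4) * (norm z)\<^sup>2))"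
   using mult_left_mono[OF bd[of z], of ?K]
   by (simp add: ennreal_mult''[symmetric] mult_ac ennreal_leI)
 qed
 also have "... = ennreal (?K * (fact n * exp 1)) * (\<integral>\<^sup>+(z::'a). ennreal (exp (- (1/4) * (norm z)\<^sup>2)) \<partial>lborel)"
  by (rule nn_integral_cmult) auto
 also have "... < \<infinity>"
  by (subst nn_integral_gauss) (auto simp: ennreal_mult_less_top)
 finally show "(\<integral>\<^sup>+z. ennreal (norm (z::'a) ^ n) \<partial>std_gauss) < \<infinity>" .
qed auto

lemma integrable_std_gauss_wt:
 fixes f :: "'a::euclidean_space => 'b::{banach, second_countable_topology}"
 assumes [measurable]: "f : Bm borel" and bd: "!!y. norm (f y) <= C * wt n y"
 shows "integrable std_gauss (%z. f (x + c *\<^sub>R z))"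
proof (rule Bochner_Integration.integrable_bound)
 show "integrable std_gauss (%z::'a. \<bar>C\<bar> * (1 + 2 ^ n * (norm x ^ n + \<bar>c\<bar> ^ n * norm z ^ n)))"
  using integrable_std_gauss_norm_power[where 'a='a] by (auto intro!: Bochner_Integration.integrable_add)
 show "AE z in std_gauss. norm (f (x + c *\<^sub>R z))
   <= norm (\<bar>C\<bar> * (1 + 2 ^ n * (norm x ^ n + \<bar>c\<bar> ^ n * norm z ^ n)))"
 proof (rule AE_I2)
  fix z :: 'a
  have "norm (f (x + c *\<^sub>R z)) <= \<bar>C\<bar> * wt n (x + c *\<^sub>R z)"
   by (rule order_trans[OF bd]) (intro mult_right_mono, auto)
  also have "... <= \<bar>C\<bar> * (1 + 2 ^ n * (norm x ^ n + \<bar>c\<bar> ^ n * norm z ^ n))"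
   by (intro mult_left_mono wt_add_scale) auto
  finally show "norm (f (x + c *\<^sub>R z)) <= norm (\<bar>C\<bar> * (1 + 2 ^ n * (norm x ^ n + \<bar>c\<bar> ^ n * norm z ^ n)))"
   by simp
 qed
qed simp

section \<open>The Ornstein-Uhlenbeck semigroup on functions of polynomial growth\<close>

definition ou_sd :: "real => real => real => real" where
 "ou_sd \<sigma> b t = \<sigma> * sqrt ((1 - exp (- 2 * b * t)) / (2 * b))"

lemma OU_P_eq: "OU_P \<sigma> b t f x = (LINT z|std_gauss. f (exp (- b * t) *\<^sub>R x + ou_sd \<sigma> b t *\<^sub>R z))"
 by (simp add: OU_P_def ou_sd_def)

lemma ou_sd_measurable [measurable]: "ou_sd \<sigma> b : Bm borel"
 unfolding ou_sd_def by measurable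

text \<open>Time, function and point may all depend on the parameter, which lets the measurability
  of nested integrals over time and space be derived automatically.\<close>

lemma OU_P_measurable [measurable (raw)]:
 assumes [measurable]: "(%(\<omega>, y). G \<omega> y) : Bm (N \<Otimes>\<^sub>M borel)"
  "s : Bm N" "x : Bm N"
 shows "(%\<omega>. OU_P \<sigma> b (s \<omega>) (G \<omega>) (x \<omega>)) : Bm N"
 unfolding OU_P_eq by measurable

lemma OU_P_0 [simp]: "OU_P \<sigma> b 0 f x = f x"
 by (simp add: OU_P_eq ou_sd_def)

locale ou =
 fixes \<sigma> b :: real
 assumes sigma_pos: "0 < \<sigma>" and b_pos: "0 < b"
begin

abbreviation "sd \<equiv> ou_sd \<sigma> b"

definition "sd_inf = \<sigma> / sqrt (2 * b)"

lemma sd_inf_pos: "0 < sd_inf"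
 using sigma_pos b_pos by (simp add: sd_inf_def)

lemma sd_nonneg: "0 <= t ==> 0 <= sd t"
 using sigma_pos b_pos by (simp add: ou_sd_def)

lemma sd_pos: "0 < t ==> 0 < sd t"
 using sigma_pos b_pos by (simp add: ou_sd_def)

lemma sd_le: "0 <= t ==> sd t <= sd_inf"
proof -
 assume "0 <= t"
 have *: "sqrt ((1 - exp (- 2 * b * t)) / (2 * b)) <= sqrt (1 / (2 * b))"
  using b_pos by (intro real_sqrt_le_mono divide_right_mono) auto
 then show ?thesis
  using mult_left_mono[OF *, of \<sigma>] sigma_pos by (simp add: ou_sd_def sd_inf_def real_sqrt_divide)
qed

lemma sd_square: "0 <= t ==> (sd t)\<^sup>2 = \<sigma>\<^sup>2 * (1 - exp (- 2 * b * t)) / (2 * b)"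
 using b_pos by (simp add: ou_sd_def power_mult_distrib)

lemma norm_drift_le: "0 <= t ==> norm (exp (- b * t) *\<^sub>R x) <= norm x"
 using b_pos mult_right_mono[of "exp (- b * t)" 1 "norm x"] by simp

text \<open>Uniform in t, since the standard deviation never exceeds its stationary value
  \<open>sd_inf\<close>. The type argument only transmits the dimension that enters the Gaussian
  moment.\<close>

definition growth_const :: "'a::euclidean_space itself => nat => real" where
 "growth_const T n = 2 ^ n * (1 + sd_inf ^ n * (LINT z|std_gauss. norm (z::'a) ^ n))"

lemma growth_const_ge_1: "1 <= growth_const T n"
proof -
 have "0 <= sd_inf ^ n * (LINT z|std_gauss. norm (z::'a) ^ n)"
  using sd_inf_pos by (intro mult_nonneg_nonneg) auto
 then have "1 * 1 <= growth_const T n"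
  unfolding growth_const_def by (intro mult_mono) auto
 then show ?thesis by simp
qed

lemma integrable_OU:
 fixes f :: "'a::euclidean_space => 'b::{banach, second_countable_topology}"
 assumes "f : Bm borel" "!!y. norm (f y) <= C * wt n y"
 shows "integrable std_gauss (%z. f (exp (- b * t) *\<^sub>R x + sd t *\<^sub>R z))"
 using assms by (rule integrable_std_gauss_wt)

lemma OU_P_wt:
 fixes x :: "'a::euclidean_space"
 assumes "0 <= t"
 shows "OU_P \<sigma> b t (wt n) x <= growth_const TYPE('a) n * wt n x"
proof -
 have "OU_P \<sigma> b t (wt n) x <= (LINT (z::'a)|std_gauss. 1 + 2 ^ n * (norm x ^ n + sd_inf ^ n * norm z ^ n))"
  unfolding OU_P_eq
 proof (rule integral_mono)
  show "integrable std_gauss (%z. wt n (exp (- b * t) *\<^sub>R x + sd t *\<^sub>R z))"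
   by (rule integrable_OU[where C=1]) auto
  show "integrable std_gauss (%z::'a. 1 + 2 ^ n * (norm x ^ n + sd_inf ^ n * norm z ^ n))"
   using integrable_std_gauss_norm_power[where 'a='a] by (auto intro!: Bochner_Integration.integrable_add)
  fix z :: 'a
  have "wt n (exp (- b * t) *\<^sub>R x + sd t *\<^sub>R z) <= 1 + 2 ^ n * (norm x ^ n + \<bar>sd t\<bar> ^ n * norm z ^ n)"
   by (rule wt_add_scale[OF norm_drift_le[OF assms]])
  also have "... <= 1 + 2 ^ n * (norm x ^ n + sd_inf ^ n * norm z ^ n)"
   using sd_le[OF assms] sd_nonneg[OF assms]
   by (intro add_left_mono mult_left_mono mult_right_mono power_mono) auto
  finally show "wt n (exp (- b * t) *\<^sub>R x + sd t *\<^sub>R z)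
   <= 1 + 2 ^ n * (norm x ^ n + sd_inf ^ n * norm z ^ n)" .
 qed
 also have "... = 1 + 2 ^ n * (norm x ^ n + sd_inf ^ n * (LINT z|std_gauss. norm (z::'a) ^ n))"
  using integrable_std_gauss_norm_power[where 'a='a, of n] by simp
 also have "... <= growth_const TYPE('a) n * wt n x"
 proof -
  define m where "m = sd_inf ^ n * (LINT z|std_gauss. norm (z::'a) ^ n)"
  have m: "0 <= m" using sd_inf_pos by (auto simp: m_def)
  define T where "T = (2::real) ^ n"
  have "1 <= T" by (simp add: T_def)
  moreover have "0 <= T * (m * norm x ^ n)" using m by (simp add: T_def)
  ultimately show ?thesis unfolding growth_const_def wt_def m_def[symmetric] T_def[symmetric]
   by (simp add: algebra_simps)
 qed
 finally show ?thesis .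
qed

lemma OU_P_mono:
 fixes f g :: "'a::euclidean_space => real"
 assumes "f : Bm borel" "!!y. \<bar>f y\<bar> <= C * wt n y"
  and "g : Bm borel" "!!y. \<bar>g y\<bar> <= D * wt m y" and "!!y. f y <= g y"
 shows "OU_P \<sigma> b t f x <= OU_P \<sigma> b t g x"
 unfolding OU_P_eq using assms by (intro integral_mono integrable_OU) auto

lemma OU_P_nonneg: "(!!y. 0 <= f y) ==> 0 <= (OU_P \<sigma> b t f x :: real)"
 unfolding OU_P_eq by (rule integral_nonneg_AE) auto

lemma OU_P_norm_le:
 fixes f :: "'a::euclidean_space => 'b::{banach, second_countable_topology}"
 assumes "f : Bm borel" "!!y. norm (f y) <= C * wt n y" "0 <= t"
 shows "norm (OU_P \<sigma> b t f x) <= C * growth_const TYPE('a) n * wt n x"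
proof -
 have C: "0 <= C" using order_trans[OF norm_ge_zero assms(2)[of 0]] by (simp add: zero_le_mult_iff wt_def power_0_left split: if_splits)
 have "norm (OU_P \<sigma> b t f x) <= (LINT z|std_gauss. norm (f (exp (- b * t) *\<^sub>R x + sd t *\<^sub>R z)))"
  unfolding OU_P_eq by (rule integral_norm_bound)
 also have "... <= (LINT z|std_gauss. C * wt n (exp (- b * t) *\<^sub>R x + sd t *\<^sub>R z))"
 proof (rule integral_mono)
  show "integrable std_gauss (%z. norm (f (exp (- b * t) *\<^sub>R x + sd t *\<^sub>R z)))"
   using integrable_OU[OF assms(1,2)] by simp
  show "integrable std_gauss (%z. C * wt n (exp (- b * t) *\<^sub>R x + sd t *\<^sub>R z))"
   by (intro integrable_mult_right integrable_OU[where C=1]) auto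
 qed (use assms in auto)
 also have "... = C * OU_P \<sigma> b t (wt n) x" by (simp add: OU_P_eq)
 also have "... <= C * (growth_const TYPE('a) n * wt n x)"
  using C by (intro mult_left_mono OU_P_wt assms)
 finally show ?thesis by (simp add: mult_ac)
qed

lemma OU_P_bounded:
 fixes f :: "'a::euclidean_space => 'b::{banach, second_countable_topology}"
 assumes "f : Bm borel" "!!y. norm (f y) <= C"
 shows "norm (OU_P \<sigma> b t f x) <= C"
proof -
 have "norm (OU_P \<sigma> b t f x) <= (LINT z|std_gauss. norm (f (exp (- b * t) *\<^sub>R x + sd t *\<^sub>R z)))"
  unfolding OU_P_eq by (rule integral_norm_bound)
 also have "... <= (LINT (z::'a)|std_gauss. C)"
  using assms order_trans[OF norm_ge_zero assms(2)[of 0]]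
  by (intro integral_mono std_gauss.integrable_const_bound[where B=C]) auto
 also have "... = C" by simp
 finally show ?thesis .
qed

lemma sd_semigroup:
 assumes "0 <= s" "0 <= t"
 shows "sqrt ((exp (- b * t) * sd s)\<^sup>2 + (sd t)\<^sup>2) = sd (s + t)"
proof -
 have e: "(exp (- b * t))\<^sup>2 = exp (- 2 * b * t)"
  by (simp add: power2_eq_square flip: exp_add)
 have "(exp (- b * t) * sd s)\<^sup>2 + (sd t)\<^sup>2
   = \<sigma>\<^sup>2 * (exp (- 2 * b * t) * (1 - exp (- 2 * b * s)) + (1 - exp (- 2 * b * t))) / (2 * b)"
  unfolding power_mult_distrib e using assms
  using b_pos by (simp add: sd_square field_simps)
 also have "... = \<sigma>\<^sup>2 * (1 - exp (- 2 * b * (s + t))) / (2 * b)"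
  by (simp add: algebra_simps exp_add[symmetric])
 also have "... = (sd (s + t))\<^sup>2" using assms by (simp add: sd_square)
 finally show ?thesis using sd_nonneg[of "s + t"] assms by simp
qed

text \<open>Two successive steps add two independent Gaussian vectors with standard deviations
  \<open>c1\<close> and \<open>c2\<close>, and \<open>sd_semigroup\<close> is the addition of their
  variances. The times 0 are split off because there the variance degenerates.\<close>

lemma OU_P_semigroup:
 fixes f :: "'a::euclidean_space => 'b::{banach, second_countable_topology}"
 assumes f[measurable]: "f : Bm borel" and bd: "!!y. norm (f y) <= C * wt n y"
  and "0 <= s" "0 <= t"
 shows "OU_P \<sigma> b s (OU_P \<sigma> b t f) x = OU_P \<sigma> b (s + t) f x"
proof (cases "s = 0 \<or> t = 0")
 case True
 then show ?thesis by (auto simp: OU_P_0[abs_def])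
next
 case False
 then have st: "0 < s" "0 < t" using assms by auto
 define c1 c2 m where "c1 = exp (- b * t) * sd s" and "c2 = sd t" and "m = exp (- b * (s + t)) *\<^sub>R x"
 have c: "0 < c1" "0 < c2" "sqrt (c1\<^sup>2 + c2\<^sup>2) = sd (s + t)"
  using sd_pos st sd_semigroup[of s t] by (auto simp: c1_def c2_def)
 interpret pg: pair_sigma_finite "std_gauss :: 'a measure" "std_gauss :: 'a measure"
  by (intro pair_sigma_finite.intro std_gauss.sigma_finite_measure_axioms)
 have D: "distr (std_gauss \<Otimes>\<^sub>M std_gauss) borel (%(z1, z2). c1 *\<^sub>R z1 + c2 *\<^sub>R (z2::'a))
  = distr std_gauss borel (%z. sd (s + t) *\<^sub>R z)"
  using distr_std_gauss_add[OF c(1,2), where 'a='a, unfolded c(3)] .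
 have "integrable std_gauss (%z. f (m + sd (s + t) *\<^sub>R z))"
  using assms by (intro integrable_std_gauss_wt) auto
 then have "integrable (distr std_gauss borel (%z. sd (s + t) *\<^sub>R z)) (%y. f (m + y))"
  by (subst integrable_distr_eq) auto
 then have int: "integrable (std_gauss \<Otimes>\<^sub>M std_gauss) (%(z1, z2). f (m + (c1 *\<^sub>R z1 + c2 *\<^sub>R z2)))"
  unfolding D[symmetric] by (subst (asm) integrable_distr_eq) (auto simp: split_beta')
 have "OU_P \<sigma> b (s + t) f x = (LINT y|(distr std_gauss borel (%z. sd (s + t) *\<^sub>R z)). f (m + y))"
  by (subst integral_distr) (auto simp: OU_P_eq m_def)
 also have "... = (LINT z|(std_gauss \<Otimes>\<^sub>M std_gauss). f (m + (c1 *\<^sub>R fst z + c2 *\<^sub>R snd z)))"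
  unfolding D[symmetric] by (subst integral_distr) (auto simp: split_beta')
 also have "... = (LINT z1|std_gauss. (LINT z2|std_gauss. f (m + (c1 *\<^sub>R z1 + c2 *\<^sub>R z2))))"
  using pg.integral_fst[OF int] by (simp add: split_beta')
 also have "... = OU_P \<sigma> b s (OU_P \<sigma> b t f) x"
 proof -
  have "exp (- b * (s + t)) = exp (- b * t) * exp (- b * s)"
   by (subst exp_add[symmetric]) (simp add: algebra_simps)
  then have "m + (c1 *\<^sub>R z1 + c2 *\<^sub>R z2)
   = exp (- b * t) *\<^sub>R (exp (- b * s) *\<^sub>R x + sd s *\<^sub>R z1) + sd t *\<^sub>R z2" for z1 z2
   by (simp only: m_def c1_def c2_def scaleR_add_right scaleR_scaleR add.assoc)
  then show ?thesis unfolding OU_P_eq by (simp only:)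
 qed
 finally show ?thesis by (rule sym)
qed

end

subsection \<open>Duhamel integrals\<close>

text \<open>The variation-of-constants integral with source g. The rate \<open>a\<close> stays free
  because the same equation is used with rate 0 (the definition of the cumulant), with rate alpha
  (growth moved into the semigroup) and with a lowered rate (positivity of the solution).\<close>

definition duh :: "real => real => real => real => (real => 'a::euclidean_space => real) => 'a => real" where
 "duh \<sigma> b a t g x = (LINT s:{0..t}|lborel. exp (a * s) * OU_P \<sigma> b s (g (t - s)) x)"

lemma set_integrable_bounded_Icc:
 fixes f :: "real => 'b::{banach, second_countable_topology}"
 assumes "f : Bm borel" "!!s. s : {u..v} ==> norm (f s) <= B"
 shows "set_integrable lborel {u..v} f"
 unfolding set_integrable_def using assms
 by (intro integrableI_bounded_set_indicator[where B=B]) (auto simp: emeasure_lborel_Icc_eq)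

lemma set_integral_bound_Icc:
 fixes f :: "real => real"
 assumes "f : Bm borel" "!!s. s : {0..t} ==> \<bar>f s\<bar> <= B" "0 <= t"
 shows "\<bar>LINT s:{0..t}|lborel. f s\<bar> <= t * B"
proof -
 have i: "set_integrable lborel {0..t} f" using assms by (intro set_integrable_bounded_Icc[where B=B]) auto
 have "\<bar>LINT s:{0..t}|lborel. f s\<bar> <= (LINT s:{0..t}|lborel. \<bar>f s\<bar>)"
  using set_integral_norm_bound[OF i] by simp
 also have "... <= (LINT s:{0..t}|lborel. B)"
  using assms i by (intro set_integral_mono set_integrable_abs set_integrable_bounded_Icc[where B="\<bar>B\<bar>"])
   (auto intro: order_trans[OF assms(2) abs_ge_self])
 also have "... = t * B" using assms(3) by (simp add: set_lebesgue_integral_def)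
 finally show ?thesis .
qed

lemma set_integral_FTC_Icc:
 fixes F :: "real => real"
 assumes "u <= v" "!!x. DERIV F x :> f x" "!!x. isCont f x"
 shows "(LINT s:{u..v}|lborel. f s) = F v - F u"
proof -
 have "(LINT x|lborel. f x * indicator {u..v} x) = F v - F u"
  using assms by (intro integral_FTC_Icc_real) auto
 then show ?thesis by (simp add: set_lebesgue_integral_def mult.commute)
qed

lemma set_integral_power_reflect:
 assumes "0 <= t"
 shows "(LINT s:{0..t}|lborel. (t - s) ^ n) = t ^ Suc n / real (Suc n)"
proof -
 have "(LINT s:{0..t}|lborel. (t - s) ^ n) = - ((t - t) ^ Suc n) / real (Suc n) - (- ((t - 0) ^ Suc n) / real (Suc n))"
  using assms
  by (intro set_integral_FTC_Icc[where F="%s. - ((t - s) ^ Suc n) / real (Suc n)"]) (auto intro!: derivative_eq_intros continuous_intros simp: field_simps simp del: of_nat_Suc power_Suc)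
 then show ?thesis by simp
qed

context ou
begin

abbreviation "D \<equiv> duh \<sigma> b"

lemma duh_integrand_bound:
 fixes g :: "real => 'a::euclidean_space => real"
 assumes [measurable]: "case_prod g : Bm (borel \<Otimes>\<^sub>M borel)"
  and "!!r y. 0 <= r ==> r <= t ==> \<bar>g r y\<bar> <= C * wt n y" and s: "s : {0..t}"
 shows "\<bar>exp (a * s) * OU_P \<sigma> b s (g (t - s)) x\<bar> <= exp (\<bar>a\<bar> * t) * (C * growth_const TYPE('a) n * wt n x)"
proof -
 have "\<bar>OU_P \<sigma> b s (g (t - s)) x\<bar> <= C * growth_const TYPE('a) n * wt n x"
  using OU_P_norm_le[of "g (t - s)" C n s x] assms by auto
 moreover have "a * s <= \<bar>a\<bar> * t"
  using s by (intro mult_mono) auto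
 ultimately show ?thesis unfolding abs_mult by (intro mult_mono) auto
qed

lemma duh_integrable:
 fixes g :: "real => 'a::euclidean_space => real"
 assumes [measurable]: "case_prod g : Bm (borel \<Otimes>\<^sub>M borel)"
  and "!!r y. 0 <= r ==> r <= t ==> \<bar>g r y\<bar> <= C * wt n y"
 shows "set_integrable lborel {0..t} (%s. exp (a * s) * OU_P \<sigma> b s (g (t - s)) x)"
 by (rule set_integrable_bounded_Icc[where B="exp (\<bar>a\<bar> * t) * (C * growth_const TYPE('a) n * wt n x)"])
   (measurable, use duh_integrand_bound[OF assms] in auto)

lemma duh_abs_le:
 fixes g :: "real => 'a::euclidean_space => real"
 assumes [measurable]: "case_prod g : Bm (borel \<Otimes>\<^sub>M borel)"
  and "!!r y. 0 <= r ==> r <= t ==> \<bar>g r y\<bar> <= C * wt n y" and "0 <= t"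
 shows "\<bar>D a t g x\<bar> <= t * (exp (\<bar>a\<bar> * t) * (C * growth_const TYPE('a) n * wt n x))"
 unfolding duh_def
 by (rule set_integral_bound_Icc) (measurable, use duh_integrand_bound[OF assms(1,2)] assms in auto)

lemma duh_mono:
 fixes g h :: "real => 'a::euclidean_space => real"
 assumes g[measurable]: "case_prod g : Bm (borel \<Otimes>\<^sub>M borel)"
  and gb: "!!r y. 0 <= r ==> r <= t ==> \<bar>g r y\<bar> <= C * wt n y"
  and h[measurable]: "case_prod h : Bm (borel \<Otimes>\<^sub>M borel)"
  and hb: "!!r y. 0 <= r ==> r <= t ==> \<bar>h r y\<bar> <= E * wt m y"
  and le: "!!r y. 0 <= r ==> r <= t ==> g r y <= h r y"
 shows "D a t g x <= D a t h x"
 unfolding duh_def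
proof (rule set_integral_mono)
 fix s assume s: "s : {0..t}"
 have "OU_P \<sigma> b s (g (t - s)) x <= OU_P \<sigma> b s (h (t - s)) x"
  using s gb hb le by (intro OU_P_mono[where C=C and n=n and D=E and m=m]) auto
 then show "exp (a * s) * OU_P \<sigma> b s (g (t - s)) x <= exp (a * s) * OU_P \<sigma> b s (h (t - s)) x" by simp
qed (auto intro!: duh_integrable[OF g gb] duh_integrable[OF h hb])

lemma duh_nonneg:
 fixes g :: "real => 'a::euclidean_space => real"
 assumes "!!r y. 0 <= r ==> r <= t ==> 0 <= g r y"
 shows "0 <= D a t g x"
 unfolding duh_def set_lebesgue_integral_def using assms
 by (intro integral_nonneg_AE AE_I2) (auto intro!: OU_P_nonneg mult_nonneg_nonneg split: split_indicator)

lemma duh_lincomb: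
 fixes g h :: "real => 'a::euclidean_space => real"
 assumes g[measurable]: "case_prod g : Bm (borel \<Otimes>\<^sub>M borel)"
  and gb: "!!r y. 0 <= r ==> r <= t ==> \<bar>g r y\<bar> <= C * wt n y"
  and h[measurable]: "case_prod h : Bm (borel \<Otimes>\<^sub>M borel)"
  and hb: "!!r y. 0 <= r ==> r <= t ==> \<bar>h r y\<bar> <= E * wt m y"
 shows "D a t (%r y. g r y + c * h r y) x = D a t g x + c * D a t h x"
proof -
 have e: "OU_P \<sigma> b s (%y. g (t - s) y + c * h (t - s) y) x
   = OU_P \<sigma> b s (g (t - s)) x + c * OU_P \<sigma> b s (h (t - s)) x" if "s : {0..t}" for s
 proof -
  have "integrable std_gauss (%z. g (t - s) (exp (- b * s) *\<^sub>R x + sd s *\<^sub>R z))"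
   using that gb by (intro integrable_OU[where C=C and n=n]) auto
  moreover have "integrable std_gauss (%z. h (t - s) (exp (- b * s) *\<^sub>R x + sd s *\<^sub>R z))"
   using that hb by (intro integrable_OU[where C=E and n=m]) auto
  ultimately show ?thesis by (simp add: OU_P_eq)
 qed
 have "D a t (%r y. g r y + c * h r y) x
   = (LINT s:{0..t}|lborel. exp (a * s) * OU_P \<sigma> b s (g (t - s)) x + c * (exp (a * s) * OU_P \<sigma> b s (h (t - s)) x))"
  unfolding duh_def by (rule set_lebesgue_integral_cong) (auto simp: e algebra_simps)
 also have "... = D a t g x + c * D a t h x"
  unfolding duh_def using duh_integrable[OF g gb] duh_integrable[OF h hb]
  by (subst set_integral_add) auto
 finally show ?thesis .
qed

text \<open>A source of order r^n produces an integral of order t^(n+1)/(n+1); iterating this gives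
  the factorials behind both the Picard iteration and the Gronwall argument.\<close>

lemma duh_le_power:
 fixes g :: "real => 'a::euclidean_space => real"
 assumes [measurable]: "case_prod g : Bm (borel \<Otimes>\<^sub>M borel)"
  and gb: "!!r y. 0 <= r ==> r <= t ==> \<bar>g r y\<bar> <= C * r ^ n" and t: "0 <= t"
 shows "\<bar>D a t g x\<bar> <= exp (\<bar>a\<bar> * t) * C * (t ^ Suc n / real (Suc n))"
proof -
 have bd: "\<bar>exp (a * s) * OU_P \<sigma> b s (g (t - s)) x\<bar> <= exp (\<bar>a\<bar> * t) * C * (t - s) ^ n" if s: "s : {0..t}" for s
 proof -
  have "\<bar>OU_P \<sigma> b s (g (t - s)) x\<bar> <= C * (t - s) ^ n"
   using OU_P_bounded[of "g (t - s)" "C * (t - s) ^ n" s x] gb s by auto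
  moreover have "a * s <= \<bar>a\<bar> * t" using s by (intro mult_mono) auto
  ultimately show ?thesis unfolding abs_mult mult.assoc by (intro mult_mono) auto
 qed
 have C: "0 <= C * t ^ n" using order_trans[OF abs_ge_zero gb[of t 0]] t by auto
 have i: "set_integrable lborel {0..t} (%s. exp (a * s) * OU_P \<sigma> b s (g (t - s)) x)"
  using bd C t
  by (intro set_integrable_bounded_Icc[where B="exp (\<bar>a\<bar> * t) * \<bar>C\<bar> * t ^ n"], measurable)
    (force intro: order_trans[OF bd] mult_mono power_mono)
 have "\<bar>D a t g x\<bar> <= (LINT s:{0..t}|lborel. \<bar>exp (a * s) * OU_P \<sigma> b s (g (t - s)) x\<bar>)"
  unfolding duh_def using set_integral_norm_bound[OF i] by simp
 also have "... <= (LINT s:{0..t}|lborel. exp (\<bar>a\<bar> * t) * C * (t - s) ^ n)"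
 proof (rule set_integral_mono)
  show "set_integrable lborel {0..t} (%s. exp (\<bar>a\<bar> * t) * C * (t - s) ^ n)"
   by (intro borel_integrable_atLeastAtMost' continuous_intros)
 qed (use i bd in \<open>auto intro: set_integrable_abs\<close>)
 also have "... = exp (\<bar>a\<bar> * t) * C * (t ^ Suc n / real (Suc n))"
  using set_integral_power_reflect[OF t, of n] by simp
 finally show ?thesis .
qed

lemma measurable_duh [measurable (raw)]:
 assumes [measurable]: "case_prod g : Bm (borel \<Otimes>\<^sub>M borel)"
  "u : Bm N" "x : Bm N"
 shows "(%\<omega>. D a (u \<omega>) g (x \<omega>)) : Bm N"
proof -
 \<comment> \<open>The domain of integration depends on u; writing its indicator by inequalities
   makes it jointly measurable in u and s.\<close>
 have ind: "indicator {0..u} s = (if 0 <= s & s <= u then 1 else 0 :: real)" for u s by (auto simp: indicator_def)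
 show ?thesis unfolding duh_def set_lebesgue_integral_def ind by measurable
qed

text \<open>Fubini moves P_s inside the time integral, where the semigroup property merges it with
  P_r.\<close>

lemma OU_P_duh:
 fixes g :: "real => 'a::euclidean_space => real"
 assumes [measurable]: "case_prod g : Bm (borel \<Otimes>\<^sub>M borel)"
  and gb: "!!r y. 0 <= r ==> r <= u ==> \<bar>g r y\<bar> <= C" and "0 <= s" "0 <= u"
 shows "OU_P \<sigma> b s (D a u g) x = (LINT r:{0..u}|lborel. exp (a * r) * OU_P \<sigma> b (s + r) (g (u - r)) x)"
proof -
 let ?h = "%z r. indicator {0..u} r *\<^sub>R (exp (a * r) * OU_P \<sigma> b r (g (u - r)) (exp (- b * s) *\<^sub>R x + sd s *\<^sub>R z))"
 interpret pg: pair_sigma_finite "std_gauss :: 'a measure" "lborel :: real measure"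
  by (intro pair_sigma_finite.intro std_gauss.sigma_finite_measure_axioms lborel.sigma_finite_measure_axioms)
 have bd: "\<bar>exp (a * r) * OU_P \<sigma> b r (g (u - r)) y\<bar> <= exp (\<bar>a\<bar> * u) * C" if "r : {0..u}" for r y
 proof -
  have "\<bar>OU_P \<sigma> b r (g (u - r)) y\<bar> <= C"
   using OU_P_bounded[of "g (u - r)" C r y] gb that by auto
  moreover have "a * r <= \<bar>a\<bar> * u" using that by (intro mult_mono) auto
  ultimately show ?thesis unfolding abs_mult by (intro mult_mono) auto
 qed
 have int: "integrable (std_gauss \<Otimes>\<^sub>M lborel) (%(z, r). ?h z r)"
 proof (rule integrableI_bounded_set[where A="UNIV \<times> {0..u}" and B="exp (\<bar>a\<bar> * u) * C"])
  show "emeasure (std_gauss \<Otimes>\<^sub>M lborel) (UNIV \<times> {0..u}) < \<infinity>"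
   by (subst lborel.emeasure_pair_measure_Times) (auto simp: emeasure_lborel_Icc_eq)
  show "AE w in std_gauss \<Otimes>\<^sub>M lborel. w : UNIV \<times> {0..u} --> norm (case w of (z, r) => ?h z r) <= exp (\<bar>a\<bar> * u) * C"
   using bd by (intro AE_I2) auto
  show "AE w in std_gauss \<Otimes>\<^sub>M lborel. w \<notin> UNIV \<times> {0..u} --> (case w of (z, r) => ?h z r) = 0"
   by (intro AE_I2) (auto simp: indicator_def)
 qed measurable
 have "OU_P \<sigma> b s (D a u g) x = (LINT z|std_gauss. (LINT r|lborel. ?h z r))"
  unfolding OU_P_eq[of \<sigma> b s] duh_def set_lebesgue_integral_def by simp
 also have "... = (LINT r|lborel. (LINT z|std_gauss. ?h z r))"
  using pg.Fubini_integral[OF int] by simp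
 also have "... = (LINT r:{0..u}|lborel. exp (a * r) * OU_P \<sigma> b s (OU_P \<sigma> b r (g (u - r))) x)"
  unfolding set_lebesgue_integral_def by (intro Bochner_Integration.integral_cong) (simp_all add: OU_P_eq[of \<sigma> b s])
 also have "... = (LINT r:{0..u}|lborel. exp (a * r) * OU_P \<sigma> b (s + r) (g (u - r)) x)"
 proof (rule set_lebesgue_integral_cong)
  show "\<forall>r. r : {0..u} --> exp (a * r) * OU_P \<sigma> b s (OU_P \<sigma> b r (g (u - r))) x
    = exp (a * r) * OU_P \<sigma> b (s + r) (g (u - r)) x"
  proof (intro allI impI)
   fix r assume r: "r : {0..u}"
   then have "\<bar>g (u - r) y\<bar> <= C" for y using gb by auto
   then have "\<bar>g (u - r) y\<bar> <= C * wt 0 y" for y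
   proof -
    assume *: "!!y. \<bar>g (u - r) y\<bar> <= C"
    have "0 <= C" using *[of y] by linarith
    then show ?thesis using *[of y] by (simp add: wt_def)
   qed
   then show "exp (a * r) * OU_P \<sigma> b s (OU_P \<sigma> b r (g (u - r))) x
    = exp (a * r) * OU_P \<sigma> b (s + r) (g (u - r)) x"
    using r assms(3) by (subst OU_P_semigroup[where C=C and n=0]) auto
  qed
 qed simp
 finally show ?thesis .
qed

section \<open>Changing the exponential rate in a mild equation\<close>

text \<open>Multiplied by \<open>a - a'\<close> instead of divided, so that the case of equal rates
  is included.\<close>

lemma integral_exp_rates:
 fixes a a' w :: real
 assumes "0 <= w"
 shows "(a - a') * (LINT s:{0..w}|lborel. exp (a' * s + a * (w - s))) = exp (a * w) - exp (a' * w)"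
proof -
 have "(LINT s:{0..w}|lborel. (a - a') * exp (a' * s + a * (w - s)))
   = - exp (a' * w + a * (w - w)) - (- exp (a' * 0 + a * (w - 0)))"
  using assms by (intro set_integral_FTC_Icc[where F="%s. - exp (a' * s + a * (w - s))"])
   (auto intro!: derivative_eq_intros continuous_intros simp: algebra_simps)
 then show ?thesis by simp
qed

text \<open>On the triangle 0 <= s <= w = s + r <= T the order of integration is exchanged; the
  integral over s for fixed w is the one in \<open>integral_exp_rates\<close>.\<close>

lemma iterated_Duhamel:
 fixes q :: "real => real"
 assumes [measurable]: "q : Bm borel" and qb: "!!w. w : {0..T} ==> \<bar>q w\<bar> <= C" and T: "0 <= T"
 shows "(a - a') * (LINT s:{0..T}|lborel. exp (a' * s) * (LINT r:{0..T-s}|lborel. exp (a * r) * q (s + r)))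
  = (LINT w:{0..T}|lborel. exp (a * w) * q w) - (LINT w:{0..T}|lborel. exp (a' * w) * q w)"
proof -
 let ?h = "%s w. (if 0 <= s & s <= w & w <= T then exp (a' * s + a * (w - s)) * q w else 0)"
 have int: "integrable (lborel \<Otimes>\<^sub>M lborel) (%(s, w). ?h s w)"
 proof (rule integrableI_bounded_set[where A="{0..T} \<times> {0..T}" and B="exp (\<bar>a'\<bar> * T + \<bar>a\<bar> * T) * C"])
  show "emeasure (lborel \<Otimes>\<^sub>M lborel) ({0..T} \<times> {0..T}) < \<infinity>"
   by (subst lborel.emeasure_pair_measure_Times) (auto simp: emeasure_lborel_Icc_eq ennreal_mult_less_top)
  have "\<bar>?h s w\<bar> <= exp (\<bar>a'\<bar> * T + \<bar>a\<bar> * T) * C" if "s : {0..T}" "w : {0..T}" for s w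
  proof -
   have C: "0 <= C" using qb[OF that(2)] by linarith
   have "a' * s <= \<bar>a'\<bar> * T" using that by (intro mult_mono) auto
   moreover have "a * (w - s) <= \<bar>a\<bar> * T" if "s <= w" using that \<open>s : _\<close> \<open>w : _\<close> by (intro mult_mono) auto
   ultimately show ?thesis using qb[OF that(2)] C
    by (auto simp: abs_mult intro!: mult_mono)
  qed
  then show "AE w in lborel \<Otimes>\<^sub>M lborel. w : {0..T} \<times> {0..T} --> norm (case w of (s, w) => ?h s w) <= exp (\<bar>a'\<bar> * T + \<bar>a\<bar> * T) * C"
   by (intro AE_I2) auto
 qed (auto simp: split_beta')
 have inner: "(LINT r:{0..T-s}|lborel. exp (a * r) * q (s + r)) * exp (a' * s) * indicator {0..T} s = (LINT w|lborel. ?h s w)" for s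
 proof (cases "0 <= s & s <= T")
  case True
  have "(LINT r:{0..T-s}|lborel. exp (a * r) * q (s + r))
    = (LINT w|lborel. indicator {0..T-s} (- s + 1 * w) *\<^sub>R (exp (a * (- s + 1 * w)) * q (s + (- s + 1 * w))))"
   unfolding set_lebesgue_integral_def by (subst lborel_integral_real_affine[of 1 _ "- s"]) auto
  then have "(LINT r:{0..T-s}|lborel. exp (a * r) * q (s + r)) * exp (a' * s)
    = (LINT w|lborel. indicator {0..T-s} (- s + 1 * w) *\<^sub>R (exp (a * (- s + 1 * w)) * q (s + (- s + 1 * w))) * exp (a' * s))"
   by simp
  also have "... = (LINT w|lborel. ?h s w)"
   using True by (intro Bochner_Integration.integral_cong) (auto simp: indicator_def exp_add mult_ac)
  finally show ?thesis using True by simp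
 next
  case False
  then have "?h s w = 0" for w by auto
  then show ?thesis using False by (auto simp only: indicator_def) auto
 qed
 have outer: "(a - a') * (LINT s|lborel. ?h s w) = indicator {0..T} w * (exp (a * w) * q w - exp (a' * w) * q w)" for w
 proof (cases "w : {0..T}")
  case True
  have "(LINT s|lborel. ?h s w) = (LINT s|lborel. indicator {0..w} s *\<^sub>R exp (a' * s + a * (w - s)) * q w)"
   using True by (intro Bochner_Integration.integral_cong) (auto simp: indicator_def)
  also have "... = (LINT s:{0..w}|lborel. exp (a' * s + a * (w - s))) * q w"
   unfolding set_lebesgue_integral_def by simp
  finally have "(a - a') * (LINT s|lborel. ?h s w) = ((a - a') * (LINT s:{0..w}|lborel. exp (a' * s + a * (w - s)))) * q w"
   by simp
  also have "... = (exp (a * w) - exp (a' * w)) * q w"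
   using True by (subst integral_exp_rates) auto
  finally show ?thesis using True by (simp add: algebra_simps)
 next
  case False
  then have "?h s w = 0" for s by auto
  then show ?thesis using False by simp
 qed
 have "(a - a') * (LINT s:{0..T}|lborel. exp (a' * s) * (LINT r:{0..T-s}|lborel. exp (a * r) * q (s + r)))
   = (a - a') * (LINT s|lborel. (LINT w|lborel. ?h s w))"
  unfolding inner[symmetric] unfolding set_lebesgue_integral_def[of _ "{0..T}"]
  by (simp add: mult_ac)
 also have "... = (a - a') * (LINT w|lborel. (LINT s|lborel. ?h s w))"
  using lborel_pair.Fubini_integral[OF int] by simp
 also have "... = (LINT w|lborel. (a - a') * (LINT s|lborel. ?h s w))"
  by simp
 also have "... = (LINT w:{0..T}|lborel. exp (a * w) * q w - exp (a' * w) * q w)"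
  unfolding outer set_lebesgue_integral_def by simp
 also have "... = (LINT w:{0..T}|lborel. exp (a * w) * q w) - (LINT w:{0..T}|lborel. exp (a' * w) * q w)"
 proof (rule set_integral_diff)
  have bd: "norm (exp (c * w) * q w) <= exp (\<bar>c\<bar> * T) * C" if "w : {0..T}" for c w
  proof -
   have "c * w <= \<bar>c\<bar> * T" using that by (intro mult_mono) auto
   then show ?thesis using qb[OF that] unfolding real_norm_def abs_mult by (intro mult_mono) auto
  qed
  show "set_integrable lborel {0..T} (%w. exp (a * w) * q w)"
   by (rule set_integrable_bounded_Icc[OF _ bd]) auto
  show "set_integrable lborel {0..T} (%w. exp (a' * w) * q w)"
   by (rule set_integrable_bounded_Icc[OF _ bd]) auto
 qed
 finally show ?thesis .
qed

text \<open>An equation with rate a is rewritten with rate a' by adding (a - a') v to the source.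
  The equation is inserted into the Duhamel integral of v, and \<open>iterated_Duhamel\<close>
  evaluates the resulting double integral, so the argument stays on the level of integral equations,
  without time derivatives.\<close>

lemma change_rate:
 fixes f :: "'a::euclidean_space => real"
 assumes f[measurable]: "f : Bm borel" and fb: "!!y. \<bar>f y\<bar> <= B"
  and g[measurable]: "case_prod g : Bm (borel \<Otimes>\<^sub>M borel)"
  and gb: "!!r y. 0 <= r ==> r <= T ==> \<bar>g r y\<bar> <= C"
  and v[measurable]: "case_prod v : Bm (borel \<Otimes>\<^sub>M borel)"
  and vb: "!!r y. 0 <= r ==> r <= T ==> \<bar>v r y\<bar> <= E"
  and eq: "!!t y. 0 <= t ==> t <= T ==> v t y = exp (a * t) * OU_P \<sigma> b t f y + D a t g y"
  and T: "0 <= T"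
 shows "v T x = exp (a' * T) * OU_P \<sigma> b T f x + D a' T (%r y. g r y + (a - a') * v r y) x"
proof -
 have pos: "0 <= B" "0 <= C" "0 <= E"
  using fb[of 0] gb[of 0 0] vb[of 0 0] T by linarith+
 have fb': "\<bar>f y\<bar> <= B * wt 0 y" for y using fb[of y] pos by (simp add: wt_def)
 have gb': "\<bar>g r y\<bar> <= C * wt 0 y" if "0 <= r" "r <= T" for r y using gb[OF that, of y] pos by (simp add: wt_def)
 have vb': "\<bar>v r y\<bar> <= E * wt 0 y" if "0 <= r" "r <= T" for r y using vb[OF that, of y] pos by (simp add: wt_def)
 define q where "q w = OU_P \<sigma> b w (g (T - w)) x" for w
 have q[measurable]: "q : Bm borel" unfolding q_def by measurable
 have qb: "\<bar>q w\<bar> <= C" if "w : {0..T}" for w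
  unfolding q_def using that gb OU_P_bounded[of "g (T - w)" C w x] by auto
 let ?I = "%s. LINT r:{0..T-s}|lborel. exp (a * r) * q (s + r)"
 \<comment> \<open>The semigroup property makes the first term a multiple of P_T f, independent of s
   up to an exponential factor.\<close>
 have Pv: "OU_P \<sigma> b s (v (T - s)) x = exp (a * (T - s)) * OU_P \<sigma> b T f x + ?I s" if s: "s : {0..T}" for s
 proof -
  have 1: "integrable std_gauss (%z. exp (a * (T - s)) * OU_P \<sigma> b (T - s) f (exp (- b * s) *\<^sub>R x + sd s *\<^sub>R z))"
   using OU_P_bounded[OF f, of B] fb by (intro integrable_mult_right std_gauss.integrable_const_bound[where B=B]) auto
  have Db: "\<bar>D a (T - s) g y\<bar> <= (T - s) * (exp (\<bar>a\<bar> * (T - s)) * (C * growth_const TYPE('a) 0 * wt 0 y))" for y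
   using s gb' by (intro duh_abs_le) auto
  have 2: "integrable std_gauss (%z. D a (T - s) g (exp (- b * s) *\<^sub>R x + sd s *\<^sub>R z))"
   by (rule integrable_OU[where C="(T - s) * (exp (\<bar>a\<bar> * (T - s)) * (C * growth_const TYPE('a) 0))" and n=0])
     (use Db in \<open>auto simp: mult_ac\<close>)
  have "OU_P \<sigma> b s (v (T - s)) x
   = exp (a * (T - s)) * OU_P \<sigma> b s (OU_P \<sigma> b (T - s) f) x + OU_P \<sigma> b s (D a (T - s) g) x"
   using s 1 2 by (simp add: OU_P_eq[of \<sigma> b s] eq)
  also have "OU_P \<sigma> b s (OU_P \<sigma> b (T - s) f) x = OU_P \<sigma> b T f x"
   using s fb' by (subst OU_P_semigroup[where C=B and n=0]) auto
  also have "OU_P \<sigma> b s (D a (T - s) g) x = ?I s"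
   using s gb by (subst OU_P_duh[where C=C]) (auto simp: q_def algebra_simps)
  finally show ?thesis .
 qed
 have [measurable]: "?I : Bm borel"
 proof -
  have ind: "indicator {0..T-s} r = (if 0 <= r & r <= T-s then 1 else 0 :: real)" for r s by (auto simp: indicator_def)
  show ?thesis unfolding set_lebesgue_integral_def ind by measurable
 qed
 have Ib: "\<bar>?I s\<bar> <= T * (exp (\<bar>a\<bar> * T) * C)" if s: "s : {0..T}" for s
 proof -
  have "\<bar>?I s\<bar> <= (T - s) * (exp (\<bar>a\<bar> * T) * C)"
  proof (rule set_integral_bound_Icc)
   fix r assume r: "r : {0..T - s}"
   have "a * r <= \<bar>a\<bar> * T" using r s by (intro mult_mono) auto
   then show "\<bar>exp (a * r) * q (s + r)\<bar> <= exp (\<bar>a\<bar> * T) * C"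
    using qb[of "s + r"] r s unfolding abs_mult by (intro mult_mono) auto
  qed (use s in auto)
  also have "... <= T * (exp (\<bar>a\<bar> * T) * C)" using s pos by (intro mult_right_mono) auto
  finally show ?thesis .
 qed
 have int1: "set_integrable lborel {0..T} (%s. exp (a' * s + a * (T - s)) * OU_P \<sigma> b T f x)"
  by (intro borel_integrable_atLeastAtMost' continuous_intros)
 have int2: "set_integrable lborel {0..T} (%s. exp (a' * s) * ?I s)"
 proof (rule set_integrable_bounded_Icc[where B="exp (\<bar>a'\<bar> * T) * (T * (exp (\<bar>a\<bar> * T) * C))"])
  fix s assume s: "s : {0..T}"
  have "a' * s <= \<bar>a'\<bar> * T" using s by (intro mult_mono) auto
  then show "norm (exp (a' * s) * ?I s) <= exp (\<bar>a'\<bar> * T) * (T * (exp (\<bar>a\<bar> * T) * C))"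
   using Ib[OF s] unfolding real_norm_def abs_mult by (intro mult_mono) auto
 qed measurable
 have "D a' T v x = (LINT s:{0..T}|lborel. exp (a' * s + a * (T - s)) * OU_P \<sigma> b T f x + exp (a' * s) * ?I s)"
  unfolding duh_def by (rule set_lebesgue_integral_cong) (auto simp: Pv exp_add distrib_left mult.assoc)
 also have "... = (LINT s:{0..T}|lborel. exp (a' * s + a * (T - s))) * OU_P \<sigma> b T f x + (LINT s:{0..T}|lborel. exp (a' * s) * ?I s)"
  using int1 int2 by (subst set_integral_add) auto
 finally have "(a - a') * D a' T v x
   = ((a - a') * (LINT s:{0..T}|lborel. exp (a' * s + a * (T - s)))) * OU_P \<sigma> b T f x
    + (a - a') * (LINT s:{0..T}|lborel. exp (a' * s) * ?I s)"
  by (simp add: algebra_simps)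
 also have "(a - a') * (LINT s:{0..T}|lborel. exp (a' * s) * ?I s) = D a T g x - D a' T g x"
  using iterated_Duhamel[OF q qb T, of a a'] by (simp add: duh_def q_def)
 also have "(a - a') * (LINT s:{0..T}|lborel. exp (a' * s + a * (T - s))) = exp (a * T) - exp (a' * T)"
  by (rule integral_exp_rates[OF T])
 finally have "(a - a') * D a' T v x = (exp (a * T) - exp (a' * T)) * OU_P \<sigma> b T f x + (D a T g x - D a' T g x)" .
 moreover have "D a' T (%r y. g r y + (a - a') * v r y) x = D a' T g x + (a - a') * D a' T v x"
  by (rule duh_lincomb[OF g gb' v vb'])
 ultimately show ?thesis
  using eq[OF T order_refl, of x] by (simp add: algebra_simps)
qed

end

section \<open>The branching mechanism\<close>

definition kexp :: "real => real" where "kexp y = exp (- y) - 1 + y"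

lemma kexp_measurable [measurable]: "kexp : Bm borel"
 unfolding kexp_def by measurable

lemma kexp_0 [simp]: "kexp 0 = 0"
 by (simp add: kexp_def)

lemma kexp_deriv: "DERIV kexp x :> 1 - exp (- x)"
 unfolding kexp_def by (auto intro!: derivative_eq_intros)

lemma kexp_nonneg [simp]: "0 <= kexp y"
 using exp_ge_add_one_self[of "- y"] by (simp add: kexp_def)

lemma kexp_le_self: "0 <= y ==> kexp y <= y"
 by (simp add: kexp_def)

lemma kexp_le_square: "0 <= y ==> kexp y <= y\<^sup>2"
proof -
 assume y: "0 <= y"
 have "0\<^sup>2 / 2 - kexp 0 <= y\<^sup>2 / 2 - kexp y"
 proof (rule DERIV_nonneg_imp_nondecreasing[OF y])
  fix x :: real assume "0 <= x" "x <= y"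
  then show "\<exists>d. DERIV (%y. y\<^sup>2 / 2 - kexp y) x :> d & 0 <= d"
   using exp_ge_add_one_self[of "- x"]
   by (intro exI[of _ "x - (1 - exp (- x))"]) (auto intro!: derivative_eq_intros kexp_deriv)
 qed
 then have "2 * kexp y <= y\<^sup>2" by simp
 then show ?thesis using kexp_nonneg[of y] by linarith
qed

text \<open>For nonnegative y the value \<open>kexp y\<close> is at most min(y, y^2), which lies
  below every power with exponent between 1 and 2.\<close>

lemma kexp_le_powr:
 assumes "0 <= y" "1 <= p" "p <= 2"
 shows "kexp y <= y powr p"
proof (cases "y <= 1")
 case True
 have "kexp y <= y powr 2" using kexp_le_square[OF assms(1)] assms(1) by (simp add: powr_numeral)
 also have "... <= y powr p" using assms True by (intro powr_mono') auto
 finally show ?thesis .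
next
 case False
 have "kexp y <= y powr 1" using kexp_le_self[OF assms(1)] assms(1) by simp
 also have "... <= y powr p" using assms False by (intro powr_mono) auto
 finally show ?thesis .
qed

text \<open>The derivative 1 - exp(-x) is nonnegative and at most min(1, v) on the interval.\<close>

lemma kexp_diff:
 assumes "0 <= u" "u <= v"
 shows "0 <= kexp v - kexp u" "kexp v - kexp u <= (v - u) * min 1 v"
proof -
 have "kexp u <= kexp v"
 proof (rule DERIV_nonneg_imp_nondecreasing[OF assms(2)])
  fix x assume "u <= x" "x <= v"
  then show "\<exists>d. DERIV kexp x :> d & 0 <= d"
   using assms by (intro exI[of _ "1 - exp (- x)"]) (auto intro!: kexp_deriv)
 qed
 then show "0 <= kexp v - kexp u" by simp
 have "u * min 1 v - kexp u <= v * min 1 v - kexp v"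
 proof (rule DERIV_nonneg_imp_nondecreasing[OF assms(2)])
  fix x assume x: "u <= x" "x <= v"
  have "1 - exp (- x) <= min 1 v"
   using exp_ge_add_one_self[of "- x"] x by (auto simp: min_def)
  then show "\<exists>d. DERIV (%x. x * min 1 v - kexp x) x :> d & 0 <= d"
   by (intro exI[of _ "min 1 v - (1 - exp (- x))"]) (auto intro!: derivative_eq_intros kexp_deriv)
 qed
 then show "kexp v - kexp u <= (v - u) * min 1 v" by (simp add: algebra_simps)
qed

lemma kexp_convex:
 assumes "0 <= s" "s <= 1"
 shows "kexp ((1 - s) * u + s * v) <= (1 - s) * kexp u + s * kexp v"
proof -
 have "exp ((1 - s) *\<^sub>R (- u) + s *\<^sub>R (- v)) <= (1 - s) * exp (- u) + s * exp (- v)"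
  using assms by (intro convex_onD[OF exp_convex]) auto
 then have "exp (- ((1 - s) * u + s * v)) <= (1 - s) * exp (- u) + s * exp (- v)"
  by (simp add: algebra_simps)
 then show ?thesis by (simp add: kexp_def algebra_simps)
qed

locale branching =
 fixes \<alpha> \<rho> :: real and \<pi> :: "real measure"
 assumes alpha_pos: "0 < \<alpha>" and rho_nonneg: "0 <= \<rho>"
  and sets_pi [simp, measurable_cong]: "sets \<pi> = sets borel"
  and pi_nonpos: "emeasure \<pi> {..0} = 0"
  and pi_moment: "(\<integral>\<^sup>+y. ennreal (min y (y\<^sup>2)) \<partial>\<pi>) < \<infinity>"
begin

lemma space_pi [simp]: "space \<pi> = UNIV"
 using sets_eq_imp_space_eq[OF sets_pi] by simp

lemma AE_pi_pos: "AE y in \<pi>. 0 < y"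
 by (rule AE_I[where N="{..0}"]) (auto simp: pi_nonpos)

lemma integrable_min: "integrable \<pi> (%y. min y (y\<^sup>2))"
proof (rule integrableI_nonneg)
 show "AE y in \<pi>. 0 <= min y (y\<^sup>2)" using AE_pi_pos by eventually_elim auto
qed (use pi_moment in auto)

definition "mom1 = (LINT y|\<pi>. min y (y\<^sup>2))"

lemma mom1_nonneg: "0 <= mom1"
 unfolding mom1_def by (rule integral_nonneg_AE) (use AE_pi_pos in eventually_elim, auto)

lemma kexp_le_min: "0 <= z ==> 0 < y ==> kexp (z * y) <= (z + z\<^sup>2) * min y (y\<^sup>2)"
proof (cases "y <= 1")
 case True
 assume zy: "0 <= z" "0 < y"
 have "kexp (z * y) <= z\<^sup>2 * y\<^sup>2" using kexp_le_square[of "z * y"] zy by (simp add: power_mult_distrib)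
 also have "... <= (z + z\<^sup>2) * y\<^sup>2" using zy by (intro mult_right_mono) auto
 also have "(z + z\<^sup>2) * y\<^sup>2 = (z + z\<^sup>2) * min y (y\<^sup>2)" using True zy mult_left_le[of y y] by (auto simp: power2_eq_square min_def)
 finally show ?thesis .
next
 case False
 assume zy: "0 <= z" "0 < y"
 have "kexp (z * y) <= z * y" using kexp_le_self[of "z * y"] zy by simp
 also have "... <= (z + z\<^sup>2) * y" using zy by (intro mult_right_mono) auto
 also have "(z + z\<^sup>2) * y = (z + z\<^sup>2) * min y (y\<^sup>2)" using False zy mult_left_mono[of 1 y y] by (auto simp: power2_eq_square min_def)
 finally show ?thesis .
qed

lemma integrable_kexp:
 assumes "0 <= z" shows "integrable \<pi> (%y. kexp (z * y))"
proof (rule Bochner_Integration.integrable_bound[OF integrable_mult_right[OF integrable_min, of "z + z\<^sup>2"]])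
 show "AE y in \<pi>. norm (kexp (z * y)) <= norm ((z + z\<^sup>2) * min y (y\<^sup>2))"
  using AE_pi_pos
 proof eventually_elim
  case (elim y)
  show ?case using order_trans[OF kexp_le_min[OF assms elim] abs_ge_self] by simp
 qed
qed simp

text \<open>The nonlinear part of \<open>psi\<close>, extended by \<open>0\<close> to the negative half line.\<close>

definition psi0 :: "real => real" where
 "psi0 z = \<rho> * (max 0 z)\<^sup>2 + (LINT y|\<pi>. kexp (max 0 z * y))"

lemma psi_eq: "0 <= z ==> psi \<alpha> \<rho> \<pi> z = psi0 z - \<alpha> * z"
 by (simp add: psi_def psi0_def kexp_def)

lemma psi0_nonpos [simp]: "z <= 0 ==> psi0 z = 0"
 by (simp add: psi0_def)

lemma psi0_nonneg [simp]: "0 <= psi0 z"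
 unfolding psi0_def using rho_nonneg by (intro add_nonneg_nonneg integral_nonneg_AE) auto

text \<open>A Lipschitz constant of \<open>psi0\<close> on the half line up to R: 2 rho R from the
  quadratic term, and (1 + R) \<open>mom1\<close> from y min(1, R y) <= (1 + R) min(y, y^2).\<close>

definition "lip R = 2 * \<rho> * R + (1 + R) * mom1"

lemma lip_nonneg: "0 <= R ==> 0 <= lip R"
 using rho_nonneg mom1_nonneg by (simp add: lip_def)

lemma psi0_diff:
 assumes "u <= v" "v <= R" "0 <= R"
 shows "0 <= psi0 v - psi0 u" "psi0 v - psi0 u <= lip R * (v - u)"
proof -
 define a c where "a = max 0 u" and "c = max 0 v"
 have ac: "0 <= a" "a <= c" "c <= R" "c - a <= v - u"
  using assms by (auto simp: a_def c_def)
 have eq: "psi0 v - psi0 u = \<rho> * (c\<^sup>2 - a\<^sup>2) + (LINT y|\<pi>. kexp (c * y) - kexp (a * y))"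
  using integrable_kexp[of a] integrable_kexp[of c] ac
  by (simp add: psi0_def a_def[symmetric] c_def[symmetric] algebra_simps)
 have sq: "c\<^sup>2 - a\<^sup>2 = (c - a) * (c + a)" by (simp add: power2_eq_square algebra_simps)
 show "0 <= psi0 v - psi0 u"
  unfolding eq sq
 proof (intro add_nonneg_nonneg mult_nonneg_nonneg integral_nonneg_AE)
  show "AE y in \<pi>. 0 <= kexp (c * y) - kexp (a * y)"
   using AE_pi_pos
  proof eventually_elim
   case (elim y) show ?case using ac elim by (intro kexp_diff) auto
  qed
 qed (use ac rho_nonneg in auto)
 have "(LINT y|\<pi>. kexp (c * y) - kexp (a * y)) <= (LINT y|\<pi>. ((c - a) * (1 + R)) * min y (y\<^sup>2))"
 proof (rule integral_mono_AE)
  show "AE y in \<pi>. kexp (c * y) - kexp (a * y) <= ((c - a) * (1 + R)) * min y (y\<^sup>2)"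
   using AE_pi_pos
  proof eventually_elim
   case (elim y)
   have "kexp (c * y) - kexp (a * y) <= (c * y - a * y) * min 1 (c * y)"
    using ac elim by (intro kexp_diff) auto
   also have "... = (c - a) * (y * min 1 (c * y))" by (simp add: algebra_simps)
   also have "y * min 1 (c * y) <= (1 + R) * min y (y\<^sup>2)"
   proof (cases "y <= 1")
    case True
    have "y * min 1 (c * y) <= y * (c * y)" using elim by (intro mult_left_mono) auto
    also have "... = c * y\<^sup>2" by (simp add: power2_eq_square)
    also have "... <= (1 + R) * y\<^sup>2" using ac by (intro mult_right_mono) auto
    also have "(1 + R) * y\<^sup>2 = (1 + R) * min y (y\<^sup>2)" using True elim mult_left_le[of y y] by (auto simp: power2_eq_square min_def)
    finally show ?thesis .
   next
    case False
    have "y * min 1 (c * y) <= 1 * y" using elim by (simp add: min_def)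
    also have "... <= (1 + R) * y" using elim assms by (intro mult_right_mono) auto
    also have "(1 + R) * y = (1 + R) * min y (y\<^sup>2)" using False elim mult_left_mono[of 1 y y] by (auto simp: power2_eq_square min_def)
    finally show ?thesis .
   qed
   finally show ?case using ac by (simp add: mult_left_mono mult.assoc)
  qed
  show "integrable \<pi> (%y. kexp (c * y) - kexp (a * y))"
   using integrable_kexp[of a] integrable_kexp[of c] ac by auto
 qed (auto intro!: integrable_mult_right integrable_min)
 also have "... = (c - a) * ((1 + R) * mom1)" by (simp add: mom1_def)
 finally have "psi0 v - psi0 u <= \<rho> * ((c - a) * (c + a)) + (c - a) * ((1 + R) * mom1)"
  unfolding eq sq by simp
 also have "... <= \<rho> * ((c - a) * (2 * R)) + (c - a) * ((1 + R) * mom1)"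
  using ac rho_nonneg by (intro add_right_mono mult_left_mono) auto
 also have "... = lip R * (c - a)" by (simp add: lip_def algebra_simps)
 also have "... <= lip R * (v - u)" using ac lip_nonneg[OF assms(3)] by (intro mult_left_mono) auto
 finally show "psi0 v - psi0 u <= lip R * (v - u)" .
qed

lemma psi0_mono: "u <= v ==> psi0 u <= psi0 v"
 using psi0_diff(1)[of u v "max 0 v"] by simp

lemma psi0_lipschitz:
 assumes "u <= R" "v <= R" "0 <= R"
 shows "\<bar>psi0 v - psi0 u\<bar> <= lip R * \<bar>v - u\<bar>"
 using psi0_diff[of u v R] psi0_diff[of v u R] assms by (cases "u <= v") (auto simp: abs_if)

lemma psi0_le_lip: "0 <= v ==> v <= R ==> psi0 v <= lip R * v"
 using psi0_diff(2)[of 0 v R] by simp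

lemma isCont_psi0: "isCont psi0 x"
proof -
 define R where "R = \<bar>x\<bar> + 1"
 have "((%v. psi0 v - psi0 x) \<longlongrightarrow> 0) (at x)"
 proof (rule Lim_null_comparison)
  have "eventually (%v. dist v x < 1) (at x)" unfolding eventually_at by (intro exI[of _ 1]) auto
  then show "\<forall>\<^sub>F v in at x. norm (psi0 v - psi0 x) <= lip R * \<bar>v - x\<bar>"
  proof eventually_elim
   case (elim v)
   then show ?case using psi0_lipschitz[of x R v] by (auto simp: R_def dist_real_def)
  qed
  show "((%v. lip R * \<bar>v - x\<bar>) \<longlongrightarrow> 0) (at x)"
   by (auto intro!: tendsto_eq_intros)
 qed
 then show ?thesis by (simp add: isCont_def LIM_zero_iff)
qed

lemma psi0_measurable [measurable]: "psi0 : Bm borel"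
 by (intro borel_measurable_continuous_onI continuous_at_imp_continuous_on ballI isCont_psi0)

text \<open>Inherited from the convexity of the square and of \<open>kexp\<close>. It yields that
  psi is negative all the way from 0 to its largest zero.\<close>

lemma psi0_convex:
 assumes "0 <= s" "s <= 1" "0 <= u" "0 <= v"
 shows "psi0 ((1 - s) * u + s * v) <= (1 - s) * psi0 u + s * psi0 v"
proof -
 define w where "w = (1 - s) * u + s * v"
 have w: "0 <= w" using assms by (simp add: w_def)
 have "(LINT y|\<pi>. kexp (w * y)) <= (LINT y|\<pi>. (1 - s) * kexp (u * y) + s * kexp (v * y))"
 proof (rule integral_mono)
  fix y
  show "kexp (w * y) <= (1 - s) * kexp (u * y) + s * kexp (v * y)"
   using kexp_convex[OF assms(1,2), of "u * y" "v * y"] by (simp add: w_def algebra_simps)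
 qed (use integrable_kexp w assms in auto)
 also have "... = (1 - s) * (LINT y|\<pi>. kexp (u * y)) + s * (LINT y|\<pi>. kexp (v * y))"
  using integrable_kexp assms by simp
 finally have 1: "(LINT y|\<pi>. kexp (w * y)) <= (1 - s) * (LINT y|\<pi>. kexp (u * y)) + s * (LINT y|\<pi>. kexp (v * y))" .
 have "(1 - s) * u\<^sup>2 + s * v\<^sup>2 - w\<^sup>2 = s * (1 - s) * (u - v)\<^sup>2"
  by (simp add: w_def power2_eq_square algebra_simps)
 then have "w\<^sup>2 <= (1 - s) * u\<^sup>2 + s * v\<^sup>2"
  using assms by (smt (verit) mult_nonneg_nonneg zero_le_power2)
 from mult_left_mono[OF this rho_nonneg] 1 w show ?thesis
  unfolding w_def[symmetric] using assms by (simp add: psi0_def algebra_simps)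
qed

end


subsection \<open>Behaviour of the branching mechanism at zero\<close>

lemma Gamma_integral_Ioi:
 fixes s :: real
 assumes "0 < s"
 shows "set_integrable lborel {0<..} (%t. exp (- t) * t powr (s - 1))"
  "(LINT t:{0<..}|lborel. exp (- t) * t powr (s - 1)) = Gamma s"
proof -
 let ?f = "%t::real. indicator {0<..} t *\<^sub>R (exp (- t) * t powr (s - 1))"
 have "(\<integral>\<^sup>+t. ennreal (?f t) \<partial>lborel) = (\<integral>\<^sup>+t. ennreal (indicator {0..} t * t powr (s - 1) / exp t) \<partial>lborel)"
 proof (rule nn_integral_cong_AE, rule AE_mp[OF AE_lborel_singleton[of 0]], rule AE_I2, rule impI)
  fix t :: real assume "t ~= 0"
  then have "?f t = indicator {0..} t * t powr (s - 1) / exp t"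
   by (simp add: indicator_def exp_minus divide_inverse)
  then show "ennreal (?f t) = ennreal (indicator {0..} t * t powr (s - 1) / exp t)" by (rule arg_cong)
 qed
 then have nn: "(\<integral>\<^sup>+t. ennreal (?f t) \<partial>lborel) = ennreal (Gamma s)"
  using Gamma_conv_nn_integral_real[OF assms] by simp
 have "has_bochner_integral lborel ?f (Gamma s)"
  by (rule has_bochner_integral_nn_integral[OF _ _ _ nn]) (use assms in \<open>auto simp: Gamma_real_pos less_imp_le\<close>)
 then show "set_integrable lborel {0<..} (%t. exp (- t) * t powr (s - 1))"
  "(LINT t:{0<..}|lborel. exp (- t) * t powr (s - 1)) = Gamma s"
  by (auto simp: set_integrable_def set_lebesgue_integral_def has_bochner_integral_iff)
qed

lemma set_integrable_powr_Ioi: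
 assumes "0 < b"
 shows "set_integrable lborel {1<..} (%y::real. y powr (- 1 - b))"
proof -
 have "set_integrable lborel (einterval 1 \<infinity>) (%y::real. y powr (- 1 - b))"
 proof (rule interval_integral_FTC_nonneg(1)[where F="%y. - (y powr (- b)) / b" and A="- 1 / b" and B=0])
  show "(((%y. - (y powr - b) / b) \<circ> real_of_ereal) \<longlongrightarrow> - 1 / b) (at_right 1)"
   unfolding one_ereal_def ereal_tendsto_simps using assms by (auto intro!: tendsto_eq_intros)
  show "(((%y. - (y powr - b) / b) \<circ> real_of_ereal) \<longlongrightarrow> 0) (at_left \<infinity>)"
   unfolding ereal_tendsto_simps using assms by real_asymp
 qed (use assms in \<open>auto intro!: derivative_eq_intros continuous_intros simp: powr_diff powr_minus one_ereal_def field_simps\<close>)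
 also have "einterval 1 \<infinity> = {1<..}" by (auto simp: einterval_def one_ereal_def)
 finally show ?thesis .
qed

text \<open>The boundary terms of two integrations by parts applied to
  \<open>kexp y * y powr (- 2 - b)\<close>. What they leave is the integrand exp(-y) y^(-b) / (b (1
  + b)) of Euler's Gamma integral.\<close>

definition kexp_prim :: "real => real => real" where
 "kexp_prim b y = - kexp y * y powr (- 1 - b) / (1 + b) - (1 - exp (- y)) * y powr (- b) / (b * (1 + b))"

lemma kexp_prim_deriv:
 assumes b: "0 < b" and y: "0 < y"
 shows "(kexp_prim b has_real_derivative
  kexp y * y powr (- 2 - b) - exp (- y) * y powr (- b) / (b * (1 + b))) (at y)"
proof -
 have dE: "((%y. 1 - exp (- y)) has_real_derivative exp (- y)) (at y)"
  by (auto intro!: derivative_eq_intros)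
 have dP: "((%y. y powr c) has_real_derivative c * y powr (c - 1)) (at y)" for c
  by (rule has_real_derivative_powr[OF y])
 define u1 u2 u3 u4 u5 u6 where "u1 = 1 - exp (- y)" and "u2 = y powr (- 1 - b)" and "u3 = kexp y"
  and "u4 = y powr (- 2 - b)" and "u5 = exp (- y)" and "u6 = y powr (- b)"
 note u = u1_def u2_def u3_def u4_def u5_def u6_def
 have pw: "y powr (- 1 - b - 1) = u4" "y powr (- b - 1) = u2"
  by (auto simp: u intro!: arg_cong[where f="(powr) y"])
 have "(kexp_prim b has_real_derivative
    (- u1 * u2 + (- 1 - b) * y powr (- 1 - b - 1) * - u3) / (1 + b)
    - (u5 * u6 + (- b) * y powr (- b - 1) * u1) / (b * (1 + b))) (at y)"
  unfolding u kexp_prim_def[abs_def]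
  by (rule DERIV_diff[OF DERIV_cdivide[OF DERIV_mult[OF DERIV_minus[OF kexp_deriv] dP]]
      DERIV_cdivide[OF DERIV_mult[OF dE dP]]])
 also have "(- u1 * u2 + (- 1 - b) * y powr (- 1 - b - 1) * - u3) / (1 + b)
    - (u5 * u6 + (- b) * y powr (- b - 1) * u1) / (b * (1 + b)) = u3 * u4 - u5 * u6 / (b * (1 + b))"
  unfolding pw using b by (simp add: divide_simps) (simp add: algebra_simps)
 finally show ?thesis by (simp only: u)
qed

text \<open>The first power controls the primitive at 0 and the second one at infinity; when
  moreover b < 1, both boundary values vanish.\<close>

lemma kexp_prim_bound:
 assumes b: "0 < b" and y: "0 < y"
 shows "\<bar>kexp_prim b y\<bar> <= (1 / (1 + b) + 1 / (b * (1 + b))) * min (y powr (1 - b)) (y powr (- b))"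
proof -
 have m: "min (y powr (1 - b)) (y powr (- b)) = min y 1 * y powr (- b)"
  using y powr_add[of y 1 "- b"] by (simp add: min_mult_distrib_right)
 have "kexp y * y powr (- 1 - b) <= (min y 1 * y) * y powr (- 1 - b)"
  using kexp_le_self[of y] kexp_le_square[of y] y
  by (intro mult_right_mono) (auto simp: min_def power2_eq_square)
 also have "... = min y 1 * y powr (- b)"
  using y powr_add[of y 1 "- 1 - b"] by simp
 finally have 1: "kexp y * y powr (- 1 - b) <= min y 1 * y powr (- b)" .
 have 2: "(1 - exp (- y)) * y powr (- b) <= min y 1 * y powr (- b)"
  using exp_ge_add_one_self[of "- y"] y by (intro mult_right_mono) auto
 define U V where "U = kexp y * y powr (- 1 - b) / (1 + b)" and "V = (1 - exp (- y)) * y powr (- b) / (b * (1 + b))"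
 have "0 <= U" "0 <= V" "kexp_prim b y = - U - V"
  using b y by (auto simp: U_def V_def kexp_prim_def)
 then have "\<bar>kexp_prim b y\<bar> = U + V" by linarith
 also have "... = kexp y * y powr (- 1 - b) / (1 + b) + (1 - exp (- y)) * y powr (- b) / (b * (1 + b))"
  by (simp add: U_def V_def)
 also have "... <= min y 1 * y powr (- b) / (1 + b) + min y 1 * y powr (- b) / (b * (1 + b))"
  using 1 2 b by (intro add_mono divide_right_mono) auto
 finally show ?thesis unfolding m by (simp add: distrib_right)
qed

lemma kexp_prim_at_0: "0 < b ==> b < 1 ==> (kexp_prim b \<longlongrightarrow> 0) (at_right 0)"
proof (rule Lim_null_comparison)
 assume b: "0 < b" "b < 1"
 let ?C = "1 / (1 + b) + 1 / (b * (1 + b))"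
 show "\<forall>\<^sub>F y in at_right 0. norm (kexp_prim b y) <= ?C * y powr (1 - b)"
  using eventually_at_right_less[of "0::real"]
 proof eventually_elim
  case (elim y)
  have "?C * min (y powr (1 - b)) (y powr (- b)) <= ?C * y powr (1 - b)"
   using b by (intro mult_left_mono) auto
  then show ?case using kexp_prim_bound[OF b(1) elim] by simp
 qed
 have "((%y::real. y powr (1 - b)) \<longlongrightarrow> 0 powr (1 - b)) (at_right 0)"
  using b eventually_at_right_less[of "0::real"]
  by (intro tendsto_powr2) (auto elim: eventually_mono)
 then have "((%y::real. y powr (1 - b)) \<longlongrightarrow> 0) (at_right 0)" by simp
 then show "((%y. ?C * y powr (1 - b)) \<longlongrightarrow> 0) (at_right 0)"
  by (rule tendsto_mult_right_zero)
qed

lemma kexp_prim_at_top: "0 < b ==> (kexp_prim b \<longlongrightarrow> 0) at_top"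
proof (rule Lim_null_comparison)
 assume b: "0 < b"
 let ?C = "1 / (1 + b) + 1 / (b * (1 + b))"
 show "\<forall>\<^sub>F y in at_top. norm (kexp_prim b y) <= ?C * y powr (- b)"
  using eventually_gt_at_top[of "0::real"]
 proof eventually_elim
  case (elim y)
  have "?C * min (y powr (1 - b)) (y powr (- b)) <= ?C * y powr (- b)"
   using b by (intro mult_left_mono) auto
  then show ?case using kexp_prim_bound[OF b(1) elim] by simp
 qed
 have "((%y::real. y powr (- b)) \<longlongrightarrow> 0) at_top"
  using b by (intro tendsto_neg_powr filterlim_ident) auto
 then show "((%y. ?C * y powr (- b)) \<longlongrightarrow> 0) at_top"
  by (rule tendsto_mult_right_zero)
qed

text \<open>Outside the half plane of convergence Gamma is governed by its functional equation;
  applied twice it turns the Euler integral Gamma(1 - b) into b (1 + b) Gamma(-1 - b), and the two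
  integrations by parts divide by exactly that factor.\<close>

lemma kexp_Gamma:
 assumes b: "0 < b" "b < 1"
 shows "set_integrable lborel {0<..} (%y. kexp y * y powr (- 2 - b))"
  "(LINT y:{0<..}|lborel. kexp y * y powr (- 2 - b)) = Gamma (- 1 - b)"
proof -
 let ?g = "%y. kexp y * y powr (- 2 - b)"
 let ?h = "%y. exp (- y) * y powr ((1 - b) - 1) / (b * (1 + b))"
 have G: "set_integrable lborel {0<..} (%t. exp (- t) * t powr ((1 - b) - 1))"
  "(LINT t:{0<..}|lborel. exp (- t) * t powr ((1 - b) - 1)) = Gamma (1 - b)"
  using Gamma_integral_Ioi[of "1 - b"] b by auto
 show gi: "set_integrable lborel {0<..} ?g"
  unfolding set_integrable_def
 proof (rule Bochner_Integration.integrable_bound)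
  \<comment> \<open>Near 0 the bound kexp y <= y^2 leads to a Gamma integrand, beyond 1 the bound
    kexp y <= y leads to y^(-1 - b).\<close>
  show "integrable lborel (%y. exp 1 * (indicator {0<..} y *\<^sub>R (exp (- y) * y powr ((1 - b) - 1)))
    + indicator {1<..} y *\<^sub>R (y powr (- 1 - b)))"
   using G(1) set_integrable_powr_Ioi[OF b(1)] unfolding set_integrable_def
   by (intro Bochner_Integration.integrable_add integrable_mult_right)
  show "AE y in lborel. norm (indicator {0<..} y *\<^sub>R ?g y) <=
    norm (exp 1 * (indicator {0<..} y *\<^sub>R (exp (- y) * y powr ((1 - b) - 1)))
    + indicator {1<..} y *\<^sub>R (y powr (- 1 - b)))"
  proof (rule AE_I2)
   fix y :: real
   consider "y <= 0" | "0 < y" "y <= 1" | "1 < y" by linarith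
   then show "norm (indicator {0<..} y *\<^sub>R ?g y) <=
    norm (exp 1 * (indicator {0<..} y *\<^sub>R (exp (- y) * y powr ((1 - b) - 1)))
    + indicator {1<..} y *\<^sub>R (y powr (- 1 - b)))"
   proof cases
    case 2
    have "?g y <= y powr 2 * y powr (- 2 - b)"
     using kexp_le_square[of y] 2 by (intro mult_right_mono) (auto simp: powr_numeral)
    also have "... = 1 * y powr (- b)" by (simp only: powr_add[symmetric]) simp
    also have "... <= (exp 1 * exp (- y)) * y powr (- b)"
     using 2 by (intro mult_right_mono) (auto simp flip: exp_add)
    finally show ?thesis using 2 by (simp add: mult.assoc)
   next
    case 3
    have "?g y <= y powr 1 * y powr (- 2 - b)"
     using kexp_le_self[of y] 3 by (intro mult_right_mono) auto
    also have "... = y powr (- 1 - b)" using 3 by (simp only: powr_add[symmetric]) simp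
    also have "... <= exp 1 * (exp (- y) * y powr ((1 - b) - 1)) + y powr (- 1 - b)" by simp
    finally show ?thesis using 3 by simp
   qed auto
  qed
 qed (auto simp: set_borel_measurable_def)
 have hi: "set_integrable lborel {0<..} ?h"
  using G(1) by (rule set_integrable_divide) 
 have ein: "einterval 0 \<infinity> = {0<..}" by (auto simp: einterval_def zero_ereal_def)
 have "(LBINT y=0..\<infinity>. ?g y - ?h y) = 0 - 0"
 proof (rule interval_integral_FTC_integrable[where F="kexp_prim b"])
  fix y :: real assume "0 < ereal y"
  then have y: "0 < y" by (simp add: zero_ereal_def)
  show "(kexp_prim b has_vector_derivative ?g y - ?h y) (at y)"
   using kexp_prim_deriv[OF b(1) y] by (simp add: has_real_derivative_iff_has_vector_derivative)
  have "isCont (%y. y powr c) y" for c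
   using y by (intro continuous_intros) auto
  then show "isCont (%y. ?g y - ?h y) y"
   using b by (intro isCont_diff isCont_mult isCont_divide isCont_exp isCont_minus continuous_ident continuous_const DERIV_isCont[OF kexp_deriv]) auto
 next
  show "set_integrable lborel (einterval 0 \<infinity>) (%y. ?g y - ?h y)"
   unfolding ein using gi hi by (rule set_integral_diff)
  show "((kexp_prim b \<circ> real_of_ereal) \<longlongrightarrow> 0) (at_right 0)"
   unfolding zero_ereal_def ereal_tendsto_simps by (rule kexp_prim_at_0[OF b])
  show "((kexp_prim b \<circ> real_of_ereal) \<longlongrightarrow> 0) (at_left \<infinity>)"
   unfolding ereal_tendsto_simps by (rule kexp_prim_at_top[OF b(1)])
 qed simp
 then have "(LINT y:{0<..}|lborel. ?g y - ?h y) = 0"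
  by (simp add: interval_lebesgue_integral_def ein)
 then have "(LINT y:{0<..}|lborel. ?g y) = (LINT y:{0<..}|lborel. ?h y)"
  using set_integral_diff(2)[OF gi hi] by simp
 also have "... = Gamma (1 - b) / (b * (1 + b))" using G(2) by simp
 also have "Gamma (1 - b) = (- b) * ((- 1 - b) * Gamma (- 1 - b))"
 proof -
  have "1 - b \<notin> \<int>\<^sub>\<le>\<^sub>0" using b by (auto elim!: nonpos_Ints_cases)
  have n1: "- b \<notin> \<int>\<^sub>\<le>\<^sub>0"
  proof
   assume "- b : \<int>\<^sub>\<le>\<^sub>0"
   then obtain n where "- b = of_int n" by (auto elim!: nonpos_Ints_cases)
   then have "real_of_int n < 0" "- 1 < real_of_int n" using b by linarith+
   then have "n < 0" "- 1 < n" by linarith+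
   then show False by presburger
  qed
  have n2: "- 1 - b \<notin> \<int>\<^sub>\<le>\<^sub>0"
  proof
   assume "- 1 - b : \<int>\<^sub>\<le>\<^sub>0"
   then obtain n where "- 1 - b = of_int n" by (auto elim!: nonpos_Ints_cases)
   then have "real_of_int n < - 1" "- 2 < real_of_int n" using b by linarith+
   then have "n < - 1" "- 2 < n" by linarith+
   then show False by presburger
  qed
  have "Gamma (- b + 1) = - b * Gamma (- b)" by (rule Gamma_plus1[OF n1])
  moreover have "Gamma (- 1 - b + 1) = (- 1 - b) * Gamma (- 1 - b)" by (rule Gamma_plus1[OF n2])
  ultimately show ?thesis by simp
 qed
 also have "(- b) * ((- 1 - b) * Gamma (- 1 - b)) = (b * (1 + b)) * Gamma (- 1 - b)" by (simp add: algebra_simps)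
 also have "... / (b * (1 + b)) = Gamma (- 1 - b)" using b by simp
 finally show "(LINT y:{0<..}|lborel. ?g y) = Gamma (- 1 - b)" .
qed

text \<open>The integral scales by substitution. Against the reference density of the tail
  condition, extended to (0, oo), it contributes exactly eta z^(1 + beta): this is the origin of the
  normalization 1 / Gamma(-1 - beta).\<close>

lemma kexp_scaled_Gamma:
 assumes b: "0 < b" "b < 1" and z: "0 < z"
 shows "set_integrable lborel {0<..} (%y. kexp (z * y) * y powr (- 2 - b))"
  "(LINT y:{0<..}|lborel. kexp (z * y) * y powr (- 2 - b)) = z powr (1 + b) * Gamma (- 1 - b)"
proof -
 let ?f = "%y. indicator {0<..} y *\<^sub>R (kexp y * y powr (- 2 - b))"
 have eq: "indicator {0<..} y *\<^sub>R (kexp (z * y) * y powr (- 2 - b)) = z powr (2 + b) * ?f (0 + z * y)" for y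
 proof (cases "0 < y")
  case True
  have "z powr (2 + b) * z powr (- 2 - b) = 1" using z by (simp flip: powr_add)
  then show ?thesis using True z by (simp add: powr_mult mult_ac)
 next
  case False
  then show ?thesis using z by (simp add: zero_less_mult_iff)
 qed
 have i: "integrable lborel ?f" using kexp_Gamma(1)[OF b] by (simp add: set_integrable_def)
 show "set_integrable lborel {0<..} (%y. kexp (z * y) * y powr (- 2 - b))"
  unfolding set_integrable_def eq using lborel_integrable_real_affine[OF i, of z 0] z
  by (intro integrable_mult_right) auto
 have "Gamma (- 1 - b) = z * (LINT y|lborel. ?f (0 + z * y))"
  using kexp_Gamma(2)[OF b] lborel_integral_real_affine[of z ?f 0] z
  by (simp add: set_lebesgue_integral_def)
 moreover have "z powr (2 + b) = z powr (1 + b) * z"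
  using z powr_add[of z "1 + b" 1] by (simp add: algebra_simps)
 moreover have "(LINT y:{0<..}|lborel. kexp (z * y) * y powr (- 2 - b)) = z powr (2 + b) * (LINT y|lborel. ?f (0 + z * y))"
  unfolding set_lebesgue_integral_def eq by (rule integral_mult_right_zero)
 ultimately show "(LINT y:{0<..}|lborel. kexp (z * y) * y powr (- 2 - b)) = z powr (1 + b) * Gamma (- 1 - b)"
  by (simp only: mult.assoc)
qed

lemma set_integrable_powr_Ioc:
 assumes b: "0 < b" "b < 1"
 shows "set_integrable lborel {0<..1} (%y::real. y powr (- b))"
 unfolding set_integrable_def
proof (rule Bochner_Integration.integrable_bound)
 show "integrable lborel (%y. exp 1 * (indicator {0<..} y *\<^sub>R (exp (- y) * y powr ((1 - b) - 1))))"
 proof -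
  have "set_integrable lborel {0<..} (%y. exp (- y) * y powr ((1 - b) - 1))"
   by (rule Gamma_integral_Ioi(1)) (use b in simp)
  then show ?thesis unfolding set_integrable_def by (rule integrable_mult_right)
 qed
 show "AE y in lborel. norm (indicator {0<..1} y *\<^sub>R y powr (- b))
   <= norm (exp 1 * (indicator {0<..} y *\<^sub>R (exp (- y) * y powr ((1 - b) - 1))))"
 proof (rule AE_I2)
  fix y :: real
  have "1 * y powr (- b) <= (exp 1 * exp (- y)) * y powr (- b)" if "y <= 1"
   using that by (intro mult_right_mono) (auto simp flip: exp_add)
  then show "norm (indicator {0<..1} y *\<^sub>R y powr (- b))
   <= norm (exp 1 * (indicator {0<..} y *\<^sub>R (exp (- y) * y powr ((1 - b) - 1))))"
   by (auto simp: indicator_def mult.assoc)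
 qed
qed simp

section \<open>The branching mechanism under the tail condition\<close>

locale stable_branching = branching +
 fixes \<eta> \<beta> \<delta> :: real
 assumes eta_pos: "0 < \<eta>" and beta_pos: "0 < \<beta>" and beta_lt_1: "\<beta> < 1" and delta_pos: "0 < \<delta>"
  and tail: "tail_cond \<pi> \<eta> \<beta> \<delta>"
begin

text \<open>The excess exponent, capped so that 1 + beta + dd <= 2, the range in which
  \<open>kexp_le_powr\<close> applies.\<close>

definition "dd = min \<delta> (1 - \<beta>)"

lemma dd_pos: "0 < dd" and dd_le: "dd <= \<delta>" "dd <= 1 - \<beta>"
 using delta_pos beta_lt_1 by (auto simp: dd_def)

definition "dens y = \<eta> / Gamma (- 1 - \<beta>) * y powr (- 2 - \<beta>)"

lemma dens_eq: "0 < y ==> \<eta> / (Gamma (- 1 - \<beta>) * y powr (2 + \<beta>)) = dens y"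
 unfolding dens_def using powr_minus[of y "2 + \<beta>"] by (simp add: divide_inverse)

text \<open>Nonnegative as the integral of \<open>kexp\<close> against a power; nonzero because
  Gamma takes the value 0 exactly at its poles, by convention, and -1 - beta is not an
  integer.\<close>

lemma Gamma_pos: "0 < Gamma (- 1 - \<beta>)"
proof -
 have "0 <= (LINT y:{0<..}|lborel. kexp y * y powr (- 2 - \<beta>))"
  unfolding set_lebesgue_integral_def by (intro integral_nonneg_AE AE_I2) simp
 then have "0 <= Gamma (- 1 - \<beta>)"
  by (simp only: kexp_Gamma(2)[OF beta_pos beta_lt_1])
 moreover have "Gamma (- 1 - \<beta>) ~= 0"
  unfolding Gamma_eq_zero_iff
 proof
  assume "- 1 - \<beta> : \<int>\<^sub>\<le>\<^sub>0"
  then obtain n where "- 1 - \<beta> = of_int n" by (auto elim!: nonpos_Ints_cases)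
  then have "real_of_int n < - 1" "- 2 < real_of_int n" using beta_pos beta_lt_1 by linarith+
  then have "n < - 1" "- 2 < n" by linarith+
  then show False by presburger
 qed
 ultimately show ?thesis by simp
qed

text \<open>The reference density integrates \<open>kexp (z * y)\<close> to eta z^(1 + beta) over
  the whole half line. Replacing it by pi costs O(z^2) on (0, 1], where kexp is quadratic, and
  O(z^(1 + beta + dd)) on (1, oo) by the tail condition; the rho term is O(z^2).\<close>

lemma psi0_expansion: "\<exists>C>0. \<forall>z\<ge>0. \<bar>psi0 z - \<eta> * z powr (1 + \<beta>)\<bar> <= C * (z powr (1 + \<beta> + dd) + z\<^sup>2)"
proof -
 obtain p N where p[measurable]: "p : Bm borel" and p0: "!!y. 0 <= p y"
  and N[measurable]: "N : sets borel" and N1: "N \<subseteq> {1<..}" and N0: "emeasure lborel N = 0"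
  and dec: "!!A. A : sets borel ==> A \<subseteq> {1<..} ==>
    emeasure \<pi> A = (\<integral>\<^sup>+y. ennreal (p y) * indicator A y \<partial>lborel) + emeasure \<pi> (A \<inter> N)"
  and fin: "(\<integral>\<^sup>+y. ennreal (y powr (1 + \<beta> + \<delta>) *
       \<bar>p y - \<eta> / (Gamma (- 1 - \<beta>) * y powr (2 + \<beta>))\<bar>) * indicator {1<..} y \<partial>lborel)
    + (\<integral>\<^sup>+y. ennreal (y powr (1 + \<beta> + \<delta>)) * indicator N y \<partial>\<pi>) < \<infinity>"
  using tail unfolding tail_cond_def by blast
 define q where "q = 1 + \<beta> + dd"
 have q: "1 <= q" "q <= 2" "q <= 1 + \<beta> + \<delta>" using dd_pos dd_le beta_pos by (auto simp: q_def)
 have dens0: "0 <= dens y" for y using eta_pos Gamma_pos by (simp add: dens_def)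
 have [measurable]: "dens : Bm borel" unfolding dens_def by measurable
 have yq: "y powr q <= y powr (1 + \<beta> + \<delta>)" if "1 < y" for y :: real
  using that q by (intro powr_mono) auto
 have kq: "kexp (z * y) <= z powr q * y powr q" if "0 <= z" "0 <= y" for z y
  using kexp_le_powr[of "z * y" q] that q by (simp add: powr_mult)
 \<comment> \<open>Off the null set N the measure pi has density p on (1, oo); the part of pi
   carried by N is treated separately.\<close>
 have D: "density \<pi> (indicator ({1<..} - N)) = density lborel (%y. ennreal (p y * indicator {1<..} y))"
 proof (rule measure_eqI)
  fix A assume "A : sets (density \<pi> (indicator ({1<..} - N)))"
  then have [measurable]: "A : sets borel" by simp
  have nN: "AE y in lborel. y \<notin> N" using N0 N by (intro AE_not_in) (auto simp: null_sets_def)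
  have "emeasure (density \<pi> (indicator ({1<..} - N))) A = emeasure \<pi> (A \<inter> ({1<..} - N))"
   by (subst emeasure_density) (auto simp: indicator_inter_arith[symmetric] Int_commute)
  also have "... = (\<integral>\<^sup>+y. ennreal (p y) * indicator (A \<inter> ({1<..} - N)) y \<partial>lborel) + emeasure \<pi> (A \<inter> ({1<..} - N) \<inter> N)"
   by (rule dec) auto
  also have "A \<inter> ({1<..} - N) \<inter> N = {}" by auto
  also have "(\<integral>\<^sup>+y. ennreal (p y) * indicator (A \<inter> ({1<..} - N)) y \<partial>lborel)
    = (\<integral>\<^sup>+y. ennreal (p y * indicator {1<..} y) * indicator A y \<partial>lborel)"
   using nN by (intro nn_integral_cong_AE) (auto simp: indicator_def)
  finally show "emeasure (density \<pi> (indicator ({1<..} - N))) A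
    = emeasure (density lborel (%y. ennreal (p y * indicator {1<..} y))) A"
   by (simp add: emeasure_density)
 qed simp
 have n1: "integrable \<pi> (%y. indicator N y * y powr q)"
 proof (rule integrableI_nonneg)
  have "(\<integral>\<^sup>+y. ennreal (indicator N y * y powr q) \<partial>\<pi>) <= (\<integral>\<^sup>+y. ennreal (y powr (1 + \<beta> + \<delta>)) * indicator N y \<partial>\<pi>)"
   using N1 yq by (intro nn_integral_mono) (auto simp: indicator_def intro!: ennreal_leI)
  also have "... < \<infinity>" using fin by (auto simp: less_top ennreal_add_less_top)
  finally show "(\<integral>\<^sup>+y. ennreal (indicator N y * y powr q) \<partial>\<pi>) < \<infinity>" .
 qed auto
 have n2: "integrable lborel (%y. indicator {1<..} y * (y powr q * \<bar>p y - dens y\<bar>))"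
 proof (rule integrableI_nonneg)
  have "(\<integral>\<^sup>+y. ennreal (indicator {1<..} y * (y powr q * \<bar>p y - dens y\<bar>)) \<partial>lborel)
    <= (\<integral>\<^sup>+y. ennreal (y powr (1 + \<beta> + \<delta>) *
       \<bar>p y - \<eta> / (Gamma (- 1 - \<beta>) * y powr (2 + \<beta>))\<bar>) * indicator {1<..} y \<partial>lborel)"
   using yq by (intro nn_integral_mono) (auto simp: indicator_def dens_eq intro!: ennreal_leI mult_right_mono)
  also have "... < \<infinity>" using fin by (auto simp: less_top ennreal_add_less_top)
  finally show "(\<integral>\<^sup>+y. ennreal (indicator {1<..} y * (y powr q * \<bar>p y - dens y\<bar>)) \<partial>lborel) < \<infinity>" .
 qed auto
 \<comment> \<open>I1 bounds the singular part of pi, I2 the deviation of its density from the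
   reference density on (1, oo), and I3 the contribution of the reference density on (0, 1].\<close>
 define I1 I2 I3 where "I1 = (LINT y|\<pi>. indicator N y * y powr q)"
  and "I2 = (LINT y|lborel. indicator {1<..} y * (y powr q * \<bar>p y - dens y\<bar>))"
  and "I3 = \<eta> / Gamma (- 1 - \<beta>) * (LINT y:{0<..1}|lborel. y powr (- \<beta>))"
 have I: "0 <= I1" "0 <= I2" "0 <= I3"
  using eta_pos Gamma_pos unfolding I1_def I2_def I3_def set_lebesgue_integral_def
  by (auto intro!: integral_nonneg_AE mult_nonneg_nonneg)
 have main: "\<bar>psi0 z - \<eta> * z powr (1 + \<beta>)\<bar> <= (\<rho> + mom1 + I3) * z\<^sup>2 + (I1 + I2) * z powr q" if z: "0 < z" for z
 proof -
  have ik: "integrable \<pi> (%y. kexp (z * y))" using z by (intro integrable_kexp) auto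
  have iA: "integrable \<pi> (%y. indicator S y * kexp (z * y))" if "S : sets borel" for S
   using integrable_mult_indicator[OF _ ik, of S] that by simp
  have split: "(LINT y|\<pi>. kexp (z * y)) = (LINT y|\<pi>. indicator {0<..1} y * kexp (z * y))
    + (LINT y|\<pi>. indicator N y * kexp (z * y)) + (LINT y|\<pi>. indicator ({1<..} - N) y * kexp (z * y))"
  proof -
   have "(LINT y|\<pi>. kexp (z * y)) = (LINT y|\<pi>. indicator {0<..1} y * kexp (z * y)
     + indicator N y * kexp (z * y) + indicator ({1<..} - N) y * kexp (z * y))"
   proof (rule integral_cong_AE)
    show "AE y in \<pi>. kexp (z * y) = indicator {0<..1} y * kexp (z * y)
     + indicator N y * kexp (z * y) + indicator ({1<..} - N) y * kexp (z * y)"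
     using AE_pi_pos
    proof eventually_elim
     case (elim y)
     have "y \<notin> N" if "y <= 1" using N1 that by auto
     then show ?case using elim by (auto simp: indicator_def)
    qed
   qed measurable
   then show ?thesis using iA[of "{0<..1}"] iA[of N] iA[of "{1<..} - N"] by simp
  qed
  have A: "0 <= (LINT y|\<pi>. indicator {0<..1} y * kexp (z * y))"
    "(LINT y|\<pi>. indicator {0<..1} y * kexp (z * y)) <= z\<^sup>2 * mom1"
  proof -
   have "(LINT y|\<pi>. indicator {0<..1} y * kexp (z * y)) <= (LINT y|\<pi>. z\<^sup>2 * min y (y\<^sup>2))"
   proof (rule integral_mono_AE[OF iA])
    show "AE y in \<pi>. indicator {0<..1} y * kexp (z * y) <= z\<^sup>2 * min y (y\<^sup>2)"
     using AE_pi_pos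
    proof eventually_elim
     case (elim y)
     have "kexp (z * y) <= z\<^sup>2 * y\<^sup>2" using kexp_le_square[of "z * y"] z elim by (simp add: power_mult_distrib)
     moreover have "min y (y\<^sup>2) = y\<^sup>2" if "y <= 1" using that elim mult_left_le[of y y] by (auto simp: power2_eq_square min_def)
     ultimately show ?case using elim by (auto simp: indicator_def)
    qed
   qed (auto intro: integrable_min)
   then show "(LINT y|\<pi>. indicator {0<..1} y * kexp (z * y)) <= z\<^sup>2 * mom1" by (simp add: mom1_def)
  qed (auto intro!: integral_nonneg_AE)
  have B: "0 <= (LINT y|\<pi>. indicator N y * kexp (z * y))" "(LINT y|\<pi>. indicator N y * kexp (z * y)) <= z powr q * I1"
  proof -
   have "(LINT y|\<pi>. indicator N y * kexp (z * y)) <= (LINT y|\<pi>. z powr q * (indicator N y * y powr q))"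
    using kq z N1 by (intro integral_mono iA integrable_mult_right n1) (auto simp: indicator_def)
   then show "(LINT y|\<pi>. indicator N y * kexp (z * y)) <= z powr q * I1" by (simp add: I1_def)
  qed (auto intro!: integral_nonneg_AE)
  have C: "(LINT y|\<pi>. indicator ({1<..} - N) y * kexp (z * y)) = (LINT y|lborel. p y * indicator {1<..} y * kexp (z * y))"
   and iC: "integrable lborel (%y. p y * indicator {1<..} y * kexp (z * y))"
  proof -
   have D': "density \<pi> (%y. ennreal (indicator ({1<..} - N) y)) = density lborel (%y. ennreal (p y * indicator {1<..} y))"
    using D by (simp add: ennreal_indicator)
   have "(\<integral>y. kexp (z * y) \<partial>density \<pi> (%y. ennreal (indicator ({1<..} - N) y))) = (LINT y|\<pi>. indicator ({1<..} - N) y * kexp (z * y))"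
    by (subst integral_density) auto
   moreover have "(\<integral>y. kexp (z * y) \<partial>density lborel (%y. ennreal (p y * indicator {1<..} y)))
     = (LINT y|lborel. p y * indicator {1<..} y * kexp (z * y))"
    by (subst integral_density) (use p0 in auto)
   ultimately show "(LINT y|\<pi>. indicator ({1<..} - N) y * kexp (z * y)) = (LINT y|lborel. p y * indicator {1<..} y * kexp (z * y))"
    using D' by simp
   have "integrable (density \<pi> (%y. ennreal (indicator ({1<..} - N) y))) (%y. kexp (z * y))"
    using iA[of "{1<..} - N"] by (subst integrable_density) auto
   then show "integrable lborel (%y. p y * indicator {1<..} y * kexp (z * y))"
    unfolding D' by (subst (asm) integrable_density) (use p0 in auto)
  qed
  let ?c = "\<eta> / Gamma (- 1 - \<beta>)"
  have iG: "integrable lborel (%y. indicator {0<..} y * (dens y * kexp (z * y)))"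
   using integrable_mult_right[OF kexp_scaled_Gamma(1)[OF beta_pos beta_lt_1 z, unfolded set_integrable_def], of ?c]
   by (simp add: dens_def mult_ac)
  have G: "(LINT y|lborel. indicator {0<..} y * (dens y * kexp (z * y))) = \<eta> * z powr (1 + \<beta>)"
  proof -
   have "(LINT y|lborel. indicator {0<..} y * (dens y * kexp (z * y)))
     = (LINT y|lborel. ?c * (indicator {0<..} y *\<^sub>R (kexp (z * y) * y powr (- 2 - \<beta>))))"
    by (intro Bochner_Integration.integral_cong) (auto simp: dens_def)
   also have "... = ?c * (z powr (1 + \<beta>) * Gamma (- 1 - \<beta>))"
    using kexp_scaled_Gamma(2)[OF beta_pos beta_lt_1 z] by (simp add: set_lebesgue_integral_def)
   finally show ?thesis using Gamma_pos by simp
  qed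
  have iGs: "integrable lborel (%y. indicator S y * (dens y * kexp (z * y)))" if "S : sets borel" "S \<subseteq> {0<..}" for S
   using integrable_mult_indicator[OF _ iG, of S] that
   by (rule_tac Bochner_Integration.integrable_bound[OF iG]) (auto simp: indicator_def dens0)
  have Gs: "\<eta> * z powr (1 + \<beta>) = (LINT y|lborel. indicator {0<..1} y * (dens y * kexp (z * y)))
    + (LINT y|lborel. indicator {1<..} y * (dens y * kexp (z * y)))"
  proof -
   have "(LINT y|lborel. indicator {0<..} y * (dens y * kexp (z * y)))
    = (LINT y|lborel. indicator {0<..1} y * (dens y * kexp (z * y)) + indicator {1<..} y * (dens y * kexp (z * y)))"
    by (intro Bochner_Integration.integral_cong) (auto simp: indicator_def)
   moreover have "integrable lborel (%y. indicator {0<..1} y * (dens y * kexp (z * y)))"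
    by (rule iGs) auto
   ultimately show ?thesis using G iGs[of "{1<..}"] by simp
  qed
  have E: "0 <= (LINT y|lborel. indicator {0<..1} y * (dens y * kexp (z * y)))"
   "(LINT y|lborel. indicator {0<..1} y * (dens y * kexp (z * y))) <= z\<^sup>2 * I3"
  proof -
   have i3: "integrable lborel (%y. indicator {0<..1} y * y powr (- \<beta>))"
    using set_integrable_powr_Ioc[OF beta_pos beta_lt_1] by (simp add: set_integrable_def)
   have "(LINT y|lborel. indicator {0<..1} y * (dens y * kexp (z * y)))
     <= (LINT y|lborel. (z\<^sup>2 * ?c) * (indicator {0<..1} y * y powr (- \<beta>)))"
   proof (intro integral_mono iGs integrable_mult_right i3)
    fix y :: real
    show "indicator {0<..1} y * (dens y * kexp (z * y)) <= (z\<^sup>2 * ?c) * (indicator {0<..1} y * y powr (- \<beta>))"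
    proof (cases "y : {0<..1}")
     case True
     then have y: "0 < y" by simp
     have "dens y * kexp (z * y) <= dens y * (z\<^sup>2 * y powr 2)"
      using kexp_le_square[of "z * y"] z y dens0
      by (intro mult_left_mono) (auto simp: power_mult_distrib powr_numeral)
     also have "... = (z\<^sup>2 * ?c) * (y powr (- 2 - \<beta>) * y powr 2)" by (simp add: dens_def mult_ac)
     also have "y powr (- 2 - \<beta>) * y powr 2 = y powr (- \<beta>)" by (simp only: powr_add[symmetric]) simp
     finally show ?thesis using True by simp
    qed simp
   qed auto
   then show "(LINT y|lborel. indicator {0<..1} y * (dens y * kexp (z * y))) <= z\<^sup>2 * I3"
    by (simp add: I3_def set_lebesgue_integral_def)
  qed (auto intro!: integral_nonneg_AE simp: dens0)
  have F: "\<bar>(LINT y|lborel. p y * indicator {1<..} y * kexp (z * y)) - (LINT y|lborel. indicator {1<..} y * (dens y * kexp (z * y)))\<bar>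
    <= z powr q * I2"
  proof -
   have eqF: "(LINT y|lborel. p y * indicator {1<..} y * kexp (z * y)) - (LINT y|lborel. indicator {1<..} y * (dens y * kexp (z * y)))
    = (LINT y|lborel. p y * indicator {1<..} y * kexp (z * y) - indicator {1<..} y * (dens y * kexp (z * y)))"
    using iC iGs[of "{1<..}"] by simp
   have "\<bar>\<integral>y. p y * indicator {1<..} y * kexp (z * y) - indicator {1<..} y * (dens y * kexp (z * y)) \<partial>lborel\<bar>
     <= (LINT y|lborel. z powr q * (indicator {1<..} y * (y powr q * \<bar>p y - dens y\<bar>)))"
   proof (rule integral_abs_bound_integral)
    show "integrable lborel (%y. p y * indicator {1<..} y * kexp (z * y) - indicator {1<..} y * (dens y * kexp (z * y)))"
     using iC iGs[of "{1<..}"] by auto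
    show "integrable lborel (%y. z powr q * (indicator {1<..} y * (y powr q * \<bar>p y - dens y\<bar>)))"
     by (intro integrable_mult_right n2)
    fix y :: real
    show "\<bar>p y * indicator {1<..} y * kexp (z * y) - indicator {1<..} y * (dens y * kexp (z * y))\<bar>
      <= z powr q * (indicator {1<..} y * (y powr q * \<bar>p y - dens y\<bar>))"
    proof (cases "1 < y")
     case True
     have "\<bar>p y * kexp (z * y) - dens y * kexp (z * y)\<bar> = \<bar>p y - dens y\<bar> * kexp (z * y)"
      by (simp add: left_diff_distrib[symmetric] abs_mult)
     also have "... <= \<bar>p y - dens y\<bar> * (z powr q * y powr q)"
      using kq[of z y] z True by (intro mult_left_mono) auto
     finally show ?thesis using True by (simp add: mult_ac)
    qed simp
   qed
   also have "(LINT y|lborel. z powr q * (indicator {1<..} y * (y powr q * \<bar>p y - dens y\<bar>))) = z powr q * I2"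
    unfolding I2_def by (rule integral_mult_right_zero)
   finally show ?thesis unfolding eqF .
  qed
  have "psi0 z - \<eta> * z powr (1 + \<beta>) = \<rho> * z\<^sup>2 + (LINT y|\<pi>. kexp (z * y)) - \<eta> * z powr (1 + \<beta>)"
   using z by (simp add: psi0_def)
  moreover have "0 <= \<rho> * z\<^sup>2" "0 <= z\<^sup>2 * mom1" "0 <= z\<^sup>2 * I3" "0 <= z powr q * I1" "0 <= z powr q * I2"
   using rho_nonneg mom1_nonneg I by simp_all
  moreover have "(\<rho> + mom1 + I3) * z\<^sup>2 + (I1 + I2) * z powr q
    = \<rho> * z\<^sup>2 + z\<^sup>2 * mom1 + z\<^sup>2 * I3 + z powr q * I1 + z powr q * I2"
   by (simp add: algebra_simps)
  ultimately show ?thesis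
   using split A B C E F[unfolded abs_le_iff] Gs unfolding abs_le_iff by linarith
 qed
 define C where "C = \<rho> + mom1 + I3 + I1 + I2 + 1"
 show ?thesis
 proof (intro exI[of _ C] conjI allI impI)
  show "0 < C" using I rho_nonneg mom1_nonneg by (simp add: C_def)
  fix z :: real assume "0 <= z"
  show "\<bar>psi0 z - \<eta> * z powr (1 + \<beta>)\<bar> <= C * (z powr (1 + \<beta> + dd) + z\<^sup>2)"
  proof (cases "z = 0")
   case False
   then have "\<bar>psi0 z - \<eta> * z powr (1 + \<beta>)\<bar> <= (\<rho> + mom1 + I3) * z\<^sup>2 + (I1 + I2) * z powr q"
    using \<open>0 <= z\<close> by (intro main) auto
   also have "... <= C * z\<^sup>2 + C * z powr q"
    using I rho_nonneg mom1_nonneg by (intro add_mono mult_right_mono) (auto simp: C_def)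
   finally show ?thesis by (simp add: q_def algebra_simps)
  qed simp
 qed
qed

end

section \<open>The cumulant equation\<close>

text \<open>Mean value theorem; y = 0 is treated apart, since the derivative of the power is taken
  at positive points only.\<close>

lemma powr_diff_le:
 fixes x y p :: real
 assumes "0 <= y" "y <= x" "1 <= p"
 shows "x powr p - y powr p <= p * x powr (p - 1) * (x - y)"
proof (cases "y = 0 \<or> y = x")
 case True
 show ?thesis
 proof (cases "y = x")
  case False
  then have "y = 0" "0 < x" using True assms by auto
  moreover have "x powr p = x powr (p - 1) * x" using \<open>0 < x\<close> powr_add[of x "p - 1" 1] by simp
  moreover have "1 * (x powr (p - 1) * x) <= p * (x powr (p - 1) * x)" using assms by (intro mult_right_mono) auto
  ultimately show ?thesis by (simp add: mult.assoc)
 qed simp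
next
 case False
 then have yx: "0 < y" "y < x" using assms by auto
 have "((%x. x powr p) has_real_derivative p * c powr (p - 1)) (at c)" if "y <= c" for c
  using that yx by (intro has_real_derivative_powr) auto
 then obtain c where c: "y < c" "c < x" "x powr p - y powr p = (x - y) * (p * c powr (p - 1))"
  using MVT2[of y x "%x. x powr p" "%c. p * c powr (p - 1)"] yx by blast
 have "c powr (p - 1) <= x powr (p - 1)" using c yx assms by (intro powr_mono2) auto
 then have "(x - y) * (p * c powr (p - 1)) <= (x - y) * (p * x powr (p - 1))"
  using yx assms by (intro mult_left_mono) auto
 then show ?thesis using c(3) by (simp add: mult_ac)
qed

context ou
begin

lemma duh_tendsto:
 fixes g :: "nat => real => 'a::euclidean_space => real"
 assumes g[measurable]: "!!k. case_prod (g k) : Bm (borel \<Otimes>\<^sub>M borel)"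
  and h[measurable]: "case_prod h : Bm (borel \<Otimes>\<^sub>M borel)"
  and gb: "!!k r y. 0 <= r ==> r <= t ==> \<bar>g k r y\<bar> <= C * wt n y"
  and lim: "!!r y. 0 <= r ==> r <= t ==> (%k. g k r y) ----> h r y"
 shows "(%k. D a t (g k) x) ----> D a t h x"
proof -
 let ?K = "exp (\<bar>a\<bar> * t) * (C * growth_const TYPE('a) n * wt n x)"
 have inner: "(%k. OU_P \<sigma> b s (g k (t - s)) x) ----> OU_P \<sigma> b s (h (t - s)) x" if s: "s : {0..t}" for s
  unfolding OU_P_eq
 proof (rule integral_dominated_convergence)
  show "integrable std_gauss (%z. C * wt n (exp (- b * s) *\<^sub>R x + sd s *\<^sub>R z))"
   by (intro integrable_mult_right integrable_OU[where C=1 and n=n]) auto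
 qed (use s gb lim in auto)
 have "(%k. \<integral>s. indicator {0..t} s *\<^sub>R (exp (a * s) * OU_P \<sigma> b s (g k (t - s)) x) \<partial>lborel)
   ----> (LINT s|lborel. indicator {0..t} s *\<^sub>R (exp (a * s) * OU_P \<sigma> b s (h (t - s)) x))"
 proof (rule integral_dominated_convergence)
  show "integrable lborel (%s. indicator {0..t} s *\<^sub>R ?K)"
   by (auto simp: emeasure_lborel_Icc_eq intro!: integrable_mult_left integrable_real_indicator)
  show "AE s in lborel. (%k. indicator {0..t} s *\<^sub>R (exp (a * s) * OU_P \<sigma> b s (g k (t - s)) x))
    ----> indicator {0..t} s *\<^sub>R (exp (a * s) * OU_P \<sigma> b s (h (t - s)) x)"
   by (rule AE_I2) (auto simp: indicator_def intro!: tendsto_mult_left inner)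
  show "AE s in lborel. norm (indicator {0..t} s *\<^sub>R (exp (a * s) * OU_P \<sigma> b s (g k (t - s)) x))
    <= indicator {0..t} s *\<^sub>R ?K" for k
   using duh_integrand_bound[OF g gb, where a=a] by (intro AE_I2) (auto simp: indicator_def)
 qed measurable
 then show ?thesis by (simp add: duh_def set_lebesgue_integral_def)
qed

text \<open>n-fold insertion of the inequality into itself yields C (M t)^n / n!, a term of a
  convergent series, hence 0 in the limit. The rate may have any sign.\<close>

lemma gronwall_duh:
 fixes d :: "real => 'a::euclidean_space => real"
 assumes [measurable]: "case_prod d : Bm (borel \<Otimes>\<^sub>M borel)"
  and d0: "!!r y. 0 <= r ==> r <= T ==> 0 <= d r y"
  and dC: "!!r y. 0 <= r ==> r <= T ==> d r y <= C" and L: "0 <= L"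
  and le: "!!t x. 0 <= t ==> t <= T ==> d t x <= D a t (%r y. L * d r y) x"
  and t: "0 <= t" "t <= T"
 shows "d t x = 0"
proof -
 define M where "M = exp (\<bar>a\<bar> * T) * L"
 have C: "0 <= C" using d0[of t x] dC[of t x] t by linarith
 have M: "0 <= M" using L by (simp add: M_def)
 have ind: "d t x <= C * M ^ n / fact n * t ^ n" if "0 <= t" "t <= T" for n t x
  using that
 proof (induction n arbitrary: t x)
  case 0
  then show ?case using dC by simp
 next
  case (Suc n)
  let ?c = "L * (C * M ^ n / fact n)"
  have c0: "0 <= C * M ^ n / fact n" using C M by simp
  have "d t x <= D a t (%r y. L * d r y) x" by (rule le) (use Suc.prems in auto)
  also have "... <= \<bar>D a t (%r y. L * d r y) x\<bar>" by simp
  also have "... <= exp (\<bar>a\<bar> * t) * ?c * (t ^ Suc n / real (Suc n))"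
  proof (rule duh_le_power)
   fix r y assume r: "0 <= r" "r <= t"
   have "\<bar>L * d r y\<bar> = L * d r y" using L d0[of r y] r Suc.prems by simp
   also have "... <= L * (C * M ^ n / fact n * r ^ n)"
    using L Suc.IH[of r y] r Suc.prems by (intro mult_left_mono) auto
   finally show "\<bar>L * d r y\<bar> <= ?c * r ^ n" by (simp add: mult.assoc)
  qed (use Suc.prems in measurable)
  also have "... = (exp (\<bar>a\<bar> * t) * L) * ((C * M ^ n / fact n) * (t ^ Suc n / real (Suc n)))"
   by (simp only: mult.assoc)
  also have "... <= M * ((C * M ^ n / fact n) * (t ^ Suc n / real (Suc n)))"
   using Suc.prems c0 L unfolding M_def
   by (intro mult_right_mono mult_nonneg_nonneg) (auto intro!: mult_left_mono divide_nonneg_nonneg)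
  also have "... = C * M ^ Suc n / fact (Suc n) * t ^ Suc n"
   by (simp add: field_simps del: of_nat_Suc)
  finally show ?case .
 qed
 have lim: "(%n. C * (M * t) ^ n / fact n) ----> 0"
 proof -
  have "(%n. (M * t) ^ n /\<^sub>R fact n) ----> 0"
   by (rule summable_LIMSEQ_zero[OF summable_exp_generic])
  then have "(%n. C * ((M * t) ^ n /\<^sub>R fact n)) ----> 0" by (rule tendsto_mult_right_zero)
  then show ?thesis by (simp add: divide_inverse mult_ac)
 qed
 have "d t x <= 0"
 proof (rule LIMSEQ_le_const[OF lim], intro exI allI impI)
  fix n
  show "d t x <= C * (M * t) ^ n / fact n" using ind[OF t, of x n] by (simp add: power_mult_distrib)
 qed
 then show ?thesis using d0[of t x] t by linarith
qed

end

locale super_ou = ou \<sigma> b + stable_branching \<alpha> \<rho> \<pi> \<eta> \<beta> \<delta>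
 for \<sigma> b \<alpha> \<rho> :: real and \<pi> :: "real measure" and \<eta> \<beta> \<delta> :: real
begin

abbreviation "Pa \<equiv> OU_Pa \<alpha> \<sigma> b"
abbreviation "V \<equiv> cumV \<alpha> \<rho> \<pi> \<sigma> b"

lemma Pa_eq: "Pa t f x = exp (\<alpha> * t) *\<^sub>R OU_P \<sigma> b t f x"
 by (simp add: OU_Pa_def)

definition admissible :: "('a::euclidean_space => real) => bool" where
 "admissible f \<longleftrightarrow> f : Bm borel & bounded (range f) & (\<forall>x. 0 <= f x)"

lemma admissibleD:
 assumes "admissible f"
 obtains B where "f : Bm borel" "0 <= B" "!!x. 0 <= f x" "!!x. f x <= B" "!!x. \<bar>f x\<bar> <= B"
proof -
 obtain B where B: "\<forall>x\<in>range f. norm x <= B" using assms by (auto simp: admissible_def bounded_iff)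
 have "\<bar>f x\<bar> <= B" for x using B by auto
 moreover from this[of 0] have "0 <= B" by linarith
 moreover have "f x <= B" for x using calculation(1)[of x] by linarith
 ultimately show ?thesis using assms that[of B] by (auto simp: admissible_def)
qed

lemma psi0_bound_Icc: "u <= B ==> \<bar>psi0 u\<bar> <= psi0 B"
 using psi0_mono[of u B] by simp

text \<open>The mild equation with the linear growth absorbed into the semigroup.\<close>

definition mild :: "('a::euclidean_space => real) => (real => 'a => real) => bool" where
 "mild f v \<longleftrightarrow> case_prod v : Bm (borel \<Otimes>\<^sub>M borel) & (\<forall>t x. 0 <= v t x) &
   (\<forall>T\<ge>0. \<exists>C. \<forall>t\<in>{0..T}. \<forall>x. v t x <= C) &
   (\<forall>t\<ge>0. \<forall>x. v t x = Pa t f x - D \<alpha> t (%r y. psi0 (v r y)) x)"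

lemma duh_minus:
 fixes g :: "real => 'a::euclidean_space => real"
 shows "D a t (%r y. - g r y) x = - D a t g x"
 unfolding duh_def OU_P_eq by (simp add: set_lebesgue_integral_def)

section \<open>The cumulant equation in mild form: uniqueness and existence\<close>

text \<open>The defining equation has rate 0 and the full mechanism psi; \<open>change_rate\<close>
  moves the linear term -alpha z into the factor exp(alpha t), and back. Vanishing at negative times
  supplies the sign condition there.\<close>

lemma sol_iff_mild:
 fixes f :: "'a::euclidean_space => real"
 assumes f: "admissible f" and neg: "!!t x. t < 0 ==> v t x = 0"
 shows "is_cumulant_sol \<alpha> \<rho> \<pi> \<sigma> b f v \<longleftrightarrow> mild f v"
proof -
 obtain B where B: "f : Bm borel" "0 <= B" "!!x. 0 <= f x" "!!x. f x <= B" "!!x. \<bar>f x\<bar> <= B"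
  using admissibleD[OF f] by blast
 note [measurable] = B(1)
 define g where "g r y = \<alpha> * v r y - psi0 (v r y)" for r y
 have pre: "is_cumulant_sol \<alpha> \<rho> \<pi> \<sigma> b f v \<longleftrightarrow>
   case_prod v : Bm (borel \<Otimes>\<^sub>M borel) & (\<forall>t x. 0 <= v t x) &
   (\<forall>T\<ge>0. \<exists>C. \<forall>t\<in>{0..T}. \<forall>x. v t x <= C) &
   (\<forall>t\<ge>0. \<forall>x. v t x = exp (0 * t) * OU_P \<sigma> b t f x + D 0 t g x)"
 proof -
  have nn: "(\<forall>t\<ge>0. \<forall>x. 0 <= v t x) \<longleftrightarrow> (\<forall>t x. 0 <= v t x)"
  proof (intro iffI allI impI)
   fix t x assume "\<forall>t\<ge>0. \<forall>x. 0 <= v t x"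
   then show "0 <= v t x" using neg[of t x] by (cases "t < 0") auto
  qed auto
  have eq: "(LINT s:{0..t}|lborel. OU_P \<sigma> b s (%y. psi \<alpha> \<rho> \<pi> (v (t - s) y)) x) = - D 0 t g x"
   if "\<forall>t x. 0 <= v t x" for t x
  proof -
   have "psi \<alpha> \<rho> \<pi> (v r y) = - g r y" for r y using that by (simp add: psi_eq g_def)
   then show ?thesis by (simp add: duh_minus[symmetric] duh_def[of _ _ _ _ "%r y. - g r y"])
  qed
  have bd: "(\<forall>T\<ge>0. \<exists>C. \<forall>t\<in>{0..T}. \<forall>x. \<bar>v t x\<bar> <= C) \<longleftrightarrow> (\<forall>T\<ge>0. \<exists>C. \<forall>t\<in>{0..T}. \<forall>x. v t x <= C)"
   if "\<forall>t x. 0 <= v t x" using that by simp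
  show ?thesis
  proof (cases "\<forall>t x. 0 <= v t x")
   case True
   have e: "v t x + (LINT s:{0..t}|lborel. OU_P \<sigma> b s (%y. psi \<alpha> \<rho> \<pi> (v (t - s) y)) x) = OU_P \<sigma> b t f x
     \<longleftrightarrow> v t x = exp (0 * t) * OU_P \<sigma> b t f x + D 0 t g x" for t x
    unfolding eq[OF True] by auto
   show ?thesis unfolding is_cumulant_sol_def borel_prod nn e bd[OF True] ..
  next
   case False
   then show ?thesis unfolding is_cumulant_sol_def nn by blast
  qed
 qed
 have main: "(\<forall>t\<ge>0. \<forall>x. v t x = exp (0 * t) * OU_P \<sigma> b t f x + D 0 t g x)
   \<longleftrightarrow> (\<forall>t\<ge>0. \<forall>x. v t x = Pa t f x - D \<alpha> t (%r y. psi0 (v r y)) x)"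
  if [measurable]: "case_prod v : Bm (borel \<Otimes>\<^sub>M borel)" and v0: "\<forall>t x. 0 <= v t x"
   and vb: "\<forall>T\<ge>0. \<exists>C. \<forall>t\<in>{0..T}. \<forall>x. v t x <= C"
 proof
  assume H: "\<forall>t\<ge>0. \<forall>x. v t x = exp (0 * t) * OU_P \<sigma> b t f x + D 0 t g x"
  show "\<forall>t\<ge>0. \<forall>x. v t x = Pa t f x - D \<alpha> t (%r y. psi0 (v r y)) x"
  proof (intro allI impI)
   fix T :: real and x assume T: "0 <= T"
   obtain C where C: "!!t x. t : {0..T} ==> v t x <= C" using vb T by blast
   have "v T x = exp (\<alpha> * T) * OU_P \<sigma> b T f x + D \<alpha> T (%r y. g r y + (0 - \<alpha>) * v r y) x"
   proof (rule change_rate[where a=0 and B=B and C="\<alpha> * C + psi0 C" and E=C])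
    fix r y assume r: "0 <= r" "r <= T"
    show "\<bar>g r y\<bar> <= \<alpha> * C + psi0 C"
    proof -
     have "v r y <= C" using C[of r y] r by simp
     then have 1: "0 <= \<alpha> * v r y" "\<alpha> * v r y <= \<alpha> * C" "psi0 (v r y) <= psi0 C"
      using v0 alpha_pos by (auto intro: psi0_mono)
     then show ?thesis unfolding g_def using psi0_nonneg[of "v r y"] psi0_nonneg[of C] by linarith
    qed
   next
    fix r y assume r: "0 <= r" "r <= T"
    show "\<bar>v r y\<bar> <= C" using C[of r y] v0 r by simp
    show "v r y = exp (0 * r) * OU_P \<sigma> b r f y + D 0 r g y" using H r(1) by blast
   qed (use T B in \<open>auto simp: g_def\<close>)
   then show "v T x = Pa T f x - D \<alpha> T (%r y. psi0 (v r y)) x"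
    by (simp add: g_def Pa_eq duh_minus)
  qed
 next
  assume H: "\<forall>t\<ge>0. \<forall>x. v t x = Pa t f x - D \<alpha> t (%r y. psi0 (v r y)) x"
  show "\<forall>t\<ge>0. \<forall>x. v t x = exp (0 * t) * OU_P \<sigma> b t f x + D 0 t g x"
  proof (intro allI impI)
   fix T :: real and x assume T: "0 <= T"
   obtain C where C: "!!t x. t : {0..T} ==> v t x <= C" using vb T by blast
   have "v T x = exp (0 * T) * OU_P \<sigma> b T f x + D 0 T (%r y. - psi0 (v r y) + (\<alpha> - 0) * v r y) x"
   proof (rule change_rate[where a=\<alpha> and B=B and C="psi0 C" and E=C])
    fix t y assume "0 <= t" "t <= T"
    then show "v t y = exp (\<alpha> * t) * OU_P \<sigma> b t f y + D \<alpha> t (%r y. - psi0 (v r y)) y"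
     using H by (simp add: Pa_eq duh_minus)
   qed (use C v0 T B psi0_bound_Icc in auto)
   then show "v T x = exp (0 * T) * OU_P \<sigma> b T f x + D 0 T g x"
    by (simp add: g_def[abs_def])
  qed
 qed
 show ?thesis unfolding pre mild_def using main by blast
qed

text \<open>The difference satisfies a Gronwall inequality, because both solutions are bounded on
  [0, t] by a common C, below which \<open>psi0\<close> is Lipschitz.\<close>

lemma mild_unique:
 fixes f :: "'a::euclidean_space => real"
 assumes v: "mild f v" and w: "mild f w" and t: "0 <= t"
 shows "v t x = w t x"
proof -
 have [measurable]: "case_prod v : Bm (borel \<Otimes>\<^sub>M borel)"
  "case_prod w : Bm (borel \<Otimes>\<^sub>M borel)"
  using v w by (auto simp: mild_def)
 obtain C1 C2 where C12: "!!r y. r : {0..t} ==> v r y <= C1" "!!r y. r : {0..t} ==> w r y <= C2"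
  using v w t unfolding mild_def by meson
 define C where "C = max C1 C2"
 have C: "v r y <= C" "w r y <= C" if "r : {0..t}" for r y
  using C12[OF that, of y] by (auto simp: C_def)
 have nn: "0 <= v r y" "0 <= w r y" for r y using v w by (auto simp: mild_def)
 have C0: "0 <= C" using C(1)[of t x] nn(1)[of t x] t by auto
 have "\<bar>v t x - w t x\<bar> = 0"
 proof (rule gronwall_duh[where d="%t x. \<bar>v t x - w t x\<bar>" and T=t and C=C and L="lip C" and a=\<alpha>])
  fix r y assume r: "0 <= r" "r <= t"
  show "\<bar>v r y - w r y\<bar> <= C" using C[of r y] nn[of r y] r by (auto simp: abs_le_iff)
  have bd: "\<bar>psi0 u\<bar> <= psi0 C * wt 0 z" if "u <= C" for u and z :: 'a
  proof -
   have "psi0 C * 1 <= psi0 C * wt 0 z" by (intro mult_left_mono) auto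
   then show ?thesis using psi0_bound_Icc[OF that] by linarith
  qed
  have "v r y - w r y = D \<alpha> r (%q z. psi0 (w q z)) y + (- 1) * D \<alpha> r (%q z. psi0 (v q z)) y"
   using v w r by (simp add: mild_def)
  also have "... = D \<alpha> r (%q z. psi0 (w q z) + (- 1) * psi0 (v q z)) y"
   using bd C r by (intro duh_lincomb[symmetric, where C="psi0 C" and n=0 and E="psi0 C" and m=0]) auto
  finally have eq: "v r y - w r y = D \<alpha> r (%q z. psi0 (w q z) + (- 1) * psi0 (v q z)) y" .
  have lp: "\<bar>psi0 (w q z) + (- 1) * psi0 (v q z)\<bar> <= lip C * \<bar>v q z - w q z\<bar>" if "0 <= q" "q <= r" for q z
   using psi0_lipschitz[of "v q z" C "w q z"] C[of q z] C0 that r by (auto simp: abs_minus_commute)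
  have lb: "\<bar>lip C * \<bar>v q z - w q z\<bar>\<bar> <= (lip C * C) * wt 0 z" if "0 <= q" "q <= r" for q z
  proof -
   have "\<bar>v q z - w q z\<bar> <= C" using C[of q z] nn[of q z] that r by (auto simp: abs_le_iff)
   then have "lip C * \<bar>v q z - w q z\<bar> <= lip C * C" using lip_nonneg[OF C0] by (rule mult_left_mono)
   moreover have "0 <= lip C * \<bar>v q z - w q z\<bar>" "0 <= lip C * C" using lip_nonneg[OF C0] C0 by auto
   ultimately show ?thesis by (simp add: wt_def)
  qed
  have "D \<alpha> r (%q z. psi0 (w q z) + (- 1) * psi0 (v q z)) y <= D \<alpha> r (%q z. lip C * \<bar>v q z - w q z\<bar>) y"
  proof (rule duh_mono[where C="lip C * C" and n=0 and E="lip C * C" and m=0])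
   fix q z assume q: "0 <= q" "q <= r"
   show "psi0 (w q z) + (- 1) * psi0 (v q z) <= lip C * \<bar>v q z - w q z\<bar>" using lp[OF q, of z] by linarith
   show "\<bar>psi0 (w q z) + (- 1) * psi0 (v q z)\<bar> <= lip C * C * wt 0 z"
    using lp[OF q, of z] lb[OF q, of z] by linarith
  qed (use lb in auto)
  moreover have "D \<alpha> r (%q z. - (psi0 (w q z) + (- 1) * psi0 (v q z))) y <= D \<alpha> r (%q z. lip C * \<bar>v q z - w q z\<bar>) y"
  proof (rule duh_mono[where C="lip C * C" and n=0 and E="lip C * C" and m=0])
   fix q z assume q: "0 <= q" "q <= r"
   show "- (psi0 (w q z) + (- 1) * psi0 (v q z)) <= lip C * \<bar>v q z - w q z\<bar>" using lp[OF q, of z] by linarith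
   show "\<bar>- (psi0 (w q z) + (- 1) * psi0 (v q z))\<bar> <= lip C * C * wt 0 z"
    using lp[OF q, of z] lb[OF q, of z] by linarith
  qed (use lb in auto)
  ultimately show "\<bar>v r y - w r y\<bar> <= D \<alpha> r (%q z. lip C * \<bar>v q z - w q z\<bar>) y"
   unfolding eq duh_minus by linarith
 qed (use t lip_nonneg[OF C0] in auto)
 then show ?thesis by simp
qed

text \<open>Picard iteration for a modified nonlinearity. Capping the argument of
  \<open>psi0\<close> at B exp(alpha r) makes it globally Lipschitz on each time interval; since the
  limit stays below P^alpha f, hence below the cap, the cap is inactive there. The iterates may
  become negative, so positivity is proved for the limit only. The clause on constants prepares the
  scalar equation.\<close>

lemma mild_exists:
 fixes f :: "'a::euclidean_space => real"
 assumes f: "admissible f"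
 shows "\<exists>v. mild f v & (\<forall>t<0. \<forall>x. v t x = 0) & ((\<forall>x y. f x = f y) --> (\<forall>t x y. v t x = v t y))"
proof -
 obtain B where fm[measurable]: "f : Bm borel" and B0: "0 <= B"
  and f0: "!!x. 0 <= f x" and fB: "!!x. f x <= B" "!!x. \<bar>f x\<bar> <= B"
  using admissibleD[OF f] by blast
 define Psi where "Psi r z = psi0 (min z (B * exp (\<alpha> * r)))" for r z
 have [measurable]: "case_prod Psi : Bm (borel \<Otimes>\<^sub>M borel)" unfolding Psi_def by measurable
 define it where "it = rec_nat (%t x. 0) (%n w t x. if t < 0 then 0 else Pa t f x - D \<alpha> t (%r y. Psi r (w r y)) x)"
 have it_0: "it 0 t x = 0" for t x by (simp add: it_def)
 have it_Suc: "it (Suc n) t x = (if t < 0 then 0 else Pa t f x - D \<alpha> t (%r y. Psi r (it n r y)) x)" for n t x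
  by (simp add: it_def)
 have [measurable]: "case_prod (it n) : Bm (borel \<Otimes>\<^sub>M borel)" for n
 proof (induction n)
  case (Suc n)
  note [measurable] = Suc
  show ?case unfolding it_Suc[abs_def] Pa_eq by measurable
 qed (simp add: it_def)
 define P where "P T = psi0 (B * exp (\<alpha> * T))" for T
 define L where "L T = lip (B * exp (\<alpha> * T))" for T
 have BT: "0 <= B * exp (\<alpha> * T)" for T using B0 by simp
 have Bmono: "B * exp (\<alpha> * r) <= B * exp (\<alpha> * T)" if "r <= T" for r T
  using B0 alpha_pos that by (intro mult_left_mono) auto
 have Psi0: "0 <= Psi r z" for r z by (simp add: Psi_def)
 have PsiP: "Psi r z <= P T" if "r <= T" for r z T
  unfolding Psi_def P_def using Bmono[OF that] by (intro psi0_mono) auto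
 have PsiP': "\<bar>Psi r z\<bar> <= P T * wt 0 y" if "r <= T" for r z T and y :: 'a
  using PsiP[OF that, of z] Psi0[of r z] by (simp add: wt_def)
 have L0: "0 <= L T" for T unfolding L_def by (rule lip_nonneg[OF BT])
 have PsiL: "\<bar>Psi r z - Psi r w\<bar> <= L T * \<bar>z - w\<bar>" if "r <= T" for r z w T
 proof -
  have "\<bar>Psi r z - Psi r w\<bar> <= L T * \<bar>min z (B * exp (\<alpha> * r)) - min w (B * exp (\<alpha> * r))\<bar>"
   unfolding Psi_def L_def using Bmono[OF that] BT by (intro psi0_lipschitz) auto
  also have "... <= L T * \<bar>z - w\<bar>" by (intro mult_left_mono L0) (auto simp: min_def)
  finally show ?thesis .
 qed
 \<comment> \<open>Successive differences gain a factor M t / (n + 1) each time, as in the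
   exponential series, uniformly on [0, T].\<close>
 have step: "\<exists>C M. 0 <= C & 0 <= M & (\<forall>n t x. 0 <= t --> t <= T --> \<bar>it (Suc n) t x - it n t x\<bar> <= C * M ^ n / fact n * t ^ n)" if T: "0 <= T" for T
 proof -
  define C where "C = exp (\<alpha> * T) * B + T * (exp (\<bar>\<alpha>\<bar> * T) * (P T * growth_const TYPE('a) 0 * 2))"
  define M where "M = exp (\<alpha> * T) * L T"
  have P0: "0 <= P T" by (simp add: P_def)
  have C: "0 <= C" using P0 B0 T growth_const_ge_1[of "TYPE('a)" 0] unfolding C_def by (intro add_nonneg_nonneg mult_nonneg_nonneg) auto
  have M: "0 <= M" using L0 by (simp add: M_def)
  have "\<bar>it (Suc n) t x - it n t x\<bar> <= C * M ^ n / fact n * t ^ n" if "0 <= t" "t <= T" for n t x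
   using that
  proof (induction n arbitrary: t x)
   case 0
   have "\<bar>D \<alpha> t (%r y. Psi r 0) x\<bar> <= t * (exp (\<bar>\<alpha>\<bar> * t) * (P T * growth_const TYPE('a) 0 * wt 0 x))"
    using 0 PsiP' by (intro duh_abs_le) auto
   also have "... <= T * (exp (\<bar>\<alpha>\<bar> * T) * (P T * growth_const TYPE('a) 0 * 2))"
    using 0 P0 growth_const_ge_1[of "TYPE('a)" 0] by (intro mult_mono) (auto simp: wt_def intro!: mult_left_mono)
   finally have 1: "\<bar>D \<alpha> t (%r y. Psi r 0) x\<bar> <= T * (exp (\<bar>\<alpha>\<bar> * T) * (P T * growth_const TYPE('a) 0 * 2))" .
   have "\<bar>Pa t f x\<bar> <= exp (\<alpha> * T) * B"
    using OU_P_bounded[of f B t x] fB(2) 0 alpha_pos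
    unfolding Pa_eq by (auto simp: abs_mult intro!: mult_mono)
   then show ?case using 1 0 by (simp add: it_Suc it_0 C_def)
  next
   case (Suc n)
   let ?g = "%r y. Psi r (it n r y) + (- 1) * Psi r (it (Suc n) r y)"
   have "it (Suc (Suc n)) t x - it (Suc n) t x
     = D \<alpha> t (%r y. Psi r (it n r y)) x + (- 1) * D \<alpha> t (%r y. Psi r (it (Suc n) r y)) x"
    using Suc.prems by (simp add: it_Suc[of "Suc n"] it_Suc[of n t x])
   also have "... = D \<alpha> t ?g x"
    using PsiP' by (intro duh_lincomb[symmetric, where C="P t" and n=0 and E="P t" and m=0]) auto
   finally have "\<bar>it (Suc (Suc n)) t x - it (Suc n) t x\<bar> = \<bar>D \<alpha> t ?g x\<bar>" by simp
   also have "... <= exp (\<bar>\<alpha>\<bar> * t) * (L T * (C * M ^ n / fact n)) * (t ^ Suc n / real (Suc n))"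
   proof (rule duh_le_power)
    fix r y assume r: "0 <= r" "r <= t"
    have "\<bar>?g r y\<bar> <= L T * \<bar>it (Suc n) r y - it n r y\<bar>"
     using PsiL[of r T "it n r y" "it (Suc n) r y"] r Suc.prems by (simp add: abs_minus_commute)
    also have "... <= L T * (C * M ^ n / fact n * r ^ n)"
     using r Suc.prems by (intro mult_left_mono Suc.IH L0) auto
    finally show "\<bar>?g r y\<bar> <= (L T * (C * M ^ n / fact n)) * r ^ n" by (simp add: mult.assoc)
   qed (use Suc.prems in auto)
   also have "... = (exp (\<bar>\<alpha>\<bar> * t) * L T) * ((C * M ^ n / fact n) * (t ^ Suc n / real (Suc n)))"
    by (simp only: mult.assoc)
   also have "... <= M * ((C * M ^ n / fact n) * (t ^ Suc n / real (Suc n)))"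
   proof (intro mult_right_mono mult_nonneg_nonneg divide_nonneg_nonneg)
    show "exp (\<bar>\<alpha>\<bar> * t) * L T <= M" unfolding M_def using Suc.prems alpha_pos L0 by (intro mult_right_mono) auto
   qed (use C M Suc.prems in auto)
   also have "... = C * M ^ Suc n / fact (Suc n) * t ^ Suc n"
    by (simp add: field_simps del: of_nat_Suc)
   finally show ?case .
  qed
  then show ?thesis using C M by blast
 qed
 define v where "v t x = (if t < 0 then 0 else lim (%n. it n t x))" for t x
 have conv: "(%n. it n t x) ----> v t x" if t: "0 <= t" for t x
 proof -
  obtain C M where CM: "0 <= C" "0 <= M" "!!n. \<bar>it (Suc n) t x - it n t x\<bar> <= C * M ^ n / fact n * t ^ n"
   using step[OF t] t by blast
  have "summable (%n. C * ((M * t) ^ n /\<^sub>R fact n))"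
   by (intro summable_mult summable_exp_generic)
  then have "summable (%n. it (Suc n) t x - it n t x)"
  proof (rule summable_comparison_test'[where N=0])
   fix n show "norm (it (Suc n) t x - it n t x) <= C * ((M * t) ^ n /\<^sub>R fact n)"
    using CM(3)[of n] by (simp add: power_mult_distrib divide_inverse mult_ac)
  qed
  then have "convergent (%n. \<Sum>k<n. it (Suc k) t x - it k t x)"
   by (simp add: summable_iff_convergent)
  then have "convergent (%n. it n t x)" by (simp add: sum_lessThan_telescope[of "%n. it n t x"] it_0)
  then show ?thesis using t by (simp add: v_def convergent_LIMSEQ_iff)
 qed
 have vm[measurable]: "case_prod v : Bm (borel \<Otimes>\<^sub>M borel)"
  unfolding v_def by measurable
 have eq: "v t x = Pa t f x - D \<alpha> t (%r y. Psi r (v r y)) x" if t: "0 <= t" for t x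
 proof (rule LIMSEQ_unique)
  show "(%n. it (Suc n) t x) ----> v t x" by (rule LIMSEQ_Suc[OF conv[OF t]])
  have "isCont (%z. Psi r z) z" for r z
   unfolding Psi_def by (intro isCont_o2[OF _ isCont_psi0] continuous_intros)
  then have "(%n. D \<alpha> t (%r y. Psi r (it n r y)) x) ----> D \<alpha> t (%r y. Psi r (v r y)) x"
   using PsiP' conv by (intro duh_tendsto[where C="P t" and n=0]) (auto intro: isCont_tendsto_compose)
  then show "(%n. it (Suc n) t x) ----> Pa t f x - D \<alpha> t (%r y. Psi r (v r y)) x"
   using t by (simp add: it_Suc tendsto_diff)
 qed
 have vB: "v t x <= B * exp (\<alpha> * t)" for t x
 proof (cases "t < 0")
  case True then show ?thesis using BT by (simp add: v_def)
 next
  case False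
  then have "v t x <= Pa t f x" using eq[of t x] duh_nonneg[of t "%r y. Psi r (v r y)" \<alpha> x] Psi0 by simp
  also have "... <= exp (\<alpha> * t) * B" unfolding Pa_eq using OU_P_bounded[of f B t x] fB(2) by auto
  finally show ?thesis by (simp add: mult.commute)
 qed
 have Psi_v: "Psi r (v r y) = psi0 (v r y)" for r y
  using vB[of r y] by (simp add: Psi_def min_def)
 have vabs: "\<bar>v t x\<bar> <= B * exp (\<alpha> * T) + T * (exp (\<bar>\<alpha>\<bar> * T) * (P T * growth_const TYPE('a) 0 * 2))"
  if t: "0 <= t" "t <= T" for t x T
 proof -
  have P0: "0 <= P T" by (simp add: P_def)
  have "\<bar>D \<alpha> t (%r y. Psi r (v r y)) x\<bar> <= t * (exp (\<bar>\<alpha>\<bar> * t) * (P T * growth_const TYPE('a) 0 * wt 0 x))"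
   using t PsiP' by (intro duh_abs_le) auto
  also have "... <= T * (exp (\<bar>\<alpha>\<bar> * T) * (P T * growth_const TYPE('a) 0 * 2))"
   using t P0 growth_const_ge_1[of "TYPE('a)" 0] by (intro mult_mono) (auto simp: wt_def intro!: mult_left_mono)
  finally have d: "\<bar>D \<alpha> t (%r y. Psi r (v r y)) x\<bar> <= T * (exp (\<bar>\<alpha>\<bar> * T) * (P T * growth_const TYPE('a) 0 * 2))" .
  have "0 <= Pa t f x" unfolding Pa_eq using OU_P_nonneg[of f t x] f0 by simp
  then have "- v t x <= T * (exp (\<bar>\<alpha>\<bar> * T) * (P T * growth_const TYPE('a) 0 * 2))"
   using d eq[OF t(1), of x] by linarith
  moreover have "v t x <= B * exp (\<alpha> * T)" using vB[of t x] Bmono[OF t(2)] by simp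
  moreover have "0 <= T * (exp (\<bar>\<alpha>\<bar> * T) * (P T * growth_const TYPE('a) 0 * 2))"
   using t P0 growth_const_ge_1[of "TYPE('a)" 0] by (intro mult_nonneg_nonneg) auto
  ultimately show ?thesis using BT[of T] unfolding abs_le_iff by linarith
 qed
 \<comment> \<open>With the rate lowered to alpha - L the source becomes L v - psi0(v). This is
   nonnegative where v >= 0, because psi0(v) <= L v, and equals L v where v < 0; so the negative
   part of v satisfies a Gronwall inequality.\<close>
 have v0: "0 <= v T x" for T x
 proof (cases "T < 0")
  case False
  then have T: "0 <= T" by simp
  define E where "E = B * exp (\<alpha> * T) + T * (exp (\<bar>\<alpha>\<bar> * T) * (P T * growth_const TYPE('a) 0 * 2))"
  have vE: "\<bar>v t x\<bar> <= E" if "0 <= t" "t <= T" for t x unfolding E_def by (rule vabs[OF that])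
  have E0: "0 <= E" using vE[of T x] T by auto
  have "max 0 (- v T x) = 0"
  proof (rule gronwall_duh[where T=T and d="%t x. max 0 (- v t x)" and C=E and L="L T" and a="\<alpha> - L T"])
   fix t x assume t: "0 <= t" "t <= T"
   let ?g = "%r y. - Psi r (v r y) + (\<alpha> - (\<alpha> - L T)) * v r y"
   have "v t x = exp ((\<alpha> - L T) * t) * OU_P \<sigma> b t f x + D (\<alpha> - L T) t ?g x"
   proof (rule change_rate[where B=B and C="P T" and E=E])
    fix r y assume "0 <= r" "r <= t"
    then show "v r y = exp (\<alpha> * r) * OU_P \<sigma> b r f y + D \<alpha> r (%r y. - Psi r (v r y)) y"
     using eq[of r y] by (simp add: duh_minus Pa_eq)
   qed (use t vE fB PsiP Psi0 in auto)
   moreover have "0 <= exp ((\<alpha> - L T) * t) * OU_P \<sigma> b t f x"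
    using OU_P_nonneg[of f t x] f0 by simp
   ultimately have lower: "D (\<alpha> - L T) t ?g x <= v t x" by simp
   have nb: "\<bar>L T * max 0 (- v r y)\<bar> <= (L T * E) * wt 0 y" if "0 <= r" "r <= t" for r y
   proof -
    have "L T * max 0 (- v r y) <= L T * E" using vE[of r y] that t E0 L0 by (intro mult_left_mono) auto
    moreover have "0 <= L T * max 0 (- v r y)" "0 <= L T * E" using L0 E0 by auto
    ultimately show ?thesis by (simp add: wt_def)
   qed
   have "D (\<alpha> - L T) t (%r y. - (L T * max 0 (- v r y))) x <= D (\<alpha> - L T) t ?g x"
   proof (rule duh_mono[where C="L T * E" and n=0 and E="P T + L T * E" and m=0])
    fix r y assume r: "0 <= r" "r <= t"
    show "\<bar>- (L T * max 0 (- v r y))\<bar> <= L T * E * wt 0 y" using nb[OF r, of y] by simp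
    have "\<bar>?g r y\<bar> <= Psi r (v r y) + L T * \<bar>v r y\<bar>"
    proof -
     have e: "?g r y = L T * v r y - Psi r (v r y)" by simp
     have "\<bar>L T * v r y\<bar> = L T * \<bar>v r y\<bar>" using L0[of T] by (simp add: abs_mult)
     then show ?thesis unfolding e using Psi0[of r "v r y"] by linarith
    qed
    also have "... <= P T + L T * E"
     using PsiP[of r T] r t vE[of r y] L0 by (intro add_mono mult_left_mono) auto
    also have "... <= (P T + L T * E) * wt 0 y"
    proof -
     have "(P T + L T * E) * 1 <= (P T + L T * E) * wt 0 y"
      using L0 E0 by (intro mult_left_mono add_nonneg_nonneg mult_nonneg_nonneg) (auto simp: P_def)
     then show ?thesis by (simp only: mult_1_right)
    qed
    finally show "\<bar>?g r y\<bar> <= (P T + L T * E) * wt 0 y" .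
    show "- (L T * max 0 (- v r y)) <= ?g r y"
    proof (cases "0 <= v r y")
     case True
     have "Psi r (v r y) <= L T * v r y" unfolding Psi_v L_def
      using vB[of r y] Bmono[of r T] r t True by (intro psi0_le_lip) auto
     moreover have "max 0 (- v r y) = 0" using True by simp
     ultimately show ?thesis by (simp only: mult_zero_right diff_diff_eq2 add_diff_cancel_left')
    next
     case False
     then have "max 0 (- v r y) = - v r y" "Psi r (v r y) = 0" by (auto simp: Psi_v)
     then show ?thesis by (simp only: mult_minus_right minus_minus) simp
    qed
   qed (use vm in measurable)
   then have "- v t x <= D (\<alpha> - L T) t (%r y. L T * max 0 (- v r y)) x"
    using lower by (simp add: duh_minus)
   moreover have "0 <= D (\<alpha> - L T) t (%r y. L T * max 0 (- v r y)) x"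
    using L0 by (intro duh_nonneg) auto
   ultimately show "max 0 (- v t x) <= D (\<alpha> - L T) t (%r y. L T * max 0 (- v r y)) x" by simp
  qed (use T vE E0 L0 in \<open>auto simp: abs_le_iff\<close>)
  then show ?thesis by linarith
 qed (simp add: v_def)
 \<comment> \<open>Every iterate started from a constant function is constant in space.\<close>
 have const: "v t x = v t y" if c: "\<forall>x y. f x = f y" for t x y
 proof -
  have itc: "it n t x = it n t y" for n t x y
  proof (induction n arbitrary: t x y)
   case (Suc n)
   define k l where "k = f 0" and "l r = it n r 0" for r
   have fc: "f z = k" for z unfolding k_def using c by blast
   have ic: "it n r z = l r" for r z unfolding l_def by (rule Suc)
   have "Pa t f x = Pa t f y" unfolding Pa_eq OU_P_eq fc by simp
   moreover have "D \<alpha> t (%r y. Psi r (it n r y)) x = D \<alpha> t (%r y. Psi r (it n r y)) y"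
    unfolding duh_def OU_P_eq ic ..
   ultimately show ?case by (simp add: it_Suc)
  qed (simp add: it_0)
  have "(%n. it n t x) = (%n. it n t y)" by (rule ext, rule itc)
  then show ?thesis unfolding v_def by (simp only:)
 qed
 have bdd: "\<exists>C. \<forall>t\<in>{0..T}. \<forall>x. v t x <= C" if "0 <= T" for T
  using order_trans[OF vB Bmono] by (intro exI[of _ "B * exp (\<alpha> * T)"]) auto
 have "mild f v" unfolding mild_def using vm v0 bdd eq Psi_v by simp
 then show ?thesis using const by (intro exI[of _ v]) (auto simp: v_def)
qed

text \<open>Uniqueness concerns nonnegative times; together with the value 0 prescribed at negative
  times it makes the definite description in \<open>cumV\<close> denote the solution constructed
  above.\<close>

lemma
 fixes f :: "'a::euclidean_space => real"
 assumes f: "admissible f"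
 shows V_mild: "mild f (V f)" and V_neg: "t < 0 ==> V f t x = 0"
  and V_const: "(!!x y. f x = f y) ==> V f t x = V f t y"
proof -
 obtain v where v: "mild f v" "!!t x. t < 0 ==> v t x = 0"
  and c: "(\<forall>x y. f x = f y) ==> \<forall>t x y. v t x = v t y"
  using mild_exists[OF f] by blast
 have "V f = v"
  unfolding cumV_def
 proof (rule the_equality)
  show "is_cumulant_sol \<alpha> \<rho> \<pi> \<sigma> b f v & (\<forall>t<0. \<forall>x. v t x = 0)"
   using v sol_iff_mild[OF f, of v] by blast
  fix w assume w: "is_cumulant_sol \<alpha> \<rho> \<pi> \<sigma> b f w & (\<forall>t<0. \<forall>x. w t x = 0)"
  then have "mild f w" using sol_iff_mild[OF f, of w] by blast
  then have "w t x = v t x" for t x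
   using mild_unique[OF _ v(1), of w t x] v(2)[of t x] w by (cases "t < 0") auto
  then show "w = v" by blast
 qed
 then show "mild f (V f)" "t < 0 ==> V f t x = 0" "(!!x y. f x = f y) ==> V f t x = V f t y"
  using v c by blast+
qed

lemma V_measurable [measurable (raw)]:
 assumes "admissible f" "u : Bm N" "x : Bm N"
 shows "(%\<omega>. V f (u \<omega>) (x \<omega>)) : Bm N"
proof -
 have [measurable]: "case_prod (V f) : Bm (borel \<Otimes>\<^sub>M borel)"
  using V_mild[OF assms(1)] by (simp add: mild_def)
 note [measurable] = assms(2,3)
 show ?thesis by measurable
qed

lemma V_nonneg: "admissible f ==> 0 <= V f t x"
 using V_mild[of f] by (simp add: mild_def)

lemma V_eq: "admissible f ==> 0 <= t ==> V f t x = Pa t f x - D \<alpha> t (%r y. psi0 (V f r y)) x"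
 using V_mild[of f] by (simp add: mild_def)

lemma V_le: "admissible f ==> 0 <= t ==> V f t x <= Pa t f x"
 using V_eq[of f t x] duh_nonneg[of t "%r y. psi0 (V f r y)" \<alpha> x] by simp

subsection \<open>Expansion of the cumulant semigroup at zero\<close>

text \<open>The counterpart of \<open>Z1\<close> for nonnegative functions, without the factor -i
  and for a general time T; the two time variables are related by the reflection s -> T - s.\<close>

definition Zr :: "real => ('a::euclidean_space => real) => 'a => real" where
 "Zr T h = D \<alpha> T (%r y. \<eta> * (Pa r h y) powr (1 + \<beta>))"

text \<open>Two errors compete: \<open>dd\<close> from the expansion of psi at 0, and beta from
  replacing V by its linearization inside the power.\<close>

definition "kap = min dd \<beta>"

lemma kap_pos: "0 < kap"
 using dd_pos beta_pos by (simp add: kap_def)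

lemma Pa_nonneg: "(!!y. 0 <= h y) ==> 0 <= (Pa t h x :: real)"
 unfolding Pa_eq using OU_P_nonneg[of h t x] by simp

lemma Pa_measurable [measurable (raw)]:
 assumes [measurable]: "h : Bm borel" "s : Bm N" "x : Bm N"
 shows "(%\<omega>. Pa (s \<omega>) h (x \<omega>)) : Bm N"
 unfolding Pa_eq by measurable

lemma Pa_norm_le:
 fixes h :: "'a::euclidean_space => 'b::{banach, second_countable_topology}"
 assumes "h : Bm borel" "!!y. norm (h y) <= C * wt n y" "0 <= t" "t <= T"
 shows "norm (Pa t h x) <= exp (\<alpha> * T) * (C * growth_const TYPE('a) n) * wt n x"
proof -
 have "norm (Pa t h x) = exp (\<alpha> * t) * norm (OU_P \<sigma> b t h x)" by (simp add: Pa_eq)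
 also have "... <= exp (\<alpha> * T) * (C * growth_const TYPE('a) n * wt n x)"
 proof (rule mult_mono)
  show "norm (OU_P \<sigma> b t h x) <= C * growth_const TYPE('a) n * wt n x"
   by (rule OU_P_norm_le[OF assms(1-3)])
  show "exp (\<alpha> * t) <= exp (\<alpha> * T)" using assms alpha_pos by simp
 qed auto
 finally show ?thesis by (simp add: mult_ac)
qed

text \<open>V differs from c P^alpha h by O(c^(1 + beta)), so inserting the linear term into psi0
  leaves an error of order c^(1 + beta + kap). The constant K depends on h through the growth bound
  C and n alone, never through its supremum, because it will be applied to the truncations of an
  unbounded function.\<close>

lemma V_expansion:
 fixes C T :: real and n :: nat
 assumes T: "0 < T"
 shows "\<exists>K>0. \<forall>h::'a::euclidean_space => real. admissible h --> (\<forall>x. h x <= C * wt n x) -->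
   (\<forall>c x. 0 <= c --> c <= 1 --> \<bar>c * Pa T h x - V (%y. c * h y) T x - c powr (1 + \<beta>) * Zr T h x\<bar>
    <= K * c powr (1 + \<beta> + kap) * wt (4 * n) x)"
proof -
 obtain C5 where C5: "0 < C5" "!!z. 0 <= z ==> \<bar>psi0 z - \<eta> * z powr (1 + \<beta>)\<bar> <= C5 * (z powr (1 + \<beta> + dd) + z\<^sup>2)"
  using psi0_expansion by blast
 define G where "G = growth_const TYPE('a)"
 have G: "1 <= G k" for k by (simp add: G_def growth_const_ge_1)
 have G0: "0 <= G k" for k using G[of k] by linarith
 \<comment> \<open>Successive bounds: C1 for the growth of P^alpha h, C3 for psi0(V), C4 for c
   P^alpha h - V, and C7 for the error of the source; the weights pass from degree n to 2n and then
   to 4n.\<close>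
 define C1 where "C1 = max 1 (exp (\<alpha> * T) * (C * G n))"
 define C3 where "C3 = (\<eta> + 2 * C5) * (2 * C1\<^sup>2)"
 define C4 where "C4 = T * (exp (\<bar>\<alpha>\<bar> * T) * (C3 * G (2 * n)))"
 define C7 where "C7 = 8 * C5 * C1\<^sup>2 + 8 * \<eta> * C1 * C4"
 define K where "K = T * (exp (\<bar>\<alpha>\<bar> * T) * (C7 * G (4 * n))) + 1"
 have pos: "1 <= C1" "0 <= C3" "0 <= C4" "0 <= C7" "0 < K"
  using G0 C5 eta_pos T by (auto simp: C1_def C3_def C4_def C7_def K_def intro!: add_nonneg_nonneg add_nonneg_pos mult_nonneg_nonneg)
 have main: "\<bar>c * Pa T h x - V (%y. c * h y) T x - c powr (1 + \<beta>) * Zr T h x\<bar>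
    <= K * c powr (1 + \<beta> + kap) * wt (4 * n) x"
  if h: "admissible h" and hC: "!!x. h x <= C * wt n x" and c: "0 <= c" "c <= 1"
  for h :: "'a => real" and c x
 proof -
  obtain B where hm[measurable]: "h : Bm borel" and B0: "0 <= B"
   and h0: "!!x. 0 <= h x" and "!!x. h x <= B" and B: "!!x. \<bar>h x\<bar> <= B"
   by (rule admissibleD[OF h]) blast
  define hc where "hc y = c * h y" for y
  have hcm[measurable]: "hc : Bm borel" unfolding hc_def[abs_def] by measurable
  have hcB: "\<bar>hc y\<bar> <= B" for y
  proof -
   have "c * \<bar>h y\<bar> <= 1 * B" by (rule mult_mono) (use B B0 c in auto)
   then show ?thesis using c by (simp add: hc_def abs_mult)
  qed
  have hc: "admissible hc"
   unfolding admissible_def bounded_iff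
  proof (intro conjI allI exI[of _ B] ballI)
   show "0 <= hc x" for x using h0[of x] c by (simp add: hc_def)
  qed (use hcB hcm in auto)
  define u v where "u r y = Pa r h y" and "v r y = V hc r y" for r y
  have Phc: "Pa r hc y = c * u r y" for r y
   by (simp add: Pa_eq OU_P_eq hc_def u_def)
  have [measurable]: "case_prod u : Bm (borel \<Otimes>\<^sub>M borel)" "case_prod v : Bm (borel \<Otimes>\<^sub>M borel)"
   unfolding u_def v_def using hc by measurable
  have u0: "0 <= u r y" for r y unfolding u_def by (rule Pa_nonneg[OF h0])
  have v0: "0 <= v r y" for r y unfolding v_def by (rule V_nonneg[OF hc])
  have uC: "u r y <= C1 * wt n y" if r: "0 <= r" "r <= T" for r y
  proof -
   have "\<bar>u r y\<bar> <= exp (\<alpha> * T) * (C * G n) * wt n y"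
    unfolding u_def G_def using Pa_norm_le[OF hm, of C n r T y] hC h0 r by simp
   also have "... <= C1 * wt n y" unfolding C1_def by (intro mult_right_mono) auto
   finally show ?thesis by simp
  qed
  have vu: "v r y <= c * u r y" if r: "0 <= r" for r y
   unfolding v_def Phc[symmetric] by (rule V_le[OF hc r])
  have pw: "(c * u r y) powr p <= c powr p * (2 * C1\<^sup>2 * wt (2 * n) y)" if "0 <= r" "r <= T" "1 <= p" "p <= 2" for r y p
  proof -
   have "u r y powr p <= 2 * C1\<^sup>2 * wt (2 * n) y"
    by (rule wt_powr[OF that(3,4) pos(1) u0 uC[OF that(1,2)]])
   then have "c powr p * u r y powr p <= c powr p * (2 * C1\<^sup>2 * wt (2 * n) y)"
    by (rule mult_left_mono) simp
   then show ?thesis by (simp only: powr_mult)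
  qed
  have cp: "c powr p <= c powr q" if "q <= p" for p q using c that by (intro powr_mono') auto
  have b2: "1 <= 1 + \<beta>" "1 + \<beta> <= 2" "1 <= 1 + \<beta> + dd" "1 + \<beta> + dd <= 2" "1 + \<beta> + kap <= 1 + \<beta> + dd"
   "1 + \<beta> + kap <= 2" "1 + \<beta> + kap <= 1 + 2 * \<beta>"
   using beta_pos beta_lt_1 dd_pos dd_le by (auto simp: kap_def)
  have c2: "(c * w)\<^sup>2 = (c * w) powr 2" if "0 <= w" for w using c that by (simp add: powr_numeral)
  have psiv: "psi0 (v r y) <= c powr (1 + \<beta>) * (C3 * wt (2 * n) y)" if r: "0 <= r" "r <= T" for r y
  proof -
   let ?W = "2 * C1\<^sup>2 * wt (2 * n) y"
   have W: "0 <= ?W" by simp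
   have "psi0 (v r y) <= psi0 (c * u r y)" by (rule psi0_mono[OF vu[OF r(1)]])
   also have "... <= \<eta> * (c * u r y) powr (1 + \<beta>) + C5 * ((c * u r y) powr (1 + \<beta> + dd) + (c * u r y)\<^sup>2)"
    using C5(2)[of "c * u r y"] c u0[of r y] by (simp add: abs_le_iff)
   also have "... <= \<eta> * (c powr (1 + \<beta>) * ?W) + C5 * (c powr (1 + \<beta>) * ?W + c powr (1 + \<beta>) * ?W)"
   proof (intro add_mono mult_left_mono)
    show "(c * u r y) powr (1 + \<beta>) <= c powr (1 + \<beta>) * ?W" using r b2 by (intro pw) auto
    have "(c * u r y) powr (1 + \<beta> + dd) <= c powr (1 + \<beta> + dd) * ?W" using r b2 by (intro pw) auto
    also have "... <= c powr (1 + \<beta>) * ?W" using dd_pos by (intro mult_right_mono cp W) auto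
    finally show "(c * u r y) powr (1 + \<beta> + dd) <= c powr (1 + \<beta>) * ?W" .
    have "(c * u r y)\<^sup>2 <= c powr 2 * ?W" unfolding c2[OF u0] using r by (intro pw) auto
    also have "... <= c powr (1 + \<beta>) * ?W" using b2 by (intro mult_right_mono cp W) auto
    finally show "(c * u r y)\<^sup>2 <= c powr (1 + \<beta>) * ?W" .
   qed (use eta_pos C5 in auto)
   also have "... = c powr (1 + \<beta>) * (C3 * wt (2 * n) y)" by (simp add: C3_def algebra_simps)
   finally show ?thesis .
  qed
  have dif: "c * u r y - v r y = D \<alpha> r (%q z. psi0 (v q z)) y" if "0 <= r" for r y
   using V_eq[OF hc that, of y] by (simp add: Phc v_def)
  have uv: "c * u r y - v r y <= c powr (1 + \<beta>) * (C4 * wt (2 * n) y)" if r: "0 <= r" "r <= T" for r y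
  proof -
   have "\<bar>D \<alpha> r (%q z. psi0 (v q z)) y\<bar>
     <= r * (exp (\<bar>\<alpha>\<bar> * r) * ((c powr (1 + \<beta>) * C3) * growth_const TYPE('a) (2 * n) * wt (2 * n) y))"
    using psiv r by (intro duh_abs_le) (auto simp: mult.assoc)
   also have "... <= T * (exp (\<bar>\<alpha>\<bar> * T) * ((c powr (1 + \<beta>) * C3) * growth_const TYPE('a) (2 * n) * wt (2 * n) y))"
    using r pos G0[of "2 * n"] unfolding G_def
    by (intro mult_mono) (auto intro!: mult_left_mono mult_nonneg_nonneg)
   finally show ?thesis unfolding dif[OF r(1)] C4_def G_def by (simp add: mult_ac)
  qed
  have wt24: "wt (2 * n) y <= 2 * wt (4 * n) y" for y :: 'a by (rule wt_mono) simp
  have wtp: "wt n y * wt (2 * n) y <= 4 * wt (4 * n) y" for y :: 'a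
  proof -
   have "wt n y * wt (2 * n) y <= (2 * wt (2 * n) y) * wt (2 * n) y"
    by (intro mult_right_mono wt_mono) auto
   also have "... = 2 * (wt (2 * n) y)\<^sup>2" by (simp add: power2_eq_square)
   also have "... <= 2 * (2 * wt (2 * (2 * n)) y)" by (intro mult_left_mono wt_square) auto
   finally show ?thesis by simp
  qed
  \<comment> \<open>The error of the source: the actual nonlinearity minus its leading term
    evaluated at the linearization.\<close>
  let ?d = "%r y. psi0 (v r y) + (- (c powr (1 + \<beta>))) * (\<eta> * (u r y) powr (1 + \<beta>))"
  have dd_le: "\<bar>?d r y\<bar> <= (c powr (1 + \<beta> + kap) * C7) * wt (4 * n) y" if r: "0 <= r" "r <= T" for r y
  proof -
   let ?W = "2 * C1\<^sup>2 * wt (2 * n) y"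
   have W: "0 <= ?W" by simp
   let ?ck = "c powr (1 + \<beta> + kap)"
   have vle: "v r y powr p <= c powr p * ?W" if "1 <= p" "p <= 2" for p
    using powr_mono2[of p "v r y" "c * u r y"] vu[OF r(1), of y] v0[of r y] that pw[OF r that, of y] by linarith
   have "v r y powr (1 + \<beta> + dd) <= ?ck * ?W"
    using vle[of "1 + \<beta> + dd"] mult_right_mono[OF cp[OF b2(5)] W] b2 by linarith
   moreover have "(v r y)\<^sup>2 <= ?ck * ?W"
    using vle[of 2] mult_right_mono[OF cp[OF b2(6)] W] v0[of r y] by (simp add: powr_numeral)
   ultimately have "\<bar>psi0 (v r y) - \<eta> * v r y powr (1 + \<beta>)\<bar> <= C5 * (?ck * ?W + ?ck * ?W)"
    using C5(1) by (intro order_trans[OF C5(2)[OF v0]] mult_left_mono add_mono) auto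
   also have "... = ?ck * (4 * C5 * C1\<^sup>2) * wt (2 * n) y" by (simp add: algebra_simps)
   also have "... <= ?ck * (4 * C5 * C1\<^sup>2) * (2 * wt (4 * n) y)" using C5(1) by (intro mult_left_mono wt24) auto
   finally have 1: "\<bar>psi0 (v r y) - \<eta> * v r y powr (1 + \<beta>)\<bar> <= ?ck * (8 * C5 * C1\<^sup>2) * wt (4 * n) y" by (simp add: mult_ac)
   have ub: "u r y powr \<beta> <= C1 * wt n y"
   proof -
    have "1 <= C1 * wt n y" using pos(1) mult_mono[of 1 C1 1 "wt n y"] by simp
    have "u r y powr \<beta> <= (C1 * wt n y) powr \<beta>" using uC[OF r, of y] u0[of r y] beta_pos by (intro powr_mono2) auto
    also have "... <= (C1 * wt n y) powr 1" using \<open>1 <= C1 * wt n y\<close> beta_lt_1 by (intro powr_mono) auto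
    finally show ?thesis using \<open>1 <= C1 * wt n y\<close> by simp
   qed
   have "(c * u r y) powr (1 + \<beta>) - v r y powr (1 + \<beta>) <= (1 + \<beta>) * (c * u r y) powr (1 + \<beta> - 1) * (c * u r y - v r y)"
    using v0 vu[OF r(1)] beta_pos by (intro powr_diff_le) auto
   also have "... = (1 + \<beta>) * (c powr \<beta> * u r y powr \<beta>) * (c * u r y - v r y)"
    using c u0[of r y] by (simp add: powr_mult)
   also have "... <= 2 * (c powr \<beta> * (C1 * wt n y)) * (c powr (1 + \<beta>) * (C4 * wt (2 * n) y))"
    using beta_pos beta_lt_1 ub uv[OF r, of y] vu[OF r(1), of y] pos(1)
    by (intro mult_mono) (auto intro!: mult_left_mono mult_nonneg_nonneg)
   also have "... = (c powr \<beta> * c powr (1 + \<beta>)) * (2 * C1 * C4) * (wt n y * wt (2 * n) y)"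
    by (simp add: mult_ac)
   also have "... = c powr (1 + 2 * \<beta>) * (2 * C1 * C4) * (wt n y * wt (2 * n) y)"
   proof -
    have "\<beta> + (1 + \<beta>) = 1 + 2 * \<beta>" by simp
    then have "c powr \<beta> * c powr (1 + \<beta>) = c powr (1 + 2 * \<beta>)" by (simp only: powr_add[symmetric])
    then show ?thesis by (simp only:)
   qed
   also have "... <= ?ck * (2 * C1 * C4) * (4 * wt (4 * n) y)"
    using pos by (intro mult_mono cp b2 wtp) auto
   finally have 2: "(c * u r y) powr (1 + \<beta>) - v r y powr (1 + \<beta>) <= ?ck * (8 * C1 * C4) * wt (4 * n) y"
    by (simp add: mult_ac)
   have 3: "v r y powr (1 + \<beta>) <= (c * u r y) powr (1 + \<beta>)"
    using v0 vu[OF r(1)] beta_pos by (intro powr_mono2) auto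
   have 4: "(c * u r y) powr (1 + \<beta>) = c powr (1 + \<beta>) * u r y powr (1 + \<beta>)"
    using c u0[of r y] by (simp add: powr_mult)
   have "?d r y = (psi0 (v r y) - \<eta> * v r y powr (1 + \<beta>)) - \<eta> * ((c * u r y) powr (1 + \<beta>) - v r y powr (1 + \<beta>))"
    unfolding 4 by (simp add: algebra_simps)
   also have "\<bar>(psi0 (v r y) - \<eta> * v r y powr (1 + \<beta>)) - \<eta> * ((c * u r y) powr (1 + \<beta>) - v r y powr (1 + \<beta>))\<bar>
     <= ?ck * (8 * C5 * C1\<^sup>2) * wt (4 * n) y + \<eta> * (?ck * (8 * C1 * C4) * wt (4 * n) y)"
   proof -
    have "0 <= \<eta> * ((c * u r y) powr (1 + \<beta>) - v r y powr (1 + \<beta>))" using 3 eta_pos by simp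
    moreover have "\<eta> * ((c * u r y) powr (1 + \<beta>) - v r y powr (1 + \<beta>)) <= \<eta> * (?ck * (8 * C1 * C4) * wt (4 * n) y)"
     using 2 eta_pos by (intro mult_left_mono) auto
    ultimately show ?thesis using 1 unfolding abs_le_iff by linarith
   qed
   finally show ?thesis by (simp add: C7_def algebra_simps)
  qed
  have "c * Pa T h x - V hc T x = D \<alpha> T (%q z. psi0 (v q z)) x"
   using dif[of T x] T by (simp add: u_def v_def)
  moreover have "D \<alpha> T ?d x = D \<alpha> T (%q z. psi0 (v q z)) x + (- (c powr (1 + \<beta>))) * D \<alpha> T (%r y. \<eta> * u r y powr (1 + \<beta>)) x"
  proof (rule duh_lincomb[where C="c powr (1 + \<beta>) * C3" and n="2 * n" and E="\<eta> * (2 * C1\<^sup>2)" and m="2 * n"])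
   fix r y assume r: "0 <= r" "r <= T"
   show "\<bar>psi0 (v r y)\<bar> <= c powr (1 + \<beta>) * C3 * wt (2 * n) y" using psiv[OF r, of y] by (simp add: mult.assoc)
   have "u r y powr (1 + \<beta>) <= 2 * C1\<^sup>2 * wt (2 * n) y"
    using wt_powr[of "1 + \<beta>" C1 "u r y" n y] uC[OF r, of y] u0[of r y] b2 pos by simp
   then show "\<bar>\<eta> * u r y powr (1 + \<beta>)\<bar> <= \<eta> * (2 * C1\<^sup>2) * wt (2 * n) y"
    using eta_pos by (simp add: abs_mult mult.assoc)
  qed measurable
  ultimately have "c * Pa T h x - V hc T x - c powr (1 + \<beta>) * Zr T h x = D \<alpha> T ?d x"
   by (simp add: Zr_def u_def[symmetric])
  moreover have "\<bar>D \<alpha> T ?d x\<bar> <= T * (exp (\<bar>\<alpha>\<bar> * T) * ((c powr (1 + \<beta> + kap) * C7) * growth_const TYPE('a) (4 * n) * wt (4 * n) x))"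
   using dd_le T by (intro duh_abs_le) auto
  moreover have "T * (exp (\<bar>\<alpha>\<bar> * T) * ((c powr (1 + \<beta> + kap) * C7) * growth_const TYPE('a) (4 * n) * wt (4 * n) x))
    = (K - 1) * c powr (1 + \<beta> + kap) * wt (4 * n) x"
   by (simp add: K_def G_def mult_ac)
  moreover have "(K - 1) * c powr (1 + \<beta> + kap) * wt (4 * n) x <= K * c powr (1 + \<beta> + kap) * wt (4 * n) x"
   by (intro mult_right_mono) auto
  ultimately show ?thesis unfolding hc_def[abs_def] by simp
 qed
 show ?thesis using main pos(5) by blast
qed

end

section \<open>The scalar equation\<close>

text \<open>After the last time at which u >= l the solution would lie below l, but at that time it
  has the value l and the positive slope F l, a contradiction. Only the sign of F at the single
  level l enters.\<close>

lemma deriv_barrier: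
 fixes u F :: "real => real"
 assumes d: "!!q. q : {s..r} ==> (u has_real_derivative F (u q)) (at q within {s..r})"
  and F: "0 < F l" and s: "l <= u s" and sr: "s <= r"
 shows "l <= u r"
proof (rule ccontr)
 assume "\<not> l <= u r"
 then have r: "u r < l" by simp
 have cont: "continuous_on {s..r} u"
  using d by (intro DERIV_continuous_on) auto
 define S where "S = {q : {s..r}. l <= u q}"
 have "S = {s..r} \<inter> u -` {l..}" by (auto simp: S_def)
 then have "closed S" using continuous_closed_preimage[OF cont] by simp
 moreover have ne: "S ~= {}" "bdd_above S" unfolding S_def using s sr by auto
 ultimately have SS: "Sup S : S" by (intro closed_contains_Sup)
 define q0 where "q0 = Sup S"
 have q0: "s <= q0" "q0 <= r" "l <= u q0" using SS by (auto simp: S_def q0_def)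
 have after: "u q < l" if "q0 < q" "q <= r" for q
  using cSup_upper[of q S] ne that q0 unfolding q0_def S_def by fastforce
 have "q0 < r" using q0 r by (cases "q0 = r") auto
 have lim: "(u \<longlongrightarrow> u q0) (at_right q0)"
 proof -
  have "continuous (at q0 within {s..r}) u" using cont q0 by (simp add: continuous_on_eq_continuous_within)
  then have "(u \<longlongrightarrow> u q0) (at q0 within {q0..r})"
   unfolding continuous_within by (rule tendsto_within_subset) (use q0 in auto)
  then show ?thesis using at_within_Icc_at_right[OF \<open>q0 < r\<close>] by simp
 qed
 have "u q0 <= l"
 proof (rule tendsto_upperbound[OF lim])
  show "\<forall>\<^sub>F q in at_right q0. u q <= l"
   unfolding eventually_at_right_field using after \<open>q0 < r\<close> by (intro exI[of _ r]) force
 qed simp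
 then have "u q0 = l" using q0 by simp
 then obtain e where e: "0 < e" "!!h. 0 < h ==> q0 + h : {s..r} ==> h < e ==> u q0 < u (q0 + h)"
  using has_real_derivative_pos_inc_right[OF d[of q0]] F q0 by auto
 define h where "h = min (e / 2) (r - q0)"
 have "0 < h" "h < e" "q0 + h : {s..r}" using e \<open>q0 < r\<close> q0 by (auto simp: h_def min_def)
 from e(2)[OF this(1,3,2)] after[of "q0 + h"] this \<open>u q0 = l\<close> show False by auto
qed

text \<open>As long as m has not been reached, the barrier at k keeps u in [k, m], where its speed
  is at least c; the mean value theorem then bounds the waiting time by (m - k) / c.\<close>

lemma deriv_reach:
 fixes u F :: "real => real"
 assumes d: "!!q. q : {s..r} ==> (u has_real_derivative F (u q)) (at q within {s..r})"
  and F: "!!z. k <= z ==> z <= m ==> c <= F z" and c: "0 < c" and s: "k <= u s" and km: "k <= m"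
  and r: "s + (m - k) / c <= r"
 shows "m <= u r"
proof (rule ccontr)
 assume "\<not> m <= u r"
 then have ur: "u r < m" by simp
 have "0 <= (m - k) / c" using km c by simp
 then have sr: "s <= r" using r by linarith
 have d': "(u has_real_derivative F (u q)) (at q within {x..y})" if "q : {x..y}" "s <= x" "y <= r" for x y q
  using d[of q] that by (intro has_field_derivative_subset[OF d]) auto
 have bd: "k <= u q & u q <= m" if q: "q : {s..r}" for q
 proof
  show "k <= u q"
  proof (rule deriv_barrier[where s=s and r=q and u=u and F=F])
   show "(u has_real_derivative F (u x)) (at x within {s..q})" if "x : {s..q}" for x
    using d'[OF that] q by auto
  qed (use q F[of k] km c s in auto)
  show "u q <= m"
  proof (rule ccontr)
   assume "\<not> u q <= m"
   have "m <= u r"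
   proof (rule deriv_barrier[where s=q and r=r and u=u and F=F])
    show "(u has_real_derivative F (u x)) (at x within {q..r})" if "x : {q..r}" for x
     using d'[OF that] q by auto
   qed (use q F[of m] km c \<open>\<not> u q <= m\<close> in auto)
   then show False using ur by simp
  qed
 qed
 show False
 proof (cases "s = r")
  case True
  then have "(m - k) / c <= 0" using r by simp
  then show ?thesis using c km s ur True by (simp add: divide_le_0_iff)
 next
  case False
  then have "s < r" using sr by simp
  then obtain x where x: "x : {s<..<r}" "u r - u s = F (u x) * (r - s)"
   using mvt_simple[of s r u "%x. (*) (F (u x))"] d by (auto simp: has_field_derivative_def)
  have "c * (r - s) <= F (u x) * (r - s)" using F[of "u x"] bd[of x] x(1) \<open>s < r\<close> by (intro mult_right_mono) auto
  moreover have "m - k <= c * (r - s)" using r c by (simp add: field_simps)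
  ultimately show False using x(2) ur s by linarith
 qed
qed

section \<open>The flow started from constant functions\<close>

context super_ou
begin

abbreviation "psi' \<equiv> psi \<alpha> \<rho> \<pi>"

text \<open>For a constant initial function V is constant in space and follows the flow w' =
  -psi(w), w(0) = l. The type argument names the space on which the underlying cumulant
  lives.\<close>

definition scal :: "'a::euclidean_space itself => real => real => real" where
 "scal T l t = V (%_::'a. l) t 0"

lemma admissible_const [simp]: "admissible (%_. l) \<longleftrightarrow> 0 <= l"
 by (simp add: admissible_def)

lemma V_eq_scal: "0 <= l ==> V (%_::'a::euclidean_space. l) t x = scal TYPE('a) l t"
 unfolding scal_def by (rule V_const) auto

lemma scal_nonneg: "0 <= l ==> 0 <= scal TYPE('a::euclidean_space) l t"
 unfolding scal_def by (rule V_nonneg) simp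

lemma scal_measurable [measurable]: "0 <= l ==> scal TYPE('a::euclidean_space) l : Bm borel"
 unfolding scal_def by measurable

lemma OU_P_const [simp]: "OU_P \<sigma> b t (%_. l) x = l"
 by (simp add: OU_P_eq)

lemma scal_eq:
 assumes "0 <= l" "0 <= t"
 shows "scal TYPE('a::euclidean_space) l t
  = exp (\<alpha> * t) * l - (LINT s:{0..t}|lborel. exp (\<alpha> * s) * psi0 (scal TYPE('a) l (t - s)))"
 using V_eq[of "%_::'a. l" t 0] assms by (simp add: scal_def[symmetric] V_eq_scal duh_def Pa_eq)

lemma scal_le: "0 <= l ==> 0 <= t ==> scal TYPE('a::euclidean_space) l t <= exp (\<alpha> * t) * l"
 using V_le[of "%_::'a. l" t 0] by (simp add: scal_def Pa_eq)

lemma scal_integral_eq: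
 assumes l: "0 <= l" and t: "0 <= t"
 shows "scal TYPE('a::euclidean_space) l t = l - (LINT r:{0..t}|lborel. psi' (scal TYPE('a) l r))"
proof -
 have "is_cumulant_sol \<alpha> \<rho> \<pi> \<sigma> b (%_::'a. l) (V (%_::'a. l))"
  using l V_mild[of "%_::'a. l"] V_neg[of "%_::'a. l"] by (subst sol_iff_mild) auto
 then have "\<forall>t\<ge>0. \<forall>x. V (%_::'a. l) t x + (LINT s:{0..t}|lborel. OU_P \<sigma> b s (%y. psi' (V (%_::'a. l) (t - s) y)) x)
   = OU_P \<sigma> b t (%_::'a. l) x"
  unfolding is_cumulant_sol_def by blast
 then have "scal TYPE('a) l t + (LINT s:{0..t}|lborel. psi' (scal TYPE('a) l (t - s))) = l"
  using t l by (simp add: V_eq_scal)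
 moreover have "(LINT s:{0..t}|lborel. psi' (scal TYPE('a) l (t - s))) = (LINT r:{0..t}|lborel. psi' (scal TYPE('a) l r))"
  unfolding set_lebesgue_integral_def
  by (subst lborel_integral_real_affine[of "-1" _ t])
    (auto intro!: Bochner_Integration.integral_cong simp: indicator_def)
 ultimately show ?thesis by linarith
qed

lemma continuous_psi: "continuous_on {0..} psi'"
proof -
 have "continuous_on {0..} (%z. psi0 z - \<alpha> * z)"
  by (intro continuous_intros continuous_at_imp_continuous_on ballI isCont_psi0)
 then show ?thesis by (rule continuous_on_cong[THEN iffD1, rotated -1]) (auto simp: psi_eq)
qed

text \<open>The integral equation gives continuity of the flow first; continuity of psi then makes
  the integral differentiable.\<close>

lemma scal_deriv:
 assumes l: "0 <= l" and t: "t : {0..T}"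
 shows "(scal TYPE('a::euclidean_space) l has_real_derivative - psi' (scal TYPE('a) l t)) (at t within {0..T})"
proof -
 let ?w = "scal TYPE('a) l"
 have pw: "psi' (?w r) = psi0 (?w r) - \<alpha> * ?w r" for r using scal_nonneg[OF l] by (intro psi_eq)
 have [measurable]: "?w : Bm borel" by (rule scal_measurable[OF l])
 define C where "C = exp (\<alpha> * T) * l"
 have wC: "?w r <= C" if "r : {0..T}" for r
 proof -
  have "exp (\<alpha> * r) * l <= C" unfolding C_def using that l alpha_pos by (intro mult_right_mono) auto
  then show ?thesis using scal_le[OF l, of r, where 'a='a] that by auto
 qed
 have bd: "\<bar>psi' (?w r)\<bar> <= psi0 C + \<alpha> * C" if "r : {0..T}" for r
 proof -
  have "0 <= psi0 (?w r)" "psi0 (?w r) <= psi0 C" "0 <= \<alpha> * ?w r" "\<alpha> * ?w r <= \<alpha> * C"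
   using wC[OF that] scal_nonneg[OF l, of r, where 'a='a] alpha_pos by (auto intro: psi0_mono)
  then show ?thesis unfolding pw by linarith
 qed
 have int: "set_integrable lborel {0..T} (%r. psi' (?w r))"
 proof (rule set_integrable_bounded_Icc)
  show "(%r. psi' (?w r)) : Bm borel" unfolding pw by measurable
 qed (use bd in auto)
 have eqI: "?w q = l - integral {0..q} (%r. psi' (?w r))" if "q : {0..T}" for q
 proof -
  have "set_integrable lborel {0..q} (%r. psi' (?w r))"
   using int by (rule set_integrable_subset) (use that in auto)
  then have "(LINT r:{0..q}|lborel. psi' (?w r)) = integral {0..q} (%r. psi' (?w r))"
   by (rule set_borel_integral_eq_integral)
  then show ?thesis using scal_integral_eq[OF l, of q, where 'a='a] that by simp
 qed
 have "(%r. psi' (?w r)) integrable_on {0..T}"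
  using int by (rule set_borel_integral_eq_integral)
 then have "continuous_on {0..T} (%q. l - integral {0..q} (%r. psi' (?w r)))"
  by (intro continuous_intros indefinite_integral_continuous_1)
 then have cw: "continuous_on {0..T} ?w"
  by (rule continuous_on_cong[THEN iffD2, rotated -1]) (auto simp: eqI)
 have "continuous_on {0..T} (%r. psi' (?w r))"
  by (rule continuous_on_compose2[OF continuous_psi cw]) (auto simp: scal_nonneg[OF l])
 then have "((%q. integral {0..q} (%r. psi' (?w r))) has_real_derivative psi' (?w t)) (at t within {0..T})"
  using t by (rule integral_has_real_derivative)
 then have "((%q. l - integral {0..q} (%r. psi' (?w r))) has_real_derivative 0 - psi' (?w t)) (at t within {0..T})"
  by (intro DERIV_diff DERIV_const)
 then have D: "((%q. l - integral {0..q} (%r. psi' (?w r))) has_real_derivative - psi' (?w t)) (at t within {0..T})"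
  by simp
 show ?thesis
  by (rule has_field_derivative_transform_within[OF D zero_less_one t]) (simp add: eqI)
qed

lemma psi0_small: "\<exists>C>0. \<forall>z\<in>{0..1}. psi0 z <= C * z powr (1 + \<beta>)"
proof -
 obtain C5 where C5: "0 < C5" "!!z. 0 <= z ==> \<bar>psi0 z - \<eta> * z powr (1 + \<beta>)\<bar> <= C5 * (z powr (1 + \<beta> + dd) + z\<^sup>2)"
  using psi0_expansion by blast
 show ?thesis
 proof (intro exI[of _ "\<eta> + 2 * C5"] conjI ballI)
  fix z :: real assume z: "z : {0..1}"
  have 1: "z powr (1 + \<beta> + dd) <= z powr (1 + \<beta>)"
   by (rule powr_mono') (use z dd_pos in auto)
  have 2: "z powr 2 <= z powr (1 + \<beta>)"
   by (rule powr_mono') (use z beta_lt_1 in auto)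
  have z2: "z powr 2 = z\<^sup>2" using z by (simp add: powr_numeral)
  have "C5 * (z powr (1 + \<beta> + dd) + z\<^sup>2) <= C5 * (z powr (1 + \<beta>) + z powr (1 + \<beta>))"
   using C5 1 2 z2 by (intro mult_left_mono add_mono) auto
  then show "psi0 z <= (\<eta> + 2 * C5) * z powr (1 + \<beta>)"
   using C5(2)[of z] z by (simp add: abs_le_iff algebra_simps)
 qed (use C5 eta_pos in auto)
qed

lemma small_powr_bound:
 assumes "0 < C" "0 < e" shows "\<exists>z0\<in>{0<..1}. \<forall>z\<in>{0<..z0}. C * z powr \<beta> <= e"
proof -
 define z0 where "z0 = min 1 ((e / C) powr (1 / \<beta>))"
 have "C * z powr \<beta> <= e" if "z : {0<..z0}" for z
 proof -
  have "z powr \<beta> <= ((e / C) powr (1 / \<beta>)) powr \<beta>" using that beta_pos by (intro powr_mono2) (auto simp: z0_def)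
  also have "... = e / C" using assms beta_pos by (simp add: powr_powr)
  finally show ?thesis using assms by (simp add: field_simps)
 qed
 moreover have "z0 : {0<..1}" using assms by (auto simp: z0_def)
 ultimately show ?thesis by blast
qed

lemma psi_neg_near_0: "\<exists>z0\<in>{0<..1}. \<forall>z\<in>{0<..z0}. psi' z < 0"
proof -
 obtain C where C: "0 < C" "!!z. z : {0..1} ==> psi0 z <= C * z powr (1 + \<beta>)" using psi0_small by blast
 obtain z0 where z0: "z0 : {0<..1}" "!!z. z : {0<..z0} ==> C * z powr \<beta> <= \<alpha> / 2"
  using small_powr_bound[OF C(1), of "\<alpha> / 2"] alpha_pos by auto
 have "psi' z < 0" if z: "z : {0<..z0}" for z
 proof -
  have "psi0 z <= C * z powr (1 + \<beta>)" using z z0 by (intro C) auto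
  also have "... = (C * z powr \<beta>) * z" using z powr_add[of z \<beta> 1] by (simp add: add.commute)
  also have "... <= (\<alpha> / 2) * z" using z0(2)[OF z] z by (intro mult_right_mono) auto
  also have "... < \<alpha> * z" using z alpha_pos by simp
  finally show ?thesis using z by (simp add: psi_eq)
 qed
 then show ?thesis using z0 by blast
qed

text \<open>A starting value of order exp(-alpha t) reaches order 1 at time t. At distance s from
  the final time the flow is at most k exp(-alpha s), so psi0 is of order exp(-alpha (1 + beta) s)
  there and the weighted loss is integrable in s, uniformly in t.\<close>

lemma scal_lower:
 "\<exists>k>0. \<forall>t\<ge>0. k / 2 <= scal TYPE('a::euclidean_space) (k * exp (- \<alpha> * t)) t"
proof -
 obtain C where C: "0 < C" "!!z. z : {0..1} ==> psi0 z <= C * z powr (1 + \<beta>)" using psi0_small by blast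
 \<comment> \<open>C / (alpha beta) is the integral of C exp(-alpha beta s) over the half line; the
   choice makes the total loss at most k / 2.\<close>
 obtain k where k: "k : {0<..1}" "(C / (\<alpha> * \<beta>)) * k powr \<beta> <= 1 / 2"
  using small_powr_bound[of "C / (\<alpha> * \<beta>)" "1 / 2"] C alpha_pos beta_pos by fastforce
 have "k / 2 <= scal TYPE('a) (k * exp (- \<alpha> * t)) t" if t: "0 <= t" for t
 proof -
  let ?l = "k * exp (- \<alpha> * t)"
  let ?w = "scal TYPE('a) ?l"
  have l: "0 <= ?l" using k by simp
  have [measurable]: "?w : Bm borel" by (rule scal_measurable[OF l])
  have wb: "?w (t - s) <= k * exp (- \<alpha> * s)" if "s : {0..t}" for s
  proof -
   have "?w (t - s) <= exp (\<alpha> * (t - s)) * ?l" using that by (intro scal_le l) auto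
   also have "... = k * (exp (\<alpha> * (t - s)) * exp (- \<alpha> * t))" by simp
   also have "exp (\<alpha> * (t - s)) * exp (- \<alpha> * t) = exp (- \<alpha> * s)"
    by (subst exp_add[symmetric]) (simp add: algebra_simps)
   finally show ?thesis .
  qed
  have ib: "exp (\<alpha> * s) * psi0 (?w (t - s)) <= C * k powr (1 + \<beta>) * exp (- (\<alpha> * \<beta>) * s)" if s: "s : {0..t}" for s
  proof -
   let ?z = "k * exp (- \<alpha> * s)"
   have "?z <= 1 * 1" using k s alpha_pos by (intro mult_mono) auto
   then have z: "?z : {0..1}" using k by auto
   have "psi0 (?w (t - s)) <= psi0 ?z" by (rule psi0_mono[OF wb[OF s]])
   also have "... <= C * ?z powr (1 + \<beta>)" by (rule C(2)[OF z])
   also have "?z powr (1 + \<beta>) = k powr (1 + \<beta>) * exp (- \<alpha> * s * (1 + \<beta>))"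
    by (simp add: powr_mult exp_powr_real)
   finally have "exp (\<alpha> * s) * psi0 (?w (t - s)) <= exp (\<alpha> * s) * (C * (k powr (1 + \<beta>) * exp (- \<alpha> * s * (1 + \<beta>))))"
    by (rule mult_left_mono) simp
   also have "... = C * k powr (1 + \<beta>) * (exp (\<alpha> * s) * exp (- \<alpha> * s * (1 + \<beta>)))" by (simp only: mult_ac)
   also have "exp (\<alpha> * s) * exp (- \<alpha> * s * (1 + \<beta>)) = exp (- (\<alpha> * \<beta>) * s)"
    by (subst exp_add[symmetric]) (simp add: algebra_simps)
   finally show ?thesis .
  qed
  have i2: "set_integrable lborel {0..t} (%s. C * k powr (1 + \<beta>) * exp (- (\<alpha> * \<beta>) * s))"
   by (intro borel_integrable_atLeastAtMost' continuous_intros)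
  have i1: "set_integrable lborel {0..t} (%s. exp (\<alpha> * s) * psi0 (?w (t - s)))"
  proof (rule set_integrable_bounded_Icc)
   fix s assume s: "s : {0..t}"
   have "C * k powr (1 + \<beta>) * exp (- (\<alpha> * \<beta>) * s) <= C * k powr (1 + \<beta>) * 1"
    using C s alpha_pos beta_pos by (intro mult_left_mono) auto
   moreover have "0 <= exp (\<alpha> * s) * psi0 (?w (t - s))" by simp
   ultimately show "norm (exp (\<alpha> * s) * psi0 (?w (t - s))) <= C * k powr (1 + \<beta>) * 1"
    using ib[OF s] unfolding real_norm_def by linarith
  qed measurable
  have "(LINT s:{0..t}|lborel. exp (\<alpha> * s) * psi0 (?w (t - s))) <= (LINT s:{0..t}|lborel. C * k powr (1 + \<beta>) * exp (- (\<alpha> * \<beta>) * s))"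
   by (rule set_integral_mono[OF i1 i2 ib])
  also have "... = - (C * k powr (1 + \<beta>) / (\<alpha> * \<beta>)) * exp (- (\<alpha> * \<beta>) * t) - (- (C * k powr (1 + \<beta>) / (\<alpha> * \<beta>)) * exp (- (\<alpha> * \<beta>) * 0))"
   using t alpha_pos beta_pos
   by (intro set_integral_FTC_Icc[where F="%s. - (C * k powr (1 + \<beta>) / (\<alpha> * \<beta>)) * exp (- (\<alpha> * \<beta>) * s)"])
     (auto intro!: derivative_eq_intros continuous_intros)
  also have "... <= C * k powr (1 + \<beta>) / (\<alpha> * \<beta>)" using C k alpha_pos beta_pos by simp
  also have "... = ((C / (\<alpha> * \<beta>)) * k powr \<beta>) * k" using k powr_add[of k \<beta> 1] by (simp add: add.commute)
  also have "... <= (1 / 2) * k" using k by (intro mult_right_mono) auto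
  finally have "(LINT s:{0..t}|lborel. exp (\<alpha> * s) * psi0 (?w (t - s))) <= k / 2" by simp
  moreover have "exp (\<alpha> * t) * ?l = k" by (simp add: exp_minus)
  ultimately show ?thesis using scal_eq[OF l t, where 'a='a] by linarith
 qed
 then show ?thesis using k by auto
qed

end

section \<open>Consequences of Grey's condition for the flow\<close>

locale super_ou_grey = super_ou +
 assumes grey: "\<exists>z'>0. (\<forall>z>z'. psi \<alpha> \<rho> \<pi> z > 0) & set_integrable lborel {z'<..} (%z. 1 / psi \<alpha> \<rho> \<pi> z)"
begin

text \<open>The largest point with psi <= 0 exists because such points form a closed set bounded by
  z'. Below it negativity follows from convexity, starting from a neighbourhood of 0, where the
  linear term dominates.\<close>

lemma vbar_exists:
 "\<exists>v>0. psi' v <= 0 & (\<forall>z. 0 < z --> z < v --> psi' z < 0) & (\<forall>z. v < z --> 0 < psi' z)"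
proof -
 obtain z' where z': "0 < z'" "!!z. z' < z ==> 0 < psi' z" using grey by blast
 obtain z0 where z0: "z0 : {0<..1}" "!!z. z : {0<..z0} ==> psi' z < 0" using psi_neg_near_0 by blast
 define S where "S = {z : {0..z'}. psi' z <= 0}"
 have Sin: "z : S" if "0 <= z" "psi' z <= 0" for z
  using that z'(2)[of z] by (force simp: S_def)
 have cl: "closed S"
  unfolding S_def
  by (intro continuous_on_closed_Collect_le continuous_on_subset[OF continuous_psi] continuous_on_const) auto
 have bdd: "bdd_above S" by (auto simp: S_def)
 have z0S: "z0 : S" using z0 by (intro Sin) (auto intro: less_imp_le)
 define v where "v = Sup S"
 have vS: "v : S" unfolding v_def using z0S cl bdd by (intro closed_contains_Sup) auto
 have zv: "z0 <= v" unfolding v_def by (rule cSup_upper[OF z0S bdd])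
 have pos: "0 < psi' z" if "v < z" for z
 proof (rule ccontr)
  assume "\<not> 0 < psi' z"
  then have "z : S" using that zv z0 by (intro Sin) auto
  then have "z <= v" unfolding v_def by (rule cSup_upper[OF _ bdd])
  then show False using that by simp
 qed
 have neg: "psi' z < 0" if z: "0 < z" "z < v" for z
 proof (cases "z <= z0")
  case True then show ?thesis using z by (intro z0) auto
 next
  case False
  \<comment> \<open>z is written as a convex combination of z0, where psi is negative, and v, where
    it is nonpositive.\<close>
  define s where "s = (z - z0) / (v - z0)"
  have "s * (v - z0) = z - z0" using False z by (simp add: s_def)
  then have "z = (1 - s) * z0 + s * v" by (simp add: algebra_simps)
  moreover have "0 <= s" "s < 1" using False z by (auto simp: s_def)
  ultimately have s: "0 <= s" "s < 1" "z = (1 - s) * z0 + s * v" by blast+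
  have nn: "0 <= z0" "0 <= v" "0 <= z" using z0 zv z by auto
  have "psi0 z <= (1 - s) * psi0 z0 + s * psi0 v"
   using psi0_convex[of s z0 v] s(1,2) nn unfolding s(3)[symmetric] by simp
  moreover have "\<alpha> * z = (1 - s) * (\<alpha> * z0) + s * (\<alpha> * v)"
   by (subst s(3)) (simp add: algebra_simps)
  moreover have "(1 - s) * psi' z0 + s * psi' v
    = (1 - s) * psi0 z0 + s * psi0 v - ((1 - s) * (\<alpha> * z0) + s * (\<alpha> * v))"
   by (simp add: psi_eq nn algebra_simps)
  ultimately have "psi' z <= (1 - s) * psi' z0 + s * psi' v"
   unfolding psi_eq[OF nn(3)] by linarith
  also have "... < 0"
   using vS z0 s by (intro add_neg_nonpos mult_pos_neg mult_nonneg_nonpos) (auto simp: S_def)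
  finally show ?thesis .
 qed
 show ?thesis using vS zv z0 pos neg by (intro exI[of _ v]) (auto simp: S_def)
qed

text \<open>The largest zero of psi, to which the flow converges from every positive starting
  value.\<close>

definition "vbar = (SOME v. 0 < v & psi' v <= 0 & (\<forall>z. 0 < z --> z < v --> psi' z < 0) & (\<forall>z. v < z --> 0 < psi' z))"

lemma vbar_pos: "0 < vbar"
 and psi_neg: "0 < z ==> z < vbar ==> psi' z < 0"
 and psi_pos: "vbar < z ==> 0 < psi' z"
 using someI_ex[OF vbar_exists] unfolding vbar_def[symmetric] by blast+

text \<open>The waiting time is uniform over all starts above k. Halving min(k, vbar) gives a level
  strictly inside (0, vbar), where psi is negative; if the target lies below it, the barrier alone
  suffices.\<close>

lemma scal_reach_below:
 assumes k: "0 < k" and e: "0 < e"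
 shows "\<exists>S\<ge>0. \<forall>l s t. 0 <= l --> 0 <= s --> k <= scal TYPE('a::euclidean_space) l s --> s + S <= t
   --> vbar - e <= scal TYPE('a) l t"
proof (cases "vbar - e <= min k vbar / 2")
 case True
 define k' where "k' = min k vbar / 2"
 have k': "0 < k'" "k' < vbar" "k' <= k" using k vbar_pos by (auto simp: k'_def min_def)
 have "vbar - e <= scal TYPE('a) l t" if "0 <= l" "0 <= s" "k <= scal TYPE('a) l s" "s <= t" for l s t
 proof -
  have "k' <= scal TYPE('a) l t"
  proof (rule deriv_barrier[where s=s and r=t and u="scal TYPE('a) l" and F="%z. - psi' z"])
   fix q assume "q : {s..t}"
   then show "(scal TYPE('a) l has_real_derivative - psi' (scal TYPE('a) l q)) (at q within {s..t})"
    using that by (intro has_field_derivative_subset[OF scal_deriv[where T=t]]) auto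
  qed (use that k' psi_neg[of k'] in auto)
  then show ?thesis using True unfolding k'_def by linarith
 qed
 then show ?thesis by (intro exI[of _ 0]) auto
next
 case False
 define k' where "k' = min k vbar / 2"
 have k': "0 < k'" "k' <= k" "k' <= vbar - e" using k vbar_pos False by (auto simp: k'_def min_def)
 have "\<exists>x\<in>{k'..vbar - e}. \<forall>y\<in>{k'..vbar - e}. psi' y <= psi' x"
  using k' by (intro continuous_attains_sup continuous_on_subset[OF continuous_psi]) auto
 then obtain x where x: "x : {k'..vbar - e}" "!!y. y : {k'..vbar - e} ==> psi' y <= psi' x" by blast
 define c where "c = - psi' x"
 have c: "0 < c" using psi_neg[of x] x(1) k' e by (simp add: c_def)
 show ?thesis
 proof (intro exI[of _ "(vbar - e - k') / c"] conjI allI impI)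
  show "0 <= (vbar - e - k') / c" using c k' by simp
  fix l s t assume H: "0 <= l" "0 <= s" "k <= scal TYPE('a) l s" "s + (vbar - e - k') / c <= t"
  have "0 <= (vbar - e - k') / c" using c k' by simp
  then have st: "s <= t" using H by linarith
  show "vbar - e <= scal TYPE('a) l t"
  proof (rule deriv_reach[where s=s and r=t and u="scal TYPE('a) l" and m="vbar - e" and F="%z. - psi' z" and c=c and k=k'])
   fix q assume "q : {s..t}"
   then show "(scal TYPE('a) l has_real_derivative - psi' (scal TYPE('a) l q)) (at q within {s..t})"
    using H by (intro has_field_derivative_subset[OF scal_deriv[where T=t]]) auto
  qed (use H k' c x in \<open>auto simp: c_def\<close>)
 qed
qed

text \<open>The flow comes down from infinity. Along it the integral \<open>Hf\<close> of 1 / psi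
  decreases at unit speed, while Grey's condition bounds \<open>Hf\<close> by H, so after time H
  every trajectory is below a, whatever its start; from there psi is bounded below on the remaining
  interval.\<close>

lemma scal_reach_above:
 assumes e: "0 < e"
 shows "\<exists>T\<ge>0. \<forall>l t. 0 <= l --> T <= t --> scal TYPE('a::euclidean_space) l t <= vbar + e"
proof -
 obtain z' where z': "0 < z'" "!!z. z' < z ==> 0 < psi' z"
  and zi: "set_integrable lborel {z'<..} (%z. 1 / psi' z)" using grey by blast
 \<comment> \<open>Strictly to the right of z', so that 1 / psi is continuous from a on, and not
   below the target.\<close>
 define a where "a = max (z' + 1) (vbar + e)"
 have a: "z' < a" "vbar + e <= a" by (auto simp: a_def)
 define H where "H = (LINT z:{z'<..}|lborel. 1 / psi' z)"
 have cont: "continuous_on {a..m} (%z. 1 / psi' z)" for m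
 proof (intro continuous_on_divide continuous_on_const continuous_on_subset[OF continuous_psi])
  show "\<forall>z\<in>{a..m}. psi' z ~= 0"
  proof
   fix z assume "z : {a..m}"
   then show "psi' z ~= 0" using a z'(2)[of z] by auto
  qed
 qed (use a z' in auto)
 define Hf where "Hf z = integral {a..z} (%z. 1 / psi' z)" for z
 have Hf: "0 <= Hf z" "Hf z <= H" if "a <= z" for z
 proof -
  have i: "set_integrable lborel {a..z} (%z. 1 / psi' z)"
   using zi by (rule set_integrable_subset) (use a in auto)
  then have eq: "Hf z = (LINT z:{a..z}|lborel. 1 / psi' z)"
   unfolding Hf_def by (rule set_borel_integral_eq_integral(2)[symmetric])
  have pos: "0 <= 1 / psi' y" if "z' < y" for y using z'(2)[OF that] by simp
  show "0 <= Hf z" unfolding eq set_lebesgue_integral_def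
   using pos a by (intro integral_nonneg_AE AE_I2) (auto simp: indicator_def)
  show "Hf z <= H" unfolding eq H_def set_lebesgue_integral_def
   using i zi pos a unfolding set_integrable_def by (intro integral_mono) (auto simp: indicator_def)
 qed
 have step1: "scal TYPE('a) l r <= a" if l: "0 <= l" and r: "H < r" for l r
 proof (rule ccontr)
  let ?w = "scal TYPE('a) l"
  assume "\<not> ?w r <= a"
  then have wr: "a < ?w r" by simp
  have r0: "0 < r" using Hf[of a] r by linarith
  have dw: "(?w has_real_derivative - psi' (?w q)) (at q within {x..r})" if "0 <= x" "q : {x..r}" for x q
   using that l by (intro has_field_derivative_subset[OF scal_deriv[where T=r]]) auto
  have above: "a < ?w q" if q: "q : {0..r}" for q
  proof (rule ccontr)
   assume "\<not> a < ?w q"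
   then have wq: "?w q <= a" by simp
   have "- a <= - ?w r"
   proof (rule deriv_barrier[where s=q and r=r and l="- a" and u="%q. - ?w q" and F="%z. psi' (- z)"])
    fix x assume "x : {q..r}"
    then show "((%q. - ?w q) has_real_derivative psi' (- (- ?w x))) (at x within {q..r})"
     using DERIV_minus[OF dw[of q x]] q by simp
   qed (use z'(2)[of a] a q wq in auto)
   then show False using wr by simp
  qed
  have cw: "continuous_on {0..r} ?w" using dw[of 0] by (intro DERIV_continuous_on) auto
  obtain m where m: "!!q. q : {0..r} ==> ?w q <= m"
  proof -
   have "\<exists>x\<in>{0..r}. \<forall>y\<in>{0..r}. ?w y <= ?w x" using cw r0 by (intro continuous_attains_sup) auto
   then show ?thesis using that by blast
  qed
  \<comment> \<open>Chain rule: (1 / psi(w)) times the velocity -psi(w) is -1.\<close>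
  have d: "((%q. Hf (?w q)) has_real_derivative - 1) (at q within {0..r})" if q: "q : {0..r}" for q
  proof -
   have "(Hf has_real_derivative 1 / psi' (?w q)) (at (?w q) within {a..m})"
    unfolding Hf_def[abs_def] using above[OF q] m[OF q] by (intro integral_has_real_derivative cont) auto
   then have "(Hf has_real_derivative 1 / psi' (?w q)) (at (?w q) within ?w ` {0..r})"
    by (rule has_field_derivative_subset) (use m in \<open>auto intro!: less_imp_le[OF above]\<close>)
   from DERIV_image_chain[OF this dw[of 0 q]] q
   have "((%q. Hf (?w q)) has_real_derivative 1 / psi' (?w q) * - psi' (?w q)) (at q within {0..r})"
    by (simp add: o_def)
   moreover have "0 < psi' (?w q)" using above[OF q] a by (intro z') auto
   ultimately show ?thesis by simp
  qed
  obtain x where "x : {0<..<r}" "Hf (?w r) - Hf (?w 0) = - 1 * (r - 0)"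
   using mvt_simple[of 0 r "%q. Hf (?w q)" "%x. (*) (- 1)"] d r0 by (auto simp: has_field_derivative_def)
  then show False using Hf[of "?w r"] Hf[of "?w 0"] above[of r] above[of 0] r0 r by auto
 qed
 have "\<exists>x\<in>{vbar + e..a}. \<forall>y\<in>{vbar + e..a}. psi' x <= psi' y"
  using a vbar_pos e by (intro continuous_attains_inf continuous_on_subset[OF continuous_psi]) auto
 then obtain x where x: "x : {vbar + e..a}" "!!y. y : {vbar + e..a} ==> psi' x <= psi' y" by blast
 define c where "c = psi' x"
 have c: "0 < c" unfolding c_def using x(1) e by (intro psi_pos) auto
 have H0: "0 <= H" using Hf[of a] by linarith
 have "scal TYPE('a) l t <= vbar + e" if l: "0 <= l" and t: "H + 1 + (a - (vbar + e)) / c <= t" for l t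
 proof -
  have "0 <= (a - (vbar + e)) / c" using a c by simp
  then have Ht: "H + 1 <= t" using t by linarith
  have "- (vbar + e) <= - scal TYPE('a) l t"
  proof (rule deriv_reach[where s="H + 1" and r=t and m="- (vbar + e)" and u="%q. - scal TYPE('a) l q" and F="%z. psi' (- z)" and c=c and k="- a"])
   fix q assume "q : {H + 1..t}"
   then have "(scal TYPE('a) l has_real_derivative - psi' (scal TYPE('a) l q)) (at q within {H + 1..t})"
    using l H0 by (intro has_field_derivative_subset[OF scal_deriv[where T=t]]) auto
   from DERIV_minus[OF this]
   show "((%q. - scal TYPE('a) l q) has_real_derivative psi' (- (- scal TYPE('a) l q))) (at q within {H + 1..t})" by simp
  next
   show "- a <= - scal TYPE('a) l (H + 1)" using step1[OF l, of "H + 1"] by simp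
   have "- (vbar + e) - - a = a - (vbar + e)" by simp
   then show "H + 1 + (- (vbar + e) - - a) / c <= t" using t by (simp only:)
  qed (use x c a t in \<open>auto simp: c_def\<close>)
  then show ?thesis by simp
 qed
 moreover have "0 <= H + 1 + (a - (vbar + e)) / c" using H0 a c by simp
 ultimately show ?thesis by blast
qed

end

section \<open>The superprocess\<close>

locale super_ou_X = super_ou_grey \<sigma> b \<alpha> \<rho> \<pi> \<eta> \<beta> \<delta>
 for \<sigma> b \<alpha> \<rho> :: real and \<pi> :: "real measure" and \<eta> \<beta> \<delta> :: real +
 fixes M :: "'w measure" and X :: "real => 'w => 'a::euclidean_space measure" and \<mu> :: "'a measure"
 assumes superOU: "superOU \<alpha> \<rho> \<pi> \<sigma> b M X \<mu>"
  and sets_mu [simp, measurable_cong]: "sets \<mu> = sets borel" and fin_mu: "finite_measure \<mu>"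
  and compact_mu: "\<exists>K. compact K & emeasure \<mu> (UNIV - K) = 0"
  and mu_nonzero: "emeasure \<mu> UNIV ~= 0"
  and survival_sets [measurable]: "survival M X : sets M"
begin

sublocale P: prob_space M
 using superOU by (simp add: superOU_def)

sublocale mu: finite_measure \<mu> by (rule fin_mu)

abbreviation "F \<equiv> natF M X"
text \<open>When g is not integrable this is 0 by convention; identities for unbounded g are
  therefore stated almost surely, on the event of integrability.\<close>

definition "I t g p = (LINT x|(X t p). g x)" for g :: "'a => real"
definition "Y t p = measure (X t p) UNIV"

lemma space_mu [simp]: "space \<mu> = UNIV"
 using sets_eq_imp_space_eq[OF sets_mu] by simp

lemma sets_X: "p : space M ==> sets (X t p) = sets borel"
 and finite_X: "p : space M ==> finite_measure (X t p)"
 and measurable_X: "0 <= t ==> A : sets borel ==> (%p. measure (X t p) A) : Bm M"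
 using superOU unfolding superOU_def by blast+

lemma space_X: "p : space M ==> space (X t p) = UNIV"
 using sets_eq_imp_space_eq[OF sets_X] by simp

lemma measurable_X_iff: "p : space M ==> f : Bm borel ==> f : Bm (X t p)"
 using measurable_cong_sets[OF sets_X refl] by blast

lemma Y_nonneg [simp]: "0 <= Y t p" by (simp add: Y_def)

lemma I_const: "p : space M ==> I t (%_. c) p = c * Y t p"
 by (simp add: I_def Y_def space_X)

lemma space_F [simp]: "space (F t) = space M"
 unfolding natF_def by (rule space_measure_of) auto

lemma subalgebra_F: "subalgebra M (F t)"
 unfolding subalgebra_def
proof
 show "sets (F t) \<subseteq> sets M"
  unfolding natF_def
 proof (subst sets_measure_of)
  show "sigma_sets (space M) {{p : space M. measure (X r p) A : B} |r A B. 0 <= r & r <= t & A : sets borel & B : sets borel} \<subseteq> sets M"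
  proof (rule sets.sigma_sets_subset, safe)
   fix r and A :: "'a set" and B :: "real set" assume "0 <= r" "r <= t" "A : sets borel" "B : sets borel"
   then show "{p : space M. measure (X r p) A : B} : sets M"
    using measurable_sets[OF measurable_X, of r A B] by (simp add: vimage_def Int_def conj_commute)
  qed
 qed auto
qed simp

lemma F_meas: "f : Bm (F t) ==> f : Bm M"
 by (rule measurable_from_subalg[OF subalgebra_F])

lemma F_sets: "A : sets (F t) ==> A : sets M"
 using subalgebra_F by (auto simp: subalgebra_def)

lemma cond_exp_F: "finite_measure_subalgebra M (F t)"
 by unfold_locales (rule subalgebra_F)

lemma measure_X_F:
 assumes "0 <= r" "r <= t" "A : sets borel"
 shows "(%p. measure (X r p) A) : Bm (F t)"
proof (rule measurableI)
 fix B :: "real set" assume "B : sets borel"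
 then have "{p : space M. measure (X r p) A : B} : sets (F t)"
  unfolding natF_def using assms by (subst sets_measure_of) (auto intro!: sigma_sets.Basic)
 then show "(%p. measure (X r p) A) -` B \<inter> space (F t) : sets (F t)"
  by (simp add: vimage_def Int_def conj_commute)
qed simp

text \<open>The measurability of the process is given through the masses of Borel sets; that of
  integrals follows by induction on the integrand.\<close>

lemma nn_integral_X_F:
 assumes "0 <= r" "r <= t" and g: "g : Bm borel"
 shows "(%p. \<integral>\<^sup>+x. g x \<partial>(X r p)) : Bm (F t)"
 using g
proof (induction g rule: borel_measurable_induct)
 case (cong f g)
 then have "f = g" by auto
 then show ?case using cong by simp
next
 case (set A)
 have "(\<integral>\<^sup>+x. indicator A x \<partial>(X r p)) = ennreal (measure (X r p) A)" if "p : space (F t)" for p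
 proof -
  interpret finite_measure "X r p" using that by (intro finite_X) simp
  show ?thesis using set sets_X[of p r] that by (simp add: emeasure_eq_measure)
 qed
 moreover have "(%p. ennreal (measure (X r p) A)) : Bm (F t)"
  using measure_X_F[OF assms(1,2)] set by measurable
 ultimately show ?case
  by (subst measurable_cong[where g="%p. ennreal (measure (X r p) A)"]) auto
next
 case (mult u c)
 have "(\<integral>\<^sup>+x. c * u x \<partial>(X r p)) = c * (\<integral>\<^sup>+x. u x \<partial>(X r p))" if "p : space (F t)" for p
  using that mult by (intro nn_integral_cmult measurable_X_iff) auto
 then show ?case using mult
  by (subst measurable_cong[where g="%p. c * (\<integral>\<^sup>+x. u x \<partial>(X r p))"]) auto
next
 case (add u v)
 have "(\<integral>\<^sup>+x. u x + v x \<partial>(X r p)) = (\<integral>\<^sup>+x. u x \<partial>(X r p)) + (\<integral>\<^sup>+x. v x \<partial>(X r p))" if "p : space (F t)" for p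
  using that add by (intro nn_integral_add measurable_X_iff) auto
 then show ?case using add
  by (subst measurable_cong[where g="%p. (\<integral>\<^sup>+x. u x \<partial>(X r p)) + (\<integral>\<^sup>+x. v x \<partial>(X r p))"]) (auto simp: add.commute)
next
 case (seq U)
 have f: "Sup (range U) = (%x. SUP i. U i x)"
  by (rule ext) (simp add: Sup_apply image_image)
 have "integral\<^sup>N (X r p) (Sup (range U)) = (SUP i. \<integral>\<^sup>+x. U i x \<partial>(X r p))" if "p : space (F t)" for p
  unfolding f using that seq by (intro nn_integral_monotone_convergence_SUP measurable_X_iff) auto
 then show ?case using seq
  by (subst measurable_cong[where g="%p. SUP i. \<integral>\<^sup>+x. U i x \<partial>(X r p)"]) auto
qed

lemma I_F:
 assumes "0 <= r" "r <= t" and g[measurable]: "g : Bm borel"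
 shows "I r g : Bm (F t)"
proof -
 \<comment> \<open>The case distinction reproduces the value 0 of the integral for non-integrable g,
   so the equality with \<open>I\<close> holds at every point.\<close>
 let ?J = "%p. if (\<integral>\<^sup>+x. ennreal \<bar>g x\<bar> \<partial>(X r p)) < \<infinity> then
  enn2real (\<integral>\<^sup>+x. ennreal (g x) \<partial>(X r p)) - enn2real (\<integral>\<^sup>+x. ennreal (- g x) \<partial>(X r p)) else 0"
 have [measurable]: "(%p. \<integral>\<^sup>+x. ennreal \<bar>g x\<bar> \<partial>(X r p)) : Bm (F t)"
  by (rule nn_integral_X_F[OF assms(1,2)]) simp
 have [measurable]: "(%p. \<integral>\<^sup>+x. ennreal (g x) \<partial>(X r p)) : Bm (F t)"
  by (rule nn_integral_X_F[OF assms(1,2)]) simp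
 have [measurable]: "(%p. \<integral>\<^sup>+x. ennreal (- g x) \<partial>(X r p)) : Bm (F t)"
  by (rule nn_integral_X_F[OF assms(1,2)]) simp
 have "I r g p = ?J p" if "p : space (F t)" for p
 proof -
  have gm: "g : Bm (X r p)" using that by (intro measurable_X_iff) auto
  then have "integrable (X r p) g \<longleftrightarrow> (\<integral>\<^sup>+x. ennreal \<bar>g x\<bar> \<partial>(X r p)) < \<infinity>"
   by (simp add: integrable_iff_bounded)
  then show ?thesis
   by (auto simp: I_def real_lebesgue_integral_def not_integrable_integral_eq)
 qed
 moreover have "?J : Bm (F t)" by measurable
 ultimately show ?thesis by (subst measurable_cong[where g="?J"]) auto
qed

lemma I_M: "0 <= r ==> g : Bm borel ==> I r g : Bm M"
 by (rule F_meas[OF I_F[OF _ order_refl]])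

lemma Y_F: "0 <= r ==> r <= t ==> Y r : Bm (F t)"
 unfolding Y_def by (rule measure_X_F) auto

lemma Y_M: "0 <= r ==> Y r : Bm M"
 by (rule F_meas[OF Y_F[OF _ order_refl]])

lemma I_nonneg: "(!!x. 0 <= g x) ==> 0 <= I t g p"
 by (simp add: I_def)

lemma integrable_X_bounded:
 fixes g :: "'a => real"
 assumes "p : space M" "g : Bm borel" "!!x. \<bar>g x\<bar> <= B"
 shows "integrable (X t p) g"
proof -
 interpret finite_measure "X t p" by (rule finite_X[OF assms(1)])
 show ?thesis using assms by (intro integrable_const_bound[where B=B] measurable_X_iff) auto
qed

lemma I_le_Y:
 assumes "p : space M" "g : Bm borel" "!!x. \<bar>g x\<bar> <= B"
 shows "I t g p <= B * Y t p"
proof -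
 have "I t g p <= I t (%_. B) p"
  unfolding I_def using assms order_trans[OF abs_ge_zero assms(3)]
  by (intro integral_mono integrable_X_bounded[where B=B]) (auto intro: order_trans[OF abs_ge_self])
 then show ?thesis by (simp add: I_const[OF assms(1)])
qed

text \<open>The Markov property tested against a bounded past-measurable factor; conditional
  expectations do not appear after this point.\<close>

lemma markov:
 assumes t: "0 <= t" "0 <= s" and f: "admissible f" and G: "G : Bm (F t)"
  and GB: "!!p. p : space M ==> \<bar>G p\<bar> <= B"
 shows "(LINT p|M. G p * exp (- I (t + s) f p)) = (LINT p|M. G p * exp (- I t (V f s) p))"
proof -
 interpret C: finite_measure_subalgebra M "F t" by (rule cond_exp_F)
 have fm: "f : Bm borel" and f0: "!!x. 0 <= f x" using f by (auto simp: admissible_def)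
 have AE: "AE p in M. real_cond_exp M (F t) (%p. exp (- I (t + s) f p)) p = exp (- I t (V f s) p)"
  using superOU t f unfolding superOU_def I_def admissible_def by blast
 have m1[measurable]: "(%p. exp (- I (t + s) f p)) : Bm M"
  using I_M[OF _ fm, of "t + s"] t by simp
 have [measurable]: "V f s : Bm borel" by (intro V_measurable f) auto
 have m2[measurable]: "I t (V f s) : Bm M" by (rule I_M[OF t(1)]) measurable
 have Gm[measurable]: "G : Bm M" by (rule F_meas[OF G])
 have int: "integrable M (%p. G p * exp (- I (t + s) f p))"
 proof (rule P.integrable_const_bound[where B=B])
  show "AE p in M. norm (G p * exp (- I (t + s) f p)) <= B"
  proof (rule AE_I2)
   fix p assume w: "p : space M"
   have "\<bar>G p\<bar> * exp (- I (t + s) f p) <= B * 1"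
    using GB[OF w] I_nonneg[of f "t + s" p] f0 order_trans[OF abs_ge_zero GB[OF w]] by (intro mult_mono) auto
   then show "norm (G p * exp (- I (t + s) f p)) <= B" by (simp add: abs_mult)
  qed
 qed measurable
 have "(LINT p|M. G p * exp (- I (t + s) f p)) = (LINT p|M. G p * real_cond_exp M (F t) (%p. exp (- I (t + s) f p)) p)"
  using C.real_cond_exp_intg(2)[OF int G m1] by simp
 also have "... = (LINT p|M. G p * exp (- I t (V f s) p))"
  using AE by (intro integral_cong_AE) auto
 finally show ?thesis .
qed

lemma laplace_X:
 assumes "0 <= t" "admissible f"
 shows "(LINT p|M. exp (- I t f p)) = exp (- (LINT x|\<mu>. V f t x))"
proof -
 have X0: "AE p in M. X 0 p = \<mu>" using superOU by (simp add: superOU_def)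
 have [measurable]: "V f t : Bm borel" by (intro V_measurable assms) auto
 have [measurable]: "I 0 (V f t) : Bm M" by (rule I_M) auto
 have "(LINT p|M. exp (- I t f p)) = (LINT p|M. exp (- I 0 (V f t) p))"
  using markov[of 0 t f "%_. 1" 1] assms by simp
 also have "... = (LINT p|M. exp (- (LINT x|\<mu>. V f t x)))"
 proof (rule integral_cong_AE)
  show "AE p in M. exp (- I 0 (V f t) p) = exp (- (LINT x|\<mu>. V f t x))"
   using X0 by eventually_elim (simp add: I_def)
 qed measurable
 also have "... = exp (- (LINT x|\<mu>. V f t x))" by (simp add: P.prob_space)
 finally show ?thesis .
qed

section \<open>First moments and almost sure integrability of polynomial weights\<close>

text \<open>On the compact support of the initial measure every polynomial weight is
  bounded.\<close>

lemma integrable_mu_wt: "integrable \<mu> (wt n)"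
proof -
 obtain K where K: "compact K" "emeasure \<mu> (UNIV - K) = 0" using compact_mu by blast
 obtain R where R: "!!x. x : K ==> norm x <= R" using compact_imp_bounded[OF K(1)] unfolding bounded_iff by blast
 have "K : sets borel" using K by (intro borel_closed compact_imp_closed)
 then have "AE x in \<mu>. x : K"
  using K by (intro AE_I[where N="UNIV - K"]) auto
 then have "AE x in \<mu>. norm (wt n x) <= 1 + \<bar>R\<bar> ^ n"
 proof eventually_elim
  case (elim x)
  have "norm x ^ n <= \<bar>R\<bar> ^ n" using R[OF elim] by (intro power_mono) auto
  then show ?case by (simp add: wt_def)
 qed
 then show ?thesis by (intro mu.integrable_const_bound) auto
qed

lemma integrable_mu_bound:
 fixes g :: "'a => real"
 assumes "g : Bm borel" "!!x. \<bar>g x\<bar> <= C * wt n x"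
 shows "integrable \<mu> g"
proof (rule Bochner_Integration.integrable_bound[OF integrable_mult_right[OF integrable_mu_wt, of C n]])
 show "AE x in \<mu>. norm (g x) <= norm (C * wt n x)"
  using assms(2) by (intro AE_I2) (auto intro: order_trans[OF _ abs_ge_self])
qed (use assms in simp)

lemma Pa_bound:
 fixes g :: "'a => real"
 assumes "g : Bm borel" "!!y. \<bar>g y\<bar> <= C * wt n y" "0 <= t"
 shows "\<bar>Pa t g x\<bar> <= (exp (\<alpha> * t) * (C * growth_const TYPE('a) n)) * wt n x"
 using Pa_norm_le[of g C n t t x] assms by simp

lemma Pa_meas1 [measurable]:
 fixes g :: "'a => real"
 assumes [measurable]: "g : Bm borel" shows "Pa t g : Bm borel"
 by measurable

text \<open>Since (1 - exp(-c I)) / c tends to I as c -> 0, Fatou's lemma reduces the claim to V(cg)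
  <= c P^alpha g and 1 - exp(-x) <= x. An upper bound is all that Markov's inequality will ask
  for.\<close>

lemma moment_le_bounded:
 assumes t: "0 <= t" and g: "admissible g"
 shows "(\<integral>\<^sup>+p. ennreal (I t g p) \<partial>M) <= ennreal (LINT x|\<mu>. Pa t g x)"
proof -
 obtain B where gm[measurable]: "g : Bm borel" and B0: "0 <= B"
  and g0: "!!x. 0 <= g x" and "!!x. g x <= B" and gB: "!!x. \<bar>g x\<bar> <= B"
  by (rule admissibleD[OF g]) blast
 have gB': "\<bar>g y\<bar> <= B * wt 0 y" for y
 proof -
  have "B * 1 <= B * wt 0 y" using B0 by (intro mult_left_mono) auto
  then show ?thesis using gB[of y] by simp
 qed
 have Im[measurable]: "I t g : Bm M" by (rule I_M[OF t gm])
 let ?h = "%k p. (1 - exp (- (inverse (Suc k) * I t g p))) / inverse (real (Suc k))"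
 have iP: "integrable \<mu> (Pa t g)" by (rule integrable_mu_bound[OF _ Pa_bound[OF gm gB' t]]) measurable
 have bnd: "(\<integral>\<^sup>+p. ennreal (?h k p) \<partial>M) <= ennreal (LINT x|\<mu>. Pa t g x)" for k
 proof -
  define c where "c = inverse (real (Suc k))"
  have c: "0 < c" by (simp add: c_def)
  define f where "f y = c * g y" for y
  have f: "admissible f" unfolding f_def
   using gm g0 gB c by (auto simp: admissible_def bounded_iff abs_mult intro!: exI[of _ "c * B"] mult_left_mono)
  have If: "I t f p = c * I t g p" for p by (simp add: I_def f_def)
  have Vm: "V f t : Bm borel" by (intro V_measurable f) auto
  have Pf: "Pa t f x = c * Pa t g x" for x by (simp add: Pa_eq OU_P_eq f_def)
  have vle: "V f t x <= c * Pa t g x" for x using V_le[OF f t, of x] by (simp add: Pf)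
  have iV: "integrable \<mu> (V f t)"
  proof (rule Bochner_Integration.integrable_bound[OF integrable_mult_right[OF iP, of c]])
   show "AE x in \<mu>. norm (V f t x) <= norm (c * Pa t g x)"
    using vle V_nonneg[OF f] by (intro AE_I2) (auto intro: order_trans[OF _ abs_ge_self])
  qed (use Vm in simp)
  have E: "(LINT p|M. exp (- (c * I t g p))) = exp (- (LINT x|\<mu>. V f t x))"
   using laplace_X[OF t f] by (simp add: If)
  have ie: "integrable M (%p. exp (- (c * I t g p)))"
   using I_nonneg[of g t] g0 c by (intro P.integrable_const_bound[where B=1]) auto
  have h: "(\<integral>\<^sup>+p. ennreal ((1 - exp (- (c * I t g p))) / c) \<partial>M) = ennreal (LINT p|M. (1 - exp (- (c * I t g p))) / c)"
   using I_nonneg[of g t] g0 c ie by (intro nn_integral_eq_integral) auto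
  also have "(LINT p|M. (1 - exp (- (c * I t g p))) / c) = (1 - exp (- (LINT x|\<mu>. V f t x))) / c"
   using ie E by (simp add: P.prob_space)
  also have "... <= (LINT x|\<mu>. V f t x) / c"
   using exp_ge_add_one_self[of "- (LINT x|\<mu>. V f t x)"] c by (intro divide_right_mono) auto
  also have "... <= (LINT x|\<mu>. c * Pa t g x) / c"
   using vle iV iP c by (intro divide_right_mono integral_mono) auto
  also have "... = (LINT x|\<mu>. Pa t g x)" using c by simp
  finally show ?thesis by (simp add: c_def ennreal_leI)
 qed
 have lim: "(%k. ?h k p) ----> I t g p" for p
 proof -
  have d: "((%x. 1 - exp (- (x * I t g p))) has_real_derivative I t g p) (at 0)"
   by (auto intro!: derivative_eq_intros)
  have "((%h. ((1 - exp (- ((0 + h) * I t g p))) - (1 - exp (- (0 * I t g p)))) / h) \<longlongrightarrow> I t g p) (at 0)"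
   using d unfolding DERIV_def .
  then have "((%h. (1 - exp (- (h * I t g p))) / h) \<longlongrightarrow> I t g p) (at 0)" by simp
  moreover have "filterlim (%k. inverse (real (Suc k))) (at 0) sequentially"
   unfolding filterlim_at using LIMSEQ_inverse_real_of_nat by (auto intro!: eventuallyI)
  ultimately show ?thesis by (rule filterlim_compose)
 qed
 have "(\<integral>\<^sup>+p. ennreal (I t g p) \<partial>M) = (\<integral>\<^sup>+p. liminf (%k. ennreal (?h k p)) \<partial>M)"
 proof (intro nn_integral_cong)
  fix p
  have "(%k. ennreal (?h k p)) ----> ennreal (I t g p)" by (intro tendsto_ennrealI lim)
  then show "ennreal (I t g p) = liminf (%k. ennreal (?h k p))"
   by (rule lim_imp_Liminf[symmetric, rotated]) simp
 qed
 also have "... <= liminf (%k. \<integral>\<^sup>+p. ennreal (?h k p) \<partial>M)"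
  by (rule nn_integral_liminf) measurable
 also have "... <= ennreal (LINT x|\<mu>. Pa t g x)"
  using bnd by (intro Liminf_le) auto
 finally show ?thesis .
qed

text \<open>Monotone truncation of g. The inner integral is taken in the extended sense, since its
  finiteness is what the bound is meant to provide.\<close>

lemma moment_le_nn:
 assumes t: "0 <= t" and gm[measurable]: "g : Bm borel" and g0: "!!x. 0 <= g x" and gC: "!!x. g x <= C * wt n x"
 shows "(\<integral>\<^sup>+p. (\<integral>\<^sup>+x. ennreal (g x) \<partial>(X t p)) \<partial>M) <= ennreal (LINT x|\<mu>. Pa t g x)"
proof -
 define gk where "gk k x = min (g x) (real k)" for k :: nat and x
 have [measurable]: "gk k : Bm borel" for k unfolding gk_def by measurable
 have adm: "admissible (gk k)" for k
  using g0 by (auto simp: admissible_def bounded_iff gk_def intro!: exI[of _ "real k"])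
 have gab: "\<bar>g x\<bar> <= C * wt n x" "\<bar>gk k x\<bar> <= C * wt n x" for k x
  using g0[of x] gC[of x] by (auto simp: gk_def)
 have sup: "(SUP k. ennreal (gk k x)) = ennreal (g x)" for x
 proof (rule SUP_eqI)
  show "ennreal (gk k x) <= ennreal (g x)" for k by (intro ennreal_leI) (simp add: gk_def)
  fix y assume y: "!!i. i : UNIV ==> ennreal (gk i x) <= y"
  obtain k :: nat where "g x <= real k" using real_arch_simple by blast
  then show "ennreal (g x) <= y" using y[of k] by (simp add: gk_def)
 qed
 have inc: "incseq (%k. ennreal (gk k x))" for x
  by (intro incseq_SucI ennreal_leI) (auto simp: gk_def min_def)
 have nnI: "(\<integral>\<^sup>+x. ennreal (gk k x) \<partial>(X t p)) = ennreal (I t (gk k) p)" if "p : space M" for k p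
  unfolding I_def using that g0
  by (intro nn_integral_eq_integral integrable_X_bounded[where B="real k"]) (auto simp: gk_def)
 have "(\<integral>\<^sup>+p. (\<integral>\<^sup>+x. ennreal (g x) \<partial>(X t p)) \<partial>M) = (\<integral>\<^sup>+p. (SUP k. \<integral>\<^sup>+x. ennreal (gk k x) \<partial>(X t p)) \<partial>M)"
 proof (intro nn_integral_cong)
  fix p assume w: "p : space M"
  have "(\<integral>\<^sup>+x. (SUP k. ennreal (gk k x)) \<partial>(X t p)) = (SUP k. \<integral>\<^sup>+x. ennreal (gk k x) \<partial>(X t p))"
   using inc w by (intro nn_integral_monotone_convergence_SUP measurable_X_iff)
    (auto simp: incseq_def le_fun_def)
  then show "(\<integral>\<^sup>+x. ennreal (g x) \<partial>(X t p)) = (SUP k. \<integral>\<^sup>+x. ennreal (gk k x) \<partial>(X t p))" by (simp add: sup)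
 qed
 also have "... = (SUP k. \<integral>\<^sup>+p. (\<integral>\<^sup>+x. ennreal (gk k x) \<partial>(X t p)) \<partial>M)"
 proof (rule nn_integral_monotone_convergence_SUP)
  show "incseq (%k p. \<integral>\<^sup>+x. ennreal (gk k x) \<partial>(X t p))"
   using inc by (auto simp: incseq_def le_fun_def intro!: nn_integral_mono)
  show "(%p. \<integral>\<^sup>+x. ennreal (gk k x) \<partial>(X t p)) : Bm M" for k
   by (rule F_meas[OF nn_integral_X_F[OF t order_refl]]) measurable
 qed
 also have "... <= ennreal (LINT x|\<mu>. Pa t g x)"
 proof (rule SUP_least)
  fix k
  have "(\<integral>\<^sup>+p. (\<integral>\<^sup>+x. ennreal (gk k x) \<partial>(X t p)) \<partial>M) = (\<integral>\<^sup>+p. ennreal (I t (gk k) p) \<partial>M)"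
   by (intro nn_integral_cong nnI)
  also have "... <= ennreal (LINT x|\<mu>. Pa t (gk k) x)" by (rule moment_le_bounded[OF t adm])
  also have "... <= ennreal (LINT x|\<mu>. Pa t g x)"
  proof (intro ennreal_leI integral_mono)
   show "integrable \<mu> (Pa t (gk k))" by (rule integrable_mu_bound[OF _ Pa_bound[OF _ gab(2) t]]) measurable
   show "integrable \<mu> (Pa t g)" by (rule integrable_mu_bound[OF _ Pa_bound[OF _ gab(1) t]]) measurable
   show "Pa t (gk k) x <= Pa t g x" for x
   proof -
    have "OU_P \<sigma> b t (gk k) x <= OU_P \<sigma> b t g x"
     by (rule OU_P_mono[OF _ gab(2) gm gab(1)]) (auto simp: gk_def)
    then show ?thesis by (simp add: Pa_eq)
   qed
  qed
  finally show "(\<integral>\<^sup>+p. (\<integral>\<^sup>+x. ennreal (gk k x) \<partial>(X t p)) \<partial>M) <= ennreal (LINT x|\<mu>. Pa t g x)" .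
 qed
 finally show ?thesis .
qed

lemma AE_integrable_X:
 fixes g :: "'a => real"
 assumes t: "0 <= t" and gm[measurable]: "g : Bm borel" and gC: "!!x. \<bar>g x\<bar> <= C * wt n x"
 shows "AE p in M. integrable (X t p) g"
proof -
 have "(\<integral>\<^sup>+p. (\<integral>\<^sup>+x. ennreal \<bar>g x\<bar> \<partial>(X t p)) \<partial>M) <= ennreal (LINT x|\<mu>. Pa t (%x. \<bar>g x\<bar>) x)"
  using gC by (intro moment_le_nn t) auto
 also have "... < \<infinity>" by simp
 finally have "AE p in M. (\<integral>\<^sup>+x. ennreal \<bar>g x\<bar> \<partial>(X t p)) ~= \<infinity>"
  by (intro nn_integral_noteq_infinite F_meas[OF nn_integral_X_F[OF t order_refl]]) auto
 then show ?thesis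
 proof (rule AE_mp, intro AE_I2 impI)
  fix p assume "p : space M" "(\<integral>\<^sup>+x. ennreal \<bar>g x\<bar> \<partial>(X t p)) ~= \<infinity>"
  then show "integrable (X t p) g"
   unfolding integrable_iff_bounded by (auto simp: less_top intro: measurable_X_iff)
 qed
qed

lemma moment_le:
 assumes t: "0 <= t" and gm[measurable]: "g : Bm borel" and g0: "!!x. 0 <= g x" and gC: "!!x. g x <= C * wt n x"
 shows "integrable M (I t g)" "(LINT p|M. I t g p) <= (LINT x|\<mu>. Pa t g x)"
proof -
 have [measurable]: "I t g : Bm M" by (rule I_M[OF t gm])
 have p0: "0 <= (LINT x|\<mu>. Pa t g x)" using g0 by (intro integral_nonneg_AE AE_I2 Pa_nonneg)
 have "(\<integral>\<^sup>+p. ennreal (I t g p) \<partial>M) <= (\<integral>\<^sup>+p. (\<integral>\<^sup>+x. ennreal (g x) \<partial>(X t p)) \<partial>M)"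
 proof (intro nn_integral_mono)
  fix p assume w: "p : space M"
  show "ennreal (I t g p) <= (\<integral>\<^sup>+x. ennreal (g x) \<partial>(X t p))"
  proof (cases "integrable (X t p) g")
   case True
   then show ?thesis unfolding I_def using g0 by (subst nn_integral_eq_integral) auto
  qed (simp add: I_def not_integrable_integral_eq)
 qed
 also have "... <= ennreal (LINT x|\<mu>. Pa t g x)" by (rule moment_le_nn[OF t gm g0 gC])
 finally have le: "(\<integral>\<^sup>+p. ennreal (I t g p) \<partial>M) <= ennreal (LINT x|\<mu>. Pa t g x)" .
 show int: "integrable M (I t g)"
  using le I_nonneg[of g t, OF g0] by (intro integrableI_nonneg) (auto simp: top_unique less_top intro: order_le_less_trans)
 have "ennreal (LINT p|M. I t g p) <= ennreal (LINT x|\<mu>. Pa t g x)"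
  using le nn_integral_eq_integral[OF int] I_nonneg[of g t, OF g0] by simp
 then show "(LINT p|M. I t g p) <= (LINT x|\<mu>. Pa t g x)" using p0 by simp
qed

end

section \<open>Continuity and monotonicity in the test function\<close>

context ou
begin

lemma OU_P_tendsto:
 fixes h :: "nat => 'a::euclidean_space => real"
 assumes [measurable]: "!!k. h k : Bm borel" "g : Bm borel"
  and b: "!!k x. \<bar>h k x\<bar> <= C * wt n x" and lim: "!!x. (%k. h k x) ----> g x"
 shows "(%k. OU_P \<sigma> b t (h k) x) ----> OU_P \<sigma> b t g x"
 unfolding OU_P_eq
proof (rule integral_dominated_convergence)
 show "integrable std_gauss (%z. C * wt n (exp (- b * t) *\<^sub>R x + sd t *\<^sub>R z))"
  by (intro integrable_mult_right integrable_OU[where C=1 and n=n]) auto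
qed (use b lim in auto)

end

context super_ou
begin

lemma Pa_tendsto:
 fixes h :: "nat => 'a::euclidean_space => real"
 assumes "!!k. h k : Bm borel" "g : Bm borel"
  and "!!k x. \<bar>h k x\<bar> <= C * wt n x" and "!!x. (%k. h k x) ----> g x"
 shows "(%k. Pa t (h k) x) ----> Pa t g x"
 unfolding Pa_eq by (intro tendsto_scaleR tendsto_const OU_P_tendsto[OF assms])

lemma Pa_mono:
 fixes f g :: "'a::euclidean_space => real"
 assumes "f : Bm borel" "!!y. \<bar>f y\<bar> <= C * wt n y"
  and "g : Bm borel" "!!y. \<bar>g y\<bar> <= E * wt m y" and "!!y. f y <= g y"
 shows "Pa t f x <= Pa t g x"
 unfolding Pa_eq using OU_P_mono[OF assms, of t x] by simp

text \<open>The growth constant of P^alpha h on [0, T], raised to at least 1 as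
  \<open>wt_powr\<close> requires.\<close>

definition zr_const :: "'a::euclidean_space itself => real => real => nat => real" where
 "zr_const TY T C n = max 1 (exp (\<alpha> * T) * (C * growth_const TY n))"

lemma Zr_integrand:
 fixes h :: "'a::euclidean_space => real"
 assumes hm: "h : Bm borel" and h0: "!!x. 0 <= h x" and hC: "!!x. h x <= C * wt n x"
  and r: "0 <= r" "r <= T"
 shows "\<bar>\<eta> * (Pa r h y) powr (1 + \<beta>)\<bar> <= (\<eta> * (2 * (zr_const TYPE('a) T C n)\<^sup>2)) * wt (2 * n) y"
proof -
 have "\<bar>Pa r h y\<bar> <= exp (\<alpha> * T) * (C * growth_const TYPE('a) n) * wt n y"
  using Pa_norm_le[OF hm, of C n r T y] hC h0 r by simp
 also have "... <= zr_const TYPE('a) T C n * wt n y" unfolding zr_const_def by (intro mult_right_mono) auto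
 finally have "Pa r h y powr (1 + \<beta>) <= 2 * (zr_const TYPE('a) T C n)\<^sup>2 * wt (2 * n) y"
  using beta_pos beta_lt_1 Pa_nonneg[of h r y, OF h0] by (intro wt_powr) (auto simp: zr_const_def)
 then show ?thesis using eta_pos by (simp add: abs_mult mult.assoc)
qed

lemma Zr_measurable [measurable]:
 fixes h :: "'a::euclidean_space => real"
 assumes [measurable]: "h : Bm borel" shows "Zr T h : Bm borel"
 unfolding Zr_def by measurable

lemma Zr_nonneg: "0 <= Zr T h x"
 unfolding Zr_def using eta_pos by (intro duh_nonneg) auto

lemma Zr_bound:
 fixes h :: "'a::euclidean_space => real"
 assumes [measurable]: "h : Bm borel" and h0: "!!x. 0 <= h x" and hC: "!!x. h x <= C * wt n x" and T: "0 <= T"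
 shows "\<bar>Zr T h x\<bar> <= (T * (exp (\<bar>\<alpha>\<bar> * T) * (\<eta> * (2 * (zr_const TYPE('a) T C n)\<^sup>2) * growth_const TYPE('a) (2 * n)))) * wt (2 * n) x"
 unfolding Zr_def
 using duh_abs_le[OF _ Zr_integrand[OF assms(1-3)] T, where a=\<alpha> and x=x] by (simp add: mult.assoc)

lemma Zr_mono:
 fixes h g :: "'a::euclidean_space => real"
 assumes [measurable]: "h : Bm borel" "g : Bm borel"
  and h0: "!!x. 0 <= h x" and hg: "!!x. h x <= g x" and gC: "!!x. g x <= C * wt n x"
 shows "Zr T h x <= Zr T g x"
proof -
 have g0: "0 <= g x" and hC: "h x <= C * wt n x" for x
  using h0[of x] hg[of x] gC[of x] by linarith+
 have ab: "\<bar>h x\<bar> <= C * wt n x" "\<bar>g x\<bar> <= C * wt n x" for x using h0[of x] g0[of x] hC[of x] gC[of x] by auto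
 show ?thesis
  unfolding Zr_def
 proof (rule duh_mono[OF _ Zr_integrand[OF assms(1) h0 hC] _ Zr_integrand[OF assms(2) g0 gC]])
  fix r y
  show "\<eta> * Pa r h y powr (1 + \<beta>) <= \<eta> * Pa r g y powr (1 + \<beta>)"
   using eta_pos beta_pos Pa_nonneg[of h r y, OF h0] Pa_mono[OF assms(1) ab(1) assms(2) ab(2) hg, of r y]
   by (intro mult_left_mono powr_mono2) auto
 qed measurable
qed

lemma Zr_tendsto:
 fixes h :: "nat => 'a::euclidean_space => real"
 assumes [measurable]: "!!k. h k : Bm borel" "g : Bm borel"
  and h0: "!!k x. 0 <= h k x" and hC: "!!k x. h k x <= C * wt n x" and lim: "!!x. (%k. h k x) ----> g x"
 shows "(%k. Zr T (h k) x) ----> Zr T g x"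
 unfolding Zr_def
proof (rule duh_tendsto[OF _ _ Zr_integrand[OF assms(1) h0 hC]])
 fix r y
 have ab: "\<bar>h k x\<bar> <= C * wt n x" for k x using h0[of k x] hC[of k x] by simp
 show "(%k. \<eta> * Pa r (h k) y powr (1 + \<beta>)) ----> \<eta> * Pa r g y powr (1 + \<beta>)"
  using beta_pos Pa_nonneg[of "h _" r y, OF h0]
  by (intro tendsto_mult tendsto_const tendsto_powr2 Pa_tendsto[OF assms(1,2) ab lim]) auto
qed measurable

end

context super_ou_X
begin

subsection \<open>Extinction\<close>

text \<open>A population of mass below e at time q is likely to have little mass at time T: the
  Laplace functional and 1 - exp(-x) <= x bound the conditional mean of 1 - exp(-Y_T) by exp(alpha
  T) e.\<close>

lemma extinct_step:
 assumes q: "0 <= q" "q <= T" and A: "A : sets (F q)" and Ae: "!!p. p : A ==> Y q p < e"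
 shows "(LINT p|M. indicator A p * (1 - exp (- Y T p))) <= exp (\<alpha> * T) * e * measure M A"
proof -
 have AM[measurable]: "A : sets M" by (rule F_sets[OF A])
 have AS: "p : space M" if "p : A" for p using sets.sets_into_space[OF AM] that by auto
 have Ym[measurable]: "Y T : Bm M" using q by (intro Y_M) auto
 have [measurable]: "V (%_::'a. 1) (T - q) : Bm borel" by (intro V_measurable) auto
 have [measurable]: "I q (V (%_::'a. 1) (T - q)) : Bm M" by (intro I_M q) auto
 have "(LINT p|M. indicator A p * exp (- I (q + (T - q)) (%_. 1) p))
   = (LINT p|M. indicator A p * exp (- I q (V (%_. 1) (T - q)) p))"
  using q A by (intro markov[where B=1]) (auto simp: indicator_def)
 moreover have "(LINT p|M. indicator A p * exp (- I (q + (T - q)) (%_. 1) p)) = (LINT p|M. indicator A p * exp (- Y T p))"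
  by (intro Bochner_Integration.integral_cong) (auto simp: I_const)
 ultimately have eq: "(LINT p|M. indicator A p * exp (- Y T p)) = (LINT p|M. indicator A p * exp (- I q (V (%_. 1) (T - q)) p))"
  by simp
 have bd: "\<bar>indicator A p * exp (- z)\<bar> <= 1" if "0 <= z" for z :: real and p using that by (auto simp: indicator_def)
 have V0: "0 <= V (%_::'a. 1) (T - q) x" for x by (intro V_nonneg) auto
 have i1: "integrable M (%p. indicator A p * exp (- Y T p))"
  using bd by (intro P.integrable_const_bound[where B=1]) auto
 have i2: "integrable M (%p. indicator A p * exp (- I q (V (%_. 1) (T - q)) p))"
  using bd I_nonneg[OF V0, of q] by (intro P.integrable_const_bound[where B=1]) auto
 have i0: "integrable M (%p. indicator A p :: real)" by (intro integrable_real_indicator) (auto simp: P.emeasure_eq_measure)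
 have "(LINT p|M. indicator A p * (1 - exp (- Y T p))) = (LINT p|M. indicator A p) - (LINT p|M. indicator A p * exp (- Y T p))"
  using i0 i1 by (simp add: right_diff_distrib)
 also have "... = (LINT p|M. indicator A p - indicator A p * exp (- I q (V (%_. 1) (T - q)) p))"
  unfolding eq using i0 i2 by simp
 also have "... <= (LINT p|M. exp (\<alpha> * T) * e * indicator A p)"
 proof (rule integral_mono)
  fix p assume w: "p : space M"
  show "indicator A p - indicator A p * exp (- I q (V (%_. 1) (T - q)) p) <= exp (\<alpha> * T) * e * indicator A p"
  proof (cases "p : A")
   case True
   have Vle: "V (%_::'a. 1) (T - q) x <= exp (\<alpha> * T)" for x
   proof -
    have "V (%_::'a. 1) (T - q) x <= exp (\<alpha> * (T - q))"
     using V_le[of "%_::'a. 1" "T - q" x] q by (simp add: Pa_eq)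
    also have "... <= exp (\<alpha> * T)" using q alpha_pos by simp
    finally show ?thesis .
   qed
   have "1 - exp (- I q (V (%_. 1) (T - q)) p) <= I q (V (%_. 1) (T - q)) p"
    using exp_ge_add_one_self[of "- I q (V (%_. 1) (T - q)) p"] by simp
   also have "... <= exp (\<alpha> * T) * Y q p" using Vle V0 w by (intro I_le_Y) auto
   also have "... <= exp (\<alpha> * T) * e" using Ae[OF True] by (intro mult_left_mono) auto
   finally show ?thesis using True by simp
  qed simp
 qed (use i0 i2 in auto)
 finally show ?thesis by simp
qed

text \<open>The event is split according to the first grid time with small mass, and the pieces are
  disjoint; hence the bound does not depend on the number of grid points.\<close>

lemma extinct_grid:
 fixes q :: "nat => real"
 assumes q: "!!i. i < m ==> 0 <= q i & q i <= T" and mono: "!!i j. i <= j ==> j < m ==> q i <= q j"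
 shows "(LINT p|M. indicator {p : space M. \<exists>i<m. Y (q i) p < e} p * (1 - exp (- Y T p)))
  <= exp (\<alpha> * T) * e * measure M {p : space M. \<exists>i<m. Y (q i) p < e}"
 using assms
proof (induction m)
 case (Suc m)
 have T: "0 <= T" using Suc.prems(1)[of m] by auto
 let ?E = "{p : space M. \<exists>i<m. Y (q i) p < e}"
 define A where "A = {p : space M. Y (q m) p < e & (\<forall>i<m. \<not> Y (q i) p < e)}"
 have Yq: "Y (q i) : Bm (F (q m))" if "i <= m" for i
  using Suc.prems(1)[of i] Suc.prems(2)[of i m] that by (intro Y_F) auto
 have A: "A : sets (F (q m))"
 proof -
  have L: "{p : space (F (q m)). Y (q i) p < e} : sets (F (q m))" if "i <= m" for i
   by (rule borel_measurable_less[OF Yq[OF that] borel_measurable_const])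
  have "{p : space (F (q m)). Y (q m) p < e & (\<forall>i\<in>{..<m}. \<not> Y (q i) p < e)} : sets (F (q m))"
   by (intro sets.sets_Collect_conj sets.sets_Collect_finite_All sets.sets_Collect_neg L) auto
  then show ?thesis by (simp add: A_def Ball_def lessThan_iff)
 qed
 have [measurable]: "Y (q i) : Bm M" if "i < Suc m" for i using Suc.prems(1)[OF that] by (intro Y_M) auto
 have E[measurable]: "?E : sets M"
 proof -
  have "{p : space M. \<exists>i\<in>{..<m}. Y (q i) p < e} : sets M"
   by (intro sets.sets_Collect_finite_Ex) auto
  then show ?thesis by (simp add: Bex_def lessThan_iff)
 qed
 have AM[measurable]: "A : sets M" by (rule F_sets[OF A])
 have [measurable]: "Y T : Bm M" by (rule Y_M[OF T])
 have eq: "{p : space M. \<exists>i<Suc m. Y (q i) p < e} = ?E \<union> A" and dis: "?E \<inter> A = {}"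
  by (auto simp: A_def less_Suc_eq)
 have int: "integrable M (%p. indicator S p * (1 - exp (- Y T p)))" if "S : sets M" for S
  using that by (intro P.integrable_const_bound[where B=1]) (auto simp: indicator_def)
 have "(LINT p|M. indicator (?E \<union> A) p * (1 - exp (- Y T p)))
  = (LINT p|M. indicator ?E p * (1 - exp (- Y T p)) + indicator A p * (1 - exp (- Y T p)))"
  using dis by (intro Bochner_Integration.integral_cong) (auto simp: indicator_def)
 also have "... = (LINT p|M. indicator ?E p * (1 - exp (- Y T p))) + (LINT p|M. indicator A p * (1 - exp (- Y T p)))"
  by (rule Bochner_Integration.integral_add[OF int[OF E] int[OF AM]])
 also have "... <= exp (\<alpha> * T) * e * measure M ?E + exp (\<alpha> * T) * e * measure M A"
 proof (rule add_mono)
  show "(LINT p|M. indicator ?E p * (1 - exp (- Y T p))) <= exp (\<alpha> * T) * e * measure M ?E"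
   using Suc.prems by (intro Suc.IH) auto
  show "(LINT p|M. indicator A p * (1 - exp (- Y T p))) <= exp (\<alpha> * T) * e * measure M A"
   using Suc.prems(1)[of m] A by (intro extinct_step[where q="q m"]) (auto simp: A_def)
 qed
 also have "... = exp (\<alpha> * T) * e * measure M (?E \<union> A)"
  using P.finite_measure_Union[OF E AM dis] by (simp add: distrib_left)
 finally show ?case unfolding eq .
qed simp

lemma Y_right_continuous:
 assumes w: "p : space M" and s: "0 <= s"
 shows "((%r. Y r p) \<longlongrightarrow> Y s p) (at_right s)"
proof -
 have c: "continuous_on UNIV (%x::'a. 1::real) & bounded (range (%x::'a. 1::real))" by simp
 have "\<forall>p\<in>space M. \<forall>g::'a => real. continuous_on UNIV g & bounded (range g) -->
    (\<forall>t\<ge>0. ((%s. \<integral>x. g x \<partial>(X s p)) \<longlongrightarrow> (LINT x|(X t p). g x)) (at_right t))"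
  using superOU unfolding superOU_def by (elim conjE)
 from this[THEN bspec, OF w, THEN spec, THEN mp, OF c, THEN spec, THEN mp, OF s]
 have "((%r. \<integral>x. (1::real) \<partial>(X r p)) \<longlongrightarrow> (LINT x|(X s p). 1)) (at_right s)" .
 then show ?thesis by (simp add: Y_def space_X[OF w])
qed

text \<open>Mass 0 is absorbing, although the times s range over a continuum. By right continuity a
  zero at s forces mass below every threshold at some dyadic time after s, and the grid bound is
  uniform in the mesh. This takes the place of a strong Markov argument.\<close>

lemma extinct_AE:
 assumes T: "0 <= T"
 shows "AE p in M. (\<exists>s\<in>{0..<T}. Y s p = 0) --> Y T p = 0"
proof (cases "T = 0")
 case False
 then have T0: "0 < T" using T by simp
 define q where "q n i = T * real i / 2 ^ n" for n i :: nat
 define E where "E e n = {p : space M. \<exists>i<2 ^ n. Y (q n i) p < e}" for e :: real and n :: nat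
 define E0 where "E0 = (\<Inter>k::nat. \<Union>n. E (inverse (Suc k)) n)"
 have qb: "0 <= q n i & q n i <= T" if "i < 2 ^ n" for n i
 proof -
  have "real i / 2 ^ n <= 1" using that by (simp add: field_simps)
  then have "T * (real i / 2 ^ n) <= T * 1" using T by (intro mult_left_mono) auto
  then show ?thesis using T by (simp add: q_def)
 qed
 have Em[measurable]: "E e n : sets M" for e n
 proof -
  have "{p : space M. \<exists>i\<in>{..<2 ^ n}. Y (q n i) p < e} : sets M"
  proof (intro sets.sets_Collect_finite_Ex)
   fix i :: nat assume i: "i : {..<2 ^ n}"
   have [measurable]: "Y (q n i) : Bm M" using qb[of i n] i by (intro Y_M) auto
   show "{p : space M. Y (q n i) p < e} : sets M" by measurable
  qed simp
  moreover have "E e n = {p : space M. \<exists>i\<in>{..<2 ^ n}. Y (q n i) p < e}"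
   unfolding E_def lessThan_def by blast
  ultimately show ?thesis by (simp only:)
 qed
 have Esub: "E e n \<subseteq> E e (Suc n)" for e n
 proof
  fix p assume "p : E e n"
  then have w: "p : space M" and "\<exists>i<2 ^ n. Y (q n i) p < e" by (simp_all add: E_def)
  then obtain i where i: "i < 2 ^ n" "Y (q n i) p < e" by (elim exE conjE)
  have "q (Suc n) (2 * i) = q n i" by (simp add: q_def)
  moreover have "2 * i < 2 ^ Suc n" using i(1) by simp
  ultimately have "\<exists>i<2 ^ Suc n. Y (q (Suc n) i) p < e" using i(2) by (intro exI[of _ "2 * i"]) simp
  then show "p : E e (Suc n)" using w by (simp add: E_def)
 qed
 have inc: "incseq (E e)" for e by (rule incseq_SucI) (rule Esub)
 have [measurable]: "Y T : Bm M" by (rule Y_M[OF T])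
 have b1: "(LINT p|M. indicator (E e n) p * (1 - exp (- Y T p))) <= exp (\<alpha> * T) * e" if "0 < e" for e n
 proof -
  have "(LINT p|M. indicator (E e n) p * (1 - exp (- Y T p))) <= exp (\<alpha> * T) * e * measure M (E e n)"
   unfolding E_def using qb T by (intro extinct_grid) (auto simp: q_def intro!: divide_right_mono mult_left_mono)
  also have "... <= exp (\<alpha> * T) * e * 1" using that by (intro mult_left_mono) auto
  finally show ?thesis by simp
 qed
 have b2: "(LINT p|M. indicator (\<Union>n. E e n) p * (1 - exp (- Y T p))) <= exp (\<alpha> * T) * e" if "0 < e" for e
 proof (rule LIMSEQ_le_const2)
  show "(%n. \<integral>p. indicator (E e n) p * (1 - exp (- Y T p)) \<partial>M) ----> (LINT p|M. indicator (\<Union>n. E e n) p * (1 - exp (- Y T p)))"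
  proof (rule integral_dominated_convergence[where w="%_. 1"])
   show "AE p in M. (%n. indicator (E e n) p * (1 - exp (- Y T p))) ----> indicator (\<Union>n. E e n) p * (1 - exp (- Y T p))"
    by (intro AE_I2 tendsto_mult tendsto_const LIMSEQ_indicator_incseq inc)
  qed (auto simp: indicator_def)
 qed (use b1[OF that] in auto)
 have E0m[measurable]: "E0 : sets M" unfolding E0_def by measurable
 have nn: "0 <= indicator E0 p * (1 - exp (- Y T p))" for p by (simp add: indicator_def)
 have int: "integrable M (%p. indicator S p * (1 - exp (- Y T p)))" if "S : sets M" for S
  using that by (intro P.integrable_const_bound[where B=1]) (auto simp: indicator_def)
 have le: "(LINT p|M. indicator E0 p * (1 - exp (- Y T p))) <= exp (\<alpha> * T) * inverse (real (Suc k))" for k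
 proof -
  have "(LINT p|M. indicator E0 p * (1 - exp (- Y T p))) <= (LINT p|M. indicator (\<Union>n. E (inverse (Suc k)) n) p * (1 - exp (- Y T p)))"
   by (intro integral_mono int mult_right_mono) (auto simp: E0_def indicator_def)
  then show ?thesis using b2[of "inverse (real (Suc k))"] by simp
 qed
 have lim: "(%k. exp (\<alpha> * T) * inverse (real (Suc k))) ----> 0"
  by (rule tendsto_mult_right_zero[OF LIMSEQ_inverse_real_of_nat])
 have "(LINT p|M. indicator E0 p * (1 - exp (- Y T p))) <= 0"
  by (rule LIMSEQ_le_const[OF lim]) (use le in blast)
 moreover have "0 <= (LINT p|M. indicator E0 p * (1 - exp (- Y T p)))"
  by (intro integral_nonneg_AE AE_I2 nn)
 ultimately have "(LINT p|M. indicator E0 p * (1 - exp (- Y T p))) = 0" by linarith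
 then have "AE p in M. indicator E0 p * (1 - exp (- Y T p)) = 0"
  using integral_nonneg_eq_0_iff_AE[OF int[OF E0m]] nn by simp
 then show ?thesis
 proof (rule AE_mp, intro AE_I2 impI)
  fix p assume w: "p : space M" and z: "indicator E0 p * (1 - exp (- Y T p)) = 0" and "\<exists>s\<in>{0..<T}. Y s p = 0"
  then obtain s where s: "0 <= s" "s < T" "Y s p = 0" by auto
  have "p : E0"
   unfolding E0_def
  proof
   fix k :: nat
   let ?e = "inverse (real (Suc k))"
   have "\<forall>\<^sub>F r in at_right s. Y r p < ?e"
    using order_tendstoD(2)[OF Y_right_continuous[OF w s(1)], of ?e] s(3) by simp
   then obtain d where d: "s < d" "!!r. s < r ==> r < d ==> Y r p < ?e"
    unfolding eventually_at_right_field by blast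
   define d' where "d' = min d T"
   have d': "s < d'" "d' <= T" "d' <= d" using d s by (auto simp: d'_def)
   obtain n where n: "T / (d' - s) < 2 ^ n" using real_arch_pow[of 2 "T / (d' - s)"] by auto
   then have gap: "T / 2 ^ n < d' - s" using d' by (simp add: field_simps)
   \<comment> \<open>The first grid point strictly after s; right continuity gives information about
     later times only.\<close>
   define i where "i = nat \<lfloor>s * 2 ^ n / T\<rfloor> + 1"
   have fl: "real (nat \<lfloor>s * 2 ^ n / T\<rfloor>) <= s * 2 ^ n / T" "s * 2 ^ n / T < real (nat \<lfloor>s * 2 ^ n / T\<rfloor>) + 1"
    using s T0 by auto
   have q1: "s < q n i" using fl(2) T0 by (simp add: q_def i_def field_simps)
   have "real i <= s * 2 ^ n / T + 1" using fl(1) by (simp add: i_def)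
   then have "T * real i / 2 ^ n <= T * (s * 2 ^ n / T + 1) / 2 ^ n"
    using T0 by (intro divide_right_mono mult_left_mono) auto
   also have "... = s + T / 2 ^ n" using T0 by (simp add: field_simps)
   finally have q2: "q n i < d'" using gap by (simp add: q_def)
   have "T * real i < T * 2 ^ n" 
   proof -
    have "T * real i / 2 ^ n < T" using q2 d'(2) by (simp add: q_def)
    then show ?thesis by (simp add: field_simps)
   qed
   then have "real i < 2 ^ n" using T0 by simp
   then have "i < 2 ^ n" by (metis of_nat_less_iff of_nat_numeral of_nat_power)
   then have "p : E ?e n" using w d(2)[OF q1] q2 d' by (auto simp: E_def)
   then show "p : (\<Union>n. E ?e n)" by blast
  qed
  then show "Y T p = 0" using z by simp
 qed
qed simp

abbreviation "surv \<equiv> survival M X"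

lemma surv_eq: "surv = {p : space M. \<forall>t\<ge>0. Y t p ~= 0}"
 by (simp add: survival_def Y_def)

definition "alive t = {p : space M. Y t p ~= 0}"

lemma alive_F: "0 <= t ==> alive t : sets (F t)"
 unfolding alive_def using borel_measurable_neq[of "Y t" "F t" "%_. 0"] Y_F[of t t] by simp

lemma alive_M [measurable]: "0 <= t ==> alive t : sets M"
 by (rule F_sets[OF alive_F])

text \<open>By absorption a path that has died is almost surely still dead at all later times of the
  sequence; this ties the uncountable intersection defining survival to single times.\<close>

lemma AE_alive_tendsto:
 assumes tau: "!!n. 0 <= \<tau> n" "filterlim \<tau> at_top sequentially"
 shows "AE p in M. (%n. indicator (alive (\<tau> n)) p :: real) ----> indicator surv p"
proof -
 have "AE p in M. \<forall>n. (\<exists>s\<in>{0..<\<tau> n}. Y s p = 0) --> Y (\<tau> n) p = 0"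
  unfolding AE_all_countable using extinct_AE[OF tau(1)] by blast
 then show ?thesis
 proof (rule AE_mp, intro AE_I2 impI)
  fix p assume w: "p : space M" and H: "\<forall>n. (\<exists>s\<in>{0..<\<tau> n}. Y s p = 0) --> Y (\<tau> n) p = 0"
  show "(%n. indicator (alive (\<tau> n)) p :: real) ----> indicator surv p"
  proof (cases "p : surv")
   case True
   then have "indicator (alive (\<tau> n)) p = (1::real)" for n using tau(1) by (auto simp: surv_eq alive_def)
   then show ?thesis using True by simp
  next
   case False
   then obtain s where s: "0 <= s" "Y s p = 0" using w by (auto simp: surv_eq)
   have "\<forall>\<^sub>F n in sequentially. s < \<tau> n" using tau(2) by (simp add: filterlim_at_top_dense)
   then have "\<forall>\<^sub>F n in sequentially. (indicator (alive (\<tau> n)) p :: real) = 0"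
   proof eventually_elim
    case (elim n)
    then have "Y (\<tau> n) p = 0" using H s by force
    then show ?case by (simp add: alive_def)
   qed
   then show ?thesis using False by (simp add: tendsto_eventually)
  qed
 qed
qed

lemma surv_sub_alive: "0 <= t ==> surv \<subseteq> alive t"
 by (auto simp: surv_eq alive_def)

lemma prob_alive_tendsto:
 assumes tau: "!!n. 0 <= \<tau> n" "filterlim \<tau> at_top sequentially"
 shows "(%n. measure M (alive (\<tau> n))) ----> measure M surv"
proof -
 have [measurable]: "alive (\<tau> n) : sets M" for n using tau(1) by (rule alive_M)
 have "(%n. \<integral>p. indicator (alive (\<tau> n)) p \<partial>M) ----> (LINT p|M. (indicator surv p :: real))"
 proof (rule integral_dominated_convergence[where w="%_. 1"])
  show "AE p in M. (%n. indicator (alive (\<tau> n)) p :: real) ----> indicator surv p"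
   by (rule AE_alive_tendsto[OF tau])
 qed auto
 then show ?thesis by (simp add: sets.sets_into_space Int_absorb1)
qed

section \<open>Survival probability and the order of the mass on survival\<close>

definition "mass = measure \<mu> UNIV"

lemma mass_pos: "0 < mass"
 using mu_nonzero unfolding mass_def by (simp add: mu.emeasure_eq_measure zero_less_measure_iff)

lemma laplace_Y:
 assumes "0 <= t" "0 <= l"
 shows "(LINT p|M. exp (- (l * Y t p))) = exp (- (mass * scal TYPE('a) l t))"
proof -
 have "(LINT p|M. exp (- (l * Y t p))) = (LINT p|M. exp (- I t (%_. l) p))"
  by (intro Bochner_Integration.integral_cong) (auto simp: I_const)
 also have "... = exp (- (LINT x|\<mu>. V (%_::'a. l) t x))" using assms by (intro laplace_X) auto
 finally show ?thesis using assms by (simp add: V_eq_scal mass_def)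
qed

lemma integrable_exp_Y: "0 <= t ==> 0 <= l ==> integrable M (%p. exp (- (l * Y t p)))"
 using Y_M[of t] by (intro P.integrable_const_bound[where B=1]) auto

text \<open>P(Y_t = 0) is at most E exp(-l Y_t), and with l = k exp(-alpha t) the flow is at least k
  / 2 at time t, uniformly in t.\<close>

lemma surv_pos: "0 < measure M surv"
proof -
 obtain k where k: "0 < k" "!!t. 0 <= t ==> k / 2 <= scal TYPE('a) (k * exp (- \<alpha> * t)) t"
  using scal_lower[where 'a='a] by blast
 have "1 - exp (- (mass * (k / 2))) <= measure M (alive (real n))" for n
 proof -
  let ?l = "k * exp (- \<alpha> * real n)"
  have [measurable]: "alive (real n) : sets M" "Y (real n) : Bm M" by (auto intro: alive_M Y_M)
  have "1 - measure M (alive (real n)) = (LINT p|M. 1 - indicator (alive (real n)) p)"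
   by (subst Bochner_Integration.integral_diff) (auto simp: P.prob_space sets.sets_into_space Int_absorb1 P.emeasure_eq_measure)
  also have "... <= (LINT p|M. exp (- (?l * Y (real n) p)))"
   using k(1) by (intro integral_mono integrable_exp_Y Bochner_Integration.integrable_diff integrable_real_indicator)
    (auto simp: indicator_def alive_def P.emeasure_eq_measure)
  also have "... = exp (- (mass * scal TYPE('a) ?l (real n)))" using k(1) by (intro laplace_Y) auto
  also have "... <= exp (- (mass * (k / 2)))"
   using k(2)[of "real n"] mass_pos by simp
  finally show ?thesis by simp
 qed
 then have "1 - exp (- (mass * (k / 2))) <= measure M surv"
  using prob_alive_tendsto[of real] filterlim_real_sequentially by (intro LIMSEQ_le_const) auto
 moreover have "exp (- (mass * (k / 2))) < 1" using k(1) mass_pos by simp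
 ultimately show ?thesis by linarith
qed

text \<open>The limit of E exp(-l Y_t) as l tends to infinity is P(Y_t = 0), and the flow at time t
  is below vbar + e uniformly in l.\<close>

lemma prob_dead_ge:
 assumes e: "0 < e"
 shows "\<exists>T\<ge>0. \<forall>t\<ge>T. exp (- (mass * (vbar + e))) <= 1 - measure M (alive t)"
proof -
 obtain T where T: "0 <= T" "!!l t. 0 <= l ==> T <= t ==> scal TYPE('a) l t <= vbar + e"
  using scal_reach_above[OF e, where 'a='a] by blast
 have "exp (- (mass * (vbar + e))) <= 1 - measure M (alive t)" if t: "T <= t" for t
 proof -
  have t0: "0 <= t" using t T by simp
  have [measurable]: "alive t : sets M" "Y t : Bm M" using t0 by (auto intro: alive_M Y_M)
  have "(%k. \<integral>p. exp (- (real k * Y t p)) \<partial>M) ----> (LINT p|M. 1 - indicator (alive t) p)"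
  proof (rule integral_dominated_convergence[where w="%_. 1"])
   show "AE p in M. (%k. exp (- (real k * Y t p))) ----> 1 - indicator (alive t) p"
   proof (rule AE_I2)
    fix p assume w: "p : space M"
    show "(%k. exp (- (real k * Y t p))) ----> 1 - indicator (alive t) p"
    proof (cases "Y t p = 0")
     case False
     then have "0 < Y t p" using Y_nonneg[of t p] by linarith
     then have "exp (- Y t p) < 1" by simp
     then have lim: "(%k. exp (- Y t p) ^ k) ----> 0" by (rule LIMSEQ_realpow_zero[rotated]) simp
     have "exp (- (real k * Y t p)) = exp (- Y t p) ^ k" for k
      using exp_of_nat_mult[of k "- Y t p"] by simp
     then have "(%k. exp (- (real k * Y t p))) ----> 0" using lim by (simp only:)
     then show ?thesis using False w by (simp add: alive_def)
    qed (simp add: alive_def)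
   qed
  qed auto
  moreover have "(LINT p|M. 1 - indicator (alive t) p) = 1 - measure M (alive t)"
   by (subst Bochner_Integration.integral_diff) (auto simp: P.prob_space sets.sets_into_space Int_absorb1 P.emeasure_eq_measure)
  moreover have "exp (- (mass * (vbar + e))) <= (LINT p|M. exp (- (real k * Y t p)))" for k
   using laplace_Y[OF t0, of "real k"] T(2)[of "real k" t] t mass_pos by simp
  ultimately show ?thesis by (intro LIMSEQ_le_const) auto
 qed
 then show ?thesis using T(1) by blast
qed

text \<open>With l a suitable multiple of exp(-alpha t), both E exp(-l Y_t) and P(Y_t = 0) are close
  to exp(-mass vbar) for large t. Their difference is carried by the paths still alive, and on the
  event l Y_t <= 1 the integrand is at least 1 / e; hence that event has small probability among
  them.\<close>

lemma small_mass_gap: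
 assumes e: "0 < e"
 shows "\<exists>c>0. \<exists>T\<ge>0. \<forall>t\<ge>T. measure M {p : space M. Y t p ~= 0 & exp (- \<alpha> * t) * Y t p <= c} <= e"
proof -
 have "((%x. exp 1 * (exp (- (mass * (vbar - x))) - exp (- (mass * (vbar + x))))) \<longlongrightarrow>
   exp 1 * (exp (- (mass * (vbar - 0))) - exp (- (mass * (vbar + 0))))) (at_right 0)"
  by (intro tendsto_intros)
 then have "\<forall>\<^sub>F x in at_right 0. exp 1 * (exp (- (mass * (vbar - x))) - exp (- (mass * (vbar + x)))) < e"
  using e by (intro order_tendstoD(2)) auto
 then obtain d where d: "0 < d" "!!x. 0 < x ==> x < d ==> exp 1 * (exp (- (mass * (vbar - x))) - exp (- (mass * (vbar + x)))) < e"
  unfolding eventually_at_right_field by auto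
 define x where "x = d / 2"
 have x: "0 < x" "exp 1 * (exp (- (mass * (vbar - x))) - exp (- (mass * (vbar + x)))) < e" using d by (auto simp: x_def)
 obtain k where k: "0 < k" "!!t. 0 <= t ==> k / 2 <= scal TYPE('a) (k * exp (- \<alpha> * t)) t"
  using scal_lower[where 'a='a] by blast
 obtain S where S: "0 <= S" "!!l s t. 0 <= l ==> 0 <= s ==> k / 2 <= scal TYPE('a) l s ==> s + S <= t ==> vbar - x <= scal TYPE('a) l t"
  using scal_reach_below[of "k / 2" x, where 'a='a] k x by auto
 obtain T where T: "0 <= T" "!!t. T <= t ==> exp (- (mass * (vbar + x))) <= 1 - measure M (alive t)"
  using prob_dead_ge[OF x(1)] by blast
 \<comment> \<open>The factor exp(alpha S) lets the flow reach k / 2 already at time t - S, leaving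
   it the time S to come up to vbar - x.\<close>
 define th where "th = k * exp (\<alpha> * S)"
 have th: "0 < th" using k by (simp add: th_def)
 have "measure M {p : space M. Y t p ~= 0 & exp (- \<alpha> * t) * Y t p <= 1 / th} <= e" if t: "max S T <= t" for t
 proof -
  have t0: "0 <= t" "S <= t" "T <= t" using t T S by auto
  let ?l = "th * exp (- \<alpha> * t)"
  let ?B = "{p : space M. Y t p ~= 0 & exp (- \<alpha> * t) * Y t p <= 1 / th}"
  have l: "?l = k * exp (- \<alpha> * (t - S))"
  proof -
   have "exp (\<alpha> * S) * exp (- \<alpha> * t) = exp (- \<alpha> * (t - S))"
    by (subst exp_add[symmetric]) (simp add: algebra_simps)
   then show ?thesis by (simp add: th_def mult.assoc)
  qed
  have sl: "vbar - x <= scal TYPE('a) ?l t"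
   using k S(2)[of ?l "t - S" t] k(2)[of "t - S"] t0 th unfolding l by auto
  have [measurable]: "alive t : sets M" "Y t : Bm M" using t0 by (auto intro: alive_M Y_M)
  have Bm: "?B : sets M" by measurable
  have "measure M ?B = (LINT p|M. indicator ?B p)" using sets.sets_into_space[OF Bm] by (simp add: Int_absorb1)
  also have "... <= (LINT p|M. exp 1 * (exp (- (?l * Y t p)) - (1 - indicator (alive t) p)))"
  proof (rule integral_mono)
   show "integrable M (%p. indicator ?B p :: real)" using Bm by (intro integrable_real_indicator) (auto simp: P.emeasure_eq_measure)
   show "integrable M (%p. exp 1 * (exp (- (?l * Y t p)) - (1 - indicator (alive t) p)))"
    using th t0 by (intro integrable_mult_right Bochner_Integration.integrable_diff integrable_exp_Y integrable_real_indicator) (auto simp: P.emeasure_eq_measure)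
   fix p assume w: "p : space M"
   show "indicator ?B p <= exp 1 * (exp (- (?l * Y t p)) - (1 - indicator (alive t) p))"
   proof (cases "Y t p = 0")
    case True
    then show ?thesis by (simp add: alive_def)
   next
    case False
    then have al: "indicator (alive t) p = (1::real)" using w by (simp add: alive_def)
    show ?thesis
    proof (cases "p : ?B")
     case True
     then have "exp (- \<alpha> * t) * Y t p <= 1 / th" by blast
     then have "th * (exp (- \<alpha> * t) * Y t p) <= th * (1 / th)" using th by (intro mult_left_mono) auto
     then have "?l * Y t p <= 1" using th by (simp add: mult.assoc)
     then have "exp (-1) <= exp (- (?l * Y t p))" by simp
     then have "exp 1 * exp (-1) <= exp 1 * exp (- (?l * Y t p))" by (intro mult_left_mono) auto
     then show ?thesis using True al by (simp add: exp_minus)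
    qed (simp add: al)
   qed
  qed
  also have "... = exp 1 * (exp (- (mass * scal TYPE('a) ?l t)) - (1 - measure M (alive t)))"
  proof -
   have "(LINT p|M. exp (- (?l * Y t p)) - (1 - indicator (alive t) p))
     = (LINT p|M. exp (- (?l * Y t p))) - (LINT p|M. 1 - indicator (alive t) p)"
    using th t0 by (intro Bochner_Integration.integral_diff integrable_exp_Y Bochner_Integration.integrable_diff integrable_real_indicator) (auto simp: P.emeasure_eq_measure)
   moreover have "(LINT p|M. 1 - indicator (alive t) p) = 1 - measure M (alive t)"
    by (subst Bochner_Integration.integral_diff) (auto simp: P.prob_space sets.sets_into_space Int_absorb1 P.emeasure_eq_measure)
   ultimately show ?thesis using laplace_Y[OF t0(1), of ?l] th by simp
  qed
  also have "... <= exp 1 * (exp (- (mass * (vbar - x))) - exp (- (mass * (vbar + x))))"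
  proof (intro mult_left_mono diff_mono)
   show "exp (- (mass * scal TYPE('a) ?l t)) <= exp (- (mass * (vbar - x)))"
    using mult_left_mono[OF sl, of mass] mass_pos by simp
  qed (use T(2)[OF t0(3)] in auto)
  also have "... <= e" using x by simp
  finally show ?thesis .
 qed
 then show ?thesis using th S(1) by (intro exI[of _ "1 / th"] conjI exI[of _ "max S T"]) auto
qed

end

context super_ou_X
begin

subsection \<open>Laplace transforms of the fluctuations\<close>

lemma I_tendsto:
 fixes h :: "nat => 'a => real"
 assumes w: "p : space M" and [measurable]: "!!k. h k : Bm borel" "g : Bm borel"
  and b: "!!k x. \<bar>h k x\<bar> <= C * wt n x" and lim: "!!x. (%k. h k x) ----> g x"
  and i: "integrable (X t p) (wt n)"
 shows "(%k. I t (h k) p) ----> I t g p"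
 unfolding I_def
proof (rule integral_dominated_convergence)
 show "integrable (X t p) (%x. C * wt n x)" using i by (intro integrable_mult_right)
qed (use w b lim in \<open>auto intro!: measurable_X_iff\<close>)

lemma integrable_X_wt:
 fixes h :: "'a => real"
 assumes w: "p : space M" and "h : Bm borel"
  and b: "!!x. \<bar>h x\<bar> <= C * wt n x" and i: "integrable (X t p) (wt n)"
 shows "integrable (X t p) h"
proof (rule Bochner_Integration.integrable_bound[OF integrable_mult_right[OF i, of C]])
 show "AE x in X t p. norm (h x) <= norm (C * wt n x)"
  using b by (intro AE_I2) (auto intro: order_trans[OF _ abs_ge_self])
qed (use assms in \<open>auto intro!: measurable_X_iff\<close>)

lemma AE_integrable_wt: "0 <= t ==> AE p in M. integrable (X t p) (wt n)"
 by (rule AE_integrable_X[where C=1 and n=n]) auto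

text \<open>On each event where L takes a given value the Markov property applies with a constant
  coefficient; finitely many values are summed.\<close>

lemma markov_simple:
 assumes t: "0 <= t" "0 <= s" and h: "admissible h" and G: "G : Bm (F t)"
  and GB: "!!p. p : space M ==> \<bar>G p\<bar> <= B"
  and J: "finite J" "!!c. c : J ==> 0 <= c"
  and L: "L : Bm (F t)" and LJ: "!!p. p : space M ==> L p : J"
 shows "(%p. I t (V (%y. L p * h y) s) p) : Bm (F t)"
  "(LINT p|M. G p * exp (- (L p * I (t + s) h p))) = (LINT p|M. G p * exp (- I t (V (%y. L p * h y) s) p))"
proof -
 have hm[measurable]: "h : Bm borel" and h0: "!!x. 0 <= h x" using h by (auto simp: admissible_def)
 have adm: "admissible (%y. c * h y)" if "c : J" for c
 proof -
  obtain B where B: "\<forall>x\<in>range h. norm x <= B" using h by (auto simp: admissible_def bounded_iff)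
  then have "\<forall>x\<in>range (%y. c * h y). norm x <= c * B"
   using J(2)[OF that] by (auto simp: abs_mult intro!: mult_left_mono)
  then show ?thesis using h0 J(2)[OF that] by (auto simp: admissible_def bounded_iff)
 qed
 have [measurable]: "G : Bm M" "L : Bm M" using G L by (auto intro: F_meas)
 have Im[measurable]: "I (t + s) h : Bm M" using t by (intro I_M) auto
 have VF: "I t (V (%y. c * h y) s) : Bm (F t)" if "c : J" for c
  using V_measurable[OF adm[OF that], of "%_. s" borel "%x. x"] t by (intro I_F) auto
 have LS: "{p : space (F t). L p = c} : sets (F t)" for c
  by (rule borel_measurable_eq[OF L borel_measurable_const])
 let ?e = "%c p. indicator {p : space (F t). L p = c} p :: real"
 have expand: "f (L p) p = (\<Sum>c\<in>J. ?e c p * f c p)" if "p : space M" for f :: "real => 'w => real" and p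
 proof -
  have "(\<Sum>c\<in>J. ?e c p * f c p) = (\<Sum>c\<in>J. if L p = c then f c p else 0)"
   using that by (intro sum.cong) (auto simp: indicator_def)
  also have "... = f (L p) p" using J(1) LJ[OF that] by simp
  finally show ?thesis by simp
 qed
 have mV: "(%p. \<Sum>c\<in>J. ?e c p * I t (V (%y. c * h y) s) p) : Bm (F t)"
  by (intro borel_measurable_sum borel_measurable_times borel_measurable_indicator LS VF)
 moreover have "(%p. I t (V (%y. L p * h y) s) p) : Bm (F t)
   \<longleftrightarrow> (%p. \<Sum>c\<in>J. ?e c p * I t (V (%y. c * h y) s) p) : Bm (F t)"
  using expand[of _ "%c p. I t (V (%y. c * h y) s) p"] by (intro measurable_cong) simp
 ultimately show VLF: "(%p. I t (V (%y. L p * h y) s) p) : Bm (F t)" by blast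
 have V0: "0 <= I t (V (%y. c * h y) s) p" if "c : J" for c p
  by (intro I_nonneg V_nonneg adm that)
 have G1: "(%p. ?e c p * G p) : Bm (F t)" for c
  by (intro borel_measurable_times borel_measurable_indicator LS G)
 have G1B: "\<bar>?e c p * G p\<bar> <= B" if "p : space M" for c p
  using GB[OF that] by (auto simp: indicator_def)
 have int: "integrable M (%p. ?e c p * G p * exp (- z p))"
  if zm[measurable]: "z : Bm M" and z: "!!p. 0 <= z p" for z c
 proof (rule P.integrable_const_bound[where B=B])
  show "AE p in M. norm (?e c p * G p * exp (- z p)) <= B"
  proof (rule AE_I2)
   fix p assume w: "p : space M"
   have "\<bar>?e c p * G p\<bar> * exp (- z p) <= B * 1"
    using G1B[OF w, of c] z[of p] order_trans[OF abs_ge_zero G1B[OF w, of c]] by (intro mult_mono) auto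
   then show "norm (?e c p * G p * exp (- z p)) <= B" by (simp add: abs_mult)
  qed
  have [measurable]: "(%p. ?e c p * G p) : Bm M" by (rule F_meas[OF G1])
  show "(%p. ?e c p * G p * exp (- z p)) : Bm M" by measurable
 qed
 have "(LINT p|M. G p * exp (- (L p * I (t + s) h p)))
   = (LINT p|M. (\<Sum>c\<in>J. ?e c p * G p * exp (- (c * I (t + s) h p))))"
  using expand[of _ "%c p. G p * exp (- (c * I (t + s) h p))"]
  by (intro Bochner_Integration.integral_cong) (auto simp: mult.assoc)
 also have "... = (\<Sum>c\<in>J. \<integral>p. ?e c p * G p * exp (- (c * I (t + s) h p)) \<partial>M)"
  using J(2) I_nonneg[of h "t + s", OF h0] by (intro Bochner_Integration.integral_sum int) auto
 also have "... = (\<Sum>c\<in>J. \<integral>p. ?e c p * G p * exp (- I t (V (%y. c * h y) s) p) \<partial>M)"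
 proof (rule sum.cong[OF refl])
  fix c assume c: "c : J"
  have "I (t + s) (%y. c * h y) p = c * I (t + s) h p" for p by (simp add: I_def)
  then show "(LINT p|M. ?e c p * G p * exp (- (c * I (t + s) h p)))
    = (LINT p|M. ?e c p * G p * exp (- I t (V (%y. c * h y) s) p))"
   using markov[OF t adm[OF c] G1[of c] G1B[of _ c]] by simp
 qed
 also have "... = (LINT p|M. (\<Sum>c\<in>J. ?e c p * G p * exp (- I t (V (%y. c * h y) s) p)))"
  using V0 F_meas[OF VF] by (intro Bochner_Integration.integral_sum[symmetric] int) auto
 also have "... = (LINT p|M. G p * exp (- I t (V (%y. L p * h y) s) p))"
  using expand[of _ "%c p. G p * exp (- I t (V (%y. c * h y) s) p)"]
  by (intro Bochner_Integration.integral_cong) (auto simp: mult.assoc)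
 finally show "(LINT p|M. G p * exp (- (L p * I (t + s) h p))) = (LINT p|M. G p * exp (- I t (V (%y. L p * h y) s) p))" .
qed

text \<open>Fixes the constant of \<open>V_expansion\<close> before the test function is chosen, so
  that one K serves all truncations of h.\<close>

definition expansion_const :: "real => nat => real => real => bool" where
 "expansion_const C n T K \<longleftrightarrow> 0 < K & (\<forall>g::'a => real. admissible g --> (\<forall>x. g x <= C * wt n x) -->
   (\<forall>c x. 0 <= c --> c <= 1 --> \<bar>c * Pa T g x - V (%y. c * g y) T x - c powr (1 + \<beta>) * Zr T g x\<bar>
    <= K * c powr (1 + \<beta> + kap) * wt (4 * n) x))"

lemma expansion_const_exists: "0 < T ==> \<exists>K. expansion_const C n T K"
 unfolding expansion_const_def using V_expansion[where 'a='a, of T C n] by blast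

text \<open>Rounding down preserves every bound that is monotone in L, and at stage k the values lie
  in a finite set.\<close>

lemma dyadic_floor:
 fixes l :: real
 assumes "0 <= l" "l <= 1"
 defines "d \<equiv> %k::nat. \<lfloor>2 ^ k * l\<rfloor> / 2 ^ k"
 shows "0 <= d k" "d k <= l" "d ----> l" "d k : (%j. real j / 2 ^ k) ` {..2 ^ k}"
proof -
 have f: "0 <= \<lfloor>2 ^ k * l\<rfloor>" for k using assms by simp
 then show "0 <= d k" by (simp add: d_def)
 have "real_of_int \<lfloor>2 ^ k * l\<rfloor> <= 2 ^ k * l" for k by simp
 then have le: "d k <= l" for k by (simp add: d_def field_simps)
 then show "d k <= l" .
 have "l - (1 / 2) ^ k <= d k" for k
 proof -
  have "2 ^ k * l - 1 <= real_of_int \<lfloor>2 ^ k * l\<rfloor>" by linarith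
  then have "(2 ^ k * l - 1) / 2 ^ k <= d k" unfolding d_def by (intro divide_right_mono) auto
  then show ?thesis by (simp add: diff_divide_distrib power_one_over)
 qed
 moreover have "(%k. l - (1 / 2) ^ k) ----> l - 0" by (intro tendsto_intros LIMSEQ_realpow_zero) auto
 ultimately show "d ----> l" using le by (intro tendsto_sandwich[of "%k. l - (1 / 2) ^ k" d _ "%_. l"]) auto
 have "2 ^ k * l <= 2 ^ k * 1" using assms by (intro mult_left_mono) auto
 then have "\<lfloor>2 ^ k * l\<rfloor> <= \<lfloor>2 ^ k :: real\<rfloor>" by (intro floor_mono) simp
 also have "\<lfloor>2 ^ k :: real\<rfloor> = 2 ^ k" by (metis floor_of_int of_int_numeral of_int_power)
 finally have "nat \<lfloor>2 ^ k * l\<rfloor> <= 2 ^ k" using f[of k] by (simp add: nat_le_iff)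
 moreover have "d k = real (nat \<lfloor>2 ^ k * l\<rfloor>) / 2 ^ k" using f[of k] by (simp add: d_def)
 ultimately show "d k : (%j. real j / 2 ^ k) ` {..2 ^ k}" by blast
qed

text \<open>On A the exponent L^(1 + beta) X_t(Z h) is within e of the constant q, and the remainder
  of the expansion is at most e; this produces the factors exp(q - 2e) and exp(q + 2e). The bound J
  on L X_t(P^alpha h) is what licenses dominated convergence when the cutoff of h and the rounding
  of L are removed.\<close>

lemma core_laplace:
 assumes t: "0 <= t" and T: "0 < T" and hm[measurable]: "h : Bm borel"
  and h0: "!!x. 0 <= h x" and hC: "!!x. h x <= C * wt n x" and K: "expansion_const C n T K"
  and A: "A : sets (F t)" and L: "L : Bm (F t)" and L01: "!!p. p : space M ==> 0 <= L p & L p <= 1"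
  and q: "!!p. p : A ==> \<bar>L p powr (1 + \<beta>) * I t (Zr T h) p - q\<bar> <= e"
  and er: "!!p. p : A ==> K * L p powr (1 + \<beta> + kap) * I t (wt (4 * n)) p <= e"
  and J: "!!p. p : A ==> L p * I t (Pa T h) p <= J"
 defines "W \<equiv> %p. indicator A p * exp (- (L p * (I (t + T) h p - I t (Pa T h) p)))"
 shows "integrable M W" "exp (q - 2 * e) * measure M A <= (LINT p|M. W p)" "(LINT p|M. W p) <= exp (q + 2 * e) * measure M A"
proof -
 have K0: "0 < K" using K by (simp add: expansion_const_def)
 have AM[measurable]: "A : sets M" by (rule F_sets[OF A])
 have AS: "p : space M" if "p : A" for p using sets.sets_into_space[OF AM] that by auto
 have LM[measurable]: "L : Bm M" by (rule F_meas[OF L])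
 have hC0: "\<bar>h x\<bar> <= C * wt n x" for x using h0[of x] hC[of x] by simp
 have C0: "0 <= C" using order_trans[OF abs_ge_zero hC0[of 0]] by (simp add: zero_le_mult_iff) (smt (verit) wt_pos)
 define Cz where "Cz = T * (exp (\<bar>\<alpha>\<bar> * T) * (\<eta> * (2 * (zr_const TYPE('a) T C n)\<^sup>2) * growth_const TYPE('a) (2 * n)))"
 define Cp where "Cp = exp (\<alpha> * T) * (C * growth_const TYPE('a) n)"
 have PF[measurable]: "I t (Pa T g) : Bm (F t)" if "g : Bm borel" for g
  using t that by (intro I_F) measurable
 have ZF[measurable]: "I t (Zr T g) : Bm (F t)" if "g : Bm borel" for g
  using t that by (intro I_F Zr_measurable) auto
 have WF: "I t (wt (4 * n)) : Bm (F t)" using t by (intro I_F) auto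
 note [measurable] = F_meas[OF PF] F_meas[OF ZF] F_meas[OF WF]
 have IhM[measurable]: "I (t + T) g : Bm M" if "g : Bm borel" for g
  using t T that by (intro I_M) auto
 define hk where "hk k x = min (h x) (real k)" for k :: nat and x
 have hkm[measurable]: "hk k : Bm borel" for k unfolding hk_def by measurable
 have hk0: "0 <= hk k x" and hkh: "hk k x <= h x" and hkC: "hk k x <= C * wt n x" for k x
  using h0[of x] hC[of x] by (auto simp: hk_def)
 have hkab: "\<bar>hk k x\<bar> <= C * wt n x" for k x using hk0[of k x] hkC[of k x] by simp
 have hka: "admissible (hk k)" for k
  using hk0 by (auto simp: admissible_def bounded_iff hk_def intro!: exI[of _ "real k"])
 have hklim: "(%k. hk k x) ----> h x" for x
 proof (rule tendsto_eventually)
  obtain N :: nat where "h x <= real N" using real_arch_simple by blast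
  then show "\<forall>\<^sub>F k in sequentially. hk k x = h x"
   by (intro eventually_sequentiallyI[of N]) (auto simp: hk_def)
 qed
 define Lk where "Lk k p = \<lfloor>2 ^ k * L p\<rfloor> / 2 ^ k" for k :: nat and p
 have LkF[measurable]: "Lk k : Bm (F t)" for k
  unfolding Lk_def using L by measurable
 have LkM[measurable]: "Lk k : Bm M" for k by (rule F_meas[OF LkF])
 have Lk: "0 <= Lk k p" "Lk k p <= L p" "(%k. Lk k p) ----> L p" "Lk k p : (%j. real j / 2 ^ k) ` {..2 ^ k}"
  if "p : space M" for k p
  using dyadic_floor(1,2,4)[of "L p" k] dyadic_floor(3)[of "L p"] L01[OF that] unfolding Lk_def by blast+
 \<comment> \<open>The compensating factor is past-measurable and bounded by exp J, so it can be
   carried through the Markov property.\<close>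
 define G where "G p = indicator A p * exp (L p * I t (Pa T h) p)" for p
 have GF: "G : Bm (F t)" unfolding G_def using A L PF[OF hm] by measurable
 have GM[measurable]: "G : Bm M" by (rule F_meas[OF GF])
 have G0: "0 <= G p" for p by (simp add: G_def)
 have GB: "\<bar>G p\<bar> <= exp J" for p using J by (auto simp: G_def indicator_def)
 have Pn: "0 <= I t (Pa T g) p" if "!!x. 0 <= g x" for g p by (intro I_nonneg Pa_nonneg that)
 let ?ok = "%p. integrable (X t p) (wt (4 * n)) & integrable (X t p) (wt n) & integrable (X t p) (wt (2 * n)) & integrable (X (t + T) p) (wt n)"
 have AEi: "AE p in M. ?ok p"
  using AE_integrable_wt[of t "4 * n"] AE_integrable_wt[of t n] AE_integrable_wt[of t "2 * n"] AE_integrable_wt[of "t + T" n] t T by auto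
 let ?B = "%k. \<integral>p. G p * exp (- (Lk k p * I (t + T) (hk k) p)) \<partial>M"
 let ?v = "%k p. I t (V (%y. Lk k p * hk k y) T) p"
 have ms: "(%p. ?v k p) : Bm (F t)" "?B k = (LINT p|M. G p * exp (- ?v k p))" for k
 proof -
  have "finite ((%j. real j / 2 ^ k) ` {..2 ^ k})" "!!c. c : (%j. real j / 2 ^ k) ` {..2 ^ k} ==> 0 <= c" by auto
  from markov_simple[OF t less_imp_le[OF T] hka GF GB this LkF Lk(4)]
  show "(%p. ?v k p) : Bm (F t)" "?B k = (LINT p|M. G p * exp (- ?v k p))" by blast+
 qed
 note [measurable] = F_meas[OF ms(1)]
 have Weq: "W p = G p * exp (- (L p * I (t + T) h p))" for p
  by (simp add: W_def G_def right_diff_distrib exp_diff exp_minus field_simps)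
 have I0: "0 <= I (t + T) g p" if "!!x. 0 <= g x" for g p by (rule I_nonneg[OF that])
 have GeB: "\<bar>G p * exp (- z)\<bar> <= exp J" if "0 <= z" for z p
 proof -
  have "\<bar>G p\<bar> * exp (- z) <= exp J * 1" using GB[of p] that by (intro mult_mono) auto
  then show ?thesis by (simp add: abs_mult)
 qed
 show intW: "integrable M W"
  unfolding Weq[abs_def]
 proof (rule P.integrable_const_bound[where B="exp J"])
  show "AE p in M. norm (G p * exp (- (L p * I (t + T) h p))) <= exp J"
   using L01 I0[of h, OF h0] GeB by (intro AE_I2) auto
 qed measurable
 have Blim: "?B ----> (LINT p|M. W p)"
  unfolding Weq
 proof (rule integral_dominated_convergence[where w="%_. exp J"])
  show "AE p in M. (%k. G p * exp (- (Lk k p * I (t + T) (hk k) p))) ----> G p * exp (- (L p * I (t + T) h p))"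
   using AEi
  proof (rule AE_mp, intro AE_I2 impI)
   fix p assume w: "p : space M" and i: "?ok p"
   have "(%k. I (t + T) (hk k) p) ----> I (t + T) h p"
    using i by (intro I_tendsto[OF w _ _ hkab hklim]) auto
   then show "(%k. G p * exp (- (Lk k p * I (t + T) (hk k) p))) ----> G p * exp (- (L p * I (t + T) h p))"
    by (intro tendsto_mult tendsto_const tendsto_exp tendsto_minus Lk(3)[OF w])
  qed
  show "AE p in M. norm (G p * exp (- (Lk k p * I (t + T) (hk k) p))) <= exp J" for k
   using Lk(1) I0[of "hk k", OF hk0] GeB by (intro AE_I2) auto
 qed auto
 \<comment> \<open>The signs s = 1 and s = -1 give the upper and the lower bound for the conditional
   exponent at stage k; \<open>?y\<close> is the limit of \<open>?x\<close>.\<close>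
 let ?x = "%s k p. - (Lk k p * I t (Pa T (hk k)) p) + Lk k p powr (1 + \<beta>) * I t (Zr T (hk k)) p + s * (K * Lk k p powr (1 + \<beta> + kap) * I t (wt (4 * n)) p)"
 let ?y = "%s p. - (L p * I t (Pa T h) p) + L p powr (1 + \<beta>) * I t (Zr T h) p + s * (K * L p powr (1 + \<beta> + kap) * I t (wt (4 * n)) p)"
 \<comment> \<open>The pointwise expansion is integrated against X_t, which is possible where the
   weights are integrable.\<close>
 have vx: "?x (-1) k p <= - ?v k p & - ?v k p <= ?x 1 k p"
  if w: "p : space M" and i: "integrable (X t p) (wt (4 * n))" "integrable (X t p) (wt n)" "integrable (X t p) (wt (2 * n))" for k p
 proof -
  define c where "c = Lk k p"
  have c: "0 <= c" "c <= 1" using Lk(1,2)[OF w, of k] L01[OF w] by (auto simp: c_def)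
  have adm: "admissible (%y. c * hk k y)"
   using hk0 c by (auto simp: admissible_def bounded_iff hk_def abs_mult intro!: exI[of _ "real k"] mult_le_one)
    (smt (verit) mult_left_le_one_le mult_nonneg_nonneg of_nat_0_le_iff)
  have Vm: "V (%y. c * hk k y) T : Bm borel" by (intro V_measurable adm) auto
  have Pcb: "\<bar>Pa T (hk k) x\<bar> <= Cp * wt n x" for x unfolding Cp_def using hkab T by (intro Pa_bound) auto
  have iP: "integrable (X t p) (Pa T (hk k))" by (rule integrable_X_wt[OF w _ Pcb i(2)]) measurable
  have iZ: "integrable (X t p) (Zr T (hk k))"
   using Zr_bound[OF hkm hk0 hkC less_imp_le[OF T]] by (intro integrable_X_wt[OF w _ _ i(3)]) auto
  have iV: "integrable (X t p) (V (%y. c * hk k y) T)"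
  proof (rule Bochner_Integration.integrable_bound[OF iP])
   have Pc: "Pa T (%y. c * hk k y) x = c * Pa T (hk k) x" for x by (simp add: Pa_eq OU_P_eq)
   have "V (%y. c * hk k y) T x <= Pa T (hk k) x" for x
   proof -
    have "V (%y. c * hk k y) T x <= c * Pa T (hk k) x" using V_le[OF adm, of T x] T by (simp add: Pc)
    also have "... <= 1 * Pa T (hk k) x" using c Pa_nonneg[of "hk k" T x, OF hk0] by (intro mult_right_mono) auto
    finally show ?thesis by simp
   qed
   then show "AE x in X t p. norm (V (%y. c * hk k y) T x) <= norm (Pa T (hk k) x)"
    using V_nonneg[OF adm, of T] by (intro AE_I2) (auto intro: order_trans[OF _ abs_ge_self])
  qed (use Vm w in \<open>auto intro!: measurable_X_iff\<close>)
  have ptw: "\<bar>c * Pa T (hk k) x - V (%y. c * hk k y) T x - c powr (1 + \<beta>) * Zr T (hk k) x\<bar> <= K * c powr (1 + \<beta> + kap) * wt (4 * n) x" for x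
   using K hka hkC c unfolding expansion_const_def by blast
  have "\<bar>\<integral>x. c * Pa T (hk k) x - V (%y. c * hk k y) T x - c powr (1 + \<beta>) * Zr T (hk k) x \<partial>(X t p)\<bar>
    <= (LINT x|(X t p). K * c powr (1 + \<beta> + kap) * wt (4 * n) x)"
   using iP iZ iV i(1) ptw by (intro integral_abs_bound_integral) auto
  moreover have "(LINT x|(X t p). c * Pa T (hk k) x - V (%y. c * hk k y) T x - c powr (1 + \<beta>) * Zr T (hk k) x)
    = c * I t (Pa T (hk k)) p - I t (V (%y. c * hk k y) T) p - c powr (1 + \<beta>) * I t (Zr T (hk k)) p"
   using iP iZ iV by (simp add: I_def)
  moreover have "(LINT x|(X t p). K * c powr (1 + \<beta> + kap) * wt (4 * n) x) = K * c powr (1 + \<beta> + kap) * I t (wt (4 * n)) p"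
   by (simp add: I_def)
  ultimately show ?thesis unfolding c_def[symmetric] abs_le_iff by linarith
 qed
 have q': "L p powr (1 + \<beta>) * I t (Zr T h) p <= q + e" if "p : A" for p using q[OF that] unfolding abs_le_iff by linarith
 \<comment> \<open>The bound must not depend on k: cutoff and rounding lower the term with Z and the
   size of the remainder, and the term with the mean is nonpositive.\<close>
 have xb: "?x s k p <= q + 2 * e"
  if w: "p : A" and i: "integrable (X t p) (wt (4 * n))" "integrable (X t p) (wt n)" "integrable (X t p) (wt (2 * n))" and s: "s : {-1, 1}" for s k p
 proof -
  have wS: "p : space M" by (rule AS[OF w])
  have i4: "0 <= I t (wt (4 * n)) p" by (rule I_nonneg) auto
  have 1: "0 <= Lk k p * I t (Pa T (hk k)) p" using Lk(1)[OF wS] Pn[of "hk k", OF hk0] by auto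
  have "I t (Zr T (hk k)) p <= I t (Zr T h) p"
   unfolding I_def
  proof (rule integral_mono)
   show "integrable (X t p) (Zr T (hk k))" using Zr_bound[OF hkm hk0 hkC less_imp_le[OF T]] by (intro integrable_X_wt[OF wS _ _ i(3)]) auto
   show "integrable (X t p) (Zr T h)" using Zr_bound[OF hm h0 hC less_imp_le[OF T]] by (intro integrable_X_wt[OF wS _ _ i(3)]) auto
  qed (rule Zr_mono[OF hkm hm hk0 hkh hC])
  then have "Lk k p powr (1 + \<beta>) * I t (Zr T (hk k)) p <= L p powr (1 + \<beta>) * I t (Zr T h) p"
   using Lk(1,2)[OF wS, of k] beta_pos I_nonneg[of "Zr T (hk k)" t p, OF Zr_nonneg] by (intro mult_mono powr_mono2) auto
  moreover have "K * Lk k p powr (1 + \<beta> + kap) * I t (wt (4 * n)) p <= K * L p powr (1 + \<beta> + kap) * I t (wt (4 * n)) p"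
   using Lk(1,2)[OF wS, of k] beta_pos kap_pos i4 K0 by (intro mult_right_mono mult_left_mono powr_mono2) auto
  moreover have "0 <= K * Lk k p powr (1 + \<beta> + kap) * I t (wt (4 * n)) p" using K0 i4 by simp
  ultimately show ?thesis using 1 q'[OF w] er[OF w] s by auto
 qed
 have xlim: "(%k. ?x s k p) ----> ?y s p"
  if w: "p : space M" and i: "integrable (X t p) (wt (4 * n))" "integrable (X t p) (wt n)" "integrable (X t p) (wt (2 * n))" for s p
 proof -
  have "\<bar>Pa T (hk k) x\<bar> <= Cp * wt n x" for k x unfolding Cp_def using hkab T by (intro Pa_bound) auto
  then have "(%k. I t (Pa T (hk k)) p) ----> I t (Pa T h) p"
   by (intro I_tendsto[OF w _ _ _ Pa_tendsto[OF hkm hm hkab hklim] i(2)]) auto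
  moreover have "(%k. I t (Zr T (hk k)) p) ----> I t (Zr T h) p"
   using Zr_bound[OF hkm hk0 hkC less_imp_le[OF T]]
   by (intro I_tendsto[OF w _ _ _ Zr_tendsto[OF hkm hm hk0 hkC hklim] i(3)]) auto
  ultimately show ?thesis
   using beta_pos kap_pos Lk(1)[OF w] L01[OF w]
   by (intro tendsto_add tendsto_mult tendsto_minus tendsto_const tendsto_powr2 Lk(3)[OF w]) auto
 qed
 have Ulim: "(%k. \<integral>p. G p * exp (?x s k p) \<partial>M) ----> (LINT p|M. G p * exp (?y s p))"
  and Uint: "integrable M (%p. G p * exp (?x s k p))" "integrable M (%p. G p * exp (?y s p))" if s: "s : {-1, 1}" for s k
 proof -
  have bd: "AE p in M. norm (G p * exp (?x s k p)) <= exp J * exp (q + 2 * e)" for k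
   using AEi
  proof (rule AE_mp, intro AE_I2 impI)
   fix p assume w: "p : space M" and i: "?ok p"
   show "norm (G p * exp (?x s k p)) <= exp J * exp (q + 2 * e)"
   proof (cases "p : A")
    case True
    then have "\<bar>G p\<bar> * exp (?x s k p) <= exp J * exp (q + 2 * e)"
     using xb[OF True, of s k] i s GB[of p] by (intro mult_mono) auto
    then show ?thesis by (simp add: abs_mult)
   qed (simp add: G_def)
  qed
  have lim: "AE p in M. (%k. G p * exp (?x s k p)) ----> G p * exp (?y s p)"
   using AEi
  proof (rule AE_mp, intro AE_I2 impI)
   fix p assume w: "p : space M" and i: "?ok p"
   then show "(%k. G p * exp (?x s k p)) ----> G p * exp (?y s p)"
    by (intro tendsto_mult_left tendsto_exp xlim) auto
  qed
  have m: "(%p. G p * exp (?y s p)) : Bm M" "!!k. (%p. G p * exp (?x s k p)) : Bm M"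
   by measurable
  have ic: "integrable M (%_. exp J * exp (q + 2 * e))" by simp
  show "(%k. \<integral>p. G p * exp (?x s k p) \<partial>M) ----> (LINT p|M. G p * exp (?y s p))"
   by (rule integral_dominated_convergence[OF m ic lim bd])
  show "integrable M (%p. G p * exp (?x s k p))"
   by (rule integrable_dominated_convergence2[OF m ic lim bd])
  show "integrable M (%p. G p * exp (?y s p))"
   by (rule integrable_dominated_convergence[OF m ic lim bd])
 qed
 have vint: "integrable M (%p. G p * exp (- ?v k p))" for k
 proof (rule P.integrable_const_bound[where B="exp J"])
  show "AE p in M. norm (G p * exp (- ?v k p)) <= exp J"
  proof (rule AE_I2)
   fix p assume w: "p : space M"
   have "admissible (%y. Lk k p * hk k y)"
   proof -
    have "\<bar>Lk k p * hk k y\<bar> <= 1 * real k" for y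
     using Lk(1,2)[OF w, of k] L01[OF w] hk0[of k y] unfolding abs_mult by (intro mult_mono) (auto simp: hk_def)
    then show ?thesis using Lk(1)[OF w] hk0 by (auto simp: admissible_def bounded_iff)
   qed
   then have "0 <= ?v k p" by (intro I_nonneg V_nonneg)
   then show "norm (G p * exp (- ?v k p)) <= exp J" using GeB by simp
  qed
 qed measurable
 have up: "?B k <= (LINT p|M. G p * exp (?x 1 k p))" for k
  unfolding ms(2)
 proof (rule integral_mono_AE[OF vint])
  show "AE p in M. G p * exp (- ?v k p) <= G p * exp (?x 1 k p)"
   using AEi
  proof (rule AE_mp, intro AE_I2 impI)
   fix p assume w: "p : space M" and i: "?ok p"
   then have "exp (- ?v k p) <= exp (?x 1 k p)" using vx[OF w] by (simp only: exp_le_cancel_iff)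
   then show "G p * exp (- ?v k p) <= G p * exp (?x 1 k p)" by (intro mult_left_mono G0)
  qed
 qed (rule Uint, simp)
 have low: "(LINT p|M. G p * exp (?x (-1) k p)) <= ?B k" for k
  unfolding ms(2)
 proof (rule integral_mono_AE[OF _ vint])
  show "AE p in M. G p * exp (?x (-1) k p) <= G p * exp (- ?v k p)"
   using AEi
  proof (rule AE_mp, intro AE_I2 impI)
   fix p assume w: "p : space M" and i: "?ok p"
   then have "exp (?x (-1) k p) <= exp (- ?v k p)" using vx[OF w] by (simp only: exp_le_cancel_iff)
   then show "G p * exp (?x (-1) k p) <= G p * exp (- ?v k p)" by (intro mult_left_mono G0)
  qed
 qed (rule Uint, simp)
 have Wup: "(LINT p|M. W p) <= (LINT p|M. G p * exp (?y 1 p))"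
  by (rule LIMSEQ_le[OF Blim Ulim]) (use up in auto)
 have Wlow: "(LINT p|M. G p * exp (?y (-1) p)) <= (LINT p|M. W p)"
  by (rule LIMSEQ_le[OF Ulim Blim]) (use low in auto)
 have Gy: "G p * exp (?y s p) = indicator A p * exp (L p powr (1 + \<beta>) * I t (Zr T h) p + s * (K * L p powr (1 + \<beta> + kap) * I t (wt (4 * n)) p))" for s p
  by (simp add: G_def exp_add[symmetric] mult.assoc)
 have iA: "integrable M (%p. c * indicator A p)" for c :: real by (intro integrable_mult_right integrable_real_indicator) (auto simp: P.emeasure_eq_measure)
 have mA: "(LINT p|M. c * indicator A p) = c * measure M A" for c :: real
  using sets.sets_into_space[OF AM] by (simp add: Int_absorb1)
 have "(LINT p|M. G p * exp (?y 1 p)) <= (LINT p|M. exp (q + 2 * e) * indicator A p)"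
 proof (rule integral_mono[OF Uint(2) iA])
  show "G p * exp (?y 1 p) <= exp (q + 2 * e) * indicator A p" for p
   unfolding Gy using q'[of p] er[of p] by (cases "p : A") auto
 qed simp
 then show "(LINT p|M. W p) <= exp (q + 2 * e) * measure M A" using Wup unfolding mA by linarith
 have "(LINT p|M. exp (q - 2 * e) * indicator A p) <= (LINT p|M. G p * exp (?y (-1) p))"
 proof (rule integral_mono[OF iA Uint(2)])
  show "exp (q - 2 * e) * indicator A p <= G p * exp (?y (-1) p)" for p
   unfolding Gy using q[of p] er[of p] by (cases "p : A") (auto simp: abs_le_iff)
 qed simp
 then show "exp (q - 2 * e) * measure M A <= (LINT p|M. W p)" using Wlow unfolding mA by linarith
qed

end

lemma distr_std_gauss_density:
 fixes m :: "'a::euclidean_space"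
 assumes "0 < c"
 shows "distr std_gauss borel (%z. m + c *\<^sub>R z) = density lborel (%y. ennreal (gauss_kernel c (y - m)))"
proof (rule measure_eqI)
 fix A :: "'a set" assume "A : sets (distr std_gauss borel (%z. m + c *\<^sub>R z))"
 then have A[measurable]: "A : sets borel" by simp
 have "emeasure (distr std_gauss borel (%z. m + c *\<^sub>R z)) A = (\<integral>\<^sup>+y. indicator A y \<partial>distr std_gauss borel (%z. m + c *\<^sub>R z))" by simp
 also have "... = (\<integral>\<^sup>+z. indicator A (m + c *\<^sub>R z) \<partial>std_gauss)" by (rule nn_integral_distr) auto
 also have "... = (\<integral>\<^sup>+y. ennreal (gauss_kernel c (y - m)) * indicator A y \<partial>lborel)"
  by (rule nn_integral_std_gauss_affine[OF assms]) auto
 also have "... = emeasure (density lborel (%y. ennreal (gauss_kernel c (y - m)))) A"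
  by (rule emeasure_density[symmetric]) auto
 finally show "emeasure (distr std_gauss borel (%z. m + c *\<^sub>R z)) A = emeasure (density lborel (%y. ennreal (gauss_kernel c (y - m)))) A" .
qed simp

context ou
begin

subsection \<open>Ergodicity of the Ornstein--Uhlenbeck semigroup\<close>

text \<open>The stationary law, a centred Gaussian whose density is identified with
  \<open>OU_phi\<close> below; \<open>stat g\<close> is the pairing of g with phi.\<close>

definition phim :: "'a::euclidean_space measure" where
 "phim = density lborel (%y. ennreal (gauss_kernel sd_inf y))"

definition stat :: "('a::euclidean_space => 'b::{banach,second_countable_topology}) => 'b" where
 "stat g = (LINT x|phim. g x)"

lemma phim_distr: "phim = distr std_gauss borel (%z. 0 + sd_inf *\<^sub>R z)"
 unfolding phim_def distr_std_gauss_density[OF sd_inf_pos] by simp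

lemma sets_phim [measurable_cong, simp]: "sets phim = sets borel"
 and space_phim [simp]: "space phim = UNIV"
 by (auto simp: phim_def)

lemma prob_space_phim: "prob_space (phim :: 'a::euclidean_space measure)"
 unfolding phim_distr by (rule std_gauss.prob_space_distr) auto

lemma OU_phi_eq: "OU_phi \<sigma> b x = gauss_kernel sd_inf x"
proof -
 have e: "2 * pi * sd_inf\<^sup>2 = inverse (b / (pi * \<sigma>\<^sup>2))"
  using b_pos sigma_pos by (simp add: sd_inf_def power_divide field_simps)
 have s: "2 * sd_inf\<^sup>2 = \<sigma>\<^sup>2 / b" using b_pos by (simp add: sd_inf_def power_divide field_simps)
 have "inverse (b / (pi * \<sigma>\<^sup>2)) powr (- real DIM('a) / 2) = (b / (pi * \<sigma>\<^sup>2)) powr (real DIM('a) / 2)"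
  using b_pos by (subst inverse_powr) (auto simp: powr_minus)
 then show ?thesis unfolding OU_phi_def gauss_kernel_def e s using b_pos by (simp add: field_simps)
qed

lemma stat_eq_lborel:
 assumes "g : Bm borel"
 shows "stat g = (LINT x|lborel. OU_phi \<sigma> b x *\<^sub>R g x)"
 unfolding stat_def phim_def OU_phi_eq using assms by (intro integral_density) auto

lemma integrable_phim:
 fixes g :: "'a::euclidean_space => 'b::{banach,second_countable_topology}"
 assumes gm[measurable]: "g : Bm borel" and "!!x. norm (g x) <= C * wt n x"
 shows "integrable phim g"
 unfolding phim_distr using integrable_std_gauss_wt[OF assms, of 0 sd_inf]
 by (subst integrable_distr_eq) auto

lemma sd_tendsto: "(sd \<longlongrightarrow> sd_inf) at_top"
proof -
 have "((%t. exp (- 2 * b * t)) \<longlongrightarrow> 0) at_top" using b_pos by real_asymp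
 then have "((%t. \<sigma> * sqrt ((1 - exp (- 2 * b * t)) / (2 * b))) \<longlongrightarrow> \<sigma> * sqrt ((1 - 0) / (2 * b))) at_top"
  using b_pos by (intro tendsto_intros) auto
 then show ?thesis by (simp add: ou_sd_def[abs_def] sd_inf_def real_sqrt_divide)
qed

lemma sd_mono: "0 <= s ==> s <= t ==> sd s <= sd t"
 unfolding ou_sd_def using b_pos sigma_pos
 by (intro mult_left_mono real_sqrt_le_mono divide_right_mono) auto

text \<open>From |y|^2 <= 2 |y - m|^2 + 2 |m|^2 the displacement m of the mean is absorbed by
  doubling the variance, which explains sqrt 2. The restriction t >= 1 keeps the variance away from
  0 in the normalizing factor.\<close>

lemma gauss_kernel_dominated:
 fixes x y :: "'a::euclidean_space"
 assumes t: "1 <= t"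
 defines "K \<equiv> (2 * pi * (sd 1)\<^sup>2) powr (- real DIM('a) / 2) * exp ((norm x)\<^sup>2 / (2 * sd_inf\<^sup>2)) / (2 * pi * (sqrt 2 * sd_inf)\<^sup>2) powr (- real DIM('a) / 2)"
 shows "gauss_kernel (sd t) (y - exp (- b * t) *\<^sub>R x) <= K * gauss_kernel (sqrt 2 * sd_inf) y"
proof -
 have s1: "0 < sd 1" "sd 1 <= sd t" "sd t <= sd_inf" using sd_pos[of 1] sd_mono[of 1 t] sd_le[of t] t by auto
 define m where "m = exp (- b * t) *\<^sub>R x"
 have nm: "norm m <= norm x" unfolding m_def using norm_drift_le[of t x] t by simp
 have p: "(2 * pi * (sd t)\<^sup>2) powr (- real DIM('a) / 2) <= (2 * pi * (sd 1)\<^sup>2) powr (- real DIM('a) / 2)"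
  using s1 by (intro powr_mono2') (auto intro!: power_mono)
 have "(norm y)\<^sup>2 <= (norm (y - m) + norm m)\<^sup>2"
  using norm_triangle_sub[of y m] by (intro power_mono) (auto simp: add.commute)
 also have "... <= 2 * (norm (y - m))\<^sup>2 + 2 * (norm m)\<^sup>2"
  using zero_le_power2[of "norm (y - m) - norm m"] by (simp add: power2_sum power2_diff)
 finally have "(norm y)\<^sup>2 / 2 - (norm m)\<^sup>2 <= (norm (y - m))\<^sup>2" by simp
 moreover have "(norm m)\<^sup>2 <= (norm x)\<^sup>2" using nm by (intro power_mono) auto
 ultimately have n: "(norm y)\<^sup>2 / 2 - (norm x)\<^sup>2 <= (norm (y - m))\<^sup>2" by linarith
 have "(sd t)\<^sup>2 <= sd_inf\<^sup>2" using s1 by (intro power_mono) auto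
 then have "(norm (y - m))\<^sup>2 / (2 * sd_inf\<^sup>2) <= (norm (y - m))\<^sup>2 / (2 * (sd t)\<^sup>2)"
  using s1 by (intro divide_left_mono) auto
 moreover have "((norm y)\<^sup>2 / 2 - (norm x)\<^sup>2) / (2 * sd_inf\<^sup>2) <= (norm (y - m))\<^sup>2 / (2 * sd_inf\<^sup>2)"
  using n by (intro divide_right_mono) auto
 moreover have "((norm y)\<^sup>2 / 2 - (norm x)\<^sup>2) / (2 * sd_inf\<^sup>2) = (norm y)\<^sup>2 / (2 * (sqrt 2 * sd_inf)\<^sup>2) - (norm x)\<^sup>2 / (2 * sd_inf\<^sup>2)"
  by (simp add: power_mult_distrib diff_divide_distrib)
 ultimately have "- (norm (y - m))\<^sup>2 / (2 * (sd t)\<^sup>2) <= (norm x)\<^sup>2 / (2 * sd_inf\<^sup>2) + - (norm y)\<^sup>2 / (2 * (sqrt 2 * sd_inf)\<^sup>2)"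
  by simp
 then have "exp (- (norm (y - m))\<^sup>2 / (2 * (sd t)\<^sup>2)) <= exp ((norm x)\<^sup>2 / (2 * sd_inf\<^sup>2)) * exp (- (norm y)\<^sup>2 / (2 * (sqrt 2 * sd_inf)\<^sup>2))"
  unfolding exp_add[symmetric] exp_le_cancel_iff .
 then have "gauss_kernel (sd t) (y - m) <= (2 * pi * (sd 1)\<^sup>2) powr (- real DIM('a) / 2) * (exp ((norm x)\<^sup>2 / (2 * sd_inf\<^sup>2)) * exp (- (norm y)\<^sup>2 / (2 * (sqrt 2 * sd_inf)\<^sup>2)))"
  unfolding gauss_kernel_def using p by (intro mult_mono) auto
 also have "... = K * gauss_kernel (sqrt 2 * sd_inf) y"
  using sd_inf_pos by (simp add: K_def gauss_kernel_def)
 finally show ?thesis unfolding m_def .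
qed

text \<open>g is merely measurable, so the integrand g(exp(-b t) x + sd t z) may fail to converge
  pointwise. Moving the time dependence into the Gaussian density, which does converge, makes
  dominated convergence available.\<close>

lemma OU_P_ergodic:
 fixes g :: "'a::euclidean_space => real"
 assumes gm[measurable]: "g : Bm borel" and gC: "!!x. \<bar>g x\<bar> <= C * wt n x"
 shows "((%t. OU_P \<sigma> b t g x) \<longlongrightarrow> stat g) at_top"
proof -
 define k where "k t y = gauss_kernel (sd t) (y - exp (- b * t) *\<^sub>R x) *\<^sub>R g y" for t and y
 obtain K where K: "!!t y. 1 <= t ==> gauss_kernel (sd t) (y - exp (- b * t) *\<^sub>R x) <= K * gauss_kernel (sqrt 2 * sd_inf) y"
  using gauss_kernel_dominated[of _ _ x] by blast
 let ?N = "density lborel (%y. ennreal (gauss_kernel (sqrt 2 * sd_inf) (y - 0))) :: 'a measure"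
 have eq: "OU_P \<sigma> b t g x = (LINT y|lborel. k t y)" if "0 < t" for t
 proof -
  have "OU_P \<sigma> b t g x = (LINT y|(distr std_gauss borel (%z. exp (- b * t) *\<^sub>R x + sd t *\<^sub>R z)). g y)"
   unfolding OU_P_eq by (rule integral_distr[symmetric]) auto
  also have "... = (LINT y|lborel. k t y)"
   unfolding distr_std_gauss_density[OF sd_pos[OF that]] k_def by (rule integral_density) auto
  finally show ?thesis .
 qed
 have "((%t. \<integral>y. k t y \<partial>lborel) \<longlongrightarrow> (LINT y|lborel. gauss_kernel sd_inf y *\<^sub>R g y)) at_top"
 proof (rule integral_dominated_convergence_at_top)
  show "(%y. gauss_kernel sd_inf y *\<^sub>R g y) : Bm lborel" by measurable
  show "k t : Bm lborel" for t unfolding k_def by measurable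
  have "integrable (distr std_gauss borel (%z::'a. 0 + (sqrt 2 * sd_inf) *\<^sub>R z)) g"
   using integrable_std_gauss_wt[of g C n 0 "sqrt 2 * sd_inf"] gC by (subst integrable_distr_eq) auto
  then have "integrable ?N g" using distr_std_gauss_density[of "sqrt 2 * sd_inf" "0::'a"] sd_inf_pos by simp
  then have "integrable lborel (%y. gauss_kernel (sqrt 2 * sd_inf) (y - 0) *\<^sub>R g y)"
   by (subst (asm) integrable_density) auto
  then have "integrable lborel (%y. K * norm (gauss_kernel (sqrt 2 * sd_inf) (y - 0) *\<^sub>R g y))"
   by (intro integrable_mult_right integrable_norm)
  then show "integrable lborel (%y. K * \<bar>gauss_kernel (sqrt 2 * sd_inf) y * g y\<bar>)" by simp
  show "AE y in lborel. ((%t. k t y) \<longlongrightarrow> gauss_kernel sd_inf y *\<^sub>R g y) at_top"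
  proof (rule AE_I2)
   fix y
   have e: "((%t. exp (- b * t)) \<longlongrightarrow> 0) at_top" using b_pos by real_asymp
   have "((%t. (2 * pi * (sd t)\<^sup>2) powr (- real DIM('a) / 2) * exp (- (norm (y - exp (- b * t) *\<^sub>R x))\<^sup>2 / (2 * (sd t)\<^sup>2)))
     \<longlongrightarrow> (2 * pi * sd_inf\<^sup>2) powr (- real DIM('a) / 2) * exp (- (norm (y - 0 *\<^sub>R x))\<^sup>2 / (2 * sd_inf\<^sup>2))) at_top"
    using sd_inf_pos by (intro tendsto_intros sd_tendsto e) auto
   then show "((%t. k t y) \<longlongrightarrow> gauss_kernel sd_inf y *\<^sub>R g y) at_top"
    unfolding k_def gauss_kernel_def by (intro tendsto_scaleR tendsto_const) simp
  qed
  show "\<forall>\<^sub>F t in at_top. AE y in lborel. norm (k t y) <= K * \<bar>gauss_kernel (sqrt 2 * sd_inf) y * g y\<bar>"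
   using eventually_ge_at_top[of "1::real"]
  proof eventually_elim
   case (elim t)
   have "gauss_kernel (sd t) (y - exp (- b * t) *\<^sub>R x) * \<bar>g y\<bar> <= K * gauss_kernel (sqrt 2 * sd_inf) y * \<bar>g y\<bar>" for y
    using K[OF elim, of y] by (intro mult_right_mono) auto
   then show ?case unfolding k_def by (intro AE_I2) (simp add: abs_mult mult.assoc)
  qed
 qed
 also have "(LINT y|lborel. gauss_kernel sd_inf y *\<^sub>R g y) = stat g"
  unfolding stat_def phim_def by (rule integral_density[symmetric]) auto
 finally show ?thesis
  by (rule Lim_transform_eventually) (use eventually_gt_at_top[of "0::real"] in \<open>eventually_elim; simp add: eq\<close>)
qed

lemma stat_nonneg: "(!!x. 0 <= g x) ==> 0 <= (stat g :: real)"
 unfolding stat_def by simp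

text \<open>Ergodicity in L^1 of the stationary law: the form that survives integration against X_t,
  whose normalized mean measure approaches a multiple of that law.\<close>

lemma stat_dev_tendsto:
 fixes g :: "'a::euclidean_space => real"
 assumes gm[measurable]: "g : Bm borel" and gC: "!!x. \<bar>g x\<bar> <= C * wt n x"
 shows "((%s. stat (%x. \<bar>OU_P \<sigma> b s g x - stat g\<bar>)) \<longlongrightarrow> 0) at_top"
proof -
 let ?C = "C * growth_const TYPE('a) n + \<bar>stat g\<bar>"
 have "((%s. \<integral>x. \<bar>OU_P \<sigma> b s g x - stat g\<bar> \<partial>(phim :: 'a measure)) \<longlongrightarrow> (LINT x|(phim :: 'a measure). 0)) at_top"
 proof (rule integral_dominated_convergence_at_top)
  show "(%x. \<bar>OU_P \<sigma> b s g x - stat g\<bar>) : Bm phim" for s by measurable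
  show "integrable phim (%x::'a. \<bar>?C\<bar> * wt n x)" by (intro integrable_mult_right integrable_phim[where C=1 and n=n]) auto
  show "AE x in phim. ((%s. \<bar>OU_P \<sigma> b s g x - stat g\<bar>) \<longlongrightarrow> 0) at_top"
   using OU_P_ergodic[OF assms] by (intro AE_I2 tendsto_rabs_zero) (simp add: LIM_zero_iff)
  show "\<forall>\<^sub>F s in at_top. AE x in phim. norm \<bar>OU_P \<sigma> b s g x - stat g\<bar> <= \<bar>?C\<bar> * wt n x"
   using eventually_ge_at_top[of "0::real"]
  proof eventually_elim
   case (elim s)
   have "\<bar>OU_P \<sigma> b s g x - stat g\<bar> <= \<bar>?C\<bar> * wt n x" for x
   proof -
    have "\<bar>OU_P \<sigma> b s g x\<bar> <= C * growth_const TYPE('a) n * wt n x"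
     using OU_P_norm_le[OF gm _ elim, of C n x] gC by simp
    moreover have "\<bar>stat g\<bar> * 1 <= \<bar>stat g\<bar> * wt n x" by (intro mult_left_mono) auto
    moreover have "?C * wt n x <= \<bar>?C\<bar> * wt n x" by (intro mult_right_mono) auto
    ultimately show ?thesis by (simp add: distrib_right)
   qed
   then show ?case by (intro AE_I2) simp
  qed
 qed simp
 then show ?thesis by (simp add: stat_def)
qed

end

context super_ou_X
begin

lemma mu_OU_P_tendsto:
 fixes g :: "'a => real"
 assumes gm[measurable]: "g : Bm borel" and gC: "!!x. \<bar>g x\<bar> <= C * wt n x"
 shows "((%t. \<integral>x. OU_P \<sigma> b t g x \<partial>\<mu>) \<longlongrightarrow> mass * stat g) at_top"
proof -
 have "((%t. \<integral>x. OU_P \<sigma> b t g x \<partial>\<mu>) \<longlongrightarrow> (LINT x|\<mu>. stat g)) at_top"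
 proof (rule integral_dominated_convergence_at_top)
  show "(%x. OU_P \<sigma> b s g x) : borel_measurable \<mu>" for s using sets_mu by measurable
  show "integrable \<mu> (%x. C * growth_const TYPE('a) n * wt n x)" by (intro integrable_mult_right integrable_mu_wt)
  show "AE x in \<mu>. ((%s. OU_P \<sigma> b s g x) \<longlongrightarrow> stat g) at_top" using OU_P_ergodic[OF assms] by (intro AE_I2)
  show "\<forall>\<^sub>F s in at_top. AE x in \<mu>. norm (OU_P \<sigma> b s g x) <= C * growth_const TYPE('a) n * wt n x"
   using eventually_ge_at_top[of "0::real"]
  proof eventually_elim
   case (elim s)
   then show ?case using OU_P_norm_le[OF gm _ elim, of C n] gC by (intro AE_I2) simp
  qed
 qed simp
 then show ?thesis by (simp add: mass_def)
qed

end

context super_ou_X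
begin

subsection \<open>The law of large numbers\<close>

text \<open>Chebyshev's inequality for exp(-Phi) - 1. A deviation |Phi| > R forces |exp(-Phi) - 1|
  >= 1 - exp(-R), on the negative side because cosh R >= 1, and the square expands into Laplace
  transforms at 1 and 2.\<close>

lemma exp_sq_deviation:
 assumes A[measurable]: "A : sets M" and Fm[measurable]: "\<Phi> : Bm M" and R: "0 <= R"
  and i: "integrable M (%z. indicator A z * exp (- \<Phi> z))" "integrable M (%z. indicator A z * exp (- (2 * \<Phi> z)))"
 shows "measure M {z\<in>A. R < \<bar>\<Phi> z\<bar>} * (1 - exp (- R))\<^sup>2
  <= (LINT z|M. indicator A z * exp (- (2 * \<Phi> z))) - 2 * (LINT z|M. indicator A z * exp (- \<Phi> z)) + measure M A"
proof -
 have AS: "A \<subseteq> space M" by (rule sets.sets_into_space[OF A])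
 have "{z\<in>A. R < \<bar>\<Phi> z\<bar>} = A \<inter> {z\<in>space M. R < \<bar>\<Phi> z\<bar>}" using AS by auto
 then have Bm[measurable]: "{z\<in>A. R < \<bar>\<Phi> z\<bar>} : sets M" by simp
 have iA: "integrable M (%z. indicator B z :: real)" if "B : sets M" for B
  using that by (intro integrable_real_indicator) (auto simp: P.emeasure_eq_measure)
 have ii: "integrable M (%z. indicator A z * exp (- (2 * \<Phi> z)) - 2 * (indicator A z * exp (- \<Phi> z)) + indicator A z)"
  using i iA[OF A] by auto
 have "measure M {z\<in>A. R < \<bar>\<Phi> z\<bar>} * (1 - exp (- R))\<^sup>2 = (LINT z|M. indicator {z\<in>A. R < \<bar>\<Phi> z\<bar>} z * (1 - exp (- R))\<^sup>2)"
  using sets.sets_into_space[OF Bm] by (simp add: Int_absorb1 Int_absorb2)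
 also have "... <= (LINT z|M. indicator A z * exp (- (2 * \<Phi> z)) - 2 * (indicator A z * exp (- \<Phi> z)) + indicator A z)"
 proof (rule integral_mono[OF integrable_mult_left[OF iA[OF Bm]] ii])
  fix z
  have e2: "exp (- (2 * \<Phi> z)) = (exp (- \<Phi> z))\<^sup>2" by (simp add: power2_eq_square flip: exp_add)
  have sq: "exp (- (2 * \<Phi> z)) - 2 * exp (- \<Phi> z) + 1 = (exp (- \<Phi> z) - 1)\<^sup>2" unfolding e2 by (simp add: power2_diff)
  have "(1 - exp (- R))\<^sup>2 <= (exp (- \<Phi> z) - 1)\<^sup>2" if "R < \<bar>\<Phi> z\<bar>"
  proof (cases "0 <= \<Phi> z")
   case True
   then have "1 - exp (- R) <= 1 - exp (- \<Phi> z)" "0 <= 1 - exp (- R)" using that R by auto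
   then have "(1 - exp (- R))\<^sup>2 <= (1 - exp (- \<Phi> z))\<^sup>2" by (intro power_mono) auto
   then show ?thesis by (simp add: power2_commute)
  next
   case False
   have "exp R - 1 >= 1 - exp (- R)"
    using exp_ge_add_one_self[of R] exp_ge_add_one_self[of "- R"] cosh_real_ge_1[of R] by (simp add: cosh_field_def)
   moreover have "exp R <= exp (- \<Phi> z)" using that False by simp
   ultimately have "1 - exp (- R) <= exp (- \<Phi> z) - 1" by linarith
   then show ?thesis using R by (intro power_mono) auto
  qed
  then show "indicator {z\<in>A. R < \<bar>\<Phi> z\<bar>} z * (1 - exp (- R))\<^sup>2
    <= indicator A z * exp (- (2 * \<Phi> z)) - 2 * (indicator A z * exp (- \<Phi> z)) + indicator A z"
   using sq zero_le_power2[of "exp (- \<Phi> z) - 1"] by (auto simp: indicator_def)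
 qed
 also have "... = (LINT z|M. indicator A z * exp (- (2 * \<Phi> z))) - 2 * (LINT z|M. indicator A z * exp (- \<Phi> z)) + measure M A"
  using i iA[OF A] AS by (simp add: Int_absorb1 Int_absorb2)
 finally show ?thesis .
qed

lemma prob_moment_le:
 fixes g :: "'a => real"
 assumes t: "0 <= t" and gm[measurable]: "g : Bm borel" and g0: "!!x. 0 <= g x" and gC: "!!x. g x <= C * wt n x" and K: "0 < K"
 shows "measure M {z\<in>space M. K <= exp (- \<alpha> * t) * I t g z} <= (LINT x|\<mu>. OU_P \<sigma> b t g x) / K"
proof -
 note m = moment_le[OF t gm g0 gC]
 have "measure M {z\<in>space M. K <= exp (- \<alpha> * t) * I t g z} <= (LINT z|M. exp (- \<alpha> * t) * I t g z) / K"
  using I_nonneg[of g t, OF g0] K m(1)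
  by (intro integral_Markov_inequality_measure[where A="{}"] integrable_mult_right) auto
 also have "... <= (LINT x|\<mu>. OU_P \<sigma> b t g x) / K"
 proof (intro divide_right_mono)
  have "exp (- \<alpha> * t) * (LINT z|M. I t g z) <= exp (- \<alpha> * t) * (LINT x|\<mu>. Pa t g x)" using m(2) by (intro mult_left_mono) auto
  also have "... = (LINT x|\<mu>. OU_P \<sigma> b t g x)" by (simp add: Pa_eq mult.assoc[symmetric] flip: exp_add)
  finally show "(LINT z|M. exp (- \<alpha> * t) * I t g z) <= (LINT x|\<mu>. OU_P \<sigma> b t g x)" by simp
 qed (use K in simp)
 finally show ?thesis .
qed

lemma prob_wt_le:
 assumes "0 <= t" "0 < K"
 shows "measure M {z\<in>space M. K <= exp (- \<alpha> * t) * I t (wt m) z} <= (growth_const TYPE('a) m * (LINT x|\<mu>. wt m x)) / K"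
proof -
 have b: "\<bar>OU_P \<sigma> b t (wt m) x\<bar> <= growth_const TYPE('a) m * wt m x" for x :: 'a
  using OU_P_wt[OF assms(1), of m x] OU_P_nonneg[of "wt m" t x] by simp
 have "(LINT x|\<mu>. OU_P \<sigma> b t (wt m) x) <= (LINT x|\<mu>. growth_const TYPE('a) m * wt m x)"
  using b by (intro integral_mono integrable_mu_bound[OF _ b] integrable_mult_right integrable_mu_wt) (auto simp: abs_le_iff)
 then have "(LINT x|\<mu>. OU_P \<sigma> b t (wt m) x) / K <= (growth_const TYPE('a) m * (LINT x|\<mu>. wt m x)) / K"
  using assms by (intro divide_right_mono) auto
 moreover have "measure M {z\<in>space M. K <= exp (- \<alpha> * t) * I t (wt m) z} <= (LINT x|\<mu>. OU_P \<sigma> b t (wt m) x) / K"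
  using assms by (intro prob_moment_le[where C=1 and n=m]) auto
 ultimately show ?thesis by linarith
qed

text \<open>The factor 2 is the price of raising the degree of the weight by
  \<open>wt_mono\<close>.\<close>

lemma I_mono_wt:
 fixes h :: "'a => real"
 assumes w: "z : space M" and [measurable]: "h : Bm borel" and b: "!!x. \<bar>h x\<bar> <= C * wt k x" and km: "k <= m"
  and i: "integrable (X t z) (wt m)"
 shows "integrable (X t z) h" "I t h z <= 2 * C * I t (wt m) z"
proof -
 have C0: "0 <= C" using order_trans[OF abs_ge_zero b[of 0]] wt_pos[of k "0::'a"] by (simp add: zero_le_mult_iff)
 have b2: "\<bar>h x\<bar> <= (2 * C) * wt m x" for x
  using order_trans[OF b mult_left_mono[OF wt_mono[OF km] C0], of x] by simp
 show ih: "integrable (X t z) h" by (rule integrable_X_wt[OF w _ b2 i]) simp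
 have "I t h z <= (LINT x|(X t z). (2 * C) * wt m x)" unfolding I_def
  using ih i b2 by (intro integral_mono integrable_mult_right) (auto simp: abs_le_iff)
 then show "I t h z <= 2 * C * I t (wt m) z" by (simp add: I_def)
qed

text \<open>The factor exp(-alpha t) is smaller than the natural scale of the fluctuation: the
  exponent exp(-alpha (1 + beta) t) X_t(Z h) is of order exp(-alpha beta t), so
  \<open>core_laplace\<close> applies with q = 0, and \<open>exp_sq_deviation\<close> turns the
  resulting limits at the points 1 and 2 into convergence in probability.\<close>

lemma fluctuation_tendsto:
 assumes T: "0 < T" and hm[measurable]: "h : Bm borel" and h0: "!!x. 0 <= h x" and hC: "!!x. h x <= C * wt n x" and e: "0 < e"
 shows "((%t. measure M {z : space M. e < \<bar>exp (- \<alpha> * t) * (I (t + T) h z - I t (Pa T h) z)\<bar>}) \<longlongrightarrow> 0) at_top"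
proof (rule tendstoI)
 fix \<epsilon> :: real assume eps: "0 < \<epsilon>"
 let ?m = "4 * n"
 define B where "B = growth_const TYPE('a) ?m * (LINT x|\<mu>. wt ?m x)"
 have B0: "0 <= B" unfolding B_def using growth_const_ge_1[of "TYPE('a)" ?m] by (intro mult_nonneg_nonneg) auto
 \<comment> \<open>Large enough for Markov's inequality to leave probability below epsilon / 2
   outside A.\<close>
 define K where "K = 4 * (B + 1) / \<epsilon>"
 have K0: "0 < K" using eps B0 by (simp add: K_def add_nonneg_pos)
 have BK: "B / K < \<epsilon> / 2"
 proof -
  have "B * 2 < \<epsilon> * K" using eps B0 by (simp add: K_def)
  then show ?thesis using K0 by (simp add: field_simps)
 qed
 obtain K1 where K1: "expansion_const C n T K1" using expansion_const_exists[OF T] by blast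
 have K10: "0 < K1" using K1 by (simp add: expansion_const_def)
 define d where "d = (1 - exp (- e))\<^sup>2"
 have d0: "0 < d" using e by (simp add: d_def)
 have "((%x::real. exp (2 * x) - 2 * exp (- (2 * x)) + 1) \<longlongrightarrow> exp (2 * 0) - 2 * exp (- (2 * 0)) + 1) (at_right 0)"
  by (intro tendsto_intros)
 then have "\<forall>\<^sub>F x in at_right (0::real). exp (2 * x) - 2 * exp (- (2 * x)) + 1 < d * \<epsilon> / 2"
  using d0 eps by (intro order_tendstoD) auto
 then have "\<forall>\<^sub>F x in at_right (0::real). 0 < x & exp (2 * x) - 2 * exp (- (2 * x)) + 1 < d * \<epsilon> / 2"
  using eventually_at_right_less[of "0::real"] by eventually_elim auto
 then obtain e0 :: real where e0: "0 < e0" "exp (2 * e0) - 2 * exp (- (2 * e0)) + 1 < d * \<epsilon> / 2"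
  using eventually_happens'[OF trivial_limit_at_right_real] by blast
 define Cz where "Cz = T * (exp (\<bar>\<alpha>\<bar> * T) * (\<eta> * (2 * (zr_const TYPE('a) T C n)\<^sup>2) * growth_const TYPE('a) (2 * n)))"
 have zb: "\<bar>Zr T h x\<bar> <= Cz * wt (2 * n) x" for x unfolding Cz_def using T by (intro Zr_bound hm h0 hC) auto
 have Cz0: "0 <= Cz" using order_trans[OF abs_ge_zero zb[of 0]] wt_pos[of "2*n" "0::'a"] by (simp add: zero_le_mult_iff)
 have "((%t. (2 powr (1 + \<beta>) * 2 * Cz * K) * exp (- (\<alpha> * \<beta>) * t)) \<longlongrightarrow> (2 powr (1 + \<beta>) * 2 * Cz * K) * 0) at_top"
  using alpha_pos beta_pos by (intro tendsto_mult_left) real_asymp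
 then have ev1: "\<forall>\<^sub>F t in at_top. (2 powr (1 + \<beta>) * 2 * Cz * K) * exp (- (\<alpha> * \<beta>) * t) < e0"
  using e0 by (intro order_tendstoD) auto
 have "((%t. (K1 * 2 powr (1 + \<beta> + kap) * K) * exp (- (\<alpha> * (\<beta> + kap)) * t)) \<longlongrightarrow> (K1 * 2 powr (1 + \<beta> + kap) * K) * 0) at_top"
  using alpha_pos beta_pos kap_pos by (intro tendsto_mult_left) real_asymp
 then have ev2: "\<forall>\<^sub>F t in at_top. (K1 * 2 powr (1 + \<beta> + kap) * K) * exp (- (\<alpha> * (\<beta> + kap)) * t) < e0"
  using e0 by (intro order_tendstoD) auto
 \<comment> \<open>Below 1 / 2, so that the factor L = 2 exp(-alpha t) does not exceed 1.\<close>
 have "((%t. exp (- \<alpha> * t)) \<longlongrightarrow> 0) at_top" using alpha_pos by real_asymp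
 then have ev3: "\<forall>\<^sub>F t in at_top. exp (- \<alpha> * t) < 1 / 2" by (intro order_tendstoD) auto
 show "\<forall>\<^sub>F t in at_top. dist (measure M {z : space M. e < \<bar>exp (- \<alpha> * t) * (I (t + T) h z - I t (Pa T h) z)\<bar>}) 0 < \<epsilon>"
  using ev1 ev2 ev3 eventually_ge_at_top[of "0::real"]
 proof eventually_elim
  case (elim t)
  define \<Phi> where "\<Phi> z = exp (- \<alpha> * t) * (I (t + T) h z - I t (Pa T h) z)" for z
  have [measurable]: "I t (wt ?m) : Bm (F t)" using elim(4) by (intro I_F) auto
  have [measurable]: "I t (wt ?m) : Bm M" "I (t + T) h : Bm M" "I t (Pa T h) : Bm M"
   using elim(4) T by (auto intro!: I_M Pa_meas1)
  have Fm[measurable]: "\<Phi> : Bm M" unfolding \<Phi>_def by measurable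
  define G where "G = {z : space M. integrable (X t z) (wt ?m)}"
  \<comment> \<open>Integrability is expressed by a finite extended integral, whose measurability
    with respect to the past is known.\<close>
  define A where "A = {z : space M. exp (- \<alpha> * t) * I t (wt ?m) z < K & (\<integral>\<^sup>+x. ennreal (wt ?m x) \<partial>(X t z)) < \<infinity>}"
  have nnF: "(%z. \<integral>\<^sup>+x. ennreal (wt ?m x) \<partial>(X t z)) : Bm (F t)"
   using elim(4) by (intro nn_integral_X_F) auto
  have AF: "A : sets (F t)"
  proof -
   have "{z : space (F t). exp (- \<alpha> * t) * I t (wt ?m) z < K & (\<integral>\<^sup>+x. ennreal (wt ?m x) \<partial>(X t z)) < \<infinity>} : sets (F t)"
    using nnF by measurable
   then show ?thesis by (simp add: A_def)
  qed
  have AM[measurable]: "A : sets M" by (rule F_sets[OF AF])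
  have AS: "z : space M" "exp (- \<alpha> * t) * I t (wt ?m) z < K" "integrable (X t z) (wt ?m)" if "z : A" for z
   using that by (auto simp: A_def intro!: integrableI_nonneg measurable_X_iff)
  have lap: "integrable M (%z. indicator A z * exp (- (a * \<Phi> z)))"
    "exp (- (2 * e0)) * measure M A <= (LINT z|M. indicator A z * exp (- (a * \<Phi> z)))"
    "(LINT z|M. indicator A z * exp (- (a * \<Phi> z))) <= exp (2 * e0) * measure M A" if a: "a : {1, 2}" for a
  proof -
   let ?L = "a * exp (- \<alpha> * t)"
   have L2: "0 <= ?L" "?L <= 2 * exp (- \<alpha> * t)" using a by auto
   then have L1: "?L <= 1" using elim(3) by linarith
   have pw: "?L powr p * exp (\<alpha> * t) <= 2 powr p * exp (- (\<alpha> * (p - 1)) * t)" if "0 <= p" for p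
   proof -
    have "?L powr p <= (2 * exp (- \<alpha> * t)) powr p" using L2 that by (intro powr_mono2) auto
    also have "... = 2 powr p * exp (- \<alpha> * t * p)" by (simp add: powr_mult exp_powr_real)
    finally have "?L powr p * exp (\<alpha> * t) <= 2 powr p * exp (- \<alpha> * t * p) * exp (\<alpha> * t)" by (intro mult_right_mono) auto
    also have "... = 2 powr p * exp (- (\<alpha> * (p - 1)) * t)" by (simp add: mult.assoc flip: exp_add) (simp add: algebra_simps)
    finally show ?thesis .
   qed
   have iK: "I t (wt ?m) z <= K * exp (\<alpha> * t)" if "z : A" for z
    using AS(2)[OF that] by (simp add: exp_minus field_simps)
   have q: "\<bar>?L powr (1 + \<beta>) * I t (Zr T h) z - 0\<bar> <= e0" if w: "z : A" for z
   proof -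
    have "I t (Zr T h) z <= 2 * Cz * I t (wt ?m) z"
     using AS[OF w] zb by (intro I_mono_wt(2)) auto
    also have "... <= 2 * Cz * (K * exp (\<alpha> * t))" using iK[OF w] Cz0 by (intro mult_left_mono) auto
    finally have "?L powr (1 + \<beta>) * I t (Zr T h) z <= ?L powr (1 + \<beta>) * (2 * Cz * (K * exp (\<alpha> * t)))" by (intro mult_left_mono) auto
    also have "... = (2 * Cz * K) * (?L powr (1 + \<beta>) * exp (\<alpha> * t))" by simp
    also have "... <= (2 * Cz * K) * (2 powr (1 + \<beta>) * exp (- (\<alpha> * (1 + \<beta> - 1)) * t))"
     using pw[of "1 + \<beta>"] beta_pos Cz0 K0 by (intro mult_left_mono) auto
    also have "... <= e0" using elim(1) by (simp add: mult_ac)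
    finally show ?thesis using I_nonneg[of "Zr T h" t z, OF Zr_nonneg] by simp
   qed
   have er: "K1 * ?L powr (1 + \<beta> + kap) * I t (wt ?m) z <= e0" if w: "z : A" for z
   proof -
    have "K1 * ?L powr (1 + \<beta> + kap) * I t (wt ?m) z <= K1 * ?L powr (1 + \<beta> + kap) * (K * exp (\<alpha> * t))"
     using iK[OF w] K10 by (intro mult_left_mono) auto
    also have "... = (K1 * K) * (?L powr (1 + \<beta> + kap) * exp (\<alpha> * t))" by simp
    also have "... <= (K1 * K) * (2 powr (1 + \<beta> + kap) * exp (- (\<alpha> * (1 + \<beta> + kap - 1)) * t))"
     using pw[of "1 + \<beta> + kap"] beta_pos kap_pos K10 K0 by (intro mult_left_mono) auto
    also have "... <= e0" using elim(2) by (simp add: mult_ac)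
    finally show ?thesis .
   qed
   have J: "?L * I t (Pa T h) z <= 2 * (exp (\<alpha> * T) * (C * growth_const TYPE('a) n)) * (K * exp (\<alpha> * t))" if w: "z : A" for z
   proof -
    have pb: "\<bar>Pa T h x\<bar> <= exp (\<alpha> * T) * (C * growth_const TYPE('a) n) * wt n x" for x
     using h0 hC T by (intro Pa_bound) auto
    have C1: "0 <= exp (\<alpha> * T) * (C * growth_const TYPE('a) n)" using order_trans[OF abs_ge_zero pb[of 0]] wt_pos[of n "0::'a"] by (simp add: zero_le_mult_iff)
    have "?L * I t (Pa T h) z <= 1 * I t (Pa T h) z" using L1 I_nonneg[of "Pa T h" t z] Pa_nonneg[of h T, OF h0] by (intro mult_right_mono) auto
    also have "1 * I t (Pa T h) z <= 2 * (exp (\<alpha> * T) * (C * growth_const TYPE('a) n)) * I t (wt ?m) z"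
     unfolding mult_1 using AS[OF w] pb by (intro I_mono_wt(2)) auto
    also have "... <= 2 * (exp (\<alpha> * T) * (C * growth_const TYPE('a) n)) * (K * exp (\<alpha> * t))"
     using iK[OF w] C1 by (intro mult_left_mono) auto
    finally show ?thesis .
   qed
   note c = core_laplace[OF elim(4) T hm h0 hC K1 AF borel_measurable_const[of ?L] conjI[OF L2(1) L1] q er J]
   have eq: "?L * (I (t + T) h z - I t (Pa T h) z) = a * \<Phi> z" for z by (simp add: \<Phi>_def)
   show "integrable M (%z. indicator A z * exp (- (a * \<Phi> z)))" using c(1) unfolding eq .
   show "exp (- (2 * e0)) * measure M A <= (LINT z|M. indicator A z * exp (- (a * \<Phi> z)))" using c(2) unfolding eq by simp
   show "(LINT z|M. indicator A z * exp (- (a * \<Phi> z))) <= exp (2 * e0) * measure M A" using c(3) unfolding eq by simp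
  qed
  have "measure M {z\<in>A. e < \<bar>\<Phi> z\<bar>} * d
    <= (LINT z|M. indicator A z * exp (- (2 * \<Phi> z))) - 2 * (LINT z|M. indicator A z * exp (- \<Phi> z)) + measure M A"
   unfolding d_def using lap(1)[of 1] lap(1)[of 2] e by (intro exp_sq_deviation) auto
  also have "... <= exp (2 * e0) * measure M A - 2 * (exp (- (2 * e0)) * measure M A) + measure M A"
   using lap(2)[of 1] lap(3)[of 2] by simp
  also have "... = (exp (2 * e0) - 2 * exp (- (2 * e0)) + 1) * measure M A" by (simp add: algebra_simps)
  also have "... <= d * \<epsilon> / 2 * 1" using e0 d0 eps by (intro mult_mono) auto
  finally have 1: "measure M {z\<in>A. e < \<bar>\<Phi> z\<bar>} <= \<epsilon> / 2" using d0 by (simp add: mult.commute)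
  have Bm: "{z\<in>A. e < \<bar>\<Phi> z\<bar>} : sets M"
  proof -
   have "{z\<in>A. e < \<bar>\<Phi> z\<bar>} = A \<inter> {z\<in>space M. e < \<bar>\<Phi> z\<bar>}" using AS(1) by auto
   then show ?thesis by simp
  qed
  let ?N = "{z\<in>space M. K <= exp (- \<alpha> * t) * I t (wt ?m) z}"
  have "measure M {z : space M. e < \<bar>\<Phi> z\<bar>} <= measure M ({z\<in>A. e < \<bar>\<Phi> z\<bar>} \<union> ?N)"
  proof (rule P.finite_measure_mono_AE)
   show "AE z in M. z : {z : space M. e < \<bar>\<Phi> z\<bar>} --> z : {z\<in>A. e < \<bar>\<Phi> z\<bar>} \<union> ?N"
    using AE_integrable_wt[OF elim(4), of ?m]
   proof (rule AE_mp, intro AE_I2 impI)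
    fix z assume w: "z : space M" and i: "integrable (X t z) (wt ?m)" and F: "z : {z : space M. e < \<bar>\<Phi> z\<bar>}"
    have "(\<integral>\<^sup>+x. ennreal (wt ?m x) \<partial>(X t z)) = ennreal (LINT x|(X t z). wt ?m x)" using i by (intro nn_integral_eq_integral) auto
    then have "(\<integral>\<^sup>+x. ennreal (wt ?m x) \<partial>(X t z)) < \<infinity>" by simp
    then show "z : {z\<in>A. e < \<bar>\<Phi> z\<bar>} \<union> ?N" using w F unfolding A_def by auto
   qed
  qed (use Bm in simp)
  also have "... <= measure M {z\<in>A. e < \<bar>\<Phi> z\<bar>} + measure M ?N" using Bm by (intro measure_Un_le) auto
  also have "... < \<epsilon>" using 1 prob_wt_le[OF elim(4) K0, of ?m] BK unfolding B_def by linarith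
  finally show ?case unfolding \<Phi>_def by simp
 qed
qed

text \<open>A fixed delay S separates two effects. Over [t, t + S] the normalized fluctuations of
  X(g) and of the total mass are negligible; and X_t(P_S g) differs from \<open>stat g\<close>
  X_t(P_S 1) by at most the X_t-integral of the deviation of P_S g, whose normalized first moment is
  small once S is large. S is fixed before t tends to infinity.\<close>

lemma law_of_large_numbers:
 assumes gm[measurable]: "g : Bm borel" and g0: "!!x. 0 <= g x" and gC: "!!x. g x <= C * wt n x" and e: "0 < e"
 shows "((%t. measure M {z : space M. e < \<bar>exp (- \<alpha> * t) * (I t g z - stat g * Y t z)\<bar>}) \<longlongrightarrow> 0) at_top"
proof (rule tendstoI)
 fix \<epsilon> :: real assume eps: "0 < \<epsilon>"
 define c where "c = stat g"
 have c0: "0 <= c" unfolding c_def by (rule stat_nonneg[OF g0])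
 have gab: "\<bar>g x\<bar> <= C * wt n x" for x using g0[of x] gC[of x] by simp
 define dv where "dv S x = \<bar>OU_P \<sigma> b S g x - c\<bar>" for S x
 have dvm[measurable]: "dv S : Bm borel" for S unfolding dv_def by measurable
 define E where "E = C * growth_const TYPE('a) n + c"
 have dvb: "dv S x <= E * wt n x" if "0 <= S" for S x
 proof -
  have "\<bar>OU_P \<sigma> b S g x\<bar> <= C * growth_const TYPE('a) n * wt n x"
   using OU_P_norm_le[OF gm _ that, of C n x] gab by simp
  moreover have "c * 1 <= c * wt n x" using c0 by (intro mult_left_mono) auto
  ultimately show ?thesis unfolding dv_def E_def distrib_right using c0 by linarith
 qed
 have "((%S. mass * stat (dv S)) \<longlongrightarrow> mass * 0) at_top"
  unfolding dv_def c_def by (intro tendsto_mult_left stat_dev_tendsto[OF gm gab])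
 \<comment> \<open>Markov's inequality at level e / 4 will turn e epsilon / 16 into epsilon /
   4.\<close>
 then have "\<forall>\<^sub>F S in at_top. mass * stat (dv S) < e * \<epsilon> / 16" using e eps by (intro order_tendstoD) auto
 then have "\<forall>\<^sub>F S in at_top. 1 <= S & mass * stat (dv S) < e * \<epsilon> / 16"
  using eventually_ge_at_top[of "1::real"] by eventually_elim auto
 then obtain S where S: "1 <= S" "mass * stat (dv S) < e * \<epsilon> / 16"
  using eventually_happens'[OF trivial_limit_at_top_linorder] by blast
 have S0: "0 < S" "0 <= S" using S by auto
 have dvab: "\<bar>dv S x\<bar> <= E * wt n x" for x using dvb[OF S0(2), of x] by (simp add: dv_def)
 have ev1: "\<forall>\<^sub>F t in at_top. (LINT x|\<mu>. OU_P \<sigma> b t (dv S) x) < e * \<epsilon> / 16"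
  using S(2) by (intro order_tendstoD(2)[OF mu_OU_P_tendsto[OF dvm dvab]])
 let ?Fl = "%h e t. measure M {z : space M. e < \<bar>exp (- \<alpha> * t) * (I (t + S) h z - I t (Pa S h) z)\<bar>}"
 have ev2: "\<forall>\<^sub>F t in at_top. ?Fl g (e / 4) t < \<epsilon> / 4"
  using e eps by (intro order_tendstoD(2)[OF fluctuation_tendsto[OF S0(1) gm g0 gC]]) auto
 have ev3: "\<forall>\<^sub>F t in at_top. ?Fl (%_. 1) (e / (4 * (c + 1))) t < \<epsilon> / 4"
  using e eps c0 by (intro order_tendstoD(2)[OF fluctuation_tendsto[OF S0(1), where C=1 and n=0]]) auto
 have "\<forall>\<^sub>F t in at_top. measure M {z : space M. e < \<bar>exp (- \<alpha> * (t + S)) * (I (t + S) g z - c * Y (t + S) z)\<bar>} < \<epsilon>"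
  using ev1 ev2 ev3 eventually_ge_at_top[of "0::real"]
 proof eventually_elim
  case (elim t)
  have [measurable]: "I (t + S) h : Bm M" "I t (Pa S h) : Bm M" "I t h : Bm M"
    if "h : Bm borel" for h using that elim(4) S0 by (auto intro!: I_M Pa_meas1)
  let ?A = "{z : space M. e / 4 <= exp (- \<alpha> * t) * I t (dv S) z}"
  let ?B = "%h e. {z : space M. e < \<bar>exp (- \<alpha> * t) * (I (t + S) h z - I t (Pa S h) z)\<bar>}"
  have mA: "measure M ?A < \<epsilon> / 4"
  proof -
   have "measure M ?A <= (LINT x|\<mu>. OU_P \<sigma> b t (dv S) x) / (e / 4)"
    using elim(4) e dvb[OF S0(2)] by (intro prob_moment_le) (auto simp: dv_def)
   also have "... < (e * \<epsilon> / 16) / (e / 4)" using elim(1) e by (intro divide_strict_right_mono) auto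
   finally show ?thesis using e by simp
  qed
  have "measure M {z : space M. e < \<bar>exp (- \<alpha> * (t + S)) * (I (t + S) g z - c * Y (t + S) z)\<bar>}
    <= measure M (?A \<union> (?B g (e / 4) \<union> ?B (%_. 1) (e / (4 * (c + 1)))))"
  proof (rule P.finite_measure_mono_AE)
   show "AE z in M. z : {z : space M. e < \<bar>exp (- \<alpha> * (t + S)) * (I (t + S) g z - c * Y (t + S) z)\<bar>}
     --> z : ?A \<union> (?B g (e / 4) \<union> ?B (%_. 1) (e / (4 * (c + 1))))"
    using AE_integrable_wt[OF elim(4), of n]
   proof (rule AE_mp, intro AE_I2 impI)
    fix z assume w: "z : space M" and i: "integrable (X t z) (wt n)"
     and F: "z : {z : space M. e < \<bar>exp (- \<alpha> * (t + S)) * (I (t + S) g z - c * Y (t + S) z)\<bar>}"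
    show "z : ?A \<union> (?B g (e / 4) \<union> ?B (%_. 1) (e / (4 * (c + 1))))"
    proof (rule ccontr)
    assume N: "z \<notin> ?A \<union> (?B g (e / 4) \<union> ?B (%_. 1) (e / (4 * (c + 1))))"
    define u where "u = I (t + S) g z - I t (Pa S g) z"
    define v where "v = I (t + S) (%_. 1) z - I t (Pa S (%_. 1)) z"
    have un: "exp (- \<alpha> * t) * \<bar>u\<bar> <= e / 4" and vn: "exp (- \<alpha> * t) * \<bar>v\<bar> <= e / (4 * (c + 1))"
     and an: "exp (- \<alpha> * t) * I t (dv S) z <= e / 4"
     using N w by (auto simp: u_def v_def abs_mult)
    have iP: "integrable (X t z) (Pa S g)"
     using Pa_bound[OF gm gab S0(2)] by (intro integrable_X_wt[OF w _ _ i]) auto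
    have i1: "integrable (X t z) (Pa S (%_. 1::real))"
     using Pa_bound[of "%_. 1" 1 n S] S0(2) by (intro integrable_X_wt[OF w _ _ i]) auto
    have idv: "integrable (X t z) (dv S)" by (rule integrable_X_wt[OF w dvm dvab i])
    have P1: "OU_P \<sigma> b S (%_. 1::real) x = 1" for x :: 'a by (simp add: OU_P_def std_gauss.prob_space)
    have "I t (Pa S g) z - c * I t (Pa S (%_. 1)) z = (LINT x|(X t z). Pa S g x - c * Pa S (%_. 1) x)"
     using iP i1 by (simp add: I_def)
    also have "\<bar>...\<bar> <= (LINT x|(X t z). exp (\<alpha> * S) * dv S x)"
    proof (rule integral_abs_bound_integral)
     show "\<bar>Pa S g x - c * Pa S (%_. 1) x\<bar> <= exp (\<alpha> * S) * dv S x" for x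
     proof -
      have "Pa S g x - c * Pa S (%_. 1) x = exp (\<alpha> * S) * (OU_P \<sigma> b S g x - c)" by (simp add: Pa_eq P1 algebra_simps)
      then show ?thesis by (simp add: dv_def abs_mult)
     qed
    qed (use iP i1 idv in auto)
    finally have dd: "\<bar>I t (Pa S g) z - c * I t (Pa S (%_. 1)) z\<bar> <= exp (\<alpha> * S) * I t (dv S) z" by (simp add: I_def)
    have YI: "I (t + S) (%_. 1) z = Y (t + S) z" using I_const[OF w, of "t + S" 1] by simp
    have eS: "exp (- \<alpha> * (t + S)) = exp (- \<alpha> * t) * exp (- \<alpha> * S)" by (simp add: algebra_simps flip: exp_add)
    have "I (t + S) g z - c * Y (t + S) z = u - c * v + (I t (Pa S g) z - c * I t (Pa S (%_. 1)) z)"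
     unfolding u_def v_def YI by (simp add: algebra_simps)
    then have tri: "\<bar>I (t + S) g z - c * Y (t + S) z\<bar> <= \<bar>u\<bar> + c * \<bar>v\<bar> + exp (\<alpha> * S) * I t (dv S) z"
     using dd c0 abs_triangle_ineq4[of u "c * v"] abs_triangle_ineq[of "u - c * v"] by (simp add: abs_mult)
    have es1: "exp (- \<alpha> * S) <= 1" using alpha_pos S0 by simp
    have uv: "exp (- \<alpha> * S) * (\<bar>u\<bar> + c * \<bar>v\<bar>) <= 1 * (\<bar>u\<bar> + c * \<bar>v\<bar>)" using es1 c0 by (intro mult_right_mono) auto
    have "exp (- \<alpha> * S) * \<bar>I (t + S) g z - c * Y (t + S) z\<bar> <= exp (- \<alpha> * S) * (\<bar>u\<bar> + c * \<bar>v\<bar> + exp (\<alpha> * S) * I t (dv S) z)"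
     using tri by (intro mult_left_mono) auto
    also have "... = exp (- \<alpha> * S) * (\<bar>u\<bar> + c * \<bar>v\<bar>) + I t (dv S) z" by (simp add: distrib_left exp_minus)
    also have "... <= \<bar>u\<bar> + c * \<bar>v\<bar> + I t (dv S) z" using uv by simp
    finally have "exp (- \<alpha> * t) * (exp (- \<alpha> * S) * \<bar>I (t + S) g z - c * Y (t + S) z\<bar>) <= exp (- \<alpha> * t) * (\<bar>u\<bar> + c * \<bar>v\<bar> + I t (dv S) z)"
     by (intro mult_left_mono) auto
    then have "\<bar>exp (- \<alpha> * (t + S)) * (I (t + S) g z - c * Y (t + S) z)\<bar> <= exp (- \<alpha> * t) * \<bar>u\<bar> + c * (exp (- \<alpha> * t) * \<bar>v\<bar>) + exp (- \<alpha> * t) * I t (dv S) z"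
     unfolding eS by (simp add: abs_mult distrib_left mult_ac)
    moreover have "c * (exp (- \<alpha> * t) * \<bar>v\<bar>) <= e / 4"
    proof -
     have k: "k * (e / (4 * k)) = e / 4" if "k ~= 0" for k :: real using that by simp
     have "c * (exp (- \<alpha> * t) * \<bar>v\<bar>) <= (c + 1) * (e / (4 * (c + 1)))" using vn c0 by (intro mult_mono) auto
     also have "(c + 1) * (e / (4 * (c + 1))) = e / 4" by (rule k) (use c0 in linarith)
     finally show ?thesis .
    qed
    ultimately show False using F un an e by auto
    qed
   qed
  qed simp
  also have "... <= measure M ?A + measure M (?B g (e / 4) \<union> ?B (%_. 1) (e / (4 * (c + 1))))"
   by (intro measure_Un_le) auto
  also have "... <= measure M ?A + (measure M (?B g (e / 4)) + measure M (?B (%_. 1) (e / (4 * (c + 1)))))"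
   by (intro add_left_mono measure_Un_le) auto
  also have "... < \<epsilon>" using mA elim(2,3) eps by linarith
  finally show ?case .
 qed
 then obtain N where N: "!!t. N <= t ==> measure M {z : space M. e < \<bar>exp (- \<alpha> * (t + S)) * (I (t + S) g z - c * Y (t + S) z)\<bar>} < \<epsilon>"
  unfolding eventually_at_top_linorder by blast
 have "measure M {z : space M. e < \<bar>exp (- \<alpha> * t) * (I t g z - c * Y t z)\<bar>} < \<epsilon>" if "N + S <= t" for t
  using N[of "t - S"] that by simp
 then show "\<forall>\<^sub>F t in at_top. dist (measure M {z : space M. e < \<bar>exp (- \<alpha> * t) * (I t g z - stat g * Y t z)\<bar>}) 0 < \<epsilon>"
  unfolding eventually_at_top_linorder c_def by (auto intro!: exI[of _ "N + S"])
qed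

text \<open>Dividing by the mass is harmless once the living paths with exp(-alpha t) Y_t <= c are
  discarded, which \<open>small_mass_gap\<close> permits.\<close>

lemma ratio_tendsto:
 assumes gm[measurable]: "g : Bm borel" and g0: "!!x. 0 <= g x" and gC: "!!x. g x <= C * wt n x" and e: "0 < e"
 shows "((%t. measure M {z : alive t. e < \<bar>I t g z / Y t z - stat g\<bar>}) \<longlongrightarrow> 0) at_top"
proof (rule tendstoI)
 fix \<epsilon> :: real assume eps: "0 < \<epsilon>"
 obtain c T where c: "0 < c" "0 <= T" "!!t. T <= t ==> measure M {z : space M. Y t z ~= 0 & exp (- \<alpha> * t) * Y t z <= c} <= \<epsilon> / 2"
  using small_mass_gap[of "\<epsilon> / 2"] eps by auto
 have "\<forall>\<^sub>F t in at_top. measure M {z : space M. e * c < \<bar>exp (- \<alpha> * t) * (I t g z - stat g * Y t z)\<bar>} < \<epsilon> / 2"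
  using e c eps by (intro order_tendstoD(2)[OF law_of_large_numbers[OF gm g0 gC]]) auto
 then show "\<forall>\<^sub>F t in at_top. dist (measure M {z : alive t. e < \<bar>I t g z / Y t z - stat g\<bar>}) 0 < \<epsilon>"
  using eventually_ge_at_top[of T]
 proof eventually_elim
  case (elim t)
  then have t: "0 <= t" using c by simp
  have [measurable]: "I t g : Bm M" "Y t : Bm M" using t by (auto intro: I_M Y_M)
  let ?A = "{z : space M. Y t z ~= 0 & exp (- \<alpha> * t) * Y t z <= c}"
  let ?B = "{z : space M. e * c < \<bar>exp (- \<alpha> * t) * (I t g z - stat g * Y t z)\<bar>}"
  have "measure M {z : alive t. e < \<bar>I t g z / Y t z - stat g\<bar>} <= measure M (?A \<union> ?B)"
  proof (rule P.finite_measure_mono)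
   show "{z : alive t. e < \<bar>I t g z / Y t z - stat g\<bar>} \<subseteq> ?A \<union> ?B"
   proof
    fix z assume "z : {z : alive t. e < \<bar>I t g z / Y t z - stat g\<bar>}"
    then have w: "z : space M" "Y t z ~= 0" "e < \<bar>I t g z / Y t z - stat g\<bar>" by (auto simp: alive_def)
    have Yp: "0 < Y t z" using w(2) Y_nonneg[of t z] by linarith
    show "z : ?A \<union> ?B"
    proof (cases "exp (- \<alpha> * t) * Y t z <= c")
     case False
     have "e * c < \<bar>I t g z / Y t z - stat g\<bar> * (exp (- \<alpha> * t) * Y t z)"
      using False w(3) e c by (intro mult_strict_mono) auto
     also have "... = \<bar>(I t g z / Y t z - stat g) * (exp (- \<alpha> * t) * Y t z)\<bar>" using Yp by (simp add: abs_mult)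
     also have "(I t g z / Y t z - stat g) * (exp (- \<alpha> * t) * Y t z) = exp (- \<alpha> * t) * (I t g z - stat g * Y t z)"
      using Yp by (simp add: field_simps)
     finally show ?thesis using w by simp
    qed (use w in simp)
   qed
  qed simp
  also have "... <= measure M ?A + measure M ?B" by (intro measure_Un_le) auto
  also have "... < \<epsilon>" using elim(1) c(3)[OF elim(2)] by linarith
  finally show ?case by simp
 qed
qed

lemma large_mass_tendsto: "((%t. measure M {z : alive t. Y t z < R}) \<longlongrightarrow> 0) at_top"
proof (rule tendstoI)
 fix \<epsilon> :: real assume eps: "0 < \<epsilon>"
 obtain c T where c: "0 < c" "0 <= T" "!!t. T <= t ==> measure M {z : space M. Y t z ~= 0 & exp (- \<alpha> * t) * Y t z <= c} <= \<epsilon> / 2"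
  using small_mass_gap[of "\<epsilon> / 2"] eps by auto
 have "((%t. R * exp (- \<alpha> * t)) \<longlongrightarrow> R * 0) at_top" using alpha_pos by (intro tendsto_mult_left) real_asymp
 then have "\<forall>\<^sub>F t in at_top. R * exp (- \<alpha> * t) < c" using c by (intro order_tendstoD) auto
 then show "\<forall>\<^sub>F t in at_top. dist (measure M {z : alive t. Y t z < R}) 0 < \<epsilon>"
  using eventually_ge_at_top[of T]
 proof eventually_elim
  case (elim t)
  then have t: "0 <= t" using c by simp
  have [measurable]: "Y t : Bm M" using t by (auto intro: Y_M)
  have "measure M {z : alive t. Y t z < R} <= measure M {z : space M. Y t z ~= 0 & exp (- \<alpha> * t) * Y t z <= c}"
  proof (rule P.finite_measure_mono)
   show "{z : alive t. Y t z < R} \<subseteq> {z : space M. Y t z ~= 0 & exp (- \<alpha> * t) * Y t z <= c}"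
   proof
    fix z assume w: "z : {z : alive t. Y t z < R}"
    then have "exp (- \<alpha> * t) * Y t z <= exp (- \<alpha> * t) * R" by (intro mult_left_mono) auto
    then show "z : {z : space M. Y t z ~= 0 & exp (- \<alpha> * t) * Y t z <= c}" using w order_trans[OF _ less_imp_le[OF elim(1)]] by (auto simp: alive_def mult.commute)
   qed
  qed simp
  then show ?case using c(3)[OF elim(2)] eps by simp
 qed
qed

text \<open>A generous cap on the mass: it supplies the bound that \<open>core_laplace\<close>
  requires on L X_t(P^alpha h).\<close>

lemma huge_mass_tendsto: "((%t. measure M {z : space M. exp (2 * \<alpha> * t) < Y t z}) \<longlongrightarrow> 0) at_top"
proof (rule tendsto_sandwich[where f="%_. 0"])
 show "((%t. mass * exp (- \<alpha> * t)) \<longlongrightarrow> 0) at_top" using alpha_pos by real_asymp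
 show "\<forall>\<^sub>F t in at_top. measure M {z : space M. exp (2 * \<alpha> * t) < Y t z} <= mass * exp (- \<alpha> * t)"
  using eventually_ge_at_top[of "0::real"]
 proof eventually_elim
  case (elim t)
  have [measurable]: "Y t : Bm M" "I t (%_. 1) : Bm M" using elim by (auto intro: I_M Y_M)
  have "measure M {z : space M. exp (2 * \<alpha> * t) < Y t z} <= measure M {z\<in>space M. exp (\<alpha> * t) <= exp (- \<alpha> * t) * I t (%_. 1) z}"
  proof (rule P.finite_measure_mono)
   have "exp (\<alpha> * t) <= exp (- \<alpha> * t) * I t (%_. 1) z" if "z : space M" "exp (2 * \<alpha> * t) < Y t z" for z
   proof -
    have "exp (- \<alpha> * t) * exp (2 * \<alpha> * t) <= exp (- \<alpha> * t) * Y t z" using that by (intro mult_left_mono) auto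
    then show ?thesis using I_const[OF that(1), of t 1] by (simp flip: exp_add)
   qed
   then show "{z : space M. exp (2 * \<alpha> * t) < Y t z} \<subseteq> {z\<in>space M. exp (\<alpha> * t) <= exp (- \<alpha> * t) * I t (%_. 1) z}" by blast
  qed simp
  also have "... <= (LINT x|\<mu>. OU_P \<sigma> b t (%_. 1) x) / exp (\<alpha> * t)"
   using elim by (intro prob_moment_le[where C=1 and n=0]) auto
  also have "... = mass * exp (- \<alpha> * t)"
   by (simp add: OU_P_def std_gauss.prob_space mass_def exp_minus field_simps)
  finally show ?case .
 qed
qed auto

end

context super_ou_X
begin

subsection \<open>Laplace transforms of the normalized fluctuations\<close>

text \<open>The summand 1 is the tolerance granted to the ratio X_t(wt) / Y_t around its
  limit.\<close>

definition "Kw n = stat (wt (4 * n) :: 'a => real) + 1"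

text \<open>Measurable with respect to the past, contained in \<open>alive t\<close>, and
  asymptotically equal to it in probability; the clauses supply the bounds demanded by
  \<open>core_laplace\<close>.\<close>

definition "good n t = {z : space M. 1 <= Y t z & Y t z <= exp (2 * \<alpha> * t) &
  (\<integral>\<^sup>+x. ennreal (wt (4 * n) x) \<partial>(X t z)) < \<infinity> & I t (wt (4 * n)) z <= Kw n * Y t z}"

text \<open>\<open>core_laplace\<close> asks for L <= 1; on \<open>good n t\<close> the mass is at
  least 1 and the minimum is inactive.\<close>

definition "scl t z = min 1 (Y t z powr (- 1 / (1 + \<beta>)))"

definition "fl t h z = scl t z * (I (t + 1) h z - I t (Pa 1 h) z)"

lemma Kw_pos: "0 < Kw n"
 unfolding Kw_def using stat_nonneg[of "wt (4 * n) :: 'a => real"] by simp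

lemma good_F: "0 <= t ==> good n t : sets (F t)"
proof -
 assume t: "0 <= t"
 have [measurable]: "I t (wt (4 * n)) : Bm (F t)" "Y t : Bm (F t)"
  "(%z. \<integral>\<^sup>+x. ennreal (wt (4 * n) x) \<partial>(X t z)) : Bm (F t)"
  using t by (auto intro!: I_F Y_F nn_integral_X_F)
 have "{z : space (F t). 1 <= Y t z & Y t z <= exp (2 * \<alpha> * t) &
  (\<integral>\<^sup>+x. ennreal (wt (4 * n) x) \<partial>(X t z)) < \<infinity> & I t (wt (4 * n)) z <= Kw n * Y t z} : sets (F t)" by measurable
 then show ?thesis by (simp only: good_def space_F)
qed

lemma good_M [measurable]: "0 <= t ==> good n t : sets M"
 by (rule F_sets[OF good_F])

lemma goodD:
 assumes "z : good n t"
 shows "z : space M" "1 <= Y t z" "Y t z <= exp (2 * \<alpha> * t)" "integrable (X t z) (wt (4 * n))" "I t (wt (4 * n)) z <= Kw n * Y t z"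
 using assms by (auto simp: good_def intro!: integrableI_nonneg measurable_X_iff)

lemma good_alive: "good n t \<subseteq> alive t"
 by (auto simp: good_def alive_def)

lemma scl_F: "0 <= t ==> scl t : Bm (F t)"
 unfolding scl_def using Y_F[of t t] by measurable

lemma scl_bounds: "0 <= scl t z" "scl t z <= 1"
 by (auto simp: scl_def)

lemma scl_powr:
 assumes "1 <= Y t z" shows "scl t z = Y t z powr (- 1 / (1 + \<beta>))" "scl t z powr p = Y t z powr (- p / (1 + \<beta>))"
proof -
 have "Y t z powr (- 1 / (1 + \<beta>)) <= Y t z powr 0" using assms beta_pos by (intro powr_mono) auto
 then show "scl t z = Y t z powr (- 1 / (1 + \<beta>))" using assms by (simp add: scl_def)
 then show "scl t z powr p = Y t z powr (- p / (1 + \<beta>))" by (simp add: powr_powr)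
qed

lemma fl_M [measurable]: "0 <= t ==> h : Bm borel ==> fl t h : Bm M"
proof -
 assume t: "0 <= t" and h: "h : Bm borel"
 have [measurable]: "scl t : Bm M" "I (t + 1) h : Bm M" "I t (Pa 1 h) : Bm M"
  using F_meas[OF scl_F[OF t]] I_M[of "t + 1" h] I_M[OF t Pa_meas1[OF h]] t h by auto
 show ?thesis unfolding fl_def by measurable
qed

lemma good_prob: "((%t. measure M (alive t - good n t)) \<longlongrightarrow> 0) at_top"
proof (rule tendsto_sandwich[where f="%_. 0"])
 let ?E = "%t. {z : alive t. 1 < \<bar>I t (wt (4 * n)) z / Y t z - stat (wt (4 * n) :: 'a => real)\<bar>}"
 let ?b = "%t. measure M {z : alive t. Y t z < 1}" and ?c = "%t. measure M {z : space M. exp (2 * \<alpha> * t) < Y t z}"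
  and ?d = "%t. measure M (?E t)"
 have "((%t. ?b t + (?c t + ?d t)) \<longlongrightarrow> 0 + (0 + 0)) at_top"
  by (intro tendsto_add large_mass_tendsto huge_mass_tendsto ratio_tendsto[where C=1 and n="4 * n"]) auto
 then show "((%t. ?b t + (?c t + ?d t)) \<longlongrightarrow> 0) at_top" by simp
 show "\<forall>\<^sub>F t in at_top. measure M (alive t - good n t) <= ?b t + (?c t + ?d t)"
  using eventually_ge_at_top[of "0::real"]
 proof eventually_elim
  case (elim t)
  have [measurable]: "I t (wt (4 * n)) : Bm M" "Y t : Bm M" using elim by (auto intro: I_M Y_M)
  note [measurable] = alive_M[OF elim]
  have bM: "{z : alive t. Y t z < 1} : sets M" and dM: "(?E t) : sets M"
   and cM: "{z : space M. exp (2 * \<alpha> * t) < Y t z} : sets M"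
   unfolding alive_def by measurable
  have "measure M (alive t - good n t) <= measure M ({z : alive t. Y t z < 1} \<union> ({z : space M. exp (2 * \<alpha> * t) < Y t z} \<union>
   (?E t)))"
  proof (rule P.finite_measure_mono_AE)
   show "AE z in M. z : alive t - good n t --> z : {z : alive t. Y t z < 1} \<union> ({z : space M. exp (2 * \<alpha> * t) < Y t z} \<union>
    (?E t))"
    using AE_integrable_wt[OF elim, of "4 * n"]
   proof (rule AE_mp, intro AE_I2 impI)
    fix z assume w: "z : space M" and i: "integrable (X t z) (wt (4 * n))" and g: "z : alive t - good n t"
    show "z : {z : alive t. Y t z < 1} \<union> ({z : space M. exp (2 * \<alpha> * t) < Y t z} \<union>
     (?E t))"
    proof (rule ccontr)
     assume n: "\<not> ?thesis"
     then have y: "1 <= Y t z" "Y t z <= exp (2 * \<alpha> * t)" "I t (wt (4 * n)) z / Y t z <= Kw n"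
      using w g by (auto simp: Kw_def abs_le_iff not_less)
     have "(\<integral>\<^sup>+x. ennreal (wt (4 * n) x) \<partial>(X t z)) = ennreal (LINT x|(X t z). wt (4 * n) x)" using i by (intro nn_integral_eq_integral) auto
     then have "(\<integral>\<^sup>+x. ennreal (wt (4 * n) x) \<partial>(X t z)) < \<infinity>" by simp
     moreover have "I t (wt (4 * n)) z <= Kw n * Y t z" using y by (simp add: divide_le_eq)
     ultimately have "z : good n t" using w y by (simp add: good_def)
     then show False using g by simp
    qed
   qed
  qed (use bM cM dM in simp)
  also have "... <= ?b t + measure M ({z : space M. exp (2 * \<alpha> * t) < Y t z} \<union>
   (?E t))"
   using bM cM dM by (intro measure_Un_le) auto
  also have "... <= ?b t + (?c t + ?d t)" using cM dM by (intro add_left_mono measure_Un_le)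
  finally show ?case .
 qed
qed auto

text \<open>Here L^(1 + beta) = 1 / Y_t exactly, so the exponent becomes the ratio X_t(Z h) / Y_t,
  which the law of large numbers sends to a constant; the remainder is of order Y_t^(-kap / (1 +
  beta)).\<close>

lemma good_laplace:
 assumes hm[measurable]: "h : Bm borel" and h0: "!!x. 0 <= h x" and hC: "!!x. h x <= C * wt n x"
  and K: "expansion_const C n 1 K" and t: "0 <= t" and A: "A : sets (F t)" "A \<subseteq> good n t"
  and q: "!!z. z : A ==> \<bar>I t (Zr 1 h) z / Y t z - q\<bar> <= e"
  and er: "!!z. z : A ==> K * Kw n * Y t z powr (- kap / (1 + \<beta>)) <= e"
 shows "integrable M (%z. indicator A z * exp (- fl t h z))"
  "exp (q - 2 * e) * measure M A <= (LINT z|M. indicator A z * exp (- fl t h z))"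
  "(LINT z|M. indicator A z * exp (- fl t h z)) <= exp (q + 2 * e) * measure M A"
proof -
 have K0: "0 < K" using K by (simp add: expansion_const_def)
 have g: "z : space M" "1 <= Y t z" "Y t z <= exp (2 * \<alpha> * t)" "integrable (X t z) (wt (4 * n))" "I t (wt (4 * n)) z <= Kw n * Y t z"
  if "z : A" for z using goodD[of z n t] A(2) that by auto
 have L: "!!z. z : space M ==> 0 <= scl t z & scl t z <= 1" using scl_bounds by auto
 have q': "\<bar>scl t z powr (1 + \<beta>) * I t (Zr 1 h) z - q\<bar> <= e" if w: "z : A" for z
 proof -
  have "scl t z powr (1 + \<beta>) = 1 / Y t z"
  proof -
   have "- (1 + \<beta>) / (1 + \<beta>) = - 1" using beta_pos by (simp add: divide_eq_eq)
   then show ?thesis unfolding scl_powr(2)[OF g(2)[OF w]] using g(2)[OF w] by (simp only: powr_minus_divide) simp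
  qed
  then show ?thesis using q[OF w] by simp
 qed
 have er': "K * scl t z powr (1 + \<beta> + kap) * I t (wt (4 * n)) z <= e" if w: "z : A" for z
 proof -
  have "- (1 + \<beta> + kap) / (1 + \<beta>) = - 1 + - kap / (1 + \<beta>)" using beta_pos by (simp add: field_simps)
  then have s: "scl t z powr (1 + \<beta> + kap) * Y t z = Y t z powr (- kap / (1 + \<beta>))"
   unfolding scl_powr(2)[OF g(2)[OF w]] using g(2)[OF w] by (simp only: powr_add) (simp add: powr_minus_divide)
  have "K * scl t z powr (1 + \<beta> + kap) * I t (wt (4 * n)) z <= K * scl t z powr (1 + \<beta> + kap) * (Kw n * Y t z)"
   using g(5)[OF w] K0 by (intro mult_left_mono) auto
  also have "... = K * Kw n * (scl t z powr (1 + \<beta> + kap) * Y t z)" by simp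
  also have "... <= e" unfolding s by (rule er[OF w])
  finally show ?thesis .
 qed
 have J: "scl t z * I t (Pa 1 h) z <= 2 * (exp (\<alpha> * 1) * (C * growth_const TYPE('a) n)) * (Kw n * exp (2 * \<alpha> * t))" if w: "z : A" for z
 proof -
  have pb: "\<bar>Pa 1 h x\<bar> <= exp (\<alpha> * 1) * (C * growth_const TYPE('a) n) * wt n x" for x using h0 hC by (intro Pa_bound) auto
  have C1: "0 <= exp (\<alpha> * 1) * (C * growth_const TYPE('a) n)" using order_trans[OF abs_ge_zero pb[of 0]] wt_pos[of n "0::'a"] by (simp add: zero_le_mult_iff)
  have "scl t z * I t (Pa 1 h) z <= 1 * I t (Pa 1 h) z"
   using scl_bounds[of t z] I_nonneg[of "Pa 1 h" t z] Pa_nonneg[of h 1, OF h0] by (intro mult_right_mono) auto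
  also have "1 * I t (Pa 1 h) z <= 2 * (exp (\<alpha> * 1) * (C * growth_const TYPE('a) n)) * I t (wt (4 * n)) z"
   unfolding mult_1 using g[OF w] pb by (intro I_mono_wt(2)) auto
  also have "... <= 2 * (exp (\<alpha> * 1) * (C * growth_const TYPE('a) n)) * (Kw n * Y t z)"
   using g(5)[OF w] C1 by (intro mult_left_mono) auto
  also have "... <= 2 * (exp (\<alpha> * 1) * (C * growth_const TYPE('a) n)) * (Kw n * exp (2 * \<alpha> * t))"
   using g(3)[OF w] C1 Kw_pos[of n] by (intro mult_left_mono) auto
  finally show ?thesis .
 qed
 note c = core_laplace[OF t zero_less_one hm h0 hC K A(1) scl_F[OF t] L q' er' J]
 show "integrable M (%z. indicator A z * exp (- fl t h z))" using c(1) unfolding fl_def .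
 show "exp (q - 2 * e) * measure M A <= (LINT z|M. indicator A z * exp (- fl t h z))" using c(2) unfolding fl_def .
 show "(LINT z|M. indicator A z * exp (- fl t h z)) <= exp (q + 2 * e) * measure M A" using c(3) unfolding fl_def .
qed

text \<open>The estimate of \<open>good_laplace\<close> with q = 0 and a large e. Being proportional
  to the probability of A, it shows that small parts of the good event contribute little to the
  Laplace transform, although no bound on the integrand uniform in t is at hand.\<close>

lemma laplace_bound:
 assumes hm[measurable]: "h : Bm borel" and h0: "!!x. 0 <= h x" and hC: "!!x. h x <= C * wt n x"
 shows "\<exists>Q. \<forall>t\<ge>0. \<forall>A\<in>sets (F t). A \<subseteq> good n t --> integrable M (%z. indicator A z * exp (- fl t h z)) &
   (LINT z|M. indicator A z * exp (- fl t h z)) <= Q * measure M A"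
proof -
 obtain K where K: "expansion_const C n 1 K" using expansion_const_exists[of 1] by auto
 have K0: "0 < K" using K by (simp add: expansion_const_def)
 define Cz where "Cz = 1 * (exp (\<bar>\<alpha>\<bar> * 1) * (\<eta> * (2 * (zr_const TYPE('a) 1 C n)\<^sup>2) * growth_const TYPE('a) (2 * n)))"
 have zb: "\<bar>Zr 1 h x\<bar> <= Cz * wt (2 * n) x" for x unfolding Cz_def by (intro Zr_bound hm h0 hC) auto
 have Cz0: "0 <= Cz" using order_trans[OF abs_ge_zero zb[of 0]] wt_pos[of "2*n" "0::'a"] by (simp add: zero_le_mult_iff)
 define e where "e = 2 * Cz * Kw n + K * Kw n"
 show ?thesis
 proof (intro exI[of _ "exp (0 + 2 * e)"] allI impI ballI)
  fix t :: real and A assume t: "0 <= t" and A: "A : sets (F t)" "A \<subseteq> good n t"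
  have q: "\<bar>I t (Zr 1 h) z / Y t z - 0\<bar> <= e" if w: "z : A" for z
  proof -
   note g = goodD[of z n t, OF subsetD[OF A(2) w]]
   have "I t (Zr 1 h) z <= 2 * Cz * I t (wt (4 * n)) z" using g zb by (intro I_mono_wt(2)) auto
   also have "... <= 2 * Cz * (Kw n * Y t z)" using g Cz0 by (intro mult_left_mono) auto
   finally have "I t (Zr 1 h) z / Y t z <= 2 * Cz * Kw n" using g by (simp add: divide_le_eq)
   then show ?thesis using I_nonneg[of "Zr 1 h" t z, OF Zr_nonneg] K0 Kw_pos[of n] g by (simp add: e_def) (smt (verit) mult_pos_pos)
  qed
  have er: "K * Kw n * Y t z powr (- kap / (1 + \<beta>)) <= e" if w: "z : A" for z
  proof -
   note g = goodD[of z n t, OF subsetD[OF A(2) w]]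
   have "Y t z powr (- kap / (1 + \<beta>)) <= Y t z powr 0" using g beta_pos kap_pos by (intro powr_mono) auto
   also have "... = 1" using g by simp
   finally have "K * Kw n * Y t z powr (- kap / (1 + \<beta>)) <= K * Kw n * 1" using K0 Kw_pos[of n] by (intro mult_left_mono) auto
   moreover have "0 <= 2 * Cz * Kw n" using Cz0 Kw_pos[of n] by simp
   ultimately show ?thesis by (simp add: e_def)
  qed
  show "integrable M (%z. indicator A z * exp (- fl t h z)) &
   (LINT z|M. indicator A z * exp (- fl t h z)) <= exp (0 + 2 * e) * measure M A"
   using good_laplace(1,3)[OF hm h0 hC K t A q er] by blast
 qed
qed

text \<open>On the part A of the good event where the ratio is within e of its limit and the mass is
  at least R the sharp estimate applies; the rest has vanishing probability and is controlled by
  \<open>laplace_bound\<close>.\<close>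

lemma laplace_limit:
 assumes hm[measurable]: "h : Bm borel" and h0: "!!x. 0 <= h x" and hC: "!!x. h x <= C * wt n x"
 shows "((%t. (LINT z|M. indicator (good n t) z * exp (- fl t h z)) - exp (stat (Zr 1 h)) * measure M (good n t)) \<longlongrightarrow> 0) at_top"
proof (rule tendstoI)
 fix \<epsilon> :: real assume eps: "0 < \<epsilon>"
 define q where "q = stat (Zr 1 h)"
 obtain K where K: "expansion_const C n 1 K" using expansion_const_exists[of 1] by auto
 have K0: "0 < K" using K by (simp add: expansion_const_def)
 obtain Q where Q: "!!t A. 0 <= t ==> A : sets (F t) ==> A \<subseteq> good n t ==> integrable M (%z. indicator A z * exp (- fl t h z)) &
   (LINT z|M. indicator A z * exp (- fl t h z)) <= Q * measure M A"
  using laplace_bound[OF hm h0 hC] by metis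
 have zb: "\<bar>Zr 1 h x\<bar> <= (1 * (exp (\<bar>\<alpha>\<bar> * 1) * (\<eta> * (2 * (zr_const TYPE('a) 1 C n)\<^sup>2) * growth_const TYPE('a) (2 * n)))) * wt (2 * n) x" for x
  by (intro Zr_bound hm h0 hC) auto
 have "((%x::real. exp (q + 2 * x) - exp (q - 2 * x)) \<longlongrightarrow> exp (q + 2 * 0) - exp (q - 2 * 0)) (at_right 0)"
  by (intro tendsto_intros)
 then have "\<forall>\<^sub>F x in at_right (0::real). exp (q + 2 * x) - exp (q - 2 * x) < \<epsilon> / 2" using eps by (intro order_tendstoD) auto
 then have "\<forall>\<^sub>F x in at_right (0::real). 0 < x & exp (q + 2 * x) - exp (q - 2 * x) < \<epsilon> / 2"
  using eventually_at_right_less[of "0::real"] by eventually_elim auto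
 then obtain e :: real where e: "0 < e" "exp (q + 2 * e) - exp (q - 2 * e) < \<epsilon> / 2"
  using eventually_happens'[OF trivial_limit_at_right_real] by blast
 have "((%y. K * Kw n * y powr (- kap / (1 + \<beta>))) \<longlongrightarrow> K * Kw n * 0) at_top"
  using kap_pos beta_pos by (intro tendsto_mult_left tendsto_neg_powr) (auto simp: filterlim_ident)
 then have "\<forall>\<^sub>F y in at_top. K * Kw n * y powr (- kap / (1 + \<beta>)) < e" using e by (intro order_tendstoD) auto
 \<comment> \<open>From the mass R on, the remainder of the expansion is below e.\<close>
 then obtain R where R: "!!y. R <= y ==> K * Kw n * y powr (- kap / (1 + \<beta>)) < e" unfolding eventually_at_top_linorder by blast
 define bad where "bad t = measure M {z : alive t. e < \<bar>I t (Zr 1 h) z / Y t z - q\<bar>} + measure M {z : alive t. Y t z < R}" for t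
 have "(bad \<longlongrightarrow> 0 + 0) at_top"
  unfolding bad_def q_def using zb e(1) by (intro tendsto_add large_mass_tendsto ratio_tendsto Zr_nonneg) (auto simp: abs_le_iff)
 then have "((%t. (\<bar>Q\<bar> + exp q) * bad t) \<longlongrightarrow> (\<bar>Q\<bar> + exp q) * (0 + 0)) at_top" by (intro tendsto_mult_left)
 then have "\<forall>\<^sub>F t in at_top. (\<bar>Q\<bar> + exp q) * bad t < \<epsilon> / 2" using eps by (intro order_tendstoD) auto
 then show "\<forall>\<^sub>F t in at_top. dist ((LINT z|M. indicator (good n t) z * exp (- fl t h z)) - exp (stat (Zr 1 h)) * measure M (good n t)) 0 < \<epsilon>"
  using eventually_ge_at_top[of "0::real"]
 proof eventually_elim
  case (elim t)
  have [measurable]: "I t (Zr 1 h) : Bm (F t)" "Y t : Bm (F t)" using elim by (auto intro!: I_F Y_F Zr_measurable)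
  note [measurable] = F_meas[OF \<open>I t (Zr 1 h) : Bm (F t)\<close>] F_meas[OF \<open>Y t : Bm (F t)\<close>] good_F[OF elim(2), of n] alive_M[OF elim(2)]
  define A where "A = good n t \<inter> {z : space M. \<bar>I t (Zr 1 h) z / Y t z - q\<bar> <= e & R <= Y t z}"
  have AF: "A : sets (F t)"
  proof -
   have "{z : space (F t). \<bar>I t (Zr 1 h) z / Y t z - q\<bar> <= e & R <= Y t z} : sets (F t)" by measurable
   then show ?thesis unfolding A_def by (intro sets.Int good_F elim) simp
  qed
  have Ag: "A \<subseteq> good n t" by (auto simp: A_def)
  have DF: "good n t - A : sets (F t)" by (intro sets.Diff good_F elim AF)
  have AM: "A : sets M" "good n t - A : sets M" "good n t : sets M" using AF DF good_F[OF elim(2)] by (auto intro: F_sets)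
  have q: "\<bar>I t (Zr 1 h) z / Y t z - q\<bar> <= e" and er: "K * Kw n * Y t z powr (- kap / (1 + \<beta>)) <= e" if "z : A" for z
   using that R[of "Y t z"] by (auto simp: A_def)
  note l = good_laplace[OF hm h0 hC K elim(2) AF Ag q er]
  note D = Q[OF elim(2) DF Diff_subset]
  have split: "indicator (good n t) z * exp (- fl t h z) = indicator A z * exp (- fl t h z) + indicator (good n t - A) z * exp (- fl t h z)" for z
   using Ag by (auto simp: indicator_def)
  have E: "(LINT z|M. indicator (good n t) z * exp (- fl t h z)) = (LINT z|M. indicator A z * exp (- fl t h z)) + (LINT z|M. indicator (good n t - A) z * exp (- fl t h z))"
   unfolding split using l(1) D by (intro Bochner_Integration.integral_add) auto
  have D0: "0 <= (LINT z|M. indicator (good n t - A) z * exp (- fl t h z))" by (intro integral_nonneg_AE AE_I2) auto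
  let ?p = "measure M A" and ?d = "measure M (good n t - A)"
  have pg: "measure M (good n t) = ?p + ?d" using P.finite_measure_Diff[OF AM(3,1) Ag] by simp
  have db: "?d <= bad t"
  proof -
   have bM: "{z : alive t. e < \<bar>I t (Zr 1 h) z / Y t z - q\<bar>} : sets M" "{z : alive t. Y t z < R} : sets M"
    unfolding alive_def by measurable
   have "good n t - A \<subseteq> {z : alive t. e < \<bar>I t (Zr 1 h) z / Y t z - q\<bar>} \<union> {z : alive t. Y t z < R}"
    using good_alive[of n t] goodD(1)[of _ n t] unfolding A_def by fastforce
   then have "?d <= measure M ({z : alive t. e < \<bar>I t (Zr 1 h) z / Y t z - q\<bar>} \<union> {z : alive t. Y t z < R})"
    using bM by (intro P.finite_measure_mono) auto
   also have "... <= bad t" unfolding bad_def using bM by (intro measure_Un_le)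
   finally show ?thesis .
  qed
  have Qd: "(\<bar>Q\<bar> + exp q) * ?d < \<epsilon> / 2"
  proof -
   have "(\<bar>Q\<bar> + exp q) * ?d <= (\<bar>Q\<bar> + exp q) * bad t" using db by (intro mult_left_mono) auto
   then show ?thesis using elim(1) by linarith
  qed
  have Q1: "Q * ?d <= \<bar>Q\<bar> * ?d" by (intro mult_right_mono) auto
  have 1: "(exp (q + 2 * e) - exp q) * ?p <= (exp (q + 2 * e) - exp q) * 1" "(exp q - exp (q - 2 * e)) * ?p <= (exp q - exp (q - 2 * e)) * 1"
   using e(1) by (auto intro!: mult_left_mono)
  have 2: "exp (q - 2 * e) <= exp q" "exp q <= exp (q + 2 * e)" using e(1) by auto
  have 3: "0 <= exp q * ?d" "0 <= \<bar>Q\<bar> * ?d" by auto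
  have up: "(LINT z|M. indicator (good n t) z * exp (- fl t h z)) - exp q * measure M (good n t) < \<epsilon>"
   using l(3) D[THEN conjunct2] Q1 1[unfolded left_diff_distrib mult_1_right] 2 3 Qd[unfolded distrib_right] e(2) eps
   unfolding E pg distrib_left by linarith
  have low: "- \<epsilon> < (LINT z|M. indicator (good n t) z * exp (- fl t h z)) - exp q * measure M (good n t)"
   using l(2) D0 1[unfolded left_diff_distrib mult_1_right] 2 3 Qd[unfolded distrib_right] e(2) eps
   unfolding E pg distrib_left by linarith
  show ?case using up low unfolding q_def[symmetric] dist_real_def by (simp add: abs_less_iff)
 qed
qed

end

subsection \<open>Holomorphic functions defined by integrals\<close>

text \<open>Cauchy's estimate on discs of radius r / 3 around points of the disc of radius r / 2;
  these stay in \<open>ball w r\<close> as 1/2 + 1/3 < 1. The bound B + 1 leaves room for the strict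
  inequality in the estimate.\<close>

lemma difference_quotient_bound:
 fixes f :: "complex => complex"
 assumes hol: "f holomorphic_on S" and r: "0 < r" "ball w r \<subseteq> S" and B: "!!z. z : S ==> norm (f z) <= B"
  and h: "h ~= 0" "norm h < r / 2"
 shows "norm ((f (w + h) - f w) / h) <= (B + 1) / (r / 3)"
proof -
 have "norm (f (w + h) - f w) <= (B + 1) / (r / 3) * norm ((w + h) - w)"
 proof (rule field_differentiable_bound[where S="ball w (r / 2)" and f'="deriv f"])
  fix z assume z: "z : ball w (r / 2)"
  have sub: "cball z (r / 3) \<subseteq> ball w r"
  proof
   fix u assume "u : cball z (r / 3)"
   then show "u : ball w r" using z dist_triangle[of w u z] r by (auto simp: dist_commute)
  qed
  have hb: "f holomorphic_on ball w r" using hol r holomorphic_on_subset by blast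
  have "f holomorphic_on ball z (r / 3)" using hb sub ball_subset_cball holomorphic_on_subset by blast
  moreover have "continuous_on (cball z (r / 3)) f"
   using hb sub holomorphic_on_imp_continuous_on continuous_on_subset by blast
  moreover have "f u : ball 0 (B + 1)" if "u : ball z (r / 3)" for u
  proof -
   have "u : cball z (r / 3)" using that by simp
   then have "u : S" using sub r(2) by blast
   then show ?thesis using B[of u] by simp
  qed
  ultimately have "norm ((deriv ^^ 1) f z) <= fact 1 * (B + 1) / (r / 3) ^ 1"
   using r by (intro Cauchy_higher_deriv_bound[where y=0]) auto
  then show "norm (deriv f z) <= (B + 1) / (r / 3)" by simp
  have "z : ball w r" using z r by auto
  then show "(f has_field_derivative deriv f z) (at z within ball w (r / 2))"
   using hb by (meson DERIV_subset holomorphic_derivI open_ball subset_UNIV has_field_derivative_at_within)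
 qed (use r h in \<open>auto simp: dist_norm\<close>)
 then show ?thesis using h by (simp add: norm_divide divide_le_eq)
qed

text \<open>Differentiation under the integral sign. Domination of the integrand on S yields,
  through Cauchy's estimate, an integrable majorant for the difference quotients.\<close>

lemma holomorphic_integral:
 fixes k :: "complex => 'x => complex"
 assumes fin: "finite_measure N" and S: "open S"
  and meas[measurable]: "!!w. k w : Bm N"
  and hol: "!!x. x : space N ==> (%w. k w x) holomorphic_on S"
  and dom: "integrable N B" "!!w x. w : S ==> x : space N ==> norm (k w x) <= B x"
 shows "(%w. \<integral>x. k w x \<partial>N) holomorphic_on S"
 unfolding holomorphic_on_open[OF S]
proof
 interpret finite_measure N by fact
 fix w assume w: "w : S"
 obtain r where r: "0 < r" "ball w r \<subseteq> S" using S w openE by blast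
 have int: "integrable N (k u)" if "u : S" for u
  using dom(2)[OF that] by (intro Bochner_Integration.integrable_bound[OF dom(1)] AE_I2) (auto intro: order_trans[OF _ abs_ge_self])
 define D where "D x = deriv (%u. k u x) w" for x
 have der: "((%u. k u x) has_field_derivative D x) (at w)" if "x : space N" for x
  unfolding D_def by (rule holomorphic_derivI[OF hol[OF that] S w])
 have "((%h. ((LINT x|N. k (w + h) x) - (LINT x|N. k w x)) / h) \<longlongrightarrow> (LINT x|N. D x)) (at 0)"
  unfolding tendsto_at_iff_sequentially
 proof (intro allI impI)
  fix h :: "nat => complex" assume h0: "\<forall>i. h i : UNIV - {0}" and h: "h ----> 0"
  have "\<forall>\<^sub>F i in sequentially. norm (h i) < r / 2" using h r tendstoD[OF h, of "r / 2"] by (simp add: dist_norm)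
  then obtain m where m: "!!i. m <= i ==> norm (h i) < r / 2" unfolding eventually_sequentially by blast
  define Q where "Q i = ((LINT x|N. k (w + h i) x) - (LINT x|N. k w x)) / h i" for i
  \<comment> \<open>Shifted by m, so that all increments lie within r / 2.\<close>
  define q where "q i x = (k (w + h (i + m)) x - k w x) / h (i + m)" for i x
  have wh: "w + h (i + m) : S" for i using m[of "i + m"] r by (intro subsetD[OF r(2)]) (auto simp: dist_norm)
  have lim: "(%i. q i x) ----> D x" if "x : space N" for x
  proof -
   have "((%y. (k (w + y) x - k w x) / y) \<longlongrightarrow> D x) (at 0)" using der[OF that] by (simp add: DERIV_def)
   then have "(%i. (k (w + h i) x - k w x) / h i) ----> D x"
    using h h0 unfolding tendsto_at_iff_sequentially by (auto simp: o_def)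
   then show ?thesis unfolding q_def by (rule LIMSEQ_ignore_initial_segment)
  qed
  have qm[measurable]: "q i : Bm N" for i unfolding q_def by measurable
  have Dm: "D : Bm N" by (rule borel_measurable_LIMSEQ_metric[OF qm lim])
  have "(%i. \<integral>x. q i x \<partial>N) ----> (LINT x|N. D x)"
  proof (rule integral_dominated_convergence[OF Dm qm])
   show "integrable N (%x. (B x + 1) / (r / 3))" using dom(1) by (intro integrable_divide Bochner_Integration.integrable_add) auto
   show "AE x in N. (%i. q i x) ----> D x" using lim by (intro AE_I2)
   show "AE x in N. norm (q i x) <= (B x + 1) / (r / 3)" for i
   proof (rule AE_I2)
    fix x assume x: "x : space N"
    show "norm (q i x) <= (B x + 1) / (r / 3)" unfolding q_def
     using h0 m[of "i + m"] by (intro difference_quotient_bound[OF hol[OF x] r dom(2)[OF _ x]]) auto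
   qed
  qed
  moreover have "(LINT x|N. q i x) = ((LINT x|N. k (w + h (i + m)) x) - (LINT x|N. k w x)) / h (i + m)" for i
   unfolding q_def using int[OF wh[of i]] int[OF w] by simp
  ultimately have "(%i. Q (i + m)) ----> (LINT x|N. D x)" by (simp add: Q_def)
  then have "Q ----> (LINT x|N. D x)" by (rule LIMSEQ_offset)
  then show "((%h. ((LINT x|N. k (w + h) x) - (LINT x|N. k w x)) / h) \<circ> h) ----> (LINT x|N. D x)"
   by (simp add: o_def Q_def[abs_def])
 qed
 then show "\<exists>f'. ((%w. \<integral>x. k w x \<partial>N) has_field_derivative f') (at w)" unfolding DERIV_def by blast
qed

text \<open>Montel's theorem extracts from any subsequence a further one with a holomorphic limit,
  which agrees with g on U and hence on S by the identity theorem.\<close>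

lemma vitali_convergence:
 fixes G :: "nat => complex => complex"
 assumes S: "open S" "connected S" and hol: "!!n. G n holomorphic_on S" "g holomorphic_on S"
  and bd: "!!n z. z : S ==> norm (G n z) <= B"
  and U: "U \<subseteq> S" "\<xi> : S" "\<xi> islimpt U" "!!z. z : U ==> (%n. G n z) ----> g z" and z: "z : S"
 shows "(%n. G n z) ----> g z"
proof (rule ccontr)
 assume "\<not> (%n. G n z) ----> g z"
 then obtain e where e: "0 < e" "\<not> (\<forall>\<^sub>F n in sequentially. dist (G n z) (g z) < e)" unfolding tendsto_iff by blast
 from not_eventually_sequentiallyD[OF e(2)] obtain r :: "nat => nat" where r: "strict_mono r" "!!n. \<not> dist (G (r n) z) (g z) < e" by auto
 have bdK: "\<exists>B. \<forall>h\<in>range G. \<forall>x\<in>K. norm (h x) <= B" if "K \<subseteq> S" for K using bd that by blast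
 obtain l q where l: "l holomorphic_on S" "strict_mono q" "!!x. x : S ==> (%n. G (r (q n)) x) ----> l x"
  by (rule Montel[of S "range G" "G \<circ> r"]) (use S hol bdK in \<open>auto simp: o_def\<close>)
 have sub: "strict_mono (%n. r (q n))" using r(1) l(2) by (simp add: strict_mono_def)
 have "l x = g x" if "x : U" for x
  using l(3)[of x] LIMSEQ_subseq_LIMSEQ[OF U(4)[OF that] sub] that U(1) LIMSEQ_unique by (auto simp: o_def)
 then have "l z - g z = 0"
  using analytic_continuation[of "%x. l x - g x" S U \<xi> z] S U z l(1) hol(2) by (auto intro!: holomorphic_intros)
 then have "(%n. G (r (q n)) z) ----> g z" using l(3)[OF z] by simp
 then have "\<forall>\<^sub>F n in sequentially. dist (G (r (q n)) z) (g z) < e" using e(1) by (rule tendstoD)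
 then show False using r(2) by (auto simp: eventually_sequentially)
qed

context ou
begin

subsection \<open>Integrals against the stationary law\<close>

text \<open>Invariance is read off from ergodicity: P_s P_t g = P_(s + t) g has the same limit as
  P_s g when s tends to infinity.\<close>

lemma stat_OU_P_real:
 fixes g :: "'a::euclidean_space => real"
 assumes gm[measurable]: "g : Bm borel" and gC: "!!x. \<bar>g x\<bar> <= C * wt n x" and t: "0 <= t"
 shows "stat (OU_P \<sigma> b t g) = stat g"
proof -
 have Pb: "\<bar>OU_P \<sigma> b t g x\<bar> <= C * growth_const TYPE('a) n * wt n x" for x
  using OU_P_norm_le[OF gm _ t, of C n x] gC by simp
 have "((%s. OU_P \<sigma> b s (OU_P \<sigma> b t g) 0) \<longlongrightarrow> stat (OU_P \<sigma> b t g)) at_top"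
  by (rule OU_P_ergodic[OF _ Pb]) measurable
 moreover have "\<forall>\<^sub>F s in at_top. OU_P \<sigma> b s (OU_P \<sigma> b t g) 0 = OU_P \<sigma> b (s + t) g 0"
  using eventually_ge_at_top[of "0::real"]
 proof eventually_elim
  case (elim s)
  then show ?case using gC t by (intro OU_P_semigroup[of g C n]) auto
 qed
 ultimately have "((%s. OU_P \<sigma> b (s + t) g 0) \<longlongrightarrow> stat (OU_P \<sigma> b t g)) at_top" by (rule Lim_transform_eventually)
 moreover have "((%s. OU_P \<sigma> b (s + t) g 0) \<longlongrightarrow> stat g) at_top"
  by (rule filterlim_compose[OF OU_P_ergodic[OF gm gC]]) (auto intro: filterlim_tendsto_add_at_top filterlim_ident simp: add.commute[of _ t])
 ultimately show ?thesis by (rule tendsto_unique[OF trivial_limit_at_top_linorder])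
qed

lemma stat_OU_P:
 fixes g :: "'a::euclidean_space => complex"
 assumes gm[measurable]: "g : Bm borel" and gC: "!!x. norm (g x) <= C * wt n x" and t: "0 <= t"
 shows "stat (OU_P \<sigma> b t g) = stat g"
proof -
 have ig: "integrable phim g" by (rule integrable_phim[OF gm gC])
 have Pb: "norm (OU_P \<sigma> b t g x) <= C * growth_const TYPE('a) n * wt n x" for x
  by (rule OU_P_norm_le[OF gm gC t])
 have iP: "integrable phim (OU_P \<sigma> b t g)" by (rule integrable_phim[OF _ Pb]) measurable
 have io: "integrable std_gauss (%z. g (exp (- b * t) *\<^sub>R x + sd t *\<^sub>R z))" for x by (rule integrable_OU[OF gm gC])
 have "Re (OU_P \<sigma> b t g x) = OU_P \<sigma> b t (%y. Re (g y)) x" "Im (OU_P \<sigma> b t g x) = OU_P \<sigma> b t (%y. Im (g y)) x" for x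
  unfolding OU_P_eq using io[of x] by simp_all
 moreover have "\<bar>Re (g x)\<bar> <= C * wt n x" "\<bar>Im (g x)\<bar> <= C * wt n x" for x
  using abs_Re_le_cmod[of "g x"] abs_Im_le_cmod[of "g x"] gC[of x] by linarith+
 then have "stat (OU_P \<sigma> b t (%y. Re (g y))) = stat (%y. Re (g y))" "stat (OU_P \<sigma> b t (%y. Im (g y))) = stat (%y. Im (g y))"
  using t by (auto intro!: stat_OU_P_real)
 ultimately show ?thesis using ig iP by (intro complex_eqI) (simp_all add: stat_def flip: integral_Re integral_Im)
qed

text \<open>The time integral over [0, 1] as a probability integral, so that Duhamel integrals
  paired with phi become integrals over one product probability space.\<close>

definition unif :: "real measure" where
 "unif = density lborel (%s. ennreal (indicator {0..1} s))"

lemma sets_unif [measurable_cong, simp]: "sets unif = sets borel"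
 and space_unif [simp]: "space unif = UNIV"
 by (auto simp: unif_def)

lemma prob_space_unif: "prob_space unif"
 by (intro prob_spaceI) (simp add: unif_def emeasure_density ennreal_indicator)

lemma integral_unif:
 fixes g :: "real => 'b::{banach,second_countable_topology}"
 assumes "g : Bm borel"
 shows "(LINT s|unif. g s) = (LINT s:{0..1}|lborel. g s)"
 unfolding unif_def set_lebesgue_integral_def using assms by (intro integral_density) auto

lemma unif_phim:
 fixes g :: "real => 'a::euclidean_space => 'b::{banach,second_countable_topology}"
 assumes gm[measurable]: "(%(s, x). g s x) : Bm (borel \<Otimes>\<^sub>M borel)" and bd: "!!s x. norm (g s x) <= E * wt m x"
 shows "integrable (unif \<Otimes>\<^sub>M phim) (%(s, x). g s x)"
  "(LINT (s, x)|(unif \<Otimes>\<^sub>M phim). g s x) = (LINT s|unif. stat (g s))"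
  "(LINT (s, x)|(unif \<Otimes>\<^sub>M phim). g s x) = stat (%x. \<integral>s. g s x \<partial>unif)"
proof -
 interpret U: prob_space unif by (rule prob_space_unif)
 interpret Q: prob_space "phim :: 'a measure" by (rule prob_space_phim)
 interpret UQ: pair_sigma_finite unif "phim :: 'a measure" ..
 have gs[measurable]: "g s : Bm borel" for s by measurable
 have ig: "integrable phim (g s)" for s by (rule integrable_phim[OF gs bd])
 have iw: "integrable phim (%x::'a. E * wt m x)" by (intro integrable_mult_right integrable_phim[where C=1 and n=m]) auto
 show int: "integrable (unif \<Otimes>\<^sub>M phim) (%(s, x). g s x)"
 proof (rule UQ.Fubini_integrable)
  show "integrable unif (%s. \<integral>y. norm (case (s, y) of (s, x) => g s x) \<partial>(phim :: 'a measure))"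
  proof (rule U.integrable_const_bound[where B="\<integral>x. E * wt m x \<partial>(phim :: 'a measure)"])
   show "AE s in unif. norm (LINT y|(phim :: 'a measure). norm (case (s, y) of (s, x) => g s x)) <= (LINT x|(phim :: 'a measure). E * wt m x)"
   proof (rule AE_I2)
    fix s
    have "(LINT y|(phim :: 'a measure). norm (g s y)) <= (LINT x|(phim :: 'a measure). E * wt m x)"
     using ig iw bd by (intro integral_mono integrable_norm) auto
    moreover have "0 <= (LINT y|(phim :: 'a measure). norm (g s y))" by simp
    ultimately show "norm (LINT y|(phim :: 'a measure). norm (case (s, y) of (s, x) => g s x)) <= (LINT x|(phim :: 'a measure). E * wt m x)"
     by (simp only: prod.case real_norm_def abs_of_nonneg)
   qed
  qed measurable
 qed (use ig in auto)
 show "(LINT (s, x)|(unif \<Otimes>\<^sub>M phim). g s x) = (LINT s|unif. stat (g s))"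
  unfolding stat_def by (rule UQ.integral_fst[OF int, symmetric])
 show "(LINT (s, x)|(unif \<Otimes>\<^sub>M phim). g s x) = stat (%x. \<integral>s. g s x \<partial>unif)"
  unfolding stat_def by (rule UQ.integral_snd[OF int, symmetric])
qed

text \<open>Clamping to [0, 1] makes the estimates valid for every real s, as required on the
  product space.\<close>

definition "cl s = max 0 (min 1 (s::real))"

lemma cl: "0 <= cl s" "cl s <= 1" "s : {0..1} ==> cl s = s" by (auto simp: cl_def)

lemma cl_measurable [measurable]: "cl : Bm borel" unfolding cl_def by measurable

text \<open>Invariance of the stationary law removes the outer P_(1 - s); what remains is the growth
  factor exp(a (1 - s)).\<close>

lemma stat_duhamel:
 fixes k :: "real => 'a::euclidean_space => complex"
 assumes km[measurable]: "(%(s, x). k s x) : Bm (borel \<Otimes>\<^sub>M borel)" and bd: "!!s x. norm (k s x) <= E * wt m x"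
 shows "stat (%x. LINT s:{0..1}|lborel. OU_Pa a \<sigma> b (1 - s) (k s) x) = (LINT (s, y)|(unif \<Otimes>\<^sub>M phim). exp (a * (1 - cl s)) *\<^sub>R k s y)"
proof -
 have ks[measurable]: "k s : Bm borel" for s by measurable
 have E0: "0 <= E" using order_trans[OF norm_ge_zero bd[of 0 0]] wt_pos[of m "0::'a"] by (simp add: zero_le_mult_iff)
 have ex: "exp (a * (1 - cl s)) <= exp \<bar>a\<bar>" for s
 proof -
  have "\<bar>a * (1 - cl s)\<bar> <= \<bar>a\<bar> * 1" unfolding abs_mult using cl[of s] by (intro mult_left_mono) auto
  then show ?thesis by simp
 qed
 define g where "g s x = exp (a * (1 - cl s)) *\<^sub>R OU_P \<sigma> b (1 - cl s) (k s) x" for s x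
 have gm[measurable]: "(%(s, x). g s x) : Bm (borel \<Otimes>\<^sub>M borel)" unfolding g_def split_beta' by measurable
 have gb: "norm (g s x) <= exp \<bar>a\<bar> * (E * growth_const TYPE('a) m) * wt m x" for s x
 proof -
  have "norm (OU_P \<sigma> b (1 - cl s) (k s) x) <= E * growth_const TYPE('a) m * wt m x" using bd cl[of s] by (intro OU_P_norm_le) auto
  then have "exp (a * (1 - cl s)) * norm (OU_P \<sigma> b (1 - cl s) (k s) x) <= exp \<bar>a\<bar> * (E * growth_const TYPE('a) m * wt m x)"
   using ex by (intro mult_mono) auto
  then show ?thesis by (simp add: g_def mult_ac)
 qed
 have kb: "norm (exp (a * (1 - cl s)) *\<^sub>R k s x) <= (exp \<bar>a\<bar> * E) * wt m x" for s x
  using mult_mono[OF ex[of s] bd[of s x]] by (simp add: mult_ac)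
 have km2: "(%(s, x). exp (a * (1 - cl s)) *\<^sub>R k s x) : Bm (borel \<Otimes>\<^sub>M borel)" unfolding split_beta' by measurable
 have "(LINT s:{0..1}|lborel. OU_Pa a \<sigma> b (1 - s) (k s) x) = (LINT s|unif. g s x)" for x
 proof -
  have "(LINT s:{0..1}|lborel. OU_Pa a \<sigma> b (1 - s) (k s) x) = (LINT s:{0..1}|lborel. g s x)"
   by (rule set_lebesgue_integral_cong) (auto simp: g_def OU_Pa_def cl)
  also have "... = (LINT s|unif. g s x)" by (rule integral_unif[symmetric]) measurable
  finally show ?thesis .
 qed
 then have 1: "stat (%x. LINT s:{0..1}|lborel. OU_Pa a \<sigma> b (1 - s) (k s) x) = (LINT s|unif. stat (g s))"
  using unif_phim(2,3)[OF gm gb] by simp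
 have 2: "stat (g s) = stat (%y. exp (a * (1 - cl s)) *\<^sub>R k s y)" for s
 proof -
  have "stat (OU_P \<sigma> b (1 - cl s) (k s)) = stat (k s)" using bd cl[of s] by (intro stat_OU_P) auto
  then show ?thesis by (simp add: stat_def g_def)
 qed
 have "(LINT s|unif. stat (%y. exp (a * (1 - cl s)) *\<^sub>R k s y)) = (LINT (s, y)|(unif \<Otimes>\<^sub>M phim). exp (a * (1 - cl s)) *\<^sub>R k s y)"
  by (rule unif_phim(2)[OF km2 kb, symmetric])
 then show ?thesis unfolding 1 2 .
qed

end

subsection \<open>The limiting exponent\<close>

lemma norm_powr_of_real: "norm (z powr complex_of_real p) = norm z powr p"
 by (simp add: norm_powr_real_powr')

locale super_ou_fluct = super_ou_X \<sigma> b \<alpha> \<rho> \<pi> \<eta> \<beta> \<delta> M X \<mu>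
 for \<sigma> b \<alpha> \<rho> :: real and \<pi> :: "real measure" and \<eta> \<beta> \<delta> :: real
  and M :: "'w measure" and X :: "real => 'w => 'a::euclidean_space measure" and \<mu> :: "'a measure" +
 fixes f1 f2 :: "'a => real" and C :: real and n :: nat
 assumes f1_meas [measurable]: "f1 : Bm borel" and f2_meas [measurable]: "f2 : Bm borel"
  and f1_nonneg: "!!x. 0 <= f1 x" and f2_nonneg: "!!x. 0 <= f2 x"
  and f1_le: "!!x. f1 x <= C * wt n x" and f2_le: "!!x. f2 x <= C * wt n x"
begin

lemma f1_abs: "\<bar>f1 x\<bar> <= C * wt n x" and f2_abs: "\<bar>f2 x\<bar> <= C * wt n x"
 using f1_nonneg[of x] f2_nonneg[of x] f1_le[of x] f2_le[of x] by auto

lemma C_nonneg: "0 <= C"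
 using order_trans[OF abs_ge_zero f1_abs[of 0]] wt_pos[of n "0::'a"] by (simp add: zero_le_mult_iff)

definition "p1 s y = Pa (cl s) f1 y"
definition "p2 s y = Pa (cl s) f2 y"

lemma p_meas [measurable (raw)]:
 assumes [measurable]: "s : Bm N" "y : Bm N"
 shows "(%\<omega>. p1 (s \<omega>) (y \<omega>)) : Bm N" "(%\<omega>. p2 (s \<omega>) (y \<omega>)) : Bm N"
 unfolding p1_def p2_def by measurable

lemma p_nonneg: "0 <= p1 s y" "0 <= p2 s y"
 unfolding p1_def p2_def using Pa_nonneg[of f1, OF f1_nonneg] Pa_nonneg[of f2, OF f2_nonneg] by auto

definition "Cp = 1 + exp (\<alpha> * 1) * (C * growth_const TYPE('a) n)"

lemma Cp_ge_1: "1 <= Cp"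
 unfolding Cp_def using C_nonneg growth_const_ge_1[of "TYPE('a)" n] by auto

lemma p_le: "p1 s y <= Cp * wt n y" "p2 s y <= Cp * wt n y"
proof -
 have "norm (Pa (cl s) f1 y) <= exp (\<alpha> * 1) * (C * growth_const TYPE('a) n) * wt n y"
  using f1_abs cl by (intro Pa_norm_le) auto
 moreover have "norm (Pa (cl s) f2 y) <= exp (\<alpha> * 1) * (C * growth_const TYPE('a) n) * wt n y"
  using f2_abs cl by (intro Pa_norm_le) auto
 ultimately show "p1 s y <= Cp * wt n y" "p2 s y <= Cp * wt n y"
  unfolding p1_def p2_def Cp_def distrib_right by (auto simp: abs_le_iff intro!: add_increasing)
qed

text \<open>One integrand for both regimes: nonnegative z1 = a and z2 = c give the exponent of the
  real Laplace transform, z1 = -i theta and z2 = i theta that of \<open>Z1\<close>.\<close>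

definition "jk z1 z2 s y = complex_of_real \<eta> * (z1 * complex_of_real (p1 s y) + z2 * complex_of_real (p2 s y)) powr complex_of_real (1 + \<beta>)"

definition "jw z1 z2 = (%(s, y). exp (\<alpha> * (1 - cl s)) *\<^sub>R jk z1 z2 s y)"

definition "J z1 z2 = (LINT q|(unif \<Otimes>\<^sub>M phim). jw z1 z2 q)"

lemma jk_meas [measurable]: "(%(s, y). jk z1 z2 s y) : Bm (borel \<Otimes>\<^sub>M borel)"
 unfolding jk_def split_beta' by measurable

lemma jw_meas [measurable]: "jw z1 z2 : Bm (unif \<Otimes>\<^sub>M phim)"
 unfolding jw_def jk_def split_beta' by measurable

lemma jk_bound:
 assumes z: "norm z1 <= R" "norm z2 <= R" and R: "1 <= R"
 shows "norm (jk z1 z2 s y) <= (\<eta> * (2 * (2 * R * Cp)\<^sup>2)) * wt (2 * n) y"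
proof -
 have "norm (z1 * complex_of_real (p1 s y) + z2 * complex_of_real (p2 s y)) <= norm z1 * p1 s y + norm z2 * p2 s y"
  using p_nonneg[of s y] by (intro order_trans[OF norm_triangle_ineq]) (simp add: norm_mult)
 also have "... <= R * (Cp * wt n y) + R * (Cp * wt n y)"
  using z p_le[of s y] p_nonneg[of s y] by (intro add_mono mult_mono) (auto intro: order_trans[OF norm_ge_zero])
 finally have le: "norm (z1 * complex_of_real (p1 s y) + z2 * complex_of_real (p2 s y)) <= (2 * R * Cp) * wt n y" by (simp add: mult_ac)
 have "1 * 1 <= (2 * R) * Cp" using R Cp_ge_1 by (intro mult_mono) auto
 then have "norm (z1 * complex_of_real (p1 s y) + z2 * complex_of_real (p2 s y)) powr (1 + \<beta>) <= 2 * (2 * R * Cp)\<^sup>2 * wt (2 * n) y"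
  using beta_pos beta_lt_1 le by (intro wt_powr) auto
 then show ?thesis unfolding jk_def norm_mult norm_powr_of_real using eta_pos by (simp add: mult_left_mono mult.assoc)
qed

text \<open>One majorant for all coefficients in a disc serves both the holomorphy of J and its
  continuity at the boundary.\<close>

lemma jw_dominated:
 "\<exists>B. integrable (unif \<Otimes>\<^sub>M phim) B & (\<forall>z1 z2 q. norm z1 <= R --> norm z2 <= R --> norm (jw z1 z2 q) <= B q)"
proof -
 define R' where "R' = max 1 R"
 define E where "E = exp \<alpha> * (\<eta> * (2 * (2 * R' * Cp)\<^sup>2))"
 have E0: "0 <= E" using eta_pos by (simp add: E_def)
 show ?thesis
 proof (intro exI[of _ "%(s::real, y::'a). E * wt (2 * n) y"] conjI allI impI)
  show "integrable (unif \<Otimes>\<^sub>M phim) (%(s::real, y::'a). E * wt (2 * n) y)"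
   using E0 by (intro unif_phim(1)[where E=E and m="2 * n"]) (auto simp: split_beta')
  fix z1 z2 :: complex and q :: "real \<times> 'a" assume z: "norm z1 <= R" "norm z2 <= R"
  obtain s y where q: "q = (s, y)" by (cases q)
  have "exp (\<alpha> * (1 - cl s)) <= exp \<alpha>" using alpha_pos cl[of s] mult_left_mono[of "1 - cl s" 1 \<alpha>] by simp
  then have "exp (\<alpha> * (1 - cl s)) * norm (jk z1 z2 s y) <= exp \<alpha> * ((\<eta> * (2 * (2 * R' * Cp)\<^sup>2)) * wt (2 * n) y)"
   using z by (intro mult_mono jk_bound) (auto simp: R'_def)
  then show "norm (jw z1 z2 q) <= (case q of (s, y) => E * wt (2 * n) y)" by (simp add: q jw_def E_def mult.assoc)
 qed
qed

lemma prob_space_unif_phim: "prob_space (unif \<Otimes>\<^sub>M (phim :: 'a measure))"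
proof -
 interpret U: prob_space unif by (rule prob_space_unif)
 interpret Q: prob_space "phim :: 'a measure" by (rule prob_space_phim)
 interpret UQ: pair_prob_space unif "phim :: 'a measure" ..
 show ?thesis by (rule UQ.prob_space_axioms)
qed

text \<open>In the strip both e + w and e - w have positive real part, and p1, p2 are nonnegative;
  so the base of the power stays in the right half plane, away from the cut, unless p1 = p2 = 0,
  where the integrand vanishes identically.\<close>

lemma J_holomorphic:
 assumes R: "0 < R"
 shows "(%w. J (of_real e + w) (of_real e - w)) holomorphic_on box (Complex (- e) (- R)) (Complex e R)"
proof -
 obtain B where B: "integrable (unif \<Otimes>\<^sub>M phim) B" "!!z1 z2 q. norm z1 <= \<bar>e\<bar> + (\<bar>e\<bar> + R) ==> norm z2 <= \<bar>e\<bar> + (\<bar>e\<bar> + R) ==> norm (jw z1 z2 q) <= B q"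
  using jw_dominated by blast
 show ?thesis unfolding J_def
 proof (rule holomorphic_integral[OF _ open_box _ _ B(1)])
  show "finite_measure (unif \<Otimes>\<^sub>M (phim :: 'a measure))" using prob_space_unif_phim by (simp add: prob_space_def)
  show "jw (of_real e + w) (of_real e - w) : Bm (unif \<Otimes>\<^sub>M phim)" for w by measurable
  show "norm (jw (of_real e + w) (of_real e - w) q) <= B q" if w: "w : box (Complex (- e) (- R)) (Complex e R)" for w q
  proof (rule B(2))
   have "norm w <= \<bar>Re w\<bar> + \<bar>Im w\<bar>" by (rule cmod_le)
   also have "... <= \<bar>e\<bar> + R" using w by (auto simp: in_box_complex_iff)
   finally have "norm w <= \<bar>e\<bar> + R" .
   then show "norm (of_real e + w) <= \<bar>e\<bar> + (\<bar>e\<bar> + R)" "norm (of_real e - w) <= \<bar>e\<bar> + (\<bar>e\<bar> + R)"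
    using norm_triangle_ineq[of "of_real e :: complex" w] norm_triangle_ineq4[of "of_real e :: complex" w] by auto
  qed
  show "(%w. jw (of_real e + w) (of_real e - w) q) holomorphic_on box (Complex (- e) (- R)) (Complex e R)" for q
  proof -
   obtain s y where q: "q = (s, y)" by (cases q)
   show ?thesis
   proof (cases "p1 s y = 0 & p2 s y = 0")
    case False
    have "(of_real e + w) * complex_of_real (p1 s y) + (of_real e - w) * complex_of_real (p2 s y) \<notin> \<real>\<^sub>\<le>\<^sub>0"
     if w: "w : box (Complex (- e) (- R)) (Complex e R)" for w
    proof -
     have w': "0 < e + Re w" "0 < e - Re w" using w by (auto simp: in_box_complex_iff)
     have "0 < p1 s y \<or> 0 < p2 s y" using False p_nonneg[of s y] by auto
     then have "0 < (e + Re w) * p1 s y + (e - Re w) * p2 s y"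
      using w' p_nonneg[of s y] by (auto intro: add_pos_nonneg add_nonneg_pos)
     then show ?thesis by (auto simp: complex_nonpos_Reals_iff)
    qed
    then show ?thesis unfolding q jw_def jk_def scaleR_conv_of_real prod.case
     by (intro holomorphic_intros) auto
   qed (simp add: q jw_def jk_def)
  qed
 qed
qed

text \<open>At the limit point the base is purely imaginary, hence off the cut or equal to 0, and
  the power is continuous at both since its exponent has positive real part. The case w1 = w2 = 0 is
  included.\<close>

lemma J_tendsto:
 assumes z: "z1 ----> w1" "z2 ----> w2" and w: "Re w1 = 0" "w2 = - w1"
 shows "(%k. J (z1 k) (z2 k)) ----> J w1 w2"
proof -
 obtain R1 where R1: "!!k. norm (z1 k) <= R1" using convergent_imp_Bseq[of z1] z(1) by (auto simp: convergent_def Bseq_def)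
 obtain R2 where R2: "!!k. norm (z2 k) <= R2" using convergent_imp_Bseq[of z2] z(2) by (auto simp: convergent_def Bseq_def)
 obtain B where B: "integrable (unif \<Otimes>\<^sub>M phim) B" "!!z1 z2 q. norm z1 <= max R1 R2 ==> norm z2 <= max R1 R2 ==> norm (jw z1 z2 q) <= B q"
  using jw_dominated by blast
 show ?thesis unfolding J_def
 proof (rule integral_dominated_convergence[OF _ _ B(1)])
  show "AE q in unif \<Otimes>\<^sub>M phim. norm (jw (z1 k) (z2 k) q) <= B q" for k
   using R1[of k] R2[of k] by (intro AE_I2 B(2)) auto
  show "AE q in unif \<Otimes>\<^sub>M phim. (%k. jw (z1 k) (z2 k) q) ----> jw w1 w2 q"
  proof (rule AE_I2)
   fix q :: "real \<times> 'a"
   obtain s y where q: "q = (s, y)" by (cases q)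
   define v where "v = w1 * complex_of_real (p1 s y) + w2 * complex_of_real (p2 s y)"
   have "Re v = 0" using w by (simp add: v_def)
   then have "v \<notin> \<real>\<^sub>\<le>\<^sub>0 \<or> v = 0" by (auto simp: complex_nonpos_Reals_iff complex_eq_iff)
   then show "(%k. jw (z1 k) (z2 k) q) ----> jw w1 w2 q"
    unfolding q jw_def jk_def prod.case  using beta_pos unfolding v_def by (intro tendsto_intros z) auto
  qed
 qed measurable
qed

text \<open>A positive factor leaves the argument of a complex number unchanged, so the principal
  power is homogeneous; this is the scaling behind the stable index 1 + beta.\<close>

lemma J_homogeneous:
 assumes r: "0 <= r"
 shows "J (of_real r * z1) (of_real r * z2) = of_real (r powr (1 + \<beta>)) * J z1 z2"
proof -
 have pw: "(of_real r * z) powr complex_of_real (1 + \<beta>) = of_real (r powr (1 + \<beta>)) * z powr complex_of_real (1 + \<beta>)" for z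
 proof (cases "r = 0 \<or> z = 0")
  case False
  then have "Ln (of_real r * z) = of_real (ln r) + Ln z" using r Ln_times_of_real[of r z] by (simp add: Ln_of_real)
  then have "(of_real r * z) powr complex_of_real (1 + \<beta>) = exp (of_real ((1 + \<beta>) * ln r)) * exp (of_real (1 + \<beta>) * Ln z)"
   using False by (simp add: powr_def distrib_left flip: exp_add)
  then show ?thesis using False r by (simp add: powr_def flip: exp_of_real)
 qed (use beta_pos in auto)
 have "jw (of_real r * z1) (of_real r * z2) q = of_real (r powr (1 + \<beta>)) * jw z1 z2 q" for q
 proof -
  obtain s y where q: "q = (s, y)" by (cases q)
  have "of_real r * z1 * complex_of_real (p1 s y) + of_real r * z2 * complex_of_real (p2 s y)
   = of_real r * (z1 * complex_of_real (p1 s y) + z2 * complex_of_real (p2 s y))" by (simp add: algebra_simps)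
  then show ?thesis unfolding q jw_def jk_def prod.case by (simp only: pw) (simp add: scaleR_conv_of_real mult_ac)
 qed
 then have "jw (of_real r * z1) (of_real r * z2) = (%q. of_real (r powr (1 + \<beta>)) * jw z1 z2 q)" by blast
 then show ?thesis unfolding J_def by simp
qed

end

lemma set_integral_reflect_unit:
 fixes g :: "real => 'b::{banach,second_countable_topology}"
 shows "(LINT s:{0..1}|lborel. g (1 - s)) = (LINT s:{0..1}|lborel. g s)"
proof -
 have "(LINT s:{0..1}|lborel. g s) = (LINT x|lborel. indicator {0..1} (1 + - 1 * x) *\<^sub>R g (1 + - 1 * x))"
  unfolding set_lebesgue_integral_def
  using lborel_integral_real_affine[of "- 1" "%s. indicator {0..1} s *\<^sub>R g s" 1] by simp
 also have "... = (LINT s:{0..1}|lborel. g (1 - s))"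
  unfolding set_lebesgue_integral_def by (intro Bochner_Integration.integral_cong) (auto simp: indicator_def)
 finally show ?thesis by simp
qed

lemma norm_integral_le:
 fixes f :: "'x => 'b::{banach,second_countable_topology}"
 assumes "integrable N f" "integrable N g" "!!x. norm (f x) <= g x"
 shows "norm (LINT x|N. f x) <= (LINT x|N. g x)"
 using integral_norm_bound[of N f] integral_mono[OF integrable_norm[OF assms(1)] assms(2)] assms(3) by (meson order_trans)

text \<open>Reduces an L^1 error to the mean of a square, with a free parameter l in place of the
  Cauchy-Schwarz inequality.\<close>

lemma abs_le_square_div:
 fixes x l :: real
 assumes "0 < l" shows "\<bar>x\<bar> <= l + x\<^sup>2 / l"
proof (cases "\<bar>x\<bar> <= l")
 case False
 then have "l * \<bar>x\<bar> <= \<bar>x\<bar> * \<bar>x\<bar>" by (intro mult_right_mono) auto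
 then have "l * \<bar>x\<bar> <= x\<^sup>2" by (simp add: power2_eq_square)
 then have "\<bar>x\<bar> <= x\<^sup>2 / l" using assms by (simp add: pos_le_divide_eq mult.commute)
 then show ?thesis using assms by simp
qed (use assms in \<open>simp add: add_increasing2\<close>)

context super_ou_fluct
begin

lemma Pa_lincomb: "Pa t (%y. a * f1 y + c * f2 y) x = a * Pa t f1 x + c * Pa t f2 x"
proof -
 have "integrable std_gauss (%z. f1 (exp (- b * t) *\<^sub>R x + sd t *\<^sub>R z))" "integrable std_gauss (%z. f2 (exp (- b * t) *\<^sub>R x + sd t *\<^sub>R z))"
  using integrable_OU[of f1 C n t x] integrable_OU[of f2 C n t x] f1_abs f2_abs by auto
 then show ?thesis by (simp add: Pa_eq OU_P_eq distrib_left)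
qed

lemma lincomb_bound:
 assumes "0 <= a" "0 <= c"
 shows "0 <= a * f1 y + c * f2 y" "a * f1 y + c * f2 y <= ((a + c) * C) * wt n y"
proof -
 show "0 <= a * f1 y + c * f2 y" using assms f1_nonneg f2_nonneg by simp
 have "a * f1 y + c * f2 y <= a * (C * wt n y) + c * (C * wt n y)" using assms f1_le f2_le by (intro add_mono mult_left_mono)
 then show "a * f1 y + c * f2 y <= ((a + c) * C) * wt n y" by (simp add: algebra_simps)
qed

lemma J_duhamel:
 "J z1 z2 = stat (%x. LINT s:{0..1}|lborel. OU_Pa \<alpha> \<sigma> b (1 - s) (jk z1 z2 s) x)"
proof -
 define R where "R = max 1 (max (norm z1) (norm z2))"
 have "norm (jk z1 z2 s x) <= (\<eta> * (2 * (2 * R * Cp)\<^sup>2)) * wt (2 * n) x" for s x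
  by (rule jk_bound) (auto simp: R_def)
 from stat_duhamel[OF jk_meas this, of \<alpha>] show ?thesis unfolding J_def jw_def by simp
qed

text \<open>For nonnegative coefficients the principal power is the real one, and the reflection s
  -> 1 - s matches the Duhamel form of \<open>Zr\<close>.\<close>

lemma J_real:
 assumes a: "0 <= a" "0 <= c"
 shows "J (of_real a) (of_real c) = of_real (stat (Zr 1 (%y. a * f1 y + c * f2 y)))"
proof -
 define h where "h y = a * f1 y + c * f2 y" for y
 define g where "g s x = exp (\<alpha> * (1 - s)) * OU_P \<sigma> b (1 - s) (%y. \<eta> * (Pa s h y) powr (1 + \<beta>)) x" for s x
 have jk: "jk (of_real a) (of_real c) s = (%y. complex_of_real (\<eta> * (Pa s h y) powr (1 + \<beta>)))" if "s : {0..1}" for s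
 proof
  fix y
  have e: "of_real a * complex_of_real (p1 s y) + of_real c * complex_of_real (p2 s y) = complex_of_real (Pa s h y)"
   using that by (simp add: h_def[abs_def] Pa_lincomb p1_def p2_def cl)
  have "0 <= Pa s h y" unfolding h_def using lincomb_bound(1)[OF a] by (intro Pa_nonneg)
  then show "jk (of_real a) (of_real c) s y = complex_of_real (\<eta> * (Pa s h y) powr (1 + \<beta>))"
   unfolding jk_def e by (simp only: powr_of_real of_real_mult)
 qed
 have "(LINT s:{0..1}|lborel. OU_Pa \<alpha> \<sigma> b (1 - s) (jk (of_real a) (of_real c) s) x) = of_real (Zr 1 h x)" for x
 proof -
  have 1: "(LINT s:{0..1}|lborel. OU_Pa \<alpha> \<sigma> b (1 - s) (jk (of_real a) (of_real c) s) x) = (LINT s:{0..1}|lborel. complex_of_real (g s x))"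
  proof (rule set_lebesgue_integral_cong)
   show "\<forall>s. s : {0..1} --> OU_Pa \<alpha> \<sigma> b (1 - s) (jk (of_real a) (of_real c) s) x = complex_of_real (g s x)"
   proof (intro allI impI)
    fix s :: real assume s: "s : {0..1}"
    show "OU_Pa \<alpha> \<sigma> b (1 - s) (jk (of_real a) (of_real c) s) x = complex_of_real (g s x)"
     unfolding jk[OF s] OU_Pa_def[of \<alpha> \<sigma> b "1 - s"] OU_P_eq[of \<sigma> b "1 - s"] g_def
     by (simp only: integral_complex_of_real scaleR_conv_of_real) (simp only: of_real_mult)
   qed
  qed simp
  have 2: "(LINT s:{0..1}|lborel. g s x) = (LINT s:{0..1}|lborel. g (1 - s) x)" by (rule set_integral_reflect_unit[where g="%s. g s x", symmetric])
  have 3: "(LINT s:{0..1}|lborel. g (1 - s) x) = Zr 1 h x" unfolding Zr_def duh_def g_def by simp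
  show ?thesis unfolding 1 set_integral_complex_of_real 2 3 ..
 qed
 then show ?thesis unfolding J_duhamel h_def[symmetric] by (simp add: stat_def)
qed

text \<open>With f = f1 - f2 the base -i theta P^alpha f splits as -i theta p1 + i theta p2.\<close>

lemma J_Z1: "stat (Z1 \<alpha> \<sigma> b \<eta> \<beta> (%y. \<theta> * (f1 y - f2 y))) = J (- (\<i> * of_real \<theta>)) (\<i> * of_real \<theta>)"
proof -
 let ?k = "%s y. complex_of_real \<eta> * ((- \<i>) * complex_of_real (OU_Pa \<alpha> \<sigma> b s (%y. \<theta> * (f1 y - f2 y)) y)) powr complex_of_real (1 + \<beta>)"
 have fe: "(%y. \<theta> * (f1 y - f2 y)) = (%y. \<theta> * f1 y + (- \<theta>) * f2 y)" by (simp add: algebra_simps)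
 have k: "?k s = jk (- (\<i> * of_real \<theta>)) (\<i> * of_real \<theta>) s" if "s : {0..1}" for s
  unfolding fe Pa_lincomb jk_def p1_def p2_def cl(3)[OF that] by (rule ext) (simp add: algebra_simps)
 have "Z1 \<alpha> \<sigma> b \<eta> \<beta> (%y. \<theta> * (f1 y - f2 y)) x
  = (LINT s:{0..1}|lborel. OU_Pa \<alpha> \<sigma> b (1 - s) (jk (- (\<i> * of_real \<theta>)) (\<i> * of_real \<theta>) s) x)" for x
  unfolding Z1_def by (rule set_lebesgue_integral_cong) (simp, intro allI impI, simp only: k)
 then have "Z1 \<alpha> \<sigma> b \<eta> \<beta> (%y. \<theta> * (f1 y - f2 y))
  = (%x. LINT s:{0..1}|lborel. OU_Pa \<alpha> \<sigma> b (1 - s) (jk (- (\<i> * of_real \<theta>)) (\<i> * of_real \<theta>) s) x)" by (rule ext)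
 then show ?thesis unfolding J_duhamel by simp
qed

text \<open>Almost sure, because linearity of the integrals rests on the integrability of f1, f2 and
  of their images under the semigroup.\<close>

lemma AE_fl_lincomb:
 assumes t: "0 <= t"
 shows "AE p in M. fl t (%y. a * f1 y + c * f2 y) p = a * fl t f1 p + c * fl t f2 p"
 using AE_integrable_wt[OF t, of n]
proof (rule AE_mp)
 have "AE p in M. integrable (X (t + 1) p) (wt n)" using t by (intro AE_integrable_wt) auto
 then show "AE p in M. integrable (X t p) (wt n) --> fl t (%y. a * f1 y + c * f2 y) p = a * fl t f1 p + c * fl t f2 p"
 proof (rule AE_mp, intro AE_I2 impI)
  fix p assume w: "p : space M" and i1: "integrable (X (t + 1) p) (wt n)" and i0: "integrable (X t p) (wt n)"
  have "integrable (X (t + 1) p) f1" "integrable (X (t + 1) p) f2"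
   using integrable_X_wt[OF w f1_meas f1_abs i1] integrable_X_wt[OF w f2_meas f2_abs i1] .
  then have 1: "I (t + 1) (%y. a * f1 y + c * f2 y) p = a * I (t + 1) f1 p + c * I (t + 1) f2 p" by (simp add: I_def)
  have "integrable (X t p) (Pa 1 f1)" "integrable (X t p) (Pa 1 f2)"
   using integrable_X_wt[OF w Pa_meas1[OF f1_meas] Pa_bound[OF f1_meas f1_abs] i0, of 1]
    integrable_X_wt[OF w Pa_meas1[OF f2_meas] Pa_bound[OF f2_meas f2_abs] i0, of 1] by auto
  then have 2: "I t (Pa 1 (%y. a * f1 y + c * f2 y)) p = a * I t (Pa 1 f1) p + c * I t (Pa 1 f2) p"
   by (simp add: I_def Pa_lincomb)
  show "fl t (%y. a * f1 y + c * f2 y) p = a * fl t f1 p + c * fl t f2 p" unfolding fl_def 1 2 by (simp add: algebra_simps)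
 qed
qed

section \<open>From real Laplace transforms to characteristic functions\<close>

definition "L t a c = (LINT p|M. indicator (good n t) p * exp (- (a * fl t f1 p + c * fl t f2 p)))"

lemma L_eq:
 assumes t: "0 <= t"
 shows "L t a c = (LINT p|M. indicator (good n t) p * exp (- fl t (%y. a * f1 y + c * f2 y) p))"
  "integrable M (%p. indicator (good n t) p * exp (- (a * fl t f1 p + c * fl t f2 p)))
   \<longleftrightarrow> integrable M (%p. indicator (good n t) p * exp (- fl t (%y. a * f1 y + c * f2 y) p))"
proof -
 note [measurable] = good_M[OF t, of n] fl_M[OF t]
 have ae: "AE p in M. indicator (good n t) p * exp (- (a * fl t f1 p + c * fl t f2 p)) = indicator (good n t) p * exp (- fl t (%y. a * f1 y + c * f2 y) p)"
  using AE_fl_lincomb[OF t, of a c] by eventually_elim simp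
 show "L t a c = (LINT p|M. indicator (good n t) p * exp (- fl t (%y. a * f1 y + c * f2 y) p))"
  unfolding L_def by (rule integral_cong_AE[OF _ _ ae]) measurable
 show "integrable M (%p. indicator (good n t) p * exp (- (a * fl t f1 p + c * fl t f2 p)))
   \<longleftrightarrow> integrable M (%p. indicator (good n t) p * exp (- fl t (%y. a * f1 y + c * f2 y) p))"
  by (rule integrable_cong_AE[OF _ _ ae]) measurable
qed

text \<open>Uniform in t; the boundedness on the strip required by Vitali's theorem rests on
  this.\<close>

lemma L_bound:
 assumes a: "0 <= a" "0 <= c"
 shows "\<exists>Q. \<forall>t\<ge>0. integrable M (%p. indicator (good n t) p * exp (- (a * fl t f1 p + c * fl t f2 p))) & L t a c <= Q"
proof -
 let ?h = "%y. a * f1 y + c * f2 y"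
 have hm: "?h : Bm borel" by measurable
 from laplace_bound[OF hm lincomb_bound[OF a]]
 obtain Q where Q: "\<forall>t\<ge>0. \<forall>A\<in>sets (F t). A \<subseteq> good n t --> integrable M (%p. indicator A p * exp (- fl t ?h p)) &
   (LINT p|M. indicator A p * exp (- fl t ?h p)) <= Q * measure M A" ..
 have "integrable M (%p. indicator (good n t) p * exp (- (a * fl t f1 p + c * fl t f2 p))) & L t a c <= \<bar>Q\<bar>" if t: "0 <= t" for t
 proof -
  note q = Q[rule_format, OF t good_F[OF t] order_refl]
  have "Q * measure M (good n t) <= \<bar>Q\<bar> * 1" by (intro mult_mono) auto
  then have "L t a c <= \<bar>Q\<bar>" using q[THEN conjunct2] unfolding L_eq(1)[OF t, of a c] by linarith
  moreover have "integrable M (%p. indicator (good n t) p * exp (- (a * fl t f1 p + c * fl t f2 p)))"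
   unfolding L_eq(2)[OF t, of a c] by (rule q[THEN conjunct1])
  ultimately show ?thesis by (intro conjI)
 qed
 then show ?thesis by blast
qed

lemma L_integrable: "0 <= a ==> 0 <= c ==> 0 <= t ==> integrable M (%p. indicator (good n t) p * exp (- (a * fl t f1 p + c * fl t f2 p)))"
 using L_bound by blast

lemma good_surv_tendsto:
 assumes tau: "!!k. 0 <= \<tau> k" "filterlim \<tau> at_top sequentially"
 shows "(%k. measure M (good n (\<tau> k))) ----> measure M surv"
proof -
 have "(%k. measure M (alive (\<tau> k)) - measure M (alive (\<tau> k) - good n (\<tau> k))) ----> measure M surv - 0"
  by (rule tendsto_diff[OF prob_alive_tendsto[OF tau] filterlim_compose[OF good_prob tau(2)]])
 moreover have "measure M (alive (\<tau> k)) - measure M (alive (\<tau> k) - good n (\<tau> k)) = measure M (good n (\<tau> k))" for k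
  using P.finite_measure_Diff[OF alive_M[OF tau(1)] good_M[OF tau(1)] good_alive] by simp
 ultimately show ?thesis by simp
qed

lemma L_tendsto:
 assumes tau: "!!k. 0 <= \<tau> k" "filterlim \<tau> at_top sequentially" and a: "0 <= a" "0 <= c"
 shows "(%k. L (\<tau> k) a c) ----> measure M surv * exp (Re (J (of_real a) (of_real c)))"
proof -
 let ?h = "%y. a * f1 y + c * f2 y"
 have hm: "?h : Bm borel" by measurable
 have "(%k. (L (\<tau> k) a c - exp (stat (Zr 1 ?h)) * measure M (good n (\<tau> k))) + exp (stat (Zr 1 ?h)) * measure M (good n (\<tau> k)))
   ----> 0 + exp (stat (Zr 1 ?h)) * measure M surv"
  unfolding L_eq(1)[OF tau(1)]
  by (rule tendsto_add[OF filterlim_compose[OF laplace_limit[OF hm lincomb_bound[OF a]] tau(2)] tendsto_mult_left[OF good_surv_tendsto[OF tau]]])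
 then show ?thesis by (simp add: J_real[OF a] mult.commute)
qed

text \<open>The damping weight on the good event; at e = 0 it is the indicator of
  \<open>good n t\<close>.\<close>

definition "dmp e t p = indicator (good n t) p * exp (- (e * (fl t f1 p + fl t f2 p)))"

lemma dmp_M [measurable]: "0 <= t ==> dmp e t : Bm M"
proof -
 assume t: "0 <= t"
 note [measurable] = good_M[OF t, of n] fl_M[OF t]
 show ?thesis unfolding dmp_def by measurable
qed

text \<open>In the strip the damped kernel is bounded by exp(-2e F1) + exp(-2e F2), because e |x -
  y| - e (x + y) = -2e min(x, y); the means of these are bounded by \<open>L_bound\<close>. On a
  real segment the limit is known, and Vitali's theorem carries it to -i theta.\<close>

lemma damped_tendsto:
 assumes tau: "!!k. 0 <= \<tau> k" "filterlim \<tau> at_top sequentially" and e: "0 < e"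
 shows "(%k. \<integral>p. complex_of_real (dmp e (\<tau> k) p) * iexp (\<theta> * (fl (\<tau> k) f1 p - fl (\<tau> k) f2 p)) \<partial>M)
  ----> of_real (measure M surv) * exp (J (of_real e - \<i> * of_real \<theta>) (of_real e + \<i> * of_real \<theta>))"
proof -
 \<comment> \<open>Makes -i theta an interior point of the box.\<close>
 define R where "R = \<bar>\<theta>\<bar> + 1"
 define S where "S = box (Complex (- e) (- R)) (Complex e R)"
 define kk where "kk k w p = complex_of_real (dmp e (\<tau> k) p) * exp (- w * complex_of_real (fl (\<tau> k) f1 p - fl (\<tau> k) f2 p))" for k w p
 define G where "G k w = (LINT p|M. kk k w p)" for k w
 define g where "g w = of_real (measure M surv) * exp (J (of_real e + w) (of_real e - w))" for w
 define B where "B k p = indicator (good n (\<tau> k)) p * exp (- (0 * fl (\<tau> k) f1 p + (2 * e) * fl (\<tau> k) f2 p))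
   + indicator (good n (\<tau> k)) p * exp (- ((2 * e) * fl (\<tau> k) f1 p + 0 * fl (\<tau> k) f2 p))" for k p
 note [measurable] = fl_M[OF tau(1)] dmp_M[OF tau(1)]
 have iB: "integrable M (B k)" for k
  unfolding B_def using e tau(1) by (intro Bochner_Integration.integrable_add L_integrable) auto
 obtain Q1 where Q1: "!!t. 0 <= t ==> L t 0 (2 * e) <= Q1" using L_bound[of 0 "2 * e"] e by auto
 obtain Q2 where Q2: "!!t. 0 <= t ==> L t (2 * e) 0 <= Q2" using L_bound[of "2 * e" 0] e by auto
 have B_le: "(LINT p|M. B k p) <= Q1 + Q2" for k
 proof -
  have "(LINT p|M. B k p) = L (\<tau> k) 0 (2 * e) + L (\<tau> k) (2 * e) 0"
   unfolding B_def L_def using e tau(1) by (intro Bochner_Integration.integral_add L_integrable) auto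
  then show ?thesis using Q1[OF tau(1), of k] Q2[OF tau(1), of k] by simp
 qed
 have kB: "norm (kk k w p) <= B k p" if w: "w : S" for k w p
 proof -
  define x y where "x = fl (\<tau> k) f1 p" and "y = fl (\<tau> k) f2 p"
  have Rw: "\<bar>Re w\<bar> < e" using w by (auto simp: S_def in_box_complex_iff)
  have "- (Re w * (x - y)) <= \<bar>Re w\<bar> * \<bar>x - y\<bar>" by (metis abs_ge_minus_self abs_mult)
  also have "... <= e * \<bar>x - y\<bar>" using Rw by (intro mult_right_mono) auto
  finally have "exp (- (e * (x + y))) * exp (- (Re w * (x - y))) <= exp (- (e * (x + y)) + e * \<bar>x - y\<bar>)" by (simp flip: exp_add)
  also have "... <= exp (- ((2 * e) * y)) + exp (- ((2 * e) * x))"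
  proof (cases "y <= x")
   case True
   then have "- (e * (x + y)) + e * \<bar>x - y\<bar> = - ((2 * e) * y)" by (simp add: algebra_simps)
   then show ?thesis by simp
  next
   case False
   then have "- (e * (x + y)) + e * \<bar>x - y\<bar> = - ((2 * e) * x)" by (simp add: algebra_simps)
   then show ?thesis by simp
  qed
  finally show ?thesis
   by (auto simp: kk_def dmp_def B_def norm_mult x_def y_def indicator_def)
 qed
 have GB: "norm (G k w) <= Q1 + Q2" if w: "w : S" for k w
 proof -
  have "integrable M (kk k w)"
  proof (rule Bochner_Integration.integrable_bound[OF iB])
   show "kk k w : Bm M" unfolding kk_def by measurable
   show "AE p in M. norm (kk k w p) <= norm (B k p)"
    using kB[OF w, of k] by (intro AE_I2) (auto intro: order_trans[OF _ abs_ge_self])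
  qed
  then have "norm (G k w) <= (LINT p|M. B k p)"
   unfolding G_def by (rule norm_integral_le[OF _ iB]) (rule kB[OF w])
  then show ?thesis using B_le[of k] by simp
 qed
 have Gh: "G k holomorphic_on S" for k
 proof -
  have "(%w. \<integral>p. kk k w p \<partial>M) holomorphic_on S"
  proof (rule holomorphic_integral[OF _ _ _ _ iB])
   show "finite_measure M" by unfold_locales
   show "open S" unfolding S_def by (rule open_box)
   show "kk k w : Bm M" for w unfolding kk_def by measurable
   show "(%w. kk k w x) holomorphic_on S" for x unfolding kk_def by (intro holomorphic_intros)
  qed (use kB in blast)
  then show ?thesis unfolding G_def .
 qed
 have gh: "g holomorphic_on S"
  unfolding g_def S_def by (intro holomorphic_intros J_holomorphic) (simp add: R_def)
 have "(%k. G k (- (\<i> * of_real \<theta>))) ----> g (- (\<i> * of_real \<theta>))"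
 proof (rule vitali_convergence[OF _ _ Gh gh GB, where U="of_real ` {- e<..<e}" and \<xi>=0])
  show "open S" "connected S" unfolding S_def by (auto intro: convex_connected open_box)
  show "of_real ` {- e<..<e} \<subseteq> S" "(0::complex) : S" "- (\<i> * of_real \<theta>) : S"
   using e by (auto simp: S_def R_def in_box_complex_iff)
  show "(0::complex) islimpt of_real ` {- e<..<e}"
   unfolding islimpt_approachable
  proof (intro allI impI)
   fix d :: real assume d: "0 < d"
   obtain x where x: "0 < x" "x < e" "x < d" using field_lbound_gt_zero[OF e d] by blast
   show "\<exists>x'\<in>of_real ` {- e<..<e}. x' ~= (0::complex) & dist x' 0 < d"
    using x e by (intro bexI[of _ "of_real x"]) auto
  qed
  fix z :: complex assume "z : of_real ` {- e<..<e}"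
  then obtain u where u: "z = of_real u" "- e < u" "u < e" by auto
  \<comment> \<open>For real u the kernel is the Laplace kernel with coefficients e + u and e - u,
    both positive.\<close>
  have "kk k z p = complex_of_real (indicator (good n (\<tau> k)) p * exp (- ((e + u) * fl (\<tau> k) f1 p + (e - u) * fl (\<tau> k) f2 p)))" for k p
  proof -
   have "exp (- (e * (fl (\<tau> k) f1 p + fl (\<tau> k) f2 p))) * exp (- u * (fl (\<tau> k) f1 p - fl (\<tau> k) f2 p))
     = exp (- ((e + u) * fl (\<tau> k) f1 p + (e - u) * fl (\<tau> k) f2 p))" unfolding exp_add[symmetric] by (simp add: algebra_simps)
   then show ?thesis unfolding kk_def dmp_def u(1)
    by (simp only: of_real_minus[symmetric] of_real_mult[symmetric] exp_of_real mult.assoc)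
  qed
  then have "kk k z = (%p. complex_of_real (indicator (good n (\<tau> k)) p * exp (- ((e + u) * fl (\<tau> k) f1 p + (e - u) * fl (\<tau> k) f2 p))))" for k by (rule ext)
  then have "G k z = complex_of_real (L (\<tau> k) (e + u) (e - u))" for k
   unfolding G_def L_def by (simp only: integral_complex_of_real)
  moreover have "(%k. complex_of_real (L (\<tau> k) (e + u) (e - u)))
    ----> of_real (measure M surv * exp (Re (J (of_real (e + u)) (of_real (e - u)))))"
   using u by (intro tendsto_of_real L_tendsto tau) auto
  moreover have "J (of_real (e + u)) (of_real (e - u)) = of_real (Re (J (of_real (e + u)) (of_real (e - u))))"
   using u J_real[of "e + u" "e - u"] by simp
  then have "g z = of_real (measure M surv * exp (Re (J (of_real (e + u)) (of_real (e - u)))))"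
   unfolding g_def u(1) by (metis exp_of_real of_real_add of_real_diff of_real_mult)
  ultimately show "(%k. G k z) ----> g z" by simp
 qed
 then show ?thesis by (simp add: G_def g_def kk_def mult.assoc)
qed

lemma dmp_square:
 assumes t: "0 <= t" and e: "0 < e"
 shows "integrable M (%p. (dmp 0 t p - dmp e t p)\<^sup>2)"
  "(LINT p|M. (dmp 0 t p - dmp e t p)\<^sup>2) = L t (2 * e) (2 * e) - 2 * L t e e + measure M (good n t)"
proof -
 note i = L_integrable[of "2 * e" "2 * e" t] L_integrable[of e e t] L_integrable[of 0 0 t]
 have eq: "(dmp 0 t p - dmp e t p)\<^sup>2 = indicator (good n t) p * exp (- ((2 * e) * fl t f1 p + (2 * e) * fl t f2 p))
  - 2 * (indicator (good n t) p * exp (- (e * fl t f1 p + e * fl t f2 p))) + indicator (good n t) p * exp (- (0 * fl t f1 p + 0 * fl t f2 p))" for p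
 proof -
  define x where "x = exp (- (e * fl t f1 p + e * fl t f2 p))"
  have "exp (- ((2 * e) * fl t f1 p + (2 * e) * fl t f2 p)) = x\<^sup>2"
   unfolding x_def power2_eq_square exp_add[symmetric] by (simp add: algebra_simps)
  moreover have "(1 - x)\<^sup>2 = x\<^sup>2 - 2 * x + 1" by (simp add: power2_diff)
  ultimately show ?thesis by (simp add: dmp_def indicator_def x_def distrib_left)
 qed
 show "integrable M (%p. (dmp 0 t p - dmp e t p)\<^sup>2)" unfolding eq using i e t by (intro Bochner_Integration.integrable_add Bochner_Integration.integrable_diff integrable_mult_right) auto
 have L0: "L t 0 0 = measure M (good n t)" using sets.sets_into_space[OF good_M[OF t, of n]] by (simp add: L_def Int_absorb2)
 have "(LINT p|M. (dmp 0 t p - dmp e t p)\<^sup>2) = L t (2 * e) (2 * e) - 2 * L t e e + L t 0 0"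
  unfolding eq L_def using i e t by (subst Bochner_Integration.integral_add, (auto)[2], subst Bochner_Integration.integral_diff) auto
 then show "(LINT p|M. (dmp 0 t p - dmp e t p)\<^sup>2) = L t (2 * e) (2 * e) - 2 * L t e e + measure M (good n t)" unfolding L0 .
qed

lemma J_zero: "J 0 0 = 0"
 using J_homogeneous[of 0 0 0] beta_pos by simp

text \<open>The damping can be removed after the limit in t: on the good event the mean square of 1
  - exp(-epsilon (F1 + F2)) converges to \<open>v m\<close>, which tends to 0 with epsilon, so the
  error is small for all late times.\<close>

lemma char_tendsto:
 assumes tau: "!!k. 0 <= \<tau> k" "filterlim \<tau> at_top sequentially"
 shows "(%k. \<integral>p. complex_of_real (dmp 0 (\<tau> k) p) * iexp (\<theta> * (fl (\<tau> k) f1 p - fl (\<tau> k) f2 p)) \<partial>M)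
  ----> of_real (measure M surv) * exp (J (- (\<i> * of_real \<theta>)) (\<i> * of_real \<theta>))" (is "?a ----> ?c")
proof (rule tendstoI)
 fix d :: real assume d: "0 < d"
 \<comment> \<open>Four errors of size l occur: two from the removal of the damping, one from the
   limit in k, one from the limit in epsilon. Their sum stays below d = 5 l.\<close>
 define l where "l = d / 5"
 have l: "0 < l" using d by (simp add: l_def)
 define ep where "ep m = 1 / (real m + 1)" for m :: nat
 have ep: "0 < ep m" for m by (simp add: ep_def)
 have ep0: "ep ----> 0" unfolding ep_def by real_asymp
 define c where "c m = of_real (measure M surv) * exp (J (of_real (ep m) - \<i> * of_real \<theta>) (of_real (ep m) + \<i> * of_real \<theta>))" for m
 define v where "v m = measure M surv * exp (Re (J (of_real (2 * ep m)) (of_real (2 * ep m))))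
   - 2 * (measure M surv * exp (Re (J (of_real (ep m)) (of_real (ep m))))) + measure M surv" for m
 have "(%m. complex_of_real (ep m) - \<i> * of_real \<theta>) ----> of_real 0 - \<i> * of_real \<theta>" "(%m. complex_of_real (ep m) + \<i> * of_real \<theta>) ----> of_real 0 + \<i> * of_real \<theta>"
  by (intro tendsto_intros ep0)+
 then have "c ----> ?c" unfolding c_def by (intro tendsto_mult_left tendsto_exp J_tendsto) auto
 then have e1: "\<forall>\<^sub>F m in sequentially. dist (c m) ?c < l" using l by (rule tendstoD)
 have "(%m. complex_of_real (r * ep m)) ----> of_real (r * 0)" for r by (intro tendsto_intros ep0)
 then have Jr: "(%m. J (of_real (r * ep m)) (of_real (r * ep m))) ----> J 0 0" for r by (intro J_tendsto) auto
 have "v ----> measure M surv * exp (Re (J 0 0)) - 2 * (measure M surv * exp (Re (J 0 0))) + measure M surv"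
  unfolding v_def using Jr[of 2] Jr[of 1] by (intro tendsto_intros) simp_all
 then have "v ----> 0" by (simp add: J_zero)
 then have e2: "\<forall>\<^sub>F m in sequentially. v m < l * l" using l by (intro order_tendstoD) auto
 obtain m where m: "dist (c m) ?c < l" "v m < l * l"
  using eventually_happens'[OF sequentially_bot eventually_conj[OF e1 e2]] by blast
 let ?b = "%k. \<integral>p. complex_of_real (dmp (ep m) (\<tau> k) p) * iexp (\<theta> * (fl (\<tau> k) f1 p - fl (\<tau> k) f2 p)) \<partial>M"
 have e3: "\<forall>\<^sub>F k in sequentially. dist (?b k) (c m) < l"
  unfolding c_def by (rule tendstoD[OF damped_tendsto[OF tau ep] l])
 define V where "V k = L (\<tau> k) (2 * ep m) (2 * ep m) - 2 * L (\<tau> k) (ep m) (ep m) + measure M (good n (\<tau> k))" for k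
 have "V ----> v m"
  unfolding V_def v_def using ep[of m] by (intro tendsto_add tendsto_diff tendsto_mult_left L_tendsto good_surv_tendsto tau) auto
 then have e4: "\<forall>\<^sub>F k in sequentially. V k < l * l" using m(2) by (rule order_tendstoD)
 have avg: "(LINT p|M. l + Q p / l) = l + (LINT p|M. Q p) / l" if "integrable M Q" for Q
  using that by (simp add: P.prob_space)
 show "\<forall>\<^sub>F k in sequentially. dist (?a k) ?c < d"
  using e3 e4
 proof eventually_elim
  case (elim k)
  note [measurable] = fl_M[OF tau(1)] dmp_M[OF tau(1)]
  note sq = dmp_square[OF tau(1)[of k] ep[of m]]
  have i0: "integrable M (dmp 0 (\<tau> k))" using L_integrable[of 0 0 "\<tau> k"] tau(1) by (simp add: dmp_def[abs_def])
  have im: "integrable M (dmp (ep m) (\<tau> k))" using L_integrable[of "ep m" "ep m" "\<tau> k"] tau(1) ep[of m] by (simp add: dmp_def[abs_def] distrib_left)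
  have ii: "integrable M (%p. complex_of_real (g p) * iexp (\<theta> * (fl (\<tau> k) f1 p - fl (\<tau> k) f2 p)))" if g: "integrable M g" for g
   using borel_measurable_integrable[OF g] by (intro Bochner_Integration.integrable_bound[OF g] AE_I2) (auto simp: norm_mult)
  have ab: "?a k - ?b k = (LINT p|M. complex_of_real (dmp 0 (\<tau> k) p - dmp (ep m) (\<tau> k) p) * iexp (\<theta> * (fl (\<tau> k) f1 p - fl (\<tau> k) f2 p)))"
   using ii[OF i0] ii[OF im] by (simp add: left_diff_distrib)
  have "norm (LINT p|M. complex_of_real (dmp 0 (\<tau> k) p - dmp (ep m) (\<tau> k) p) * iexp (\<theta> * (fl (\<tau> k) f1 p - fl (\<tau> k) f2 p))) <= (LINT p|M. l + (dmp 0 (\<tau> k) p - dmp (ep m) (\<tau> k) p)\<^sup>2 / l)"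
  proof (rule norm_integral_le)
   show "norm (complex_of_real (dmp 0 (\<tau> k) p - dmp (ep m) (\<tau> k) p) * iexp (\<theta> * (fl (\<tau> k) f1 p - fl (\<tau> k) f2 p))) <= l + (dmp 0 (\<tau> k) p - dmp (ep m) (\<tau> k) p)\<^sup>2 / l" for p
    using abs_le_square_div[OF l, of "dmp 0 (\<tau> k) p - dmp (ep m) (\<tau> k) p"] unfolding norm_mult norm_of_real norm_exp_i_times by simp
   show "integrable M (%p. complex_of_real (dmp 0 (\<tau> k) p - dmp (ep m) (\<tau> k) p) * iexp (\<theta> * (fl (\<tau> k) f1 p - fl (\<tau> k) f2 p)))"
    by (rule ii[OF Bochner_Integration.integrable_diff[OF i0 im]])
  qed (use sq(1) in auto)
  then have "norm (?a k - ?b k) <= l + V k / l" unfolding ab avg[OF sq(1)] sq(2) V_def .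
  moreover have "V k / l < l" using elim(2) l by (simp only: pos_divide_less_eq)
  ultimately have "dist (?a k) (?b k) < l + l" unfolding dist_norm by linarith
  moreover have "dist (?a k) ?c <= dist (?a k) (?b k) + dist (?b k) (c m) + dist (c m) ?c"
   using dist_triangle[of "?a k" ?c "?b k"] dist_triangle[of "?b k" ?c "c m"] by linarith
  ultimately show ?case using elim(1) m(1) l d unfolding l_def by linarith
 qed
qed

end

subsection \<open>Auxiliary facts on distributions\<close>

text \<open>The finitely many laws before the estimate sets in are tight individually, and the
  maximum of their radii is taken.\<close>

lemma tight_eventually:
 fixes \<mu> :: "nat => real measure"
 assumes rd: "!!k. real_distribution (\<mu> k)"
  and ev: "!!e. 0 < e ==> \<exists>R. \<forall>\<^sub>F k in sequentially. measure (\<mu> k) {x. R < \<bar>x\<bar>} < e"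
 shows "tight \<mu>"
proof -
 have "\<exists>a b. a < b & (\<forall>k. 1 - e < measure (\<mu> k) {a<..b})" if e: "0 < e" for e
 proof -
 obtain R N where R: "!!k. N <= k ==> measure (\<mu> k) {x. R < \<bar>x\<bar>} < e"
  using ev[OF e] unfolding eventually_sequentially by blast
 have "\<exists>r. measure (\<mu> k) {x. r < \<bar>x\<bar>} < e" for k
 proof -
  interpret K: real_distribution "\<mu> k" by (rule rd)
  have "(%m. measure (\<mu> k) {x. real m < \<bar>x\<bar>}) ----> measure (\<mu> k) (\<Inter>m. {x. real m < \<bar>x\<bar>})"
   by (rule K.finite_Lim_measure_decseq) (auto simp: decseq_def)
  also have "(\<Inter>m. {x::real. real m < \<bar>x\<bar>}) = {}" using reals_Archimedean2 not_less_iff_gr_or_eq by fastforce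
  finally have "(%m. measure (\<mu> k) {x. real m < \<bar>x\<bar>}) ----> 0" by simp
  then have "\<forall>\<^sub>F m in sequentially. measure (\<mu> k) {x. real m < \<bar>x\<bar>} < e" using e by (rule order_tendstoD)
  then show ?thesis using eventually_happens'[OF sequentially_bot] by blast
 qed
 then obtain r where r: "!!k. measure (\<mu> k) {x. r k < \<bar>x\<bar>} < e" by metis
 define S where "S = Max (insert \<bar>R\<bar> ((%k. \<bar>r k\<bar>) ` {..<N})) + 1"
 have SR: "\<bar>R\<bar> < S" and Sr: "k < N ==> \<bar>r k\<bar> < S" for k
 proof -
  have "\<bar>R\<bar> <= Max (insert \<bar>R\<bar> ((%k. \<bar>r k\<bar>) ` {..<N}))" by (intro Max_ge) auto
  then show "\<bar>R\<bar> < S" unfolding S_def by linarith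
  assume "k < N"
  then have "\<bar>r k\<bar> <= Max (insert \<bar>R\<bar> ((%k. \<bar>r k\<bar>) ` {..<N}))" by (intro Max_ge) auto
  then show "\<bar>r k\<bar> < S" unfolding S_def by linarith
 qed
 show "\<exists>a b. a < b & (\<forall>k. 1 - e < measure (\<mu> k) {a<..b})"
 proof (rule exI[of _ "- S"], rule exI[of _ S], intro conjI allI)
  show "- S < S" using SR by linarith
  fix k
  interpret K: real_distribution "\<mu> k" by (rule rd)
  have "\<exists>q. q < S & measure (\<mu> k) {x. q < \<bar>x\<bar>} < e"
  proof (cases "N <= k")
   case True
   moreover have "R < S" using SR by linarith
   ultimately show ?thesis using R by blast
  next
   case False
   then have "r k < S" using Sr[of k] by linarith
   then show ?thesis using r[of k] by blast
  qed
  then obtain q where q: "q < S" "measure (\<mu> k) {x. q < \<bar>x\<bar>} < e" by blast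
  have "measure (\<mu> k) (space (\<mu> k) - {- S<..S}) <= measure (\<mu> k) {x. q < \<bar>x\<bar>}"
   using q(1) by (intro K.finite_measure_mono) auto
  then show "1 - e < measure (\<mu> k) {- S<..S}" using q(2) K.prob_compl[of "{- S<..S}"] by simp
 qed
 qed
 then show ?thesis using rd unfolding tight_def by blast
qed

lemma real_distribution_conv_pow:
 assumes "real_distribution \<nu>" shows "real_distribution (conv_pow \<nu> m)"
proof (induction m)
 case 0
 show ?case by (auto intro!: real_distribution.intro prob_space_return real_distribution_axioms.intro)
next
 case (Suc m)
 interpret N: real_distribution \<nu> by fact
 interpret K: real_distribution "conv_pow \<nu> m" by fact
 interpret NK: pair_prob_space \<nu> "conv_pow \<nu> m" ..
 have "(%(x, y). x + y) : measurable (\<nu> \<Otimes>\<^sub>M conv_pow \<nu> m) borel" unfolding split_beta' by measurable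
 then show ?case
  by (auto simp: convolution_def intro!: real_distribution.intro NK.prob_space_distr real_distribution_axioms.intro)
qed

lemma char_conv_pow:
 assumes "real_distribution \<nu>" shows "char (conv_pow \<nu> m) \<theta> = char \<nu> \<theta> ^ m"
proof (induction m)
 case 0
 show ?case by (simp add: char_def integral_return)
next
 case (Suc m)
 interpret N: real_distribution \<nu> by fact
 interpret K: real_distribution "conv_pow \<nu> m" by (rule real_distribution_conv_pow[OF assms])
 interpret NK: pair_prob_space \<nu> "conv_pow \<nu> m" ..
 have m: "(%(x, y). x + y) : measurable (\<nu> \<Otimes>\<^sub>M conv_pow \<nu> m) borel" unfolding split_beta' by measurable
 have i: "integrable (\<nu> \<Otimes>\<^sub>M conv_pow \<nu> m) (%(x, y). iexp (\<theta> * x) * iexp (\<theta> * y))"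
  by (rule NK.integrable_const_bound[where B=1]) (auto simp: norm_mult split_beta')
 have "char (conv_pow \<nu> (Suc m)) \<theta> = (LINT q|(\<nu> \<Otimes>\<^sub>M conv_pow \<nu> m). iexp (\<theta> * (case q of (x, y) => x + y)))"
  unfolding char_def conv_pow.simps convolution_def by (rule integral_distr[OF m]) measurable
 also have "... = (LINT (x, y)|(\<nu> \<Otimes>\<^sub>M conv_pow \<nu> m). iexp (\<theta> * x) * iexp (\<theta> * y))"
  by (intro Bochner_Integration.integral_cong) (auto simp: distrib_left exp_add)
 also have "... = (LINT x|\<nu>. (LINT y|(conv_pow \<nu> m). iexp (\<theta> * x) * iexp (\<theta> * y)))"
  by (rule NK.integral_fst[OF i, symmetric])
 also have "... = char \<nu> \<theta> * char (conv_pow \<nu> m) \<theta>" by (simp add: char_def)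
 finally show ?case using Suc by simp
qed

section \<open>Conditional laws on survival and identification of the limit\<close>

context super_ou_fluct
begin

abbreviation "f \<equiv> (%y. f1 y - f2 y)"

definition "Ups t s = (I (t + 1) f s - I t (Pa 1 f) s) / Y t s powr (1 - \<beta> / (1 + \<beta>))"

lemma Ups_M [measurable]: "0 <= t ==> Ups t : Bm M"
proof -
 assume t: "0 <= t"
 have [measurable]: "I (t + 1) f : Bm M" "I t (Pa 1 f) : Bm M" "Y t : Bm M"
  using t by (auto intro!: I_M Y_M Pa_meas1)
 show ?thesis unfolding Ups_def by measurable
qed

text \<open>The exponent is 1 - beta / (1 + beta) = 1 / (1 + beta), so dividing by this power of the
  mass is multiplying by \<open>scl\<close>.\<close>

lemma AE_Ups:
 assumes t: "0 <= t" shows "AE s in M. s : good n t --> Ups t s = fl t f1 s - fl t f2 s"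
 using AE_fl_lincomb[OF t, of 1 "- 1"]
proof (rule AE_mp, intro AE_I2 impI)
 fix s assume e: "fl t (%y. 1 * f1 y + - 1 * f2 y) s = 1 * fl t f1 s + - 1 * fl t f2 s" and g: "s : good n t"
 have p: "1 - \<beta> / (1 + \<beta>) = - (- 1 / (1 + \<beta>))" using beta_pos by (simp add: field_simps)
 have "Ups t s = fl t f s"
  unfolding Ups_def fl_def scl_powr(1)[OF goodD(2)[OF g]] p by (simp only: powr_minus) (simp add: divide_inverse)
 then show "Ups t s = fl t f1 s - fl t f2 s" using e by simp
qed

text \<open>Conditioning on survival as a probability measure, so that the fluctuations have genuine
  distributions to which Levy's theorem applies.\<close>

definition "cnd = density M (%s. ennreal (indicator surv s / measure M surv))"

lemma sets_cnd [measurable_cong, simp]: "sets cnd = sets M" and space_cnd [simp]: "space cnd = space M"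
 by (auto simp: cnd_def)

lemma prob_space_cnd: "prob_space cnd"
proof (rule prob_spaceI)
 have "emeasure cnd (space cnd) = (\<integral>\<^sup>+s. ennreal (1 / measure M surv) * indicator surv s \<partial>M)"
  unfolding cnd_def by (subst emeasure_density) (auto intro!: nn_integral_cong simp: indicator_def)
 also have "... = ennreal (1 / measure M surv) * emeasure M surv" by (rule nn_integral_cmult_indicator) simp
 also have "... = ennreal (1 / measure M surv * measure M surv)"
  by (simp only: P.emeasure_eq_measure ennreal_mult'' measure_nonneg)
 also have "1 / measure M surv * measure M surv = 1" using surv_pos by simp
 finally show "emeasure cnd (space cnd) = 1" by (simp only: ennreal_1)
qed

lemma integral_cnd:
 fixes g :: "'w => 'b::{banach,second_countable_topology}"
 assumes "g : Bm M"
 shows "(LINT s|cnd. g s) = (LINT s|M. (indicator surv s / measure M surv) *\<^sub>R g s)"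
 unfolding cnd_def using assms by (intro integral_density) auto

definition "law t = distr cnd borel (Ups t)"

lemma real_distribution_law: "0 <= t ==> real_distribution (law t)"
 unfolding law_def using prob_space.real_distribution_distr[OF prob_space_cnd] by simp

lemma integral_law:
 fixes g :: "real => 'b::{banach,second_countable_topology}"
 assumes t: "0 <= t" and g[measurable]: "g : Bm borel"
 shows "(LINT x|(law t). g x) = (LINT s|M. (indicator surv s / measure M surv) *\<^sub>R g (Ups t s))"
proof -
 note [measurable] = Ups_M[OF t]
 have "(LINT x|(law t). g x) = (LINT s|cnd. g (Ups t s))" unfolding law_def by (rule integral_distr) measurable
 then show ?thesis by (simp add: integral_cnd)
qed

text \<open>The good event and survival both lie in \<open>alive\<close> and differ from it by
  vanishing probability, so one indicator may be exchanged for the other at the cost of an error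
  independent of theta.\<close>

lemma char_law_tendsto:
 assumes tau: "!!k. 0 <= \<tau> k" "filterlim \<tau> at_top sequentially"
 shows "(%k. char (law (\<tau> k)) \<theta>) ----> exp (J (- (\<i> * of_real \<theta>)) (\<i> * of_real \<theta>))"
proof -
 let ?p = "measure M surv"
 let ?a = "%k. \<integral>s. complex_of_real (dmp 0 (\<tau> k) s) * iexp (\<theta> * (fl (\<tau> k) f1 s - fl (\<tau> k) f2 s)) \<partial>M"
 let ?u = "%k. \<integral>s. complex_of_real (indicator surv s) * iexp (\<theta> * Ups (\<tau> k) s) \<partial>M"
 have d: "norm (?u k - ?a k) <= (measure M (alive (\<tau> k)) - ?p) + (measure M (alive (\<tau> k)) - measure M (good n (\<tau> k)))" for k
 proof -
  note [measurable] = Ups_M[OF tau(1)] good_M[OF tau(1), of n] fl_M[OF tau(1)] dmp_M[OF tau(1)] alive_M[OF tau(1)]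
  have iA: "integrable M (%s. indicator A s :: real)" if "A : sets M" for A
   using that by (intro integrable_real_indicator) (auto simp: P.emeasure_eq_measure)
  have mA: "(LINT s|M. indicator A s) = measure M A" if "A : sets M" for A
   using sets.sets_into_space[OF that] by (simp add: Int_absorb2)
  have i: "integrable M (%s. complex_of_real (indicator A s) * iexp (\<theta> * g s))" if [measurable]: "A : sets M" "g : Bm M" for A g
   by (rule P.integrable_const_bound[where B=1]) (auto simp: norm_mult indicator_def)
  have "?a k = (LINT s|M. complex_of_real (indicator (good n (\<tau> k)) s) * iexp (\<theta> * Ups (\<tau> k) s))"
  proof (rule integral_cong_AE)
   show "AE s in M. complex_of_real (dmp 0 (\<tau> k) s) * iexp (\<theta> * (fl (\<tau> k) f1 s - fl (\<tau> k) f2 s)) = complex_of_real (indicator (good n (\<tau> k)) s) * iexp (\<theta> * Ups (\<tau> k) s)"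
    using AE_Ups[OF tau(1), of k] by eventually_elim (auto simp: dmp_def indicator_def)
  qed measurable
  then have ua: "?u k - ?a k = (LINT s|M. complex_of_real (indicator surv s) * iexp (\<theta> * Ups (\<tau> k) s) - complex_of_real (indicator (good n (\<tau> k)) s) * iexp (\<theta> * Ups (\<tau> k) s))"
   using i by simp
  have 1: "norm (LINT s|M. complex_of_real (indicator surv s) * iexp (\<theta> * Ups (\<tau> k) s) - complex_of_real (indicator (good n (\<tau> k)) s) * iexp (\<theta> * Ups (\<tau> k) s)) <= (LINT s|M. (indicator (alive (\<tau> k)) s - indicator surv s) + (indicator (alive (\<tau> k)) s - indicator (good n (\<tau> k)) s))"
  proof (rule norm_integral_le)
   fix s
   have "norm (complex_of_real (indicator surv s - indicator (good n (\<tau> k)) s) * iexp (\<theta> * Ups (\<tau> k) s)) = \<bar>indicator surv s - indicator (good n (\<tau> k)) s :: real\<bar>"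
    unfolding norm_mult norm_of_real norm_exp_i_times by simp
   also have "... <= (indicator (alive (\<tau> k)) s - indicator surv s) + (indicator (alive (\<tau> k)) s - indicator (good n (\<tau> k)) s)"
    using surv_sub_alive[OF tau(1), of k] good_alive[of n "\<tau> k"] by (auto simp: indicator_def)
   finally show "norm (complex_of_real (indicator surv s) * iexp (\<theta> * Ups (\<tau> k) s) - complex_of_real (indicator (good n (\<tau> k)) s) * iexp (\<theta> * Ups (\<tau> k) s))
    <= (indicator (alive (\<tau> k)) s - indicator surv s) + (indicator (alive (\<tau> k)) s - indicator (good n (\<tau> k)) s)"
    by (simp only: of_real_diff left_diff_distrib)
   show "integrable M (%s. complex_of_real (indicator surv s) * iexp (\<theta> * Ups (\<tau> k) s) - complex_of_real (indicator (good n (\<tau> k)) s) * iexp (\<theta> * Ups (\<tau> k) s))"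
    by (rule Bochner_Integration.integrable_diff[OF i[OF survival_sets Ups_M[OF tau(1)]] i[OF good_M[OF tau(1)] Ups_M[OF tau(1)]]])
  qed (intro Bochner_Integration.integrable_add Bochner_Integration.integrable_diff iA survival_sets good_M alive_M tau(1))
  have 2: "(LINT s|M. (indicator (alive (\<tau> k)) s - indicator surv s) + (indicator (alive (\<tau> k)) s - indicator (good n (\<tau> k)) s)) = (measure M (alive (\<tau> k)) - ?p) + (measure M (alive (\<tau> k)) - measure M (good n (\<tau> k)))"
   using iA mA by simp
  show ?thesis using 1 unfolding ua 2 .
 qed
 have "(%k. (measure M (alive (\<tau> k)) - ?p) + (measure M (alive (\<tau> k)) - measure M (good n (\<tau> k)))) ----> (?p - ?p) + (?p - ?p)"
  by (intro tendsto_add tendsto_diff tendsto_const prob_alive_tendsto[OF tau] good_surv_tendsto[OF tau])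
 then have "(%k. (measure M (alive (\<tau> k)) - ?p) + (measure M (alive (\<tau> k)) - measure M (good n (\<tau> k)))) ----> 0" by simp
 then have "(%k. ?u k - ?a k) ----> 0" by (rule Lim_null_comparison[rotated]) (use d in simp)
 from tendsto_add[OF this char_tendsto[OF tau, of \<theta>]]
 have "?u ----> of_real ?p * exp (J (- (\<i> * of_real \<theta>)) (\<i> * of_real \<theta>))" by simp
 then have "(%k. of_real (1 / ?p) * ?u k) ----> of_real (1 / ?p) * (of_real ?p * exp (J (- (\<i> * of_real \<theta>)) (\<i> * of_real \<theta>)))"
  by (intro tendsto_mult_left)
 moreover have "char (law (\<tau> k)) \<theta> = of_real (1 / ?p) * ?u k" for k
 proof -
  have "char (law (\<tau> k)) \<theta> = (LINT s|M. (indicator surv s / ?p) *\<^sub>R iexp (\<theta> * Ups (\<tau> k) s))"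
   unfolding char_def by (rule integral_law[OF tau(1)]) measurable
  also have "... = (LINT s|M. of_real (1 / ?p) * (complex_of_real (indicator surv s) * iexp (\<theta> * Ups (\<tau> k) s)))"
   by (intro Bochner_Integration.integral_cong) (auto simp: scaleR_conv_of_real)
  finally show ?thesis by simp
 qed
 ultimately show ?thesis using surv_pos by (simp flip: mult.assoc of_real_mult)
qed

text \<open>The coefficients a and c select one of the two components, so that a single statement
  serves f1 and f2; the scale is 1 / e because \<open>exp_sq_deviation\<close> is used for e times
  the fluctuation with R = 1.\<close>

lemma fl_deviation:
 assumes t: "0 <= t" and e: "0 < e" and h: "h = f1 & a = 1 & c = 0 \<or> h = f2 & a = 0 & c = 1"
 shows "measure M {s : good n t. 1 / e < \<bar>fl t h s\<bar>} * (1 - exp (- 1))\<^sup>2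
   <= L t (2 * e * a) (2 * e * c) - 2 * L t (e * a) (e * c) + measure M (good n t)"
proof -
 note [measurable] = good_M[OF t, of n] fl_M[OF t]
 have hm[measurable]: "h : Bm borel" using h by auto
 have eq: "r * (e * fl t h s) = (r * e * a) * fl t f1 s + (r * e * c) * fl t f2 s" for r s using h by auto
 have i: "integrable M (%s. indicator (good n t) s * exp (- (r * (e * fl t h s))))" if "0 <= r" for r
  unfolding eq using h e that by (intro L_integrable t) auto
 have "measure M {s : good n t. 1 < \<bar>e * fl t h s\<bar>} * (1 - exp (- 1))\<^sup>2
  <= (LINT s|M. indicator (good n t) s * exp (- (2 * (e * fl t h s)))) - 2 * (LINT s|M. indicator (good n t) s * exp (- (e * fl t h s))) + measure M (good n t)"
  using i[of 1] i[of 2] by (intro exp_sq_deviation) auto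
 moreover have "{s : good n t. 1 < \<bar>e * fl t h s\<bar>} = {s : good n t. 1 / e < \<bar>fl t h s\<bar>}"
  using e by (auto simp: abs_mult pos_divide_less_eq mult.commute)
 moreover have "(LINT s|M. indicator (good n t) s * exp (- (2 * (e * fl t h s)))) = L t (2 * e * a) (2 * e * c)"
  unfolding L_def eq ..
 moreover have "(LINT s|M. indicator (good n t) s * exp (- (e * fl t h s))) = L t (e * a) (e * c)"
  using eq[of 1] unfolding L_def by simp
 ultimately show ?thesis by simp
qed

text \<open>Continuity of the limiting Laplace transform at 0 gives tightness: the bound from
  \<open>fl_deviation\<close> converges to \<open>v\<close>, which vanishes as e -> 0. The two
  components are treated separately and then combined.\<close>

lemma law_tight:
 assumes tau: "!!k. 0 <= \<tau> k" "filterlim \<tau> at_top sequentially" and d: "0 < d"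
 shows "\<exists>R. \<forall>\<^sub>F k in sequentially. measure (law (\<tau> k)) {x. R < \<bar>x\<bar>} < d"
proof -
 let ?p = "measure M surv"
 define q where "q = (1 - exp (- 1 :: real))\<^sup>2"
 have q: "0 < q" by (simp add: q_def)
 define v where "v a c m = ?p * exp (Re (J (of_real (2 * m * a)) (of_real (2 * m * c)))) - 2 * (?p * exp (Re (J (of_real (m * a)) (of_real (m * c))))) + ?p" for a c m
 \<comment> \<open>One third for each exceptional event: leaving the good event, and a large value
   of either component.\<close>
 define l where "l = ?p * d / 3"
 have l: "0 < l" using d surv_pos by (simp add: l_def)
 have v0: "(%j. v a c (1 / (real j + 1))) ----> 0" for a c
 proof -
  have z: "(%j. 1 / (real j + 1)) ----> 0" by real_asymp
  have "(%j. complex_of_real (r * (1 / (real j + 1)) * a)) ----> of_real (r * 0 * a)" for r a by (intro tendsto_intros z)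
  then have Jr: "(%j. J (of_real (r * (1 / (real j + 1)) * a)) (of_real (r * (1 / (real j + 1)) * c))) ----> J 0 0" for r
   by (intro J_tendsto) auto
  have "(%j. v a c (1 / (real j + 1))) ----> ?p * exp (Re (J 0 0)) - 2 * (?p * exp (Re (J 0 0))) + ?p"
   unfolding v_def using Jr[of 2] Jr[of 1] by (intro tendsto_intros) simp_all
  then show ?thesis by (simp add: J_zero)
 qed
 have "\<forall>\<^sub>F j in sequentially. v 1 0 (1 / (real j + 1)) < q * l" "\<forall>\<^sub>F j in sequentially. v 0 1 (1 / (real j + 1)) < q * l"
  using v0 q l by (auto intro!: order_tendstoD)
 then obtain j where j: "v 1 0 (1 / (real j + 1)) < q * l" "v 0 1 (1 / (real j + 1)) < q * l"
  using eventually_happens'[OF sequentially_bot eventually_conj] by blast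
 define e where "e = 1 / (real j + 1)"
 have e: "0 < e" by (simp add: e_def)
 define V where "V a c k = L (\<tau> k) (2 * e * a) (2 * e * c) - 2 * L (\<tau> k) (e * a) (e * c) + measure M (good n (\<tau> k))" for a c k
 have Vt: "V a c ----> v a c e" if "0 <= a" "0 <= c" for a c
  unfolding V_def v_def using e that by (intro tendsto_add tendsto_diff tendsto_mult_left L_tendsto[OF tau] good_surv_tendsto[OF tau]) auto
 have e1: "\<forall>\<^sub>F k in sequentially. V 1 0 k < q * l" and e2: "\<forall>\<^sub>F k in sequentially. V 0 1 k < q * l"
  using j unfolding e_def[symmetric] by (auto intro!: order_tendstoD(2)[OF Vt])
 have "(%k. measure M (alive (\<tau> k)) - measure M (good n (\<tau> k))) ----> ?p - ?p"
  by (intro tendsto_diff prob_alive_tendsto[OF tau] good_surv_tendsto[OF tau])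
 then have e3: "\<forall>\<^sub>F k in sequentially. measure M (alive (\<tau> k)) - measure M (good n (\<tau> k)) < l" using l by (intro order_tendstoD) auto
 show ?thesis
 proof (intro exI[of _ "2 / e"])
  show "\<forall>\<^sub>F k in sequentially. measure (law (\<tau> k)) {x. 2 / e < \<bar>x\<bar>} < d"
   using e1 e2 e3
  proof eventually_elim
   case (elim k)
   note [measurable] = Ups_M[OF tau(1)] good_M[OF tau(1), of n] fl_M[OF tau(1)] alive_M[OF tau(1)]
   interpret Lw: real_distribution "law (\<tau> k)" by (rule real_distribution_law[OF tau(1)])
   let ?B = "%h. {s : good n (\<tau> k). 1 / e < \<bar>fl (\<tau> k) h s\<bar>}"
   have Bq: "measure M (?B f1) < l" "measure M (?B f2) < l"
   proof -
    have "measure M (?B f1) * q <= V 1 0 k" using fl_deviation[OF tau(1)[of k] e, of f1 1 0] by (simp add: V_def q_def)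
    then have "measure M (?B f1) * q < q * l" using elim(1) by linarith
    then show "measure M (?B f1) < l" using q by (simp add: mult.commute[of q])
    have "measure M (?B f2) * q <= V 0 1 k" using fl_deviation[OF tau(1)[of k] e, of f2 0 1] by (simp add: V_def q_def)
    then have "measure M (?B f2) * q < q * l" using elim(2) by linarith
    then show "measure M (?B f2) < l" using q by (simp add: mult.commute[of q])
   qed
   have Bm: "?B h : sets M" if [measurable]: "h : Bm borel" for h
   proof -
    have "?B h = good n (\<tau> k) \<inter> {s : space M. 1 / e < \<bar>fl (\<tau> k) h s\<bar>}" using goodD(1) by blast
    then show ?thesis by simp
   qed
   let ?S = "{s : space M. s : surv & 2 / e < \<bar>Ups (\<tau> k) s\<bar>}"
   have "measure M ?S <= measure M ((alive (\<tau> k) - good n (\<tau> k)) \<union> (?B f1 \<union> ?B f2))"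
   proof (rule P.finite_measure_mono_AE)
    show "AE s in M. s : ?S --> s : (alive (\<tau> k) - good n (\<tau> k)) \<union> (?B f1 \<union> ?B f2)"
     using AE_Ups[OF tau(1), of k]
    proof eventually_elim
     case (elim s)
     show ?case
     proof (intro impI, cases "s : good n (\<tau> k)")
      case True
      assume "s : ?S"
      then have "2 / e < \<bar>fl (\<tau> k) f1 s - fl (\<tau> k) f2 s\<bar>" using elim True by simp
      then have "1 / e + 1 / e < \<bar>fl (\<tau> k) f1 s\<bar> + \<bar>fl (\<tau> k) f2 s\<bar>" using abs_triangle_ineq4[of "fl (\<tau> k) f1 s" "fl (\<tau> k) f2 s"] by simp
      then have "1 / e < \<bar>fl (\<tau> k) f1 s\<bar> \<or> 1 / e < \<bar>fl (\<tau> k) f2 s\<bar>" by linarith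
      then show "s : (alive (\<tau> k) - good n (\<tau> k)) \<union> (?B f1 \<union> ?B f2)" using True by auto
     next
      case False
      assume "s : ?S"
      then show "s : (alive (\<tau> k) - good n (\<tau> k)) \<union> (?B f1 \<union> ?B f2)" using False surv_sub_alive[OF tau(1), of k] by auto
     qed
    qed
   qed (use Bm in simp)
   also have "... <= measure M (alive (\<tau> k) - good n (\<tau> k)) + (measure M (?B f1) + measure M (?B f2))"
    using Bm by (intro order_trans[OF measure_Un_le] add_left_mono measure_Un_le) auto
   also have "... < l + (l + l)" using Bq elim(3) P.finite_measure_Diff[OF alive_M[OF tau(1)] good_M[OF tau(1)] good_alive, of k n] by simp
   also have "l + (l + l) = ?p * d" by (simp add: l_def)
   finally have S: "measure M ?S < ?p * d" .
   have "measure (law (\<tau> k)) {x. 2 / e < \<bar>x\<bar>} = (LINT x|(law (\<tau> k)). indicator {x. 2 / e < \<bar>x\<bar>} x)"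
    by simp
   also have "... = (LINT s|M. (indicator surv s / ?p) *\<^sub>R indicator {x. 2 / e < \<bar>x\<bar>} (Ups (\<tau> k) s))"
    by (rule integral_law[OF tau(1)]) measurable
   also have "... = (LINT s|M. indicator ?S s / ?p)"
    by (intro Bochner_Integration.integral_cong) (auto simp: indicator_def)
   also have "... = measure M (?S \<inter> space M) / ?p" by (simp only: integral_divide_zero Bochner_Integration.integral_indicator)
   also have "... = measure M ?S / ?p" by (rule arg_cong[where f="%A. measure M A / ?p"]) blast
   also have "... < d" using S unfolding pos_divide_less_eq[OF surv_pos] mult.commute[of d "measure M surv"] .
   finally show ?case .
  qed
 qed
qed

lemma Z1_measurable: "Z1 \<alpha> \<sigma> b \<eta> \<beta> (%y. \<theta> * f y) : Bm borel"
 unfolding Z1_def set_lebesgue_integral_def OU_Pa_def by measurable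

lemma J_Z1_lborel:
 "J (- (\<i> * of_real \<theta>)) (\<i> * of_real \<theta>) = (CLINT x|lborel. Z1 \<alpha> \<sigma> b \<eta> \<beta> (%y. \<theta> * f y) x * complex_of_real (OU_phi \<sigma> b x))"
 unfolding J_Z1[symmetric] stat_eq_lborel[OF Z1_measurable] by (simp add: scaleR_conv_of_real mult.commute)

text \<open>By homogeneity, m times the exponent at theta is the exponent at m^(1 / (1 + beta))
  theta; so scaling alone matches the m-fold convolution, and the shift is 0.\<close>

lemma stable_index_limit:
 assumes nu: "real_distribution \<nu>" and ch: "!!\<theta>. char \<nu> \<theta> = exp (J (- (\<i> * of_real \<theta>)) (\<i> * of_real \<theta>))"
 shows "stable_index (1 + \<beta>) \<nu>"
 unfolding stable_index_def
proof (intro allI impI exI[of _ 0])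
 fix m :: nat assume m: "1 <= m"
 interpret N: real_distribution \<nu> by fact
 define r where "r = real m powr (1 / (1 + \<beta>))"
 have rp: "r powr (1 + \<beta>) = real m" using m beta_pos by (simp add: r_def powr_powr)
 have "char (conv_pow \<nu> m) \<theta> = char (distr \<nu> borel (%x. r * x + 0)) \<theta>" for \<theta>
 proof -
  have "char (distr \<nu> borel (%x. r * x + 0)) \<theta> = char \<nu> (r * \<theta>)"
   unfolding char_def by (subst integral_distr) (auto simp: mult_ac)
  also have "... = exp (J (of_real r * - (\<i> * of_real \<theta>)) (of_real r * (\<i> * of_real \<theta>)))" unfolding ch by (simp add: mult_ac)
  also have "... = exp (of_nat m * J (- (\<i> * of_real \<theta>)) (\<i> * of_real \<theta>))"
  proof -
   have "J (of_real r * - (\<i> * of_real \<theta>)) (of_real r * (\<i> * of_real \<theta>)) = of_real (r powr (1 + \<beta>)) * J (- (\<i> * of_real \<theta>)) (\<i> * of_real \<theta>)"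
    by (rule J_homogeneous) (simp add: r_def)
   then show ?thesis by (simp only: rp of_real_of_nat_eq)
  qed
  also have "... = char (conv_pow \<nu> m) \<theta>" unfolding char_conv_pow[OF nu] ch exp_of_nat_mult ..
  finally show ?thesis by simp
 qed
 then show "conv_pow \<nu> m = distr \<nu> borel (%x. real m powr (1 / (1 + \<beta>)) * x + 0)"
  unfolding r_def[symmetric] by (intro Levy_uniqueness real_distribution_conv_pow nu N.real_distribution_distr) auto
qed

text \<open>A subsequence of integer times produces the law nu and its characteristic function;
  Levy's continuity theorem then gives convergence along every sequence of times, and sequences
  suffice for the limit at infinity.\<close>

lemma fluctuation_limit:
 "\<exists>\<nu>. real_distribution \<nu> & stable_index (1 + \<beta>) \<nu> &
   (\<forall>\<theta>. char \<nu> \<theta> = exp (CLINT x|lborel. Z1 \<alpha> \<sigma> b \<eta> \<beta> (%y. \<theta> * f y) x * complex_of_real (OU_phi \<sigma> b x))) &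
   cond_conv_dist M surv Ups \<nu>"
proof -
 have k0: "filterlim real at_top sequentially" by (rule filterlim_real_sequentially)
 have "tight (%k. law (real k))" by (rule tight_eventually) (auto intro: real_distribution_law law_tight[OF _ k0])
 from tight_imp_convergent_subsubsequence[OF this strict_mono_id]
 obtain r \<nu> where r: "strict_mono (r :: nat => nat)" and nu: "real_distribution \<nu>" and w: "weak_conv_m (%k. law (real (r k))) \<nu>"
  by (auto simp: o_def)
 have ch: "char \<nu> \<theta> = exp (J (- (\<i> * of_real \<theta>)) (\<i> * of_real \<theta>))" for \<theta>
 proof (rule LIMSEQ_unique)
  show "(%k. char (law (real (r k))) \<theta>) ----> char \<nu> \<theta>"
   by (rule levy_continuity1[OF _ nu w]) (auto intro: real_distribution_law)
  show "(%k. char (law (real (r k))) \<theta>) ----> exp (J (- (\<i> * of_real \<theta>)) (\<i> * of_real \<theta>))"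
   using LIMSEQ_subseq_LIMSEQ[OF char_law_tendsto[OF _ k0] r] by (simp add: o_def)
 qed
 have "cond_conv_dist M surv Ups \<nu>"
  unfolding cond_conv_dist_def
 proof (intro allI impI)
  fix g :: "real => real" assume g: "continuous_on UNIV g & bounded (range g)"
  obtain B where B: "!!x. norm (g x) <= B" using g by (auto simp: bounded_iff)
  have gm[measurable]: "g : Bm borel" using g by (intro borel_measurable_continuous_onI) auto
  show "((%t. (LINT s|M. g (Ups t s) * indicator surv s) / measure M surv) \<longlongrightarrow> (LINT x|\<nu>. g x)) at_top"
  proof (rule tendsto_at_topI_sequentially)
   fix T :: "nat => real" assume T: "filterlim T at_top sequentially"
   \<comment> \<open>The facts about \<open>law\<close> concern nonnegative times;
     \<open>T k\<close> is eventually nonnegative, so the limit is unaffected.\<close>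
   define \<tau> where "\<tau> k = max 0 (T k)" for k
   have t0: "0 <= \<tau> k" for k by (simp add: \<tau>_def)
   have t1: "filterlim \<tau> at_top sequentially" by (rule filterlim_at_top_mono[OF T]) (simp add: \<tau>_def)
   have "weak_conv_m (%k. law (\<tau> k)) \<nu>"
    using char_law_tendsto[OF t0 t1] by (intro levy_continuity nu real_distribution_law t0) (simp add: ch)
   then have "(%k. \<integral>x. g x \<partial>law (\<tau> k)) ----> (LINT x|\<nu>. g x)"
    using g B real_distribution_law[OF t0] nu
    by (intro weak_conv_imp_integral_bdd_continuous_conv[where B=B]) (auto simp: continuous_on_eq_continuous_at)
   moreover have "\<forall>\<^sub>F k in sequentially. (LINT x|(law (\<tau> k)). g x) = (LINT s|M. g (Ups (T k) s) * indicator surv s) / measure M surv"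
    using filterlim_at_top[THEN iffD1, OF T, rule_format, of 0]
   proof eventually_elim
    case (elim k)
    then have "\<tau> k = T k" by (simp add: \<tau>_def)
    then show ?case using integral_law[OF t0[of k] gm] by (simp add: mult.commute)
   qed
   ultimately show "(%k. (LINT s|M. g (Ups (T k) s) * indicator surv s) / measure M surv) ----> (LINT x|\<nu>. g x)"
    by (rule Lim_transform_eventually)
  qed
 qed
 then show ?thesis using nu stable_index_limit[OF nu ch] ch unfolding J_Z1_lborel by blast
qed

end

theorem theorem3p4:
  fixes \<sigma> b \<alpha> \<rho> \<eta> \<beta> \<delta> :: real and \<pi> :: "real measure"
    and M :: "'w measure" and X :: "real \<Rightarrow> 'w \<Rightarrow> 'a::euclidean_space measure"
    and \<mu> :: "'a measure" and f :: "'a \<Rightarrow> real"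
  assumes "\<sigma> > 0" and "b > 0" and "\<alpha> > 0" and "\<rho> \<ge> 0"
    and "sets \<pi> = sets borel" and "emeasure \<pi> {..0} = 0"
    and "(\<integral>\<^sup>+y. ennreal (min y (y\<^sup>2)) \<partial>\<pi>) < \<infinity>"
    and grey: "\<exists>z'>0. (\<forall>z>z'. psi \<alpha> \<rho> \<pi> z > 0) \<and> set_integrable lborel {z'<..} (\<lambda>z. 1 / psi \<alpha> \<rho> \<pi> z)"
    and "\<eta> > 0" and "0 < \<beta>" and "\<beta> < 1" and "\<delta> > 0"
    and "tail_cond \<pi> \<eta> \<beta> \<delta>"
    and "sets \<mu> = sets borel" and "finite_measure \<mu>"
    and "\<exists>K. compact K \<and> emeasure \<mu> (UNIV - K) = 0"
    and "emeasure \<mu> UNIV \<noteq> 0"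
    and "superOU \<alpha> \<rho> \<pi> \<sigma> b M X \<mu>"
    and "survival M X \<in> sets M"
    and "poly_growth f" and "f \<noteq> (\<lambda>_. 0)"
  shows "\<exists>\<nu>. real_distribution \<nu> \<and> stable_index (1 + \<beta>) \<nu> \<and>
           (\<forall>\<theta>. char \<nu> \<theta> =
              exp (CLINT x|lborel. Z1 \<alpha> \<sigma> b \<eta> \<beta> (\<lambda>y. \<theta> * f y) x * complex_of_real (OU_phi \<sigma> b x))) \<and>
           cond_conv_dist M (survival M X)
             (\<lambda>t \<omega>. ((\<integral>x. f x \<partial>(X (t + 1) \<omega>)) - (\<integral>x. OU_Pa \<alpha> \<sigma> b 1 f x \<partial>(X t \<omega>)))
                     / (measure (X t \<omega>) UNIV) powr (1 - \<beta> / (1 + \<beta>)))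
             \<nu>"
proof -
 obtain C n where C: "!!x. \<bar>f x\<bar> <= C * (1 + norm x ^ n)" and fm[measurable]: "f : Bm borel"
  using \<open>poly_growth f\<close> unfolding poly_growth_def by blast
 have C0: "0 <= C * wt n x" for x :: 'a using order_trans[OF abs_ge_zero C[of x]] by (simp add: wt_def)
 interpret mu0: finite_measure \<mu> by fact
 \<comment> \<open>The positive and the negative part inherit the growth bound, and their difference
   is f.\<close>
 interpret super_ou_fluct \<sigma> b \<alpha> \<rho> \<pi> \<eta> \<beta> \<delta> M X \<mu> "%x. max (f x) 0" "%x. max (- f x) 0" C n
 proof (unfold_locales; (fact assms)?)
  show "max (f x) 0 <= C * wt n x" "max (- f x) 0 <= C * wt n x" for x
   using C[of x] C0[of x] by (auto simp: wt_def abs_le_iff)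
 qed ((rule mu0.sigma_finite_countable mu0.emeasure_finite | simp)+)
 have f: "max (f y) 0 - max (- f y) 0 = f y" for y by (simp add: max_def)
 show ?thesis
  using fluctuation_limit unfolding Ups_def[abs_def] I_def Y_def f .
qed

end
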